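(* Let $(\mathcal{R},\partial)$ be a commutative differential ring with ring of constants $\mathcal{C}$ and a quasi-integration $\mathrm{Q}$, and let $\mathrm{IDR}(\mathcal{R})$ with its maps $\partial,\int$ and $\mathrm{IDR}_{\mathrm{Q},\sqcup\!\sqcup}(\mathcal{R})$ with its maps $\partial,\int_{\mathrm{Q}}$ be as defined in the context. Let $\mathrm{E}_{\mathrm{Q}}:=\mathrm{id}-\int_{\mathrm{Q}}\partial$ on $\mathrm{IDR}_{\mathrm{Q},\sqcup\!\sqcup}(\mathcal{R})$. Then: 1. $(\mathrm{IDR}_{\mathrm{Q},\sqcup\!\sqcup}(\mathcal{R}),\partial,\int_{\mathrm{Q}})$ is a commutative integro-differential ring. 2. $\iota:\mathcal{R}\to\mathrm{IDR}_{\mathrm{Q},\sqcup\!\sqcup}(\mathcal{R})$ defined by $\iota(f):=f\otimes1_{\mathcal{T}}$ is an injective differential ring homomorphism such that $\int_{\mathrm{Q}}\iota(f)=\iota(\mathrm{Q}f)$ holds for all $f\in\partial\mathcal{R}$. In addition, for all $f_0\in\mathcal{R}_{\mathrm{J}}$ and all $f_1,\dots,f_n,g_1,\dots,g_m\in\mathcal{R}_{\mathrm{T}}$ where $n,m>0$, we have $$\mathrm{E}_{\mathrm{Q}}\big(\iota(f_0)\cdot N(f_1,\dots,f_n)\big)=0\quad\text{and}\quad\mathrm{E}_{\mathrm{Q}}\big(N(f_1,\dots,f_n)\cdot N(g_1,\dots,g_m)\big)=0,$$ where $N(f_1,\dots,f_n):=\int_{\mathrm{Q}}\big(\iota(f_1)\int_{\mathrm{Q}}\big(\iota(f_2)\cdots\int_{\mathrm{Q}}\iota(f_n)\big)\cdots\big)$.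 3. Let $J\subseteq\mathrm{IDR}(\mathcal{R})$ be the integro-differential ideal generated by $(\mathcal{C}\otimes\varepsilon(M_1)\otimes\mathcal{C}\otimes\mathcal{C}1_{\mathcal{T}})\cup(\mathcal{C}\otimes\mathcal{C}\otimes\varepsilon(M_2)\otimes\mathcal{C}1_{\mathcal{T}})$. Then there is a unique bijective integro-differential ring homomorphism $\psi:\mathrm{IDR}(\mathcal{R})/J\to\mathrm{IDR}_{\mathrm{Q},\sqcup\!\sqcup}(\mathcal{R})$ such that $\psi(\pi(\iota(f)))=\iota(f)$ for all $f\in\mathcal{R}$, where $\pi:\mathrm{IDR}(\mathcal{R})\to\mathrm{IDR}(\mathcal{R})/J$ is the canonical projection (the inner $\iota$ being the map $\mathcal{R}\to\mathrm{IDR}(\mathcal{R})$, $f\mapsto f\otimes1\otimes1\otimes1_{\mathcal{T}}$).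
   Context: Rings and algebras have a unit, homomorphisms preserve it. A differential ring is a ring with an additive map $\partial$ satisfying the Leibniz rule; its ring of constants is $\ker\partial$. An integro-differential ring $(\mathcal{S},\partial,\int)$ is a differential ring with a $\ker(\partial)$-linear map $\int:\mathcal{S}\to\mathcal{S}$ such that $\partial\int=\mathrm{id}$. Differential (integro-differential) ring homomorphisms are ring homomorphisms commuting with $\partial$ (with $\partial$ and the integrations). An integro-differential ideal is an ideal closed under $\partial$ and $\int$; quotients by such ideals are again integro-differential rings. Setting: $(\mathcal{R},\partial)$ is a commutative differential ring, $\mathcal{C}=\ker\partial$, and all tensor and symmetric products are over $\mathcal{C}$. A quasi-integration is a $\mathcal{C}$-linear $\mathrm{Q}:\mathcal{R}\to\mathcal{R}$ with $\partial\mathrm{Q}\partial=\partial$ and $\mathrm{Q}\partial\mathrm{Q}=\mathrm{Q}$; one such $\mathrm{Q}$ is fixed. Put $\mathcal{R}_{\mathrm{J}}=\mathrm{Q}\mathcal{R}$ and $\mathcal{R}_{\mathrm{T}}=\ker\mathrm{Q}$, so $\mathcal{R}=\mathcal{C}\oplus\mathcal{R}_{\mathrm{J}}=(\partial\mathcal{R})\oplus\mathcal{R}_{\mathrm{T}}$. Tensors: $\mathcal{T}=\bigoplus_{n\ge0}\mathcal{R}_{\mathrm{T}}^{\otimes n}$ with empty tensor $1_{\mathcal{T}}$; $\widetilde{\mathcal{T}}=\bigoplus_{n\ge1}\mathcal{R}_{\mathrm{T}}^{\otimes n}$. The shuffle product $\sqcup\!\sqcup$ on $\mathcal{T}$ is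 the $\mathcal{C}$-bilinear product with $t\sqcup\!\sqcup s=t\otimes s$ if $t$ or $s$ has length $0$ and $t\sqcup\!\sqcup s=t_1\otimes((t_2\otimes\dots\otimes t_n)\sqcup\!\sqcup s)+s_1\otimes(t\sqcup\!\sqcup(s_2\otimes\dots\otimes s_m))$ for pure tensors of lengths $n,m\ge1$. For a pure tensor $f=f_1\otimes\dots\otimes f_n$, $f_i^j:=f_i\otimes\dots\otimes f_j$, and $f_i^j=1_{\mathcal{T}}$ if $i=j+1$. Definition of $\mathrm{IDR}_{\mathrm{Q},\sqcup\!\sqcup}(\mathcal{R})$: $\mathrm{IDR}_{\mathrm{Q},\sqcup\!\sqcup}(\mathcal{R}):=\mathcal{R}\otimes\mathcal{T}$ as tensor product of $\mathcal{C}$-algebras, with $\mathcal{T}$ equipped with the shuffle product. For $f_0\in\mathcal{R}$ and a pure tensor $f\in\mathcal{R}_{\mathrm{T}}^{\otimes n}$, the $\mathcal{C}$-linear maps $\partial,\int_{\mathrm{Q}}$ are: $\partial(f_0\otimes f)=(\partial f_0)\otimes f$ if $n=0$ and $(\partial f_0)\otimes f+(f_0f_1)\otimes f_2^n$ if $n>0$; $\int_{\mathrm{Q}}(f_0\otimes f)=(\mathrm{Q}f_0)\otimes f+1\otimes((f_0-\partial\mathrm{Q}f_0)\otimes f)$ if $n=0$, and recursively $\int_{\mathrm{Q}}(f_0\otimes f)=(\mathrm{Q}f_0)\otimes f-\int_{\mathrm{Q}}(((\mathrm{Q}f_0)f_1)\otimes f_2^n)+1\otimes((f_0-\partial\mathrm{Q}f_0)\otimes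 f)$ if $n>0$. Definition of $\mathrm{IDR}(\mathcal{R})$: $M_1=\mathcal{R}_{\mathrm{J}}\otimes\mathcal{T}$, $M_2=\widetilde{\mathcal{T}}^{\odot2}$ (symmetric square). $\varepsilon(M_1),\varepsilon(M_2)$ are isomorphic copies with isomorphisms $\varepsilon$; for $r\in\mathcal{R}_{\mathrm{J}}$, $\varepsilon(r)$ means $\varepsilon(r\otimes1_{\mathcal{T}})$. $\mathcal{C}_1=\mathrm{Sym}(\varepsilon(M_1))$ and $\mathcal{C}_2=\mathrm{Sym}(\varepsilon(M_2))/J_2$ (unital symmetric $\mathcal{C}$-algebras), where $J_2$ is the ideal generated by all $$\varepsilon((f\sqcup\!\sqcup g)\odot h)-\varepsilon(f\odot(g\sqcup\!\sqcup h))+\sum_{j=0}^{m-1}\Big(\sum_{i=\max(0,1-j)}^{n-1}\varepsilon(f_{i+1}^n\odot g_{j+1}^m)\cdot\varepsilon((f_1^i\sqcup\!\sqcup g_1^j)\odot h)-\sum_{k=\max(0,1-j)}^{l-1}\varepsilon(f\odot(g_1^j\sqcup\!\sqcup h_1^k))\cdot\varepsilon(g_{j+1}^m\odot h_{k+1}^l)\Big)$$ for $n,m,l\ge1$ and pure tensors $f\in\mathcal{R}_{\mathrm{T}}^{\otimes n}$, $g\in\mathcal{R}_{\mathrm{T}}^{\otimes m}$, $h\in\mathcal{R}_{\mathrm{T}}^{\otimes l}$. Elements $\varepsilon(\cdot)$ of $\mathcal{C}_2$, and $\varepsilon(M_2)$ in $\mathcal{C}_2$, denote classes. The product on $\mathcal{C}_2\otimes\mathcal{T}$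 is the $\mathcal{C}$-bilinear map with, for $c,d\in\mathcal{C}_2$ and pure tensors $f,g$ of lengths $n,m\ge0$, $$(c\otimes f)\cdot(d\otimes g)=(c\cdot d)\otimes(f\sqcup\!\sqcup g)+\sum_{i=0}^{n-1}\sum_{j=0}^{m-1}\big(c\cdot d\cdot\varepsilon(f_{i+1}^n\odot g_{j+1}^m)\big)\otimes(f_1^i\sqcup\!\sqcup g_1^j);$$ this makes $\mathcal{C}_2\otimes\mathcal{T}$ a commutative $\mathcal{C}$-algebra with unit $1\otimes1_{\mathcal{T}}$. $\mathrm{IDR}(\mathcal{R}):=\mathcal{R}\otimes\mathcal{C}_1\otimes\mathcal{C}_2\otimes\mathcal{T}$ is the tensor product of the commutative $\mathcal{C}$-algebras $\mathcal{R}$, $\mathcal{C}_1$ and $\mathcal{C}_2\otimes\mathcal{T}$. For $f_0\in\mathcal{R}$, $c=c_1\otimes c_2\in\mathcal{C}_1\otimes\mathcal{C}_2$ and a pure tensor $f\in\mathcal{R}_{\mathrm{T}}^{\otimes n}$, its $\mathcal{C}$-linear maps $\partial,\int$ are: $\partial(f_0\otimes c\otimes f)=(\partial f_0)\otimes c\otimes f$ if $n=0$ and $(\partial f_0)\otimes c\otimes f+(f_0f_1)\otimes c\otimes f_2^n$ if $n>0$. For $n=0$: $\int(f_0\otimes c\otimes f)=(\mathrm{Q}f_0)\otimes c\otimes f-1\otimes(c_1\cdot\varepsilon(\mathrm{Q}f_0))\otimes c_2\otimes f+1\otimes c\otimes((f_0-\partial\mathrm{Q}f_0)\otimes f)$.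 For $n>0$, recursively: $\int(f_0\otimes c\otimes f)=(\mathrm{Q}f_0)\otimes c\otimes f-1\otimes(c_1\cdot\varepsilon((\mathrm{Q}f_0)\otimes f))\otimes c_2\otimes1_{\mathcal{T}}-\int(((\mathrm{Q}f_0)f_1)\otimes c\otimes f_2^n)+1\otimes c\otimes((f_0-\partial\mathrm{Q}f_0)\otimes f)$. With these, $\mathrm{IDR}(\mathcal{R})$ is a commutative integro-differential ring. *)

theory Defs
  imports "HOL-Algebra.QuotRing" "HOL-Algebra.Module"
begin

section \<open>Linear algebra over a commutative ring\<close>

definition linear_map ::
  "('k, 'r) ring_scheme \<Rightarrow> ('k, 'b, 'm) module_scheme \<Rightarrow> ('k, 'c, 'n) module_scheme
    \<Rightarrow> ('b \<Rightarrow> 'c) \<Rightarrow> bool"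
  where "linear_map K M N g \<longleftrightarrow>
    g \<in> carrier M \<rightarrow> carrier N \<and>
    (\<forall>x\<in>carrier M. \<forall>y\<in>carrier M. g (x \<oplus>\<^bsub>M\<^esub> y) = g x \<oplus>\<^bsub>N\<^esub> g y) \<and>
    (\<forall>c\<in>carrier K. \<forall>x\<in>carrier M. g (c \<odot>\<^bsub>M\<^esub> x) = c \<odot>\<^bsub>N\<^esub> g x)"

definition bilinear_map ::
  "('k, 'r) ring_scheme \<Rightarrow> ('k, 'b, 'm) module_scheme \<Rightarrow> ('k, 'c, 'n) module_scheme
    \<Rightarrow> ('k, 'e, 'p) module_scheme \<Rightarrow> ('b \<Rightarrow> 'c \<Rightarrow> 'e) \<Rightarrow> bool"
  where "bilinear_map K M N P b \<longleftrightarrow>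
    (\<forall>x\<in>carrier M. linear_map K N P (b x)) \<and>
    (\<forall>y\<in>carrier N. linear_map K M P (\<lambda>x. b x y))"

text \<open>A commutative ring as a module over itself and over its subrings.\<close>

definition self_module :: "('a, 'm) ring_scheme \<Rightarrow> ('a, 'a) module"
  where "self_module R = \<lparr>carrier = carrier R, mult = mult R, one = one R, zero = zero R,
    add = add R, smult = mult R\<rparr>"

text \<open>The record type of modules extends that of rings. In records that only serve as modules,
  the fields \<open>mult\<close> and \<open>one\<close> carry no meaning until they are overwritten.\<close>

definition free_module :: "('k, 'r) ring_scheme \<Rightarrow> 'b set \<Rightarrow> ('k, 'b \<Rightarrow> 'k) module"
  where "free_module K S =
    \<lparr>carrier = {f. (\<forall>x\<in>S. f x \<in> carrier K) \<and> (\<forall>x. x \<notin> S \<longrightarrow> f x = \<zero>\<^bsub>K\<^esub>) \<and>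
                   finite {x. f x \<noteq> \<zero>\<^bsub>K\<^esub>}},
     mult = undefined, one = undefined,
     zero = (\<lambda>_. \<zero>\<^bsub>K\<^esub>), add = (\<lambda>f g x. f x \<oplus>\<^bsub>K\<^esub> g x), smult = (\<lambda>c f x. c \<otimes>\<^bsub>K\<^esub> f x)\<rparr>"

definition free_gen :: "('k, 'r) ring_scheme \<Rightarrow> 'b \<Rightarrow> 'b \<Rightarrow> 'k"
  where "free_gen K x = (\<lambda>y. if y = x then \<one>\<^bsub>K\<^esub> else \<zero>\<^bsub>K\<^esub>)"

definition gen_submodule ::
  "('k, 'r) ring_scheme \<Rightarrow> ('k, 'b, 'm) module_scheme \<Rightarrow> 'b set \<Rightarrow> 'b set"
  where "gen_submodule K M E = \<Inter>{H. submodule H K M \<and> E \<subseteq> H}"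

text \<open>The quotient by a submodule; for an ideal of an algebra it is the quotient algebra.\<close>

definition quot_module :: "('k, 'b, 'm) module_scheme \<Rightarrow> 'b set \<Rightarrow> ('k, 'b set) module"
  where "quot_module M H = ring.extend (M Quot H)
    (module.fields (\<lambda>c X. \<Union>x\<in>X. H +>\<^bsub>M\<^esub> (c \<odot>\<^bsub>M\<^esub> x)))"

definition presented_module ::
  "('k, 'r) ring_scheme \<Rightarrow> 'b set \<Rightarrow> ('b \<Rightarrow> 'k) set \<Rightarrow> ('k, ('b \<Rightarrow> 'k) set) module"
  where "presented_module K S E =
    quot_module (free_module K S) (gen_submodule K (free_module K S) E)"

definition presented_gen ::
  "('k, 'r) ring_scheme \<Rightarrow> 'b set \<Rightarrow> ('b \<Rightarrow> 'k) set \<Rightarrow> 'b \<Rightarrow> ('b \<Rightarrow> 'k) set"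
  where "presented_gen K S E x =
    gen_submodule K (free_module K S) E +>\<^bsub>free_module K S\<^esub> free_gen K x"


section \<open>Tensor products\<close>

definition bilinear_rels ::
  "('k, 'r) ring_scheme \<Rightarrow> ('k, 'b, 'm) module_scheme \<Rightarrow> ('k, 'c, 'n) module_scheme
    \<Rightarrow> ('b \<times> 'c \<Rightarrow> 'k) set"
  where "bilinear_rels K M N =
    (let F = free_module K (carrier M \<times> carrier N); e = (\<lambda>x y. free_gen K (x, y)) in
      {e (x \<oplus>\<^bsub>M\<^esub> x') y \<ominus>\<^bsub>F\<^esub> (e x y \<oplus>\<^bsub>F\<^esub> e x' y) | x x' y.
          x \<in> carrier M \<and> x' \<in> carrier M \<and> y \<in> carrier N} \<union>
      {e x (y \<oplus>\<^bsub>N\<^esub> y') \<ominus>\<^bsub>F\<^esub> (e x y \<oplus>\<^bsub>F\<^esub> e x y') | x y y'.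
          x \<in> carrier M \<and> y \<in> carrier N \<and> y' \<in> carrier N} \<union>
      {e (c \<odot>\<^bsub>M\<^esub> x) y \<ominus>\<^bsub>F\<^esub> c \<odot>\<^bsub>F\<^esub> e x y | c x y.
          c \<in> carrier K \<and> x \<in> carrier M \<and> y \<in> carrier N} \<union>
      {e x (c \<odot>\<^bsub>N\<^esub> y) \<ominus>\<^bsub>F\<^esub> c \<odot>\<^bsub>F\<^esub> e x y | c x y.
          c \<in> carrier K \<and> x \<in> carrier M \<and> y \<in> carrier N})"

definition tensor_prod ::
  "('k, 'r) ring_scheme \<Rightarrow> ('k, 'b, 'm) module_scheme \<Rightarrow> ('k, 'c, 'n) module_scheme
    \<Rightarrow> ('k, ('b \<times> 'c \<Rightarrow> 'k) set) module"
  where "tensor_prod K M N = presented_module K (carrier M \<times> carrier N) (bilinear_rels K M N)"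

definition tens ::
  "('k, 'r) ring_scheme \<Rightarrow> ('k, 'b, 'm) module_scheme \<Rightarrow> ('k, 'c, 'n) module_scheme
    \<Rightarrow> 'b \<Rightarrow> 'c \<Rightarrow> ('b \<times> 'c \<Rightarrow> 'k) set"
  where "tens K M N x y =
    presented_gen K (carrier M \<times> carrier N) (bilinear_rels K M N) (x, y)"

text \<open>Here and below, a linear or bilinear map is given by its values on pure tensors. Since these
  generate, the map chosen by \<open>SOME\<close> is uniquely determined on the carrier.\<close>

definition alg_tensor ::
  "('k, 'r) ring_scheme \<Rightarrow> ('k, 'b, 'm) module_scheme \<Rightarrow> ('k, 'c, 'n) module_scheme
    \<Rightarrow> ('k, ('b \<times> 'c \<Rightarrow> 'k) set) module"
  where "alg_tensor K A B = (tensor_prod K A B)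
    \<lparr>mult := (SOME p.
        bilinear_map K (tensor_prod K A B) (tensor_prod K A B) (tensor_prod K A B) p \<and>
        (\<forall>a\<in>carrier A. \<forall>b\<in>carrier B. \<forall>a'\<in>carrier A. \<forall>b'\<in>carrier B.
          p (tens K A B a b) (tens K A B a' b') = tens K A B (a \<otimes>\<^bsub>A\<^esub> a') (b \<otimes>\<^bsub>B\<^esub> b'))),
     one := tens K A B \<one>\<^bsub>A\<^esub> \<one>\<^bsub>B\<^esub>\<rparr>"

text \<open>The direct sum of all tensor powers of \<open>M\<close>: generated by all lists over \<open>M\<close> subject to
  multilinearity. These relations only relate lists of the same length, so the lists of length
  \<open>n\<close> span the \<open>n\<close>-th tensor power, and the empty list spans a free module of rank one.\<close>

definition multilinear_rels ::
  "('k, 'r) ring_scheme \<Rightarrow> ('k, 'b, 'm) module_scheme \<Rightarrow> ('b list \<Rightarrow> 'k) set"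
  where "multilinear_rels K M =
    (let F = free_module K (lists (carrier M)); e = free_gen K in
      {e (xs @ (x \<oplus>\<^bsub>M\<^esub> y) # ys) \<ominus>\<^bsub>F\<^esub> (e (xs @ x # ys) \<oplus>\<^bsub>F\<^esub> e (xs @ y # ys)) | xs x y ys.
          xs \<in> lists (carrier M) \<and> x \<in> carrier M \<and> y \<in> carrier M \<and> ys \<in> lists (carrier M)} \<union>
      {e (xs @ (c \<odot>\<^bsub>M\<^esub> x) # ys) \<ominus>\<^bsub>F\<^esub> c \<odot>\<^bsub>F\<^esub> e (xs @ x # ys) | xs c x ys.
          xs \<in> lists (carrier M) \<and> c \<in> carrier K \<and> x \<in> carrier M \<and> ys \<in> lists (carrier M)})"

definition tensor_powers ::
  "('k, 'r) ring_scheme \<Rightarrow> ('k, 'b, 'm) module_scheme \<Rightarrow> ('k, ('b list \<Rightarrow> 'k) set) module"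
  where "tensor_powers K M = presented_module K (lists (carrier M)) (multilinear_rels K M)"

definition pure_tensor ::
  "('k, 'r) ring_scheme \<Rightarrow> ('k, 'b, 'm) module_scheme \<Rightarrow> 'b list \<Rightarrow> ('b list \<Rightarrow> 'k) set"
  where "pure_tensor K M xs = presented_gen K (lists (carrier M)) (multilinear_rels K M) xs"

definition tensor_algebra ::
  "('k, 'r) ring_scheme \<Rightarrow> ('k, 'b, 'm) module_scheme \<Rightarrow> ('k, ('b list \<Rightarrow> 'k) set) module"
  where "tensor_algebra K M = (tensor_powers K M)
    \<lparr>mult := (SOME p.
        bilinear_map K (tensor_powers K M) (tensor_powers K M) (tensor_powers K M) p \<and>
        (\<forall>xs\<in>lists (carrier M). \<forall>ys\<in>lists (carrier M).
          p (pure_tensor K M xs) (pure_tensor K M ys) = pure_tensor K M (xs @ ys))),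
     one := pure_tensor K M []\<rparr>"


section \<open>Symmetric square and symmetric algebra\<close>

definition sym_square_rels ::
  "('k, 'r) ring_scheme \<Rightarrow> ('k, 'b, 'm) module_scheme \<Rightarrow> ('b \<times> 'b \<Rightarrow> 'k) set"
  where "sym_square_rels K M = bilinear_rels K M M \<union>
    {free_gen K (x, y) \<ominus>\<^bsub>free_module K (carrier M \<times> carrier M)\<^esub> free_gen K (y, x) | x y.
      x \<in> carrier M \<and> y \<in> carrier M}"

definition sym_square ::
  "('k, 'r) ring_scheme \<Rightarrow> ('k, 'b, 'm) module_scheme \<Rightarrow> ('k, ('b \<times> 'b \<Rightarrow> 'k) set) module"
  where "sym_square K M = presented_module K (carrier M \<times> carrier M) (sym_square_rels K M)"

definition sym_tens ::
  "('k, 'r) ring_scheme \<Rightarrow> ('k, 'b, 'm) module_scheme \<Rightarrow> 'b \<Rightarrow> 'b \<Rightarrow> ('b \<times> 'b \<Rightarrow> 'k) set"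
  where "sym_tens K M x y =
    presented_gen K (carrier M \<times> carrier M) (sym_square_rels K M) (x, y)"

definition commutator_ideal ::
  "('k, 'r) ring_scheme \<Rightarrow> ('k, 'b, 'm) module_scheme \<Rightarrow> ('b list \<Rightarrow> 'k) set set"
  where "commutator_ideal K M =
    (let A = tensor_algebra K M; e = (\<lambda>x. pure_tensor K M [x]) in
      Idl\<^bsub>A\<^esub> {e x \<otimes>\<^bsub>A\<^esub> e y \<ominus>\<^bsub>A\<^esub> e y \<otimes>\<^bsub>A\<^esub> e x | x y. x \<in> carrier M \<and> y \<in> carrier M})"

definition sym_algebra ::
  "('k, 'r) ring_scheme \<Rightarrow> ('k, 'b, 'm) module_scheme \<Rightarrow> ('k, ('b list \<Rightarrow> 'k) set set) module"
  where "sym_algebra K M = quot_module (tensor_algebra K M) (commutator_ideal K M)"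

definition sym_incl ::
  "('k, 'r) ring_scheme \<Rightarrow> ('k, 'b, 'm) module_scheme \<Rightarrow> 'b \<Rightarrow> ('b list \<Rightarrow> 'k) set set"
  where "sym_incl K M x = commutator_ideal K M +>\<^bsub>tensor_algebra K M\<^esub> pure_tensor K M [x]"


section \<open>Differential and integro-differential rings\<close>

locale comm_diff_ring = cring R for R (structure) +
  fixes d
  assumes d_closed: "d \<in> carrier R \<rightarrow> carrier R"
    and d_add: "\<lbrakk>x \<in> carrier R; y \<in> carrier R\<rbrakk> \<Longrightarrow> d (x \<oplus> y) = d x \<oplus> d y"
    and d_mult: "\<lbrakk>x \<in> carrier R; y \<in> carrier R\<rbrakk> \<Longrightarrow> d (x \<otimes> y) = d x \<otimes> y \<oplus> x \<otimes> d y"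

definition constants :: "('a, 'm) ring_scheme \<Rightarrow> ('a \<Rightarrow> 'a) \<Rightarrow> ('a, 'm) ring_scheme"
  where "constants R d = R\<lparr>carrier := {c \<in> carrier R. d c = \<zero>\<^bsub>R\<^esub>}\<rparr>"

locale comm_int_diff_ring = comm_diff_ring R d for R (structure) and d +
  fixes I
  assumes int_linear: "linear_map (constants R d) (self_module R) (self_module R) I"
    and d_int: "x \<in> carrier R \<Longrightarrow> d (I x) = x"

definition diff_ring_hom ::
  "('a, 'm) ring_scheme \<Rightarrow> ('a \<Rightarrow> 'a) \<Rightarrow> ('b, 'n) ring_scheme \<Rightarrow> ('b \<Rightarrow> 'b) \<Rightarrow> ('a \<Rightarrow> 'b) \<Rightarrow> bool"
  where "diff_ring_hom R d S d' h \<longleftrightarrow>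
    comm_diff_ring R d \<and> comm_diff_ring S d' \<and> h \<in> ring_hom R S \<and>
    (\<forall>x\<in>carrier R. h (d x) = d' (h x))"

definition int_diff_ring_hom ::
  "('a, 'm) ring_scheme \<Rightarrow> ('a \<Rightarrow> 'a) \<Rightarrow> ('a \<Rightarrow> 'a) \<Rightarrow>
   ('b, 'n) ring_scheme \<Rightarrow> ('b \<Rightarrow> 'b) \<Rightarrow> ('b \<Rightarrow> 'b) \<Rightarrow> ('a \<Rightarrow> 'b) \<Rightarrow> bool"
  where "int_diff_ring_hom R d I S d' I' h \<longleftrightarrow>
    comm_int_diff_ring R d I \<and> comm_int_diff_ring S d' I' \<and> h \<in> ring_hom R S \<and>
    (\<forall>x\<in>carrier R. h (d x) = d' (h x)) \<and> (\<forall>x\<in>carrier R. h (I x) = I' (h x))"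

definition int_diff_ideal ::
  "('a, 'm) ring_scheme \<Rightarrow> ('a \<Rightarrow> 'a) \<Rightarrow> ('a \<Rightarrow> 'a) \<Rightarrow> 'a set \<Rightarrow> bool"
  where "int_diff_ideal R d I J \<longleftrightarrow> ideal J R \<and> d ` J \<subseteq> J \<and> I ` J \<subseteq> J"

definition gen_int_diff_ideal ::
  "('a, 'm) ring_scheme \<Rightarrow> ('a \<Rightarrow> 'a) \<Rightarrow> ('a \<Rightarrow> 'a) \<Rightarrow> 'a set \<Rightarrow> 'a set"
  where "gen_int_diff_ideal R d I E = \<Inter>{J. int_diff_ideal R d I J \<and> E \<subseteq> J}"

text \<open>The map on the quotient modulo \<open>J\<close> induced by a map that respects \<open>J\<close>.\<close>

definition quot_map :: "('a, 'm) ring_scheme \<Rightarrow> 'a set \<Rightarrow> ('a \<Rightarrow> 'a) \<Rightarrow> 'a set \<Rightarrow> 'a set"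
  where "quot_map R J g X = (\<Union>x\<in>X. J +>\<^bsub>R\<^esub> g x)"

definition evaluation ::
  "('a, 'm) ring_scheme \<Rightarrow> ('a \<Rightarrow> 'a) \<Rightarrow> ('a \<Rightarrow> 'a) \<Rightarrow> 'a \<Rightarrow> 'a"
  where "evaluation R d I x = x \<ominus>\<^bsub>R\<^esub> I (d x)"

text \<open>The nested integral of a nonempty list; the value at the empty list is irrelevant.\<close>

fun nested_int ::
  "('b, 'n) ring_scheme \<Rightarrow> ('b \<Rightarrow> 'b) \<Rightarrow> ('a \<Rightarrow> 'b) \<Rightarrow> 'a list \<Rightarrow> 'b"
  where
    "nested_int S I h [] = \<one>\<^bsub>S\<^esub>"
  | "nested_int S I h [f] = I (h f)"
  | "nested_int S I h (f # g # fs) = I (h f \<otimes>\<^bsub>S\<^esub> nested_int S I h (g # fs))"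


section \<open>The setting\<close>

locale quasi_integration = comm_diff_ring R d for R (structure) and d +
  fixes Q
  assumes Q_linear: "linear_map (constants R d) (self_module R) (self_module R) Q"
    and d_Q_d: "x \<in> carrier R \<Longrightarrow> d (Q (d x)) = d x"
    and Q_d_Q: "x \<in> carrier R \<Longrightarrow> Q (d (Q x)) = Q x"
begin

abbreviation "C \<equiv> constants R d"

abbreviation "RR \<equiv> self_module R"

definition "RJ = RR\<lparr>carrier := Q ` carrier R\<rparr>"

definition "RT = RR\<lparr>carrier := {r \<in> carrier R. Q r = \<zero>}\<rparr>"

abbreviation "words \<equiv> lists (carrier RT)"

text \<open>\<open>TA\<close> carries the concatenation product; \<open>TT\<close> is the same module with the shuffle product.\<close>

definition "TA = tensor_algebra C RT"

definition "word f = pure_tensor C RT f"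

definition "shuffle = (SOME p. bilinear_map C TA TA TA p \<and>
  (\<forall>f\<in>words. p (word []) (word f) = word f \<and> p (word f) (word []) = word f) \<and>
  (\<forall>a\<in>carrier RT. \<forall>f\<in>words. \<forall>b\<in>carrier RT. \<forall>g\<in>words.
    p (word (a # f)) (word (b # g)) =
      word [a] \<otimes>\<^bsub>TA\<^esub> p (word f) (word (b # g)) \<oplus>\<^bsub>TA\<^esub> word [b] \<otimes>\<^bsub>TA\<^esub> p (word (a # f)) (word g)))"

definition "TT = TA\<lparr>mult := shuffle\<rparr>"


subsection \<open>The integro-differential ring with quasi-integration and shuffle product\<close>

definition "IDRQ = alg_tensor C RR TT"

definition "tensQ f0 t = tens C RR TT f0 t"

definition "derivQ = (SOME D. linear_map C IDRQ IDRQ D \<and>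
  (\<forall>f0\<in>carrier R. D (tensQ f0 (word [])) = tensQ (d f0) (word [])) \<and>
  (\<forall>f0\<in>carrier R. \<forall>f1\<in>carrier RT. \<forall>f\<in>words.
    D (tensQ f0 (word (f1 # f))) = tensQ (d f0) (word (f1 # f)) \<oplus>\<^bsub>IDRQ\<^esub> tensQ (f0 \<otimes> f1) (word f)))"

definition "intQ = (SOME I. linear_map C IDRQ IDRQ I \<and>
  (\<forall>f0\<in>carrier R. I (tensQ f0 (word [])) =
    tensQ (Q f0) (word []) \<oplus>\<^bsub>IDRQ\<^esub> tensQ \<one> (word [f0 \<ominus> d (Q f0)])) \<and>
  (\<forall>f0\<in>carrier R. \<forall>f1\<in>carrier RT. \<forall>f\<in>words. I (tensQ f0 (word (f1 # f))) =
    tensQ (Q f0) (word (f1 # f)) \<ominus>\<^bsub>IDRQ\<^esub> I (tensQ (Q f0 \<otimes> f1) (word f))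
      \<oplus>\<^bsub>IDRQ\<^esub> tensQ \<one> (word ((f0 \<ominus> d (Q f0)) # f1 # f))))"

definition "inclQ f = tensQ f (word [])"


subsection \<open>The free integro-differential ring\<close>

definition "T_pos = TT\<lparr>carrier := gen_submodule C TT {word f | f. f \<in> words \<and> f \<noteq> []}\<rparr>"

definition "M1 = tensor_prod C RJ TT"

definition "M2 = sym_square C T_pos"

definition "C1 = sym_algebra C M1"

definition "eps1 r t = sym_incl C M1 (tens C RJ TT r t)"

text \<open>\<open>S2\<close> and \<open>epsS\<close> live before, \<open>C2\<close> and \<open>eps2\<close> after taking the quotient by \<open>J2\<close>.\<close>

definition "S2 = sym_algebra C M2"

definition "epsS s t = sym_incl C M2 (sym_tens C T_pos s t)"

text \<open>With \<open>f = [f\<^sub>1, \<dots>, f\<^sub>n]\<close>, the subtensors of indices \<open>1, \<dots>, i\<close> and \<open>i + 1, \<dots>, n\<close> are those of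
  \<open>take i f\<close> and \<open>drop i f\<close>. The truncated subtraction \<open>1 - j\<close> on the naturals is \<open>max 0 (1 - j)\<close>.\<close>

definition "J2_gen f g h =
  epsS (word f \<otimes>\<^bsub>TT\<^esub> word g) (word h) \<ominus>\<^bsub>S2\<^esub> epsS (word f) (word g \<otimes>\<^bsub>TT\<^esub> word h) \<oplus>\<^bsub>S2\<^esub>
  (\<Oplus>\<^bsub>S2\<^esub>j\<in>{..<length g}.
    (\<Oplus>\<^bsub>S2\<^esub>i\<in>{1 - j..<length f}.
      epsS (word (drop i f)) (word (drop j g)) \<otimes>\<^bsub>S2\<^esub>
      epsS (word (take i f) \<otimes>\<^bsub>TT\<^esub> word (take j g)) (word h)) \<ominus>\<^bsub>S2\<^esub>
    (\<Oplus>\<^bsub>S2\<^esub>k\<in>{1 - j..<length h}.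
      epsS (word f) (word (take j g) \<otimes>\<^bsub>TT\<^esub> word (take k h)) \<otimes>\<^bsub>S2\<^esub>
      epsS (word (drop j g)) (word (drop k h))))"

definition "J2 = Idl\<^bsub>S2\<^esub> {J2_gen f g h | f g h.
  f \<in> words \<and> g \<in> words \<and> h \<in> words \<and> f \<noteq> [] \<and> g \<noteq> [] \<and> h \<noteq> []}"

definition "C2 = quot_module S2 J2"

definition "eps2 s t = J2 +>\<^bsub>S2\<^esub> epsS s t"

definition "CT_module = tensor_prod C C2 TT"

definition "tensCT c t = tens C C2 TT c t"

definition "CT_mult = (SOME p. bilinear_map C CT_module CT_module CT_module p \<and>
  (\<forall>c\<in>carrier C2. \<forall>e\<in>carrier C2. \<forall>f\<in>words. \<forall>g\<in>words.
    p (tensCT c (word f)) (tensCT e (word g)) =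
      tensCT (c \<otimes>\<^bsub>C2\<^esub> e) (word f \<otimes>\<^bsub>TT\<^esub> word g) \<oplus>\<^bsub>CT_module\<^esub>
      (\<Oplus>\<^bsub>CT_module\<^esub>i\<in>{..<length f}. \<Oplus>\<^bsub>CT_module\<^esub>j\<in>{..<length g}.
        tensCT (c \<otimes>\<^bsub>C2\<^esub> e \<otimes>\<^bsub>C2\<^esub> eps2 (word (drop i f)) (word (drop j g)))
          (word (take i f) \<otimes>\<^bsub>TT\<^esub> word (take j g)))))"

definition "CT = CT_module\<lparr>mult := CT_mult, one := tensCT \<one>\<^bsub>C2\<^esub> (word [])\<rparr>"

definition "IDR = alg_tensor C RR (alg_tensor C C1 CT)"

definition "tens4 f0 c1 c2 t = tens C RR (alg_tensor C C1 CT) f0 (tens C C1 CT c1 (tensCT c2 t))"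

definition "deriv = (SOME D. linear_map C IDR IDR D \<and>
  (\<forall>f0\<in>carrier R. \<forall>c1\<in>carrier C1. \<forall>c2\<in>carrier C2.
    D (tens4 f0 c1 c2 (word [])) = tens4 (d f0) c1 c2 (word [])) \<and>
  (\<forall>f0\<in>carrier R. \<forall>c1\<in>carrier C1. \<forall>c2\<in>carrier C2. \<forall>f1\<in>carrier RT. \<forall>f\<in>words.
    D (tens4 f0 c1 c2 (word (f1 # f))) =
      tens4 (d f0) c1 c2 (word (f1 # f)) \<oplus>\<^bsub>IDR\<^esub> tens4 (f0 \<otimes> f1) c1 c2 (word f)))"

definition "integ = (SOME I. linear_map C IDR IDR I \<and>
  (\<forall>f0\<in>carrier R. \<forall>c1\<in>carrier C1. \<forall>c2\<in>carrier C2. I (tens4 f0 c1 c2 (word [])) =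
    tens4 (Q f0) c1 c2 (word [])
      \<ominus>\<^bsub>IDR\<^esub> tens4 \<one> (c1 \<otimes>\<^bsub>C1\<^esub> eps1 (Q f0) (word [])) c2 (word [])
      \<oplus>\<^bsub>IDR\<^esub> tens4 \<one> c1 c2 (word [f0 \<ominus> d (Q f0)])) \<and>
  (\<forall>f0\<in>carrier R. \<forall>c1\<in>carrier C1. \<forall>c2\<in>carrier C2. \<forall>f1\<in>carrier RT. \<forall>f\<in>words.
    I (tens4 f0 c1 c2 (word (f1 # f))) =
      tens4 (Q f0) c1 c2 (word (f1 # f))
        \<ominus>\<^bsub>IDR\<^esub> tens4 \<one> (c1 \<otimes>\<^bsub>C1\<^esub> eps1 (Q f0) (word (f1 # f))) c2 (word [])
        \<ominus>\<^bsub>IDR\<^esub> I (tens4 (Q f0 \<otimes> f1) c1 c2 (word f))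
        \<oplus>\<^bsub>IDR\<^esub> tens4 \<one> c1 c2 (word ((f0 \<ominus> d (Q f0)) # f1 # f))))"

definition "incl f = tens4 f \<one>\<^bsub>C1\<^esub> \<one>\<^bsub>C2\<^esub> (word [])"


subsection \<open>The ideal relating the two rings\<close>

text \<open>Pure tensors with scalar entries elsewhere; these form the submodules
  \<open>C \<otimes> \<epsilon>(M1) \<otimes> C \<otimes> C\<one>\<close> and \<open>C \<otimes> C \<otimes> \<epsilon>(M2) \<otimes> C\<one>\<close>, where \<open>C\<close> sits in the second
  and third factor as the multiples of the unit.\<close>

definition "J_gens =
  {tens4 a (sym_incl C M1 m) (b \<odot>\<^bsub>C2\<^esub> \<one>\<^bsub>C2\<^esub>) (c \<odot>\<^bsub>TT\<^esub> \<one>\<^bsub>TT\<^esub>) | a b c m.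
     a \<in> carrier C \<and> b \<in> carrier C \<and> c \<in> carrier C \<and> m \<in> carrier M1} \<union>
  {tens4 a (b \<odot>\<^bsub>C1\<^esub> \<one>\<^bsub>C1\<^esub>) (J2 +>\<^bsub>S2\<^esub> sym_incl C M2 m) (c \<odot>\<^bsub>TT\<^esub> \<one>\<^bsub>TT\<^esub>) | a b c m.
     a \<in> carrier C \<and> b \<in> carrier C \<and> c \<in> carrier C \<and> m \<in> carrier M2}"

definition "J = gen_int_diff_ideal IDR deriv integ J_gens"

end

end

theory Submission
  imports Defs "HOL-Library.Multiset"
begin

text \<open>
  The evaluation \<open>E\<^sub>Q = id - \<integral>\<^sub>Q \<partial>\<close> kills \<open>f\<^sub>0 \<otimes> w\<close> for every nonempty word \<open>w\<close> and maps \<open>f\<^sub>0 \<otimes> 1\<close> to the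
  constant part of \<open>f\<^sub>0\<close>. Constants are fixed by \<open>E\<^sub>Q\<close>, so the constants of the ring with shuffle product are
  just \<open>\<C> \<otimes> 1\<close>; linearity of \<open>\<integral>\<^sub>Q\<close> over them and the vanishing of \<open>E\<^sub>Q\<close> on products of nested integrals follow.

  The product of \<open>\<C>\<^sub>2 \<otimes> \<T>\<close> is the shuffle product twisted by a symmetric 2-cocycle \<open>\<omega>\<close> with values in \<open>\<C>\<^sub>2\<close>.
  Its associativity combines the cocycle identity with the compatibility of deconcatenation and shuffle. The
  augmentations of \<open>\<C>\<^sub>1\<close> and \<open>\<C>\<^sub>2\<close>, which send the generators \<open>\<epsilon>(\<dots>)\<close> to \<open>0\<close>, turn \<open>\<omega>\<close> into the trivial
  cocycle and induce a surjective homomorphism \<open>\<Psi>\<close> of integro-differential rings with section \<open>\<sigma>\<close>. Modulo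
  \<open>J\<close> every element is congruent to its image under \<open>\<sigma> \<circ> \<Psi>\<close>, hence \<open>J = ker \<Psi>\<close>, and \<open>\<psi>\<close> is induced by
  \<open>\<Psi>\<close>. It is unique because \<open>1 \<otimes> 1 \<otimes> 1 \<otimes> (a # w) = \<integral>(a \<otimes> 1 \<otimes> 1 \<otimes> w)\<close> for \<open>a \<in> \<R>\<^sub>T\<close>, so that the elements
  of \<open>\<R>\<close> generate the quotient as an integro-differential ring.
\<close>

subsection \<open>Shuffles and deconcatenations\<close>

text \<open>Every structure map is a Hilbert choice of a linear map with prescribed values on pure
  tensors, so each of them costs an existence proof before its defining equations can be used. To
  avoid returning to relations each time, existence is reduced to linearity in one argument at a
  time, and functions on words are checked letter by letter. Products of words are described by
  multisets of words: these form a commutative monoid as a type, so reorderings of nested sums are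
  proved for them once and only then mapped into the carrier-based modules. The hard point is the
  associativity of the product of \<open>CT\<close>. Commutativity rewrites x(yz) as (yz)x, so that
  only left-bracketed products have to be computed and the cocycle identity becomes an invariance
  under cyclic rotation of three words. The integro-differential laws of the quotient are read off
  from the ring with shuffle product through the injective map induced by
  \<open>\<Psi>\<close>.\<close>

lemma sum_mset_sum_mset:
  fixes F :: "'b \<Rightarrow> 'c::comm_monoid_add"
  shows "(\<Sum>x\<in>#(\<Sum>y\<in>#A. B y). F x) = (\<Sum>y\<in>#A. \<Sum>x\<in>#B y. F x)"
  by (induction A) auto

lemma image_mset_sum_mset: "image_mset k (\<Sum>y\<in>#A. B y) = (\<Sum>y\<in>#A. image_mset k (B y))"
  by (induction A) auto

lemma sum_mset_cong:
  "(\<And>x. x \<in># A \<Longrightarrow> F x = G x) \<Longrightarrow> (\<Sum>x\<in>#A. F x) = (\<Sum>x\<in>#A. G x)"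
  by (metis image_mset_cong)

text \<open>A multiset, because equal interleavings count with multiplicity; the shuffle product of
  two pure tensors is the sum of the words in it.\<close>

fun shuf :: "'a list \<Rightarrow> 'a list \<Rightarrow> 'a list multiset" where
  "shuf [] g = {#g#}"
| "shuf (a # f) [] = {#a # f#}"
| "shuf (a # f) (b # g) = image_mset (Cons a) (shuf f (b # g)) + image_mset (Cons b) (shuf (a # f) g)"

lemma shuf_Nil2 [simp]: "shuf f [] = {#f#}"
  by (cases f) auto

lemma sum_shuf_Nil [simp]: "(\<Sum>w\<in>#A. shuf [] w) = A"
  by (induction A) auto

lemma shuf_commute: "shuf f g = shuf g f"
  by (induction f g rule: shuf.induct) (auto simp: add.commute)

lemma set_shuf: "w \<in># shuf f g \<Longrightarrow> set w = set f \<union> set g"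
  by (induction f g arbitrary: w rule: shuf.induct) auto

lemma shuf_in_lists: "f \<in> lists A \<Longrightarrow> g \<in> lists A \<Longrightarrow> w \<in># shuf f g \<Longrightarrow> w \<in> lists A"
  using set_shuf[of w f g] by (auto simp: lists_eq_set)

lemma shuf_ne_Nil: "w \<in># shuf f g \<Longrightarrow> w = [] \<longleftrightarrow> f = [] \<and> g = []"
  using set_shuf[of w f g] by auto

text \<open>The first letter of a triple interleaving comes from one of the three words. Removing it
  leaves an instance of smaller total length, so both sides split into the same three parts.\<close>

lemma shuf_assoc: "(\<Sum>w\<in>#shuf f g. shuf w h) = (\<Sum>w\<in>#shuf g h. shuf f w)"
proof (induction "length f + length g + length h" arbitrary: f g h rule: less_induct)
  case less
  show ?case
  proof (cases "f = [] \<or> g = [] \<or> h = []")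
    case True
    then show ?thesis by auto
  next
    case False
    then obtain a f' b g' c h' where e: "f = a # f'" "g = b # g'" "h = c # h'"
      by (auto simp: neq_Nil_conv)
    have 1: "(\<Sum>w\<in>#shuf f' g. shuf w h) = (\<Sum>w\<in>#shuf g h. shuf f' w)"
      using less[of f' g h] e by simp
    have 2: "(\<Sum>w\<in>#shuf f g'. shuf w h) = (\<Sum>w\<in>#shuf g' h. shuf f w)"
      using less[of f g' h] e by simp
    have 3: "(\<Sum>w\<in>#shuf f g. shuf w h') = (\<Sum>w\<in>#shuf g h'. shuf f w)"
      using less[of f g h'] e by simp
    have "(\<Sum>w\<in>#shuf f g. shuf w h) =
        image_mset (Cons a) (\<Sum>w\<in>#shuf f' g. shuf w h) +
        image_mset (Cons b) (\<Sum>w\<in>#shuf f g'. shuf w h) +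
        image_mset (Cons c) (\<Sum>w\<in>#shuf f g. shuf w h')"
      by (simp add: e image_mset.compositionality o_def image_mset_sum_mset sum_mset.distrib ac_simps)
    also have "\<dots> = (\<Sum>w\<in>#shuf g h. shuf f w)"
      unfolding 1 2 3
      by (simp add: e image_mset.compositionality o_def image_mset_sum_mset sum_mset.distrib ac_simps)
    finally show ?thesis .
  qed
qed

section \<open>Deconcatenation of words\<close>

fun splits :: "'a list \<Rightarrow> ('a list \<times> 'a list) multiset" where
  "splits [] = {#([], [])#}"
| "splits (a # f) = add_mset ([], a # f) (image_mset (\<lambda>(u, v). (a # u, v)) (splits f))"

lemma splits_append: "(u, v) \<in># splits f \<Longrightarrow> u @ v = f"
  by (induction f arbitrary: u v) auto

lemma splits_in_lists: "f \<in> lists A \<Longrightarrow> (u, v) \<in># splits f \<Longrightarrow> u \<in> lists A \<and> v \<in> lists A"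
  using splits_append[of u v f] by auto

text \<open>Links cuts to the index ranges of the definitions: there the cut positions stay below
  the length, which leaves out exactly the cut with empty tail.\<close>

lemma splits_take_drop:
  "splits f = add_mset (f, []) (image_mset (\<lambda>i. (take i f, drop i f)) (mset_set {..<length f}))"
proof (induction f)
  case (Cons a f)
  have "mset_set {..<Suc n} = add_mset 0 (image_mset Suc (mset_set {..<n}))" for n
    by (simp add: lessThan_Suc_eq_insert_0 image_mset_mset_set)
  then show ?case
    by (simp add: Cons image_mset.compositionality o_def add_mset_commute)
qed simp

text \<open>Both sides run over the factorisations of \<open>f\<close> into three words.
  \<open>F\<close> is arbitrary in the induction, since the step replaces it by \<open>F\<close>
  with a letter prefixed to its first argument.\<close>

lemma splits_coassoc:
  fixes F :: "'a list \<Rightarrow> 'a list \<Rightarrow> 'a list \<Rightarrow> 'b::comm_monoid_add"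
  shows "(\<Sum>(u, v)\<in>#splits f. \<Sum>(u1, u2)\<in>#splits u. F u1 u2 v) =
    (\<Sum>(u, v)\<in>#splits f. \<Sum>(v1, v2)\<in>#splits v. F u v1 v2)"
proof (induction f arbitrary: F)
  case (Cons a f)
  show ?case
    by (simp add: image_mset.compositionality o_def case_prod_unfold sum_mset.distrib
        Cons[of "\<lambda>u. F (a # u)", unfolded case_prod_unfold] add.assoc)
qed simp

text \<open>The bialgebra law: a cut of an interleaving consists of a cut of each word together with
  an interleaving of the heads and one of the tails.\<close>

lemma splits_shuf:
  fixes F :: "'a list \<Rightarrow> 'a list \<Rightarrow> 'b::comm_monoid_add"
  shows "(\<Sum>w\<in>#shuf f g. \<Sum>(w1, w2)\<in>#splits w. F w1 w2) =
    (\<Sum>(f1, f2)\<in>#splits f. \<Sum>(g1, g2)\<in>#splits g. \<Sum>w1\<in>#shuf f1 g1. \<Sum>w2\<in>#shuf f2 g2. F w1 w2)"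
proof (induction f g arbitrary: F rule: shuf.induct)
  case (3 a f b g)
  show ?case
    by (simp add: image_mset.compositionality o_def case_prod_unfold sum_mset.distrib
        "3.IH"(1)[of "\<lambda>u. F (a # u)", unfolded case_prod_unfold]
        "3.IH"(2)[of "\<lambda>u. F (b # u)", unfolded case_prod_unfold] ac_simps)
qed (auto simp: image_mset.compositionality o_def case_prod_unfold)

section \<open>Indices of the twisted product\<close>

text \<open>An entry \<open>(f2, g2, w)\<close> records the two tails that are fed to the cocycle
  and an interleaving \<open>w\<close> of the two heads. One entry stands for one summand of the
  twisted product, empty tails included.\<close>

definition twist :: "'a list \<Rightarrow> 'a list \<Rightarrow> ('a list \<times> 'a list \<times> 'a list) multiset" where
  "twist f g = (\<Sum>(f1, f2)\<in>#splits f. \<Sum>(g1, g2)\<in>#splits g. image_mset (\<lambda>w. (f2, g2, w)) (shuf f1 g1))"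

lemma sum_twist:
  fixes F :: "_ \<Rightarrow> 'b::comm_monoid_add"
  shows "(\<Sum>p\<in>#twist f g. F p) =
    (\<Sum>(f1, f2)\<in>#splits f. \<Sum>(g1, g2)\<in>#splits g. \<Sum>w\<in>#shuf f1 g1. F (f2, g2, w))"
  by (simp add: twist_def sum_mset_sum_mset image_mset.compositionality o_def case_prod_unfold)

lemma twist_commute: "twist g f = image_mset (\<lambda>(u, v, w). (v, u, w)) (twist f g)"
  unfolding twist_def
  by (simp add: image_mset_sum_mset case_prod_unfold image_mset.compositionality o_def)
    (subst sum_mset.swap, simp add: shuf_commute)

lemma twist_in_lists:
  "f \<in> lists A \<Longrightarrow> g \<in> lists A \<Longrightarrow> (u, v, w) \<in># twist f g \<Longrightarrow>
    u \<in> lists A \<and> v \<in> lists A \<and> w \<in> lists A"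
  unfolding twist_def by (auto dest!: splits_append shuf_in_lists[of _ A, rotated 2])

lemma sum_swap3:
  fixes F :: "_ \<Rightarrow> _ \<Rightarrow> _ \<Rightarrow> 'b::comm_monoid_add"
  shows "(\<Sum>u\<in>#A. \<Sum>v\<in>#B. \<Sum>w\<in>#C. F u v w) = (\<Sum>w\<in>#C. \<Sum>u\<in>#A. \<Sum>v\<in>#B. F u v w)"
  by (subst (2) sum_mset.swap, subst sum_mset.swap) (rule refl)

lemma sum_swap4:
  fixes F :: "_ \<Rightarrow> _ \<Rightarrow> _ \<Rightarrow> 'b::comm_monoid_add"
  shows "(\<Sum>w\<in>#A. \<Sum>t\<in>#B. \<Sum>h\<in>#C. \<Sum>v\<in>#D w h. F t h v) =
    (\<Sum>h\<in>#C. \<Sum>w\<in>#A. \<Sum>v\<in>#D w h. \<Sum>t\<in>#B. F t h v)"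
proof -
  have "(\<Sum>w\<in>#A. \<Sum>t\<in>#B. \<Sum>h\<in>#C. \<Sum>v\<in>#D w h. F t h v) =
    (\<Sum>w\<in>#A. \<Sum>h\<in>#C. \<Sum>t\<in>#B. \<Sum>v\<in>#D w h. F t h v)"
    by (subst (2) sum_mset.swap) (rule refl)
  also have "\<dots> = (\<Sum>w\<in>#A. \<Sum>h\<in>#C. \<Sum>v\<in>#D w h. \<Sum>t\<in>#B. F t h v)"
    by (rule sum_mset_cong, rule sum_mset_cong) (rule sum_mset.swap)
  finally show ?thesis by (subst (asm) (2) sum_mset.swap)
qed

text \<open>Shows what an iterated twisted product looks like: three heads are interleaved into the
  remaining word \<open>v\<close>, and the tails of \<open>f\<close> and \<open>g\<close> undergo a
  twist of their own before meeting the tail of \<open>h\<close>. The inner sum over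
  \<open>twist f2 g2\<close> is the one that defines \<open>\<zeta>\<close> below.\<close>

lemma twist_twist:
  fixes G :: "_ \<Rightarrow> _ \<Rightarrow> _ \<Rightarrow> _ \<Rightarrow> _ \<Rightarrow> 'b::comm_monoid_add"
  shows "(\<Sum>(f2, g2, w)\<in>#twist f g. \<Sum>(w2, h2, v)\<in>#twist w h. G f2 g2 w2 h2 v) =
    (\<Sum>(f1, f2)\<in>#splits f. \<Sum>(g1, g2)\<in>#splits g. \<Sum>(h1, h2)\<in>#splits h.
      \<Sum>v\<in>#(\<Sum>w\<in>#shuf f1 g1. shuf w h1). \<Sum>(f3, g3, w)\<in>#twist f2 g2. G f3 g3 w h2 v)"
    (is "?L = ?R")
proof -
  let ?I = "\<lambda>f2 g2 w1 w2. \<Sum>(h1, h2)\<in>#splits h. \<Sum>v\<in>#shuf w1 h1. G f2 g2 w2 h2 v"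
  have "?L = (\<Sum>(f1, f2)\<in>#splits f. \<Sum>(g1, g2)\<in>#splits g. \<Sum>w\<in>#shuf f1 g1.
      \<Sum>(w1, w2)\<in>#splits w. ?I f2 g2 w1 w2)"
    by (simp add: sum_twist case_prod_unfold)
  \<comment> \<open>A cut of the interleaving \<open>w\<close> is traded for cuts of its two
    sources.\<close>
  also have "\<dots> = (\<Sum>(f1, f2)\<in>#splits f. \<Sum>(g1, g2)\<in>#splits g.
      \<Sum>(u1, u2)\<in>#splits f1. \<Sum>(v1, v2)\<in>#splits g1. \<Sum>w1\<in>#shuf u1 v1. \<Sum>w2\<in>#shuf u2 v2. ?I f2 g2 w1 w2)"
    by (subst splits_shuf) (rule refl)
  also have "\<dots> = (\<Sum>(f1, f2)\<in>#splits f. \<Sum>(u1, u2)\<in>#splits f1. \<Sum>(g1, g2)\<in>#splits g.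
      \<Sum>(v1, v2)\<in>#splits g1. \<Sum>w1\<in>#shuf u1 v1. \<Sum>w2\<in>#shuf u2 v2. ?I f2 g2 w1 w2)"
    unfolding case_prod_unfold by (subst (2) sum_mset.swap) (rule refl)
  \<comment> \<open>Coassociativity moves the inner cut from the head of \<open>f\<close> to its
    tail; the same is then done for \<open>g\<close>.\<close>
  also have "\<dots> = (\<Sum>(f1, f2)\<in>#splits f. \<Sum>(u1, u2)\<in>#splits f2. \<Sum>(g1, g2)\<in>#splits g.
      \<Sum>(v1, v2)\<in>#splits g1. \<Sum>w1\<in>#shuf f1 v1. \<Sum>w2\<in>#shuf u1 v2. ?I u2 g2 w1 w2)"
    by (rule splits_coassoc)
  also have "\<dots> = (\<Sum>(f1, f2)\<in>#splits f. \<Sum>(u1, u2)\<in>#splits f2. \<Sum>(g1, g2)\<in>#splits g.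
      \<Sum>(v1, v2)\<in>#splits g2. \<Sum>w1\<in>#shuf f1 g1. \<Sum>w2\<in>#shuf u1 v1. ?I u2 v2 w1 w2)"
    by (subst splits_coassoc) (rule refl)
  also have "\<dots> = (\<Sum>(f1, f2)\<in>#splits f. \<Sum>(g1, g2)\<in>#splits g. \<Sum>w1\<in>#shuf f1 g1.
      \<Sum>(u1, u2)\<in>#splits f2. \<Sum>(v1, v2)\<in>#splits g2. \<Sum>w2\<in>#shuf u1 v1. ?I u2 v2 w1 w2)"
    unfolding case_prod_unfold
    by (rule sum_mset_cong, subst sum_mset.swap, rule sum_mset_cong) (rule sum_swap3)
  also have "\<dots> = (\<Sum>(f1, f2)\<in>#splits f. \<Sum>(g1, g2)\<in>#splits g. \<Sum>w1\<in>#shuf f1 g1.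
      \<Sum>(f3, g3, w2)\<in>#twist f2 g2. ?I f3 g3 w1 w2)"
    by (simp add: sum_twist case_prod_unfold)
  also have "\<dots> = ?R"
    unfolding case_prod_unfold sum_mset_sum_mset
    by (rule sum_mset_cong, rule sum_mset_cong) (rule sum_swap4)
  finally show ?thesis .
qed

subsection \<open>Linear maps and spanning sets\<close>

text \<open>Phrased through submodules instead of linear combinations: this is the form that yields
  an induction principle at once.\<close>

definition spans ::
  "('k, 'r) ring_scheme \<Rightarrow> ('k, 'b, 'm) module_scheme \<Rightarrow> 'b set \<Rightarrow> bool"
  where "spans K M G \<longleftrightarrow>
    G \<subseteq> carrier M \<and> (\<forall>H. submodule H K M \<longrightarrow> G \<subseteq> H \<longrightarrow> carrier M \<subseteq> H)"

text \<open>The family \<open>g\<close> may have repetitions and linear relations, so prescribed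
  values can contradict each other; the predicate asserts that they do not.\<close>

definition lin_ext ::
  "('k, 'r) ring_scheme \<Rightarrow> ('k, 'b, 'm) module_scheme \<Rightarrow> ('k, 'c, 'n) module_scheme
    \<Rightarrow> ('s \<Rightarrow> 'b) \<Rightarrow> 's set \<Rightarrow> ('s \<Rightarrow> 'c) \<Rightarrow> bool"
  where "lin_ext K M P g S \<phi> \<longleftrightarrow> (\<exists>l. linear_map K M P l \<and> (\<forall>s\<in>S. l (g s) = \<phi> s))"

lemma linear_mapI:
  assumes "\<And>x. x \<in> carrier M \<Longrightarrow> g x \<in> carrier N"
    and "\<And>x y. x \<in> carrier M \<Longrightarrow> y \<in> carrier M \<Longrightarrow> g (x \<oplus>\<^bsub>M\<^esub> y) = g x \<oplus>\<^bsub>N\<^esub> g y"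
    and "\<And>c x. c \<in> carrier K \<Longrightarrow> x \<in> carrier M \<Longrightarrow> g (c \<odot>\<^bsub>M\<^esub> x) = c \<odot>\<^bsub>N\<^esub> g x"
  shows "linear_map K M N g"
  using assms by (auto simp: linear_map_def)

lemma linear_mapD:
  assumes "linear_map K M N g"
  shows "x \<in> carrier M \<Longrightarrow> g x \<in> carrier N"
    and "x \<in> carrier M \<Longrightarrow> y \<in> carrier M \<Longrightarrow> g (x \<oplus>\<^bsub>M\<^esub> y) = g x \<oplus>\<^bsub>N\<^esub> g y"
    and "c \<in> carrier K \<Longrightarrow> x \<in> carrier M \<Longrightarrow> g (c \<odot>\<^bsub>M\<^esub> x) = c \<odot>\<^bsub>N\<^esub> g x"
  using assms by (auto simp: linear_map_def)

lemma linear_map_zero: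
  assumes "module K M" "module K N" "linear_map K M N g"
  shows "g \<zero>\<^bsub>M\<^esub> = \<zero>\<^bsub>N\<^esub>"
proof -
  interpret M: module K M by fact
  interpret N: module K N by fact
  have "g (\<zero>\<^bsub>K\<^esub> \<odot>\<^bsub>M\<^esub> \<zero>\<^bsub>M\<^esub>) = \<zero>\<^bsub>K\<^esub> \<odot>\<^bsub>N\<^esub> g \<zero>\<^bsub>M\<^esub>"
    by (rule linear_mapD(3)[OF assms(3)]) auto
  then show ?thesis using linear_mapD(1)[OF assms(3), of "\<zero>\<^bsub>M\<^esub>"] by simp
qed

lemma linear_map_neg:
  assumes "module K M" "module K N" "linear_map K M N g" "x \<in> carrier M"
  shows "g (\<ominus>\<^bsub>M\<^esub> x) = \<ominus>\<^bsub>N\<^esub> g x"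
proof -
  interpret M: module K M by fact
  interpret N: module K N by fact
  have "g (\<ominus>\<^bsub>M\<^esub> x) \<oplus>\<^bsub>N\<^esub> g x = \<zero>\<^bsub>N\<^esub>"
    using linear_mapD(2)[OF assms(3), of "\<ominus>\<^bsub>M\<^esub> x" x] linear_map_zero[OF assms(1-3)] assms(4)
    by (simp add: M.M.l_neg)
  then show ?thesis
    using linear_mapD(1)[OF assms(3)] assms(4) by (simp add: N.M.minus_equality)
qed

lemma linear_map_minus:
  assumes "module K M" "module K N" "linear_map K M N g" "x \<in> carrier M" "y \<in> carrier M"
  shows "g (x \<ominus>\<^bsub>M\<^esub> y) = g x \<ominus>\<^bsub>N\<^esub> g y"
proof -
  interpret M: module K M by fact
  show ?thesis
    using linear_mapD(2)[OF assms(3), of x "\<ominus>\<^bsub>M\<^esub> y"] linear_map_neg[OF assms(1-3)] assms(4,5)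
    by (simp add: a_minus_def)
qed

lemma linear_map_const_zero: "module K N \<Longrightarrow> linear_map K M N (\<lambda>_. \<zero>\<^bsub>N\<^esub>)"
proof -
  assume "module K N"
  then interpret N: module K N .
  show ?thesis by (rule linear_mapI) auto
qed

lemma linear_map_id: "linear_map K M M (\<lambda>x. x)"
  by (rule linear_mapI) auto

lemma linear_map_add:
  assumes "module K N" "linear_map K M N f" "linear_map K M N g"
  shows "linear_map K M N (\<lambda>x. f x \<oplus>\<^bsub>N\<^esub> g x)"
proof -
  interpret N: module K N by fact
  show ?thesis
    by (rule linear_mapI)
      (auto simp: linear_mapD[OF assms(2)] linear_mapD[OF assms(3)] N.M.a_ac N.smult_r_distr)
qed

lemma linear_map_uminus:
  assumes "module K N" "linear_map K M N f"
  shows "linear_map K M N (\<lambda>x. \<ominus>\<^bsub>N\<^esub> f x)"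
proof -
  interpret N: module K N by fact
  show ?thesis
    by (rule linear_mapI)
      (auto simp: linear_mapD[OF assms(2)] N.M.a_ac N.smult_r_minus N.M.minus_add)
qed

lemma linear_map_sub:
  assumes "module K N" "linear_map K M N f" "linear_map K M N g"
  shows "linear_map K M N (\<lambda>x. f x \<ominus>\<^bsub>N\<^esub> g x)"
  unfolding a_minus_def
  by (rule linear_map_add[OF assms(1,2) linear_map_uminus[OF assms(1,3)]])

lemma linear_map_smult:
  assumes "module K N" "linear_map K M N f" "c \<in> carrier K"
  shows "linear_map K M N (\<lambda>x. c \<odot>\<^bsub>N\<^esub> f x)"
proof -
  interpret N: module K N by fact
  show ?thesis
    using assms(3)
    by (intro linear_mapI)
      (auto simp: linear_mapD[OF assms(2)] N.smult_r_distr N.smult_assoc1[symmetric] N.R.m_comm)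
qed

lemma linear_map_compose:
  assumes "linear_map K N P f" "linear_map K M N g"
  shows "linear_map K M P (\<lambda>x. f (g x))"
  by (rule linear_mapI) (auto simp: linear_mapD[OF assms(1)] linear_mapD[OF assms(2)])

lemma linear_map_cong:
  assumes "module K M" "linear_map K M N f" "\<And>x. x \<in> carrier M \<Longrightarrow> g x = f x"
  shows "linear_map K M N g"
proof -
  interpret M: module K M by fact
  show ?thesis
    by (rule linear_mapI) (auto simp: assms(3) linear_mapD[OF assms(2)])
qed

lemma bilinear_mapD:
  assumes "bilinear_map K M N P b"
  shows "x \<in> carrier M \<Longrightarrow> linear_map K N P (b x)"
    and "y \<in> carrier N \<Longrightarrow> linear_map K M P (\<lambda>x. b x y)"
  using assms by (auto simp: bilinear_map_def)

lemma bilinear_map_closed: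
  "bilinear_map K M N P b \<Longrightarrow> x \<in> carrier M \<Longrightarrow> y \<in> carrier N \<Longrightarrow> b x y \<in> carrier P"
  by (meson bilinear_mapD(1) linear_mapD(1))

lemma bilinear_map_compose_right:
  "bilinear_map K M N P b \<Longrightarrow> x \<in> carrier M \<Longrightarrow> linear_map K L N f \<Longrightarrow> linear_map K L P (\<lambda>z. b x (f z))"
  by (drule (1) bilinear_mapD(1)) (rule linear_map_compose)

lemma bilinear_map_compose_left:
  "bilinear_map K M N P b \<Longrightarrow> y \<in> carrier N \<Longrightarrow> linear_map K L M f \<Longrightarrow> linear_map K L P (\<lambda>z. b (f z) y)"
  by (drule (1) bilinear_mapD(2)) (rule linear_map_compose)

lemma span_closed: "spans K M G \<Longrightarrow> x \<in> G \<Longrightarrow> x \<in> carrier M"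
  by (auto simp: spans_def)

lemma span_induct [consumes 3, case_names gen add smult zero]:
  assumes "module K M" "spans K M G" "x \<in> carrier M"
    and gen: "\<And>x. x \<in> G \<Longrightarrow> P x"
    and add: "\<And>x y. x \<in> carrier M \<Longrightarrow> y \<in> carrier M \<Longrightarrow> P x \<Longrightarrow> P y \<Longrightarrow> P (x \<oplus>\<^bsub>M\<^esub> y)"
    and smult: "\<And>c x. c \<in> carrier K \<Longrightarrow> x \<in> carrier M \<Longrightarrow> P x \<Longrightarrow> P (c \<odot>\<^bsub>M\<^esub> x)"
    and zero: "P \<zero>\<^bsub>M\<^esub>"
  shows "P x"
proof -
  interpret M: module K M by fact
  have "submodule {x \<in> carrier M. P x} K M"
  proof (rule M.submoduleI)
    fix a assume "a \<in> {x \<in> carrier M. P x}"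
    then show "\<ominus>\<^bsub>M\<^esub> a \<in> {x \<in> carrier M. P x}"
      \<comment> \<open>The negative of \<open>a\<close> is its multiple by -1, so the induction
        rule needs no case for negatives.\<close>
      using smult[of "\<ominus>\<^bsub>K\<^esub> \<one>\<^bsub>K\<^esub>" a] by (simp add: M.smult_l_minus)
  qed (use zero add smult in auto)
  then show ?thesis using assms(2,3) gen by (auto simp: spans_def)
qed

lemma linear_map_eq:
  assumes "module K M" "module K N" "spans K M G" "linear_map K M N f" "linear_map K M N g"
    and "\<And>x. x \<in> G \<Longrightarrow> f x = g x" and "x \<in> carrier M"
  shows "f x = g x"
  using assms(1,3,7)
proof (induction rule: span_induct)
  case zero
  show ?case by (simp add: linear_map_zero[OF assms(1,2,4)] linear_map_zero[OF assms(1,2,5)])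
qed (auto simp: assms(6) linear_mapD[OF assms(4)] linear_mapD[OF assms(5)])

lemma spans_mono:
  "spans K M G \<Longrightarrow> G \<subseteq> G' \<Longrightarrow> G' \<subseteq> carrier M \<Longrightarrow> spans K M G'"
  by (auto simp: spans_def)

lemma spans_carrier: "spans K M (carrier M)"
  by (auto simp: spans_def)

text \<open>For fixed \<open>x\<close>, the functions on \<open>T\<close> that extend linearly to \<open>N\<close> form a submodule, so
  that it suffices to extend for generators \<open>x\<close>; no relations have to be checked.\<close>

lemma bilinear_ext:
  assumes M: "module K M" "spans K M (g ` S)" and N: "module K N" "spans K N (h ` T)"
    and P: "module K P"
    and l: "\<And>t. t \<in> T \<Longrightarrow> lin_ext K M P g S (\<lambda>s. b s t)"
    and r: "\<And>s. s \<in> S \<Longrightarrow> lin_ext K N P h T (\<lambda>t. b s t)"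
  shows "\<exists>B. bilinear_map K M N P B \<and> (\<forall>s\<in>S. \<forall>t\<in>T. B (g s) (h t) = b s t)"
proof -
  interpret M: module K M by fact
  interpret N: module K N by fact
  interpret P: module K P by fact
  from l obtain L where L: "\<And>t. t \<in> T \<Longrightarrow> linear_map K M P (L t)"
    "\<And>s t. s \<in> S \<Longrightarrow> t \<in> T \<Longrightarrow> L t (g s) = b s t"
    unfolding lin_ext_def by metis
  have "\<exists>k. linear_map K N P k \<and> (\<forall>t\<in>T. k (h t) = L t x)" if "x \<in> carrier M" for x
    using M that
  proof (induction rule: span_induct)
    case (gen x)
    then show ?case using r L unfolding lin_ext_def by (metis imageE)
  next
    case (add x y)
    then obtain k k' where "linear_map K N P k" "\<forall>t\<in>T. k (h t) = L t x"
      "linear_map K N P k'" "\<forall>t\<in>T. k' (h t) = L t y" by blast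
    with add(1,2) show ?case
      by (intro exI[of _ "\<lambda>z. k z \<oplus>\<^bsub>P\<^esub> k' z"]) (auto intro: linear_map_add[OF P] simp: linear_mapD[OF L(1)])
  next
    case (smult c x)
    then obtain k where "linear_map K N P k" "\<forall>t\<in>T. k (h t) = L t x" by blast
    with smult(1,2) show ?case
      by (intro exI[of _ "\<lambda>z. c \<odot>\<^bsub>P\<^esub> k z"]) (auto intro: linear_map_smult[OF P] simp: linear_mapD[OF L(1)])
  next
    case zero
    show ?case
      by (intro exI[of _ "\<lambda>z. \<zero>\<^bsub>P\<^esub>"])
        (auto intro: linear_map_const_zero[OF P] simp: linear_map_zero[OF M(1) P L(1)])
  qed
  then obtain B where B: "\<And>x. x \<in> carrier M \<Longrightarrow> linear_map K N P (B x)"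
    "\<And>x t. x \<in> carrier M \<Longrightarrow> t \<in> T \<Longrightarrow> B x (h t) = L t x"
    by metis
  have ht: "t \<in> T \<Longrightarrow> h t \<in> carrier N" for t
    using N(2) by (auto simp: spans_def)
  \<comment> \<open>\<open>B x\<close> was chosen separately for each \<open>x\<close>. It is linear
    in \<open>x\<close> nevertheless, because both sides of the required equations are linear in
    \<open>y\<close> and agree at the generators \<open>h t\<close>.\<close>
  have "linear_map K M P (\<lambda>x. B x y)" if "y \<in> carrier N" for y
  proof (rule linear_mapI)
    fix x x' assume x: "x \<in> carrier M" "x' \<in> carrier M"
    have "B (x \<oplus>\<^bsub>M\<^esub> x') y = (\<lambda>y. B x y \<oplus>\<^bsub>P\<^esub> B x' y) y"
      by (rule linear_map_eq[OF N(1) P N(2) _ _ _ that])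
        (use x B in \<open>auto intro!: linear_map_add[OF P] simp: linear_mapD[OF L(1)]\<close>)
    then show "B (x \<oplus>\<^bsub>M\<^esub> x') y = B x y \<oplus>\<^bsub>P\<^esub> B x' y" .
  next
    fix c x assume x: "c \<in> carrier K" "x \<in> carrier M"
    have "B (c \<odot>\<^bsub>M\<^esub> x) y = (\<lambda>y. c \<odot>\<^bsub>P\<^esub> B x y) y"
      by (rule linear_map_eq[OF N(1) P N(2) _ _ _ that])
        (use x B in \<open>auto intro!: linear_map_smult[OF P] simp: linear_mapD[OF L(1)]\<close>)
    then show "B (c \<odot>\<^bsub>M\<^esub> x) y = c \<odot>\<^bsub>P\<^esub> B x y" .
  qed (use B(1) that in \<open>auto dest: linear_mapD(1)\<close>)
  moreover have "s \<in> S \<Longrightarrow> g s \<in> carrier M" for s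
    using M(2) by (auto simp: spans_def)
  ultimately show ?thesis
    using B L(2) by (intro exI[of _ B]) (auto simp: bilinear_map_def)
qed

lemma lin_extI: "linear_map K M P l \<Longrightarrow> (\<And>s. s \<in> S \<Longrightarrow> l (g s) = \<phi> s) \<Longrightarrow> lin_ext K M P g S \<phi>"
  by (auto simp: lin_ext_def)

lemma lin_ext_linear: "linear_map K M P \<phi> \<Longrightarrow> lin_ext K M P (\<lambda>x. x) S \<phi>"
  by (rule lin_extI) auto

subsection \<open>Sums over multisets\<close>

text \<open>Terms outside the carrier are skipped, so that the sum is always an element of the carrier.\<close>

definition msum :: "('b, 'm) ring_scheme \<Rightarrow> ('a \<Rightarrow> 'b) \<Rightarrow> 'a multiset \<Rightarrow> 'b" where
  "msum M f A = fold_mset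
    (\<lambda>x s. if f x \<in> carrier M \<and> s \<in> carrier M then f x \<oplus>\<^bsub>M\<^esub> s else s) \<zero>\<^bsub>M\<^esub> A"

context abelian_monoid
begin

lemma msum_empty [simp]: "msum G f {#} = \<zero>"
  by (simp add: msum_def)

text \<open>\<open>fold_mset\<close> demands commutation for all arguments of the type; the guard in
  the folded function secures it outside the carrier as well.\<close>

lemma msum_aux:
  "comp_fun_commute (\<lambda>x s. if f x \<in> carrier G \<and> s \<in> carrier G then f x \<oplus> s else s)"
  by standard (auto simp: fun_eq_iff a_lcomm)

lemma msum_closed [simp, intro]: "msum G f A \<in> carrier G"
proof (induction A)
  case (add x A)
  then show ?case
    unfolding msum_def by (simp add: comp_fun_commute.fold_mset_add_mset[OF msum_aux])
qed simp

lemma msum_add_mset: "msum G f (add_mset x A) = (if f x \<in> carrier G then f x \<oplus> msum G f A else msum G f A)"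
  using msum_closed[of f A]
  unfolding msum_def by (simp add: comp_fun_commute.fold_mset_add_mset[OF msum_aux])

lemma msum_add_mset' [simp]: "f x \<in> carrier G \<Longrightarrow> msum G f (add_mset x A) = f x \<oplus> msum G f A"
  by (simp add: msum_add_mset)

lemma msum_union [simp]: "msum G f (A + B) = msum G f A \<oplus> msum G f B"
  by (induction A) (auto simp: msum_add_mset a_assoc)

lemma msum_image [simp]: "msum G f (image_mset g A) = msum G (\<lambda>x. f (g x)) A"
  by (induction A) (auto simp: msum_add_mset)

lemma msum_sum: "msum G f (\<Sum>x\<in>#A. B x) = msum G (\<lambda>x. msum G f (B x)) A"
  by (induction A) auto

lemma msum_cong: "(\<And>x. x \<in># A \<Longrightarrow> f x = g x) \<Longrightarrow> msum G f A = msum G g A"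
  by (induction A) (auto simp: msum_add_mset)

lemma msum_zero: "(\<And>x. x \<in># A \<Longrightarrow> f x = \<zero>) \<Longrightarrow> msum G f A = \<zero>"
  by (induction A) auto

lemma msum_add:
  "(\<And>x. x \<in># A \<Longrightarrow> f x \<in> carrier G) \<Longrightarrow> (\<And>x. x \<in># A \<Longrightarrow> g x \<in> carrier G) \<Longrightarrow>
    msum G (\<lambda>x. f x \<oplus> g x) A = msum G f A \<oplus> msum G g A"
  by (induction A) (auto simp: a_ac)

text \<open>The definitions sum over index ranges with \<open>finsum\<close>, whereas the
  calculations take place with multisets; this is the passage between the two.\<close>

lemma finsum_msum:
  "finite A \<Longrightarrow> (\<And>x. x \<in> A \<Longrightarrow> f x \<in> carrier G) \<Longrightarrow> finsum G f A = msum G f (mset_set A)"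
  by (induction A rule: finite_induct) (auto simp: finsum_insert Pi_def)

end

lemma linear_map_msum:
  assumes "module K M" "module K N" "linear_map K M N g" "\<And>x. x \<in># A \<Longrightarrow> f x \<in> carrier M"
  shows "g (msum M f A) = msum N (\<lambda>x. g (f x)) A"
proof -
  interpret M: module K M by fact
  interpret N: module K N by fact
  show ?thesis using assms(4)
    by (induction A) (auto simp: linear_map_zero[OF assms(1-3)] linear_mapD[OF assms(3)])
qed

lemma msum_linear_map:
  assumes "module K N" "\<And>x. x \<in># A \<Longrightarrow> linear_map K M N (f x)"
  shows "linear_map K M N (\<lambda>z. msum N (\<lambda>x. f x z) A)"
proof -
  interpret N: module K N by fact
  show ?thesis using assms(2)
  proof (induction A)
    case (add x A)
    have "linear_map K M N (\<lambda>z. f x z \<oplus>\<^bsub>N\<^esub> msum N (\<lambda>x. f x z) A)"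
      using add by (intro linear_map_add assms(1)) auto
    then show ?case
      unfolding linear_map_def N.M.msum_add_mset using add(2)[of x]
      by (auto simp: linear_mapD Pi_def intro!: linear_mapD)
  qed (auto intro: linear_map_const_zero assms(1))
qed

subsection \<open>Modules given by generators and relations\<close>

lemma abelian_group_eqI:
  assumes "abelian_group G" "x \<ominus>\<^bsub>G\<^esub> y = \<zero>\<^bsub>G\<^esub>" "x \<in> carrier G" "y \<in> carrier G"
  shows "x = y"
proof -
  interpret abelian_group G by fact
  show ?thesis
    using assms(2-4) minus_equality[of x "\<ominus>\<^bsub>G\<^esub> y"] by (simp add: a_minus_def)
qed

lemma submodule_zero: "submodule H K M \<Longrightarrow> \<zero>\<^bsub>M\<^esub> \<in> H"
  using subgroup.one_closed[OF submodule.axioms(1), of H K M] by simp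

section \<open>Free modules\<close>

lemma free_module_module:
  fixes K :: "('k, 'r) ring_scheme" and S :: "'b set"
  assumes "cring K"
  shows "module K (free_module K S)"
proof -
  interpret K: cring K by fact
  let ?F = "free_module K S"
  have add: "finite {x. f x \<oplus>\<^bsub>K\<^esub> g x \<noteq> \<zero>\<^bsub>K\<^esub>}"
    if "finite {x. f x \<noteq> \<zero>\<^bsub>K\<^esub>}" "finite {x. g x \<noteq> \<zero>\<^bsub>K\<^esub>}" for f g :: "'b \<Rightarrow> 'k"
    by (rule finite_subset[OF _ finite_UnI[OF that]]) auto
  have scale: "finite {x. c \<otimes>\<^bsub>K\<^esub> f x \<noteq> \<zero>\<^bsub>K\<^esub>}" if "finite {x. f x \<noteq> \<zero>\<^bsub>K\<^esub>}" "c \<in> carrier K"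
    for c and f :: "'b \<Rightarrow> 'k"
    by (rule finite_subset[OF _ that(1)]) (use that(2) in auto)
  have cl: "f x \<in> carrier K" if "f \<in> carrier ?F" for f x
    using that by (cases "x \<in> S") (auto simp: free_module_def)
  have "abelian_group ?F"
  proof (rule abelian_groupI)
    fix f assume f: "f \<in> carrier ?F"
    have "(\<lambda>x. \<ominus>\<^bsub>K\<^esub> f x) \<in> carrier ?F"
      using f scale[of f "\<ominus>\<^bsub>K\<^esub> \<one>\<^bsub>K\<^esub>"] cl[OF f]
      by (auto simp: free_module_def K.l_minus)
    then show "\<exists>y\<in>carrier ?F. y \<oplus>\<^bsub>?F\<^esub> f = \<zero>\<^bsub>?F\<^esub>"
      using cl[OF f] by (intro bexI[of _ "\<lambda>x. \<ominus>\<^bsub>K\<^esub> f x"]) (auto simp: free_module_def K.l_neg)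
  next
    fix f g h assume f: "f \<in> carrier ?F" and g: "g \<in> carrier ?F"
    show "f \<oplus>\<^bsub>?F\<^esub> g \<in> carrier ?F"
      using f g by (auto simp: free_module_def add)
    show "f \<oplus>\<^bsub>?F\<^esub> g = g \<oplus>\<^bsub>?F\<^esub> f"
      using cl[OF f] cl[OF g] by (auto simp: free_module_def K.a_comm)
    show "h \<in> carrier ?F \<Longrightarrow> f \<oplus>\<^bsub>?F\<^esub> g \<oplus>\<^bsub>?F\<^esub> h = f \<oplus>\<^bsub>?F\<^esub> (g \<oplus>\<^bsub>?F\<^esub> h)"
      using cl[OF f] cl[OF g] cl[of h] by (auto simp: free_module_def K.a_assoc)
    show "\<zero>\<^bsub>?F\<^esub> \<oplus>\<^bsub>?F\<^esub> f = f" using cl[OF f] by (auto simp: free_module_def)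
  qed (simp add: free_module_def)
  then show ?thesis
  proof (rule moduleI[OF assms])
    fix c f assume c: "c \<in> carrier K" and f: "f \<in> carrier ?F"
    show "c \<odot>\<^bsub>?F\<^esub> f \<in> carrier ?F"
      using c f by (auto simp: free_module_def scale)
    fix b assume b: "b \<in> carrier K"
    show "(c \<oplus>\<^bsub>K\<^esub> b) \<odot>\<^bsub>?F\<^esub> f = c \<odot>\<^bsub>?F\<^esub> f \<oplus>\<^bsub>?F\<^esub> b \<odot>\<^bsub>?F\<^esub> f"
      using c b cl[OF f] by (auto simp: free_module_def K.l_distr)
    show "(c \<otimes>\<^bsub>K\<^esub> b) \<odot>\<^bsub>?F\<^esub> f = c \<odot>\<^bsub>?F\<^esub> (b \<odot>\<^bsub>?F\<^esub> f)"
      using c b cl[OF f] by (auto simp: free_module_def K.m_assoc)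
  next
    fix c f g assume "c \<in> carrier K" and f: "f \<in> carrier ?F" "g \<in> carrier ?F"
    then show "c \<odot>\<^bsub>?F\<^esub> (f \<oplus>\<^bsub>?F\<^esub> g) = c \<odot>\<^bsub>?F\<^esub> f \<oplus>\<^bsub>?F\<^esub> c \<odot>\<^bsub>?F\<^esub> g"
      using cl[OF f(1)] cl[OF f(2)] by (auto simp: free_module_def K.r_distr)
  next
    fix f assume f: "f \<in> carrier ?F"
    then show "\<one>\<^bsub>K\<^esub> \<odot>\<^bsub>?F\<^esub> f = f" using cl[OF f] by (auto simp: free_module_def)
  qed
qed

lemma free_gen_closed:
  assumes "cring K" "x \<in> S"
  shows "free_gen K x \<in> carrier (free_module K S)"
proof -
  interpret K: cring K by fact
  have "finite {y. free_gen K x y \<noteq> \<zero>\<^bsub>K\<^esub>}"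
    by (rule finite_subset[of _ "{x}"]) (auto simp: free_gen_def)
  then show ?thesis using assms(2) by (auto simp: free_module_def free_gen_def)
qed

text \<open>Induction over a finite set containing the support: setting the value at one point to
  zero splits off a multiple of a single generator.\<close>

lemma free_module_spans:
  assumes "cring K"
  shows "spans K (free_module K S) (free_gen K ` S)"
  unfolding spans_def
proof (intro conjI allI impI subsetI)
  interpret K: cring K by fact
  interpret F: module K "free_module K S" by (rule free_module_module[OF assms])
  let ?F = "free_module K S"
  fix H f assume H: "submodule H K ?F" "free_gen K ` S \<subseteq> H" and f: "f \<in> carrier ?F"
  have "f \<in> H" if "finite A" "{x. f x \<noteq> \<zero>\<^bsub>K\<^esub>} \<subseteq> A" "f \<in> carrier ?F" for A f
    using that
  proof (induction A arbitrary: f rule: finite_induct)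
    case empty
    then have "f = \<zero>\<^bsub>?F\<^esub>" by (auto simp: free_module_def)
    with submodule_zero[OF H(1)] show ?case by simp
  next
    case (insert a A)
    show ?case
    proof (cases "a \<in> S")
      case True
      let ?f = "f(a := \<zero>\<^bsub>K\<^esub>)"
      have cl: "f x \<in> carrier K" for x
        using insert.prems(2) by (cases "x \<in> S") (auto simp: free_module_def)
      have "finite {x. ?f x \<noteq> \<zero>\<^bsub>K\<^esub>}"
        by (rule finite_subset[of _ "{x. f x \<noteq> \<zero>\<^bsub>K\<^esub>}"])
          (use insert.prems(2) in \<open>auto simp: free_module_def\<close>)
      then have "?f \<in> carrier ?F"
        using insert.prems(2) by (simp add: free_module_def)
      then have "?f \<in> H" using insert.prems(1) by (intro insert.IH[of ?f]) (force split: if_splits, assumption)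
      moreover have "f a \<odot>\<^bsub>?F\<^esub> free_gen K a \<in> H"
        using H True cl by (intro F.submoduleE(4)[OF H(1)]) auto
      moreover have "f = ?f \<oplus>\<^bsub>?F\<^esub> f a \<odot>\<^bsub>?F\<^esub> free_gen K a"
        using cl by (auto simp: free_module_def free_gen_def)
      ultimately show ?thesis using F.submoduleE(5)[OF H(1)] by metis
    next
      case False
      then have "f a = \<zero>\<^bsub>K\<^esub>" using insert.prems(2) by (auto simp: free_module_def)
      with insert show ?thesis by (intro insert.IH) auto
    qed
  qed
  from this[OF _ subset_refl f] f show "f \<in> H" by (auto simp: free_module_def)
qed (use free_gen_closed[OF assms] in auto)

lemma free_module_ext:
  assumes P: "module K P" and \<phi>: "\<And>s. s \<in> S \<Longrightarrow> \<phi> s \<in> carrier P"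
  shows "lin_ext K (free_module K S) P (free_gen K) S \<phi>"
proof (rule lin_extI)
  interpret P: module K P by fact
  let ?F = "free_module K S"
  let ?t = "\<lambda>f x. f x \<odot>\<^bsub>P\<^esub> \<phi> x"
  let ?l = "\<lambda>f. msum P (?t f) (mset_set {x. f x \<noteq> \<zero>\<^bsub>K\<^esub>})"
  have t: "?t f x \<in> carrier P" if "f \<in> carrier ?F" "x \<in> S" for f x
    using that \<phi> by (auto simp: free_module_def)
  have supp: "{x. f x \<noteq> \<zero>\<^bsub>K\<^esub>} \<subseteq> S" "finite {x. f x \<noteq> \<zero>\<^bsub>K\<^esub>}" if "f \<in> carrier ?F" for f
    using that by (auto simp: free_module_def)
  \<comment> \<open>The sum may run over any finite subset of \<open>S\<close> that contains the
    support, which allows two functions to be summed over the union of their supports.\<close>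
  have eq: "?l f = msum P (?t f) (mset_set A)"
    if f: "f \<in> carrier ?F" and A: "finite A" "{x. f x \<noteq> \<zero>\<^bsub>K\<^esub>} \<subseteq> A" "A \<subseteq> S" for f A
  proof -
    let ?B = "{x. f x \<noteq> \<zero>\<^bsub>K\<^esub>}"
    have "mset_set A = mset_set ?B + mset_set (A - ?B)"
      using A(1) Un_Diff_cancel[of ?B A] finite_subset[OF A(2,1)]
      by (subst mset_set_Union[symmetric]) (auto simp: Un_absorb1[OF A(2)])
    moreover have "msum P (?t f) (mset_set (A - ?B)) = \<zero>\<^bsub>P\<^esub>"
      using A \<phi> by (intro P.M.msum_zero) auto
    ultimately show ?thesis by simp
  qed
  show "linear_map K ?F P ?l"
  proof (rule linear_mapI)
    fix f g assume f: "f \<in> carrier ?F" and g: "g \<in> carrier ?F"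
    let ?A = "{x. f x \<noteq> \<zero>\<^bsub>K\<^esub>} \<union> {x. g x \<noteq> \<zero>\<^bsub>K\<^esub>}"
    have A: "finite ?A" "?A \<subseteq> S" using supp[OF f] supp[OF g] by auto
    have fg: "f \<oplus>\<^bsub>?F\<^esub> g \<in> carrier ?F"
      using f g by (meson free_module_module P.R.cring_axioms module.axioms(2) abelian_groupE(1))
    have "?l (f \<oplus>\<^bsub>?F\<^esub> g) = msum P (?t (f \<oplus>\<^bsub>?F\<^esub> g)) (mset_set ?A)"
      by (rule eq[OF fg A(1) _ A(2)]) (auto simp: free_module_def)
    also have "\<dots> = msum P (\<lambda>x. ?t f x \<oplus>\<^bsub>P\<^esub> ?t g x) (mset_set ?A)"
    proof (rule P.M.msum_cong)
      fix x assume "x \<in># mset_set ?A"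
      then have "x \<in> S" using A by auto
      then show "?t (f \<oplus>\<^bsub>?F\<^esub> g) x = ?t f x \<oplus>\<^bsub>P\<^esub> ?t g x"
        using f g \<phi> by (auto simp: free_module_def P.smult_l_distr)
    qed
    also have "\<dots> = msum P (?t f) (mset_set ?A) \<oplus>\<^bsub>P\<^esub> msum P (?t g) (mset_set ?A)"
      using A t[OF f] t[OF g] by (intro P.M.msum_add) auto
    also have "\<dots> = ?l f \<oplus>\<^bsub>P\<^esub> ?l g"
      using eq[OF f A(1) _ A(2)] eq[OF g A(1) _ A(2)] by simp
    finally show "?l (f \<oplus>\<^bsub>?F\<^esub> g) = ?l f \<oplus>\<^bsub>P\<^esub> ?l g" .
  next
    fix c f assume c: "c \<in> carrier K" and f: "f \<in> carrier ?F"
    let ?A = "{x. f x \<noteq> \<zero>\<^bsub>K\<^esub>}"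
    have cf: "c \<odot>\<^bsub>?F\<^esub> f \<in> carrier ?F"
      using c f by (meson free_module_module P.R.cring_axioms module.smult_closed)
    have "?l (c \<odot>\<^bsub>?F\<^esub> f) = msum P (?t (c \<odot>\<^bsub>?F\<^esub> f)) (mset_set ?A)"
      by (rule eq[OF cf supp(2)[OF f] _ supp(1)[OF f]]) (use c in \<open>auto simp: free_module_def\<close>)
    also have "\<dots> = msum P (\<lambda>x. c \<odot>\<^bsub>P\<^esub> ?t f x) (mset_set ?A)"
    proof (rule P.M.msum_cong)
      fix x assume "x \<in># mset_set ?A"
      then have "x \<in> S" using supp[OF f] by auto
      then show "?t (c \<odot>\<^bsub>?F\<^esub> f) x = c \<odot>\<^bsub>P\<^esub> ?t f x"
        using f c \<phi> by (auto simp: free_module_def P.smult_assoc1)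
    qed
    also have "\<dots> = c \<odot>\<^bsub>P\<^esub> ?l f"
      using supp[OF f] t[OF f]
      by (intro linear_map_msum[OF P P linear_map_smult[OF P linear_map_id c], symmetric]) auto
    finally show "?l (c \<odot>\<^bsub>?F\<^esub> f) = c \<odot>\<^bsub>P\<^esub> ?l f" .
  qed auto
  fix s assume s: "s \<in> S"
  have "?l (free_gen K s) = msum P (?t (free_gen K s)) (mset_set {s})"
    using free_gen_closed[OF P.R.cring_axioms s] by (rule eq) (use s in \<open>auto simp: free_gen_def\<close>)
  then show "?l (free_gen K s) = \<phi> s"
    using \<phi>[OF s] by (simp add: free_gen_def)
qed

section \<open>Quotient modules\<close>

lemma submodule_abelian_subgroup:
  assumes "module K M" "submodule H K M"
  shows "abelian_subgroup H M"
proof -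
  interpret M: module K M by fact
  show ?thesis
    using assms(2) M.M.abelian_group_axioms
    by (intro abelian_subgroupI3 additive_subgroup.intro) (auto dest: submodule.axioms(1))
qed

lemma quot_module_simps:
  "carrier (quot_module M H) = (\<lambda>x. H +>\<^bsub>M\<^esub> x) ` carrier M"
  "add (quot_module M H) = set_add M"
  "zero (quot_module M H) = H"
  "monoid.mult (quot_module M H) = rcoset_mult M H"
  "monoid.one (quot_module M H) = H +>\<^bsub>M\<^esub> \<one>\<^bsub>M\<^esub>"
  "smult (quot_module M H) c X = (\<Union>x\<in>X. H +>\<^bsub>M\<^esub> (c \<odot>\<^bsub>M\<^esub> x))"
  by (auto simp: quot_module_def FactRing_def ring.extend_def module.fields_def A_RCOSETS_def'
      a_r_coset_def')

lemma coset_eq_iff: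
  assumes "module K M" "submodule H K M" "x \<in> carrier M" "y \<in> carrier M"
  shows "H +>\<^bsub>M\<^esub> x = H +>\<^bsub>M\<^esub> y \<longleftrightarrow> x \<ominus>\<^bsub>M\<^esub> y \<in> H"
proof -
  interpret M: module K M by fact
  interpret H: abelian_subgroup H M by (rule submodule_abelian_subgroup[OF assms(1,2)])
  show ?thesis
    using H.a_rcos_module[of y x] H.a_rcos_self[of x] assms(3,4)
      M.M.a_repr_independence[OF _ assms(4) H.a_subgroup, of x]
    by (auto simp: a_minus_def)
qed

lemma coset_zero_iff:
  assumes "module K M" "submodule H K M" "x \<in> carrier M"
  shows "H +>\<^bsub>M\<^esub> x = H \<longleftrightarrow> x \<in> H"
proof -
  interpret M: module K M by fact
  interpret H: abelian_subgroup H M by (rule submodule_abelian_subgroup[OF assms(1,2)])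
  have "H +>\<^bsub>M\<^esub> \<zero>\<^bsub>M\<^esub> = H" by (rule M.M.a_coset_add_zero[OF H.a_subset])
  then show ?thesis using coset_eq_iff[OF assms M.M.zero_closed] assms(3)
    using M.M.minus_equality[of "\<zero>\<^bsub>M\<^esub>" "\<zero>\<^bsub>M\<^esub>"] by (simp add: a_minus_def)
qed

lemma coset_smult:
  assumes M: "module K M" and H: "submodule H K M" and c: "c \<in> carrier K" and x: "x \<in> carrier M"
  shows "c \<odot>\<^bsub>quot_module M H\<^esub> (H +>\<^bsub>M\<^esub> x) = H +>\<^bsub>M\<^esub> (c \<odot>\<^bsub>M\<^esub> x)"
proof -
  interpret M: module K M by fact
  interpret H: abelian_subgroup H M by (rule submodule_abelian_subgroup[OF M H])
  have "H +>\<^bsub>M\<^esub> (c \<odot>\<^bsub>M\<^esub> y) = H +>\<^bsub>M\<^esub> (c \<odot>\<^bsub>M\<^esub> x)" if "y \<in> H +>\<^bsub>M\<^esub> x" for y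
  proof -
    from that obtain h where h: "h \<in> H" "y = h \<oplus>\<^bsub>M\<^esub> x" by (auto simp: a_r_coset_def')
    then have hc: "h \<in> carrier M" using H.a_subset by blast
    have y: "y \<in> carrier M" unfolding h(2) using hc x by simp
    have "c \<odot>\<^bsub>M\<^esub> y \<ominus>\<^bsub>M\<^esub> c \<odot>\<^bsub>M\<^esub> x = c \<odot>\<^bsub>M\<^esub> h"
      unfolding h(2) using hc x c by (simp add: M.smult_r_distr a_minus_def M.M.a_assoc M.M.r_neg)
    then have "c \<odot>\<^bsub>M\<^esub> y \<ominus>\<^bsub>M\<^esub> c \<odot>\<^bsub>M\<^esub> x \<in> H" using M.submoduleE(4)[OF H c h(1)] by simp
    then show ?thesis
      using coset_eq_iff[OF M H M.smult_closed[OF c y] M.smult_closed[OF c x]] by blast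
  qed
  moreover have "x \<in> H +>\<^bsub>M\<^esub> x" by (rule H.a_rcos_self[OF x])
  ultimately show ?thesis unfolding quot_module_simps(6) by (intro SUP_eq_const) blast+
qed

lemma quot_module_module:
  assumes M: "module K M" and H: "submodule H K M"
  shows "module K (quot_module M H)"
proof -
  interpret M: module K M by fact
  interpret H: abelian_subgroup H M by (rule submodule_abelian_subgroup[OF M H])
  let ?Q = "quot_module M H"
  note s = quot_module_simps(1-3) H.a_rcos_sum coset_smult[OF M H]
  show ?thesis
  proof (rule moduleI)
    show "abelian_group ?Q"
    proof (rule abelian_groupI)
      fix X assume "X \<in> carrier ?Q"
      then obtain x where x: "x \<in> carrier M" "X = H +>\<^bsub>M\<^esub> x" by (auto simp: s)
      then have "(H +>\<^bsub>M\<^esub> (\<ominus>\<^bsub>M\<^esub> x)) \<oplus>\<^bsub>?Q\<^esub> X = \<zero>\<^bsub>?Q\<^esub>"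
        using M.M.a_coset_add_zero[OF H.a_subset] by (simp add: s M.M.l_neg)
      then show "\<exists>Y\<in>carrier ?Q. Y \<oplus>\<^bsub>?Q\<^esub> X = \<zero>\<^bsub>?Q\<^esub>"
        by (intro bexI[of _ "H +>\<^bsub>M\<^esub> (\<ominus>\<^bsub>M\<^esub> x)"]) (use x in \<open>auto simp: s\<close>)
      show "\<zero>\<^bsub>?Q\<^esub> \<oplus>\<^bsub>?Q\<^esub> X = X"
        using H.a_rcos_sum[of "\<zero>\<^bsub>M\<^esub>" x] M.M.a_coset_add_zero[OF H.a_subset] x by (simp add: s)
    next
      show "\<zero>\<^bsub>?Q\<^esub> \<in> carrier ?Q"
        unfolding s using M.M.zero_closed M.M.a_coset_add_zero[OF H.a_subset]
        by (intro image_eqI[of _ _ "\<zero>\<^bsub>M\<^esub>"]) simp_all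
    next
      fix X Y Z assume X: "X \<in> carrier ?Q" "Y \<in> carrier ?Q"
      then obtain x y where x: "x \<in> carrier M" "X = H +>\<^bsub>M\<^esub> x" "y \<in> carrier M" "Y = H +>\<^bsub>M\<^esub> y"
        by (auto simp: s)
      then show "X \<oplus>\<^bsub>?Q\<^esub> Y \<in> carrier ?Q" by (simp add: s)
      show "X \<oplus>\<^bsub>?Q\<^esub> Y = Y \<oplus>\<^bsub>?Q\<^esub> X" using x by (simp add: s M.M.a_comm)
      assume "Z \<in> carrier ?Q"
      then obtain z where "z \<in> carrier M" "Z = H +>\<^bsub>M\<^esub> z" by (auto simp: s)
      with x show "X \<oplus>\<^bsub>?Q\<^esub> Y \<oplus>\<^bsub>?Q\<^esub> Z = X \<oplus>\<^bsub>?Q\<^esub> (Y \<oplus>\<^bsub>?Q\<^esub> Z)"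
        by (simp add: s M.M.a_assoc)
    qed
  next
    show "cring K" by (rule M.R.cring_axioms)
  next
    fix a b X assume a: "a \<in> carrier K" and X: "X \<in> carrier ?Q"
    then obtain x where x: "x \<in> carrier M" "X = H +>\<^bsub>M\<^esub> x" by (auto simp: s)
    then show "a \<odot>\<^bsub>?Q\<^esub> X \<in> carrier ?Q" using a by (simp add: s)
    assume "b \<in> carrier K"
    with a x show "(a \<oplus>\<^bsub>K\<^esub> b) \<odot>\<^bsub>?Q\<^esub> X = a \<odot>\<^bsub>?Q\<^esub> X \<oplus>\<^bsub>?Q\<^esub> b \<odot>\<^bsub>?Q\<^esub> X"
      "(a \<otimes>\<^bsub>K\<^esub> b) \<odot>\<^bsub>?Q\<^esub> X = a \<odot>\<^bsub>?Q\<^esub> (b \<odot>\<^bsub>?Q\<^esub> X)"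
      by (simp_all add: s M.smult_l_distr M.smult_assoc1)
  next
    fix a X Y assume a: "a \<in> carrier K" "X \<in> carrier ?Q" "Y \<in> carrier ?Q"
    then obtain x y where x: "x \<in> carrier M" "X = H +>\<^bsub>M\<^esub> x" "y \<in> carrier M" "Y = H +>\<^bsub>M\<^esub> y"
      by (auto simp: s)
    with a(1) show "a \<odot>\<^bsub>?Q\<^esub> (X \<oplus>\<^bsub>?Q\<^esub> Y) = a \<odot>\<^bsub>?Q\<^esub> X \<oplus>\<^bsub>?Q\<^esub> a \<odot>\<^bsub>?Q\<^esub> Y"
      by (simp add: s M.smult_r_distr)
  next
    fix X assume "X \<in> carrier ?Q"
    then obtain x where "x \<in> carrier M" "X = H +>\<^bsub>M\<^esub> x" by (auto simp: s)
    then show "\<one>\<^bsub>K\<^esub> \<odot>\<^bsub>?Q\<^esub> X = X" by (simp add: s)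
  qed
qed

lemma coset_linear:
  assumes M: "module K M" and H: "submodule H K M"
  shows "linear_map K M (quot_module M H) (\<lambda>x. H +>\<^bsub>M\<^esub> x)"
proof -
  interpret M: module K M by fact
  interpret H: abelian_subgroup H M by (rule submodule_abelian_subgroup[OF M H])
  show ?thesis
    by (rule linear_mapI) (simp_all add: quot_module_simps(1-3) H.a_rcos_sum coset_smult[OF M H])
qed

lemma coset_spans:
  assumes M: "module K M" and H: "submodule H K M" and G: "spans K M G"
  shows "spans K (quot_module M H) ((\<lambda>x. H +>\<^bsub>M\<^esub> x) ` G)"
  unfolding spans_def
proof (intro conjI allI impI subsetI)
  interpret M: module K M by fact
  interpret Q: module K "quot_module M H" by (rule quot_module_module[OF M H])
  note l = coset_linear[OF M H]
  fix X Y assume X: "submodule X K (quot_module M H)" "(\<lambda>x. H +>\<^bsub>M\<^esub> x) ` G \<subseteq> X"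
    and Y: "Y \<in> carrier (quot_module M H)"
  from Y obtain y where y: "y \<in> carrier M" "Y = H +>\<^bsub>M\<^esub> y"
    by (auto simp: quot_module_simps(1))
  have "H +>\<^bsub>M\<^esub> y \<in> X"
    using M G y(1)
  proof (induction rule: span_induct)
    case zero
    show ?case using linear_map_zero[OF M Q.module_axioms l] submodule_zero[OF X(1)] by simp
  next
    case (gen x)
    then show ?case using X(2) by auto
  next
    case (add x y)
    then show ?case using Q.submoduleE(5)[OF X(1)] by (simp add: linear_mapD(2)[OF l])
  next
    case (smult c x)
    then show ?case using Q.submoduleE(4)[OF X(1)] linear_mapD(3)[OF l] by metis
  qed
  then show "Y \<in> X" using y by simp
qed (use G in \<open>auto simp: spans_def quot_module_simps(1)\<close>)

text \<open>\<open>f\<close> is evaluated at a chosen representative; two representatives differ by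
  an element of \<open>H\<close>, where \<open>f\<close> vanishes.\<close>

lemma coset_lin_ext:
  assumes M: "module K M" and H: "submodule H K M" and P: "module K P"
    and f: "linear_map K M P f" "\<And>x. x \<in> H \<Longrightarrow> f x = \<zero>\<^bsub>P\<^esub>"
  shows "lin_ext K (quot_module M H) P (\<lambda>x. H +>\<^bsub>M\<^esub> x) (carrier M) f"
proof -
  interpret M: module K M by fact
  interpret P: module K P by fact
  interpret H: abelian_subgroup H M by (rule submodule_abelian_subgroup[OF M H])
  let ?l = "\<lambda>X. f (SOME x. x \<in> carrier M \<and> X = H +>\<^bsub>M\<^esub> x)"
  have l: "?l (H +>\<^bsub>M\<^esub> x) = f x" if x: "x \<in> carrier M" for x
  proof -
    let ?y = "SOME y. y \<in> carrier M \<and> H +>\<^bsub>M\<^esub> x = H +>\<^bsub>M\<^esub> y"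
    have y: "?y \<in> carrier M \<and> H +>\<^bsub>M\<^esub> x = H +>\<^bsub>M\<^esub> ?y"
      by (rule someI[of _ x]) (use x in simp)
    then have "x \<ominus>\<^bsub>M\<^esub> ?y \<in> H" using coset_eq_iff[OF M H] x by blast
    then have "f x \<ominus>\<^bsub>P\<^esub> f ?y = \<zero>\<^bsub>P\<^esub>"
      using f(2) linear_map_minus[OF M P f(1) x, of ?y] y by metis
    moreover have "f x \<in> carrier P" "f ?y \<in> carrier P" using x y linear_mapD(1)[OF f(1)] by blast+
    ultimately show ?thesis by (rule abelian_group_eqI[OF P.M.abelian_group_axioms, symmetric])
  qed
  show ?thesis
  proof (rule lin_extI[OF linear_mapI])
    fix x assume "x \<in> carrier M"
    then show "?l (H +>\<^bsub>M\<^esub> x) = f x" by (rule l)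
  next
    fix X Y assume X: "X \<in> carrier (quot_module M H)" "Y \<in> carrier (quot_module M H)"
    then obtain x y where x: "x \<in> carrier M" "X = H +>\<^bsub>M\<^esub> x" "y \<in> carrier M" "Y = H +>\<^bsub>M\<^esub> y"
      by (auto simp: quot_module_simps(1))
    show "?l X \<in> carrier P" unfolding x(2) l[OF x(1)] by (rule linear_mapD(1)[OF f(1) x(1)])
    have "X \<oplus>\<^bsub>quot_module M H\<^esub> Y = H +>\<^bsub>M\<^esub> (x \<oplus>\<^bsub>M\<^esub> y)"
      using x by (simp add: quot_module_simps(2) H.a_rcos_sum)
    then show "?l (X \<oplus>\<^bsub>quot_module M H\<^esub> Y) = ?l X \<oplus>\<^bsub>P\<^esub> ?l Y"
      using x l[of "x \<oplus>\<^bsub>M\<^esub> y"] l[of x] l[of y] by (simp only: linear_mapD(2)[OF f(1)] M.M.a_closed)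
  next
    fix c X assume c: "c \<in> carrier K" and X: "X \<in> carrier (quot_module M H)"
    then obtain x where x: "x \<in> carrier M" "X = H +>\<^bsub>M\<^esub> x"
      by (auto simp: quot_module_simps(1))
    show "?l (c \<odot>\<^bsub>quot_module M H\<^esub> X) = c \<odot>\<^bsub>P\<^esub> ?l X"
      using x c l[of "c \<odot>\<^bsub>M\<^esub> x"] l[of x]
      by (simp only: coset_smult[OF M H] linear_mapD(3)[OF f(1)] M.smult_closed)
  qed
qed

section \<open>Generated submodules and presentations\<close>

lemma gen_submodule_submodule:
  assumes "module K M" "E \<subseteq> carrier M"
  shows "submodule (gen_submodule K M E) K M"
proof -
  interpret M: module K M by fact
  let ?\<H> = "{H. submodule H K M \<and> E \<subseteq> H}"
  have c: "carrier M \<in> ?\<H>" using M.carrier_is_submodule assms(2) by auto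
  show ?thesis
    unfolding gen_submodule_def
  proof (rule M.submoduleI)
    show "\<Inter>?\<H> \<subseteq> carrier M" using c by (rule Inter_lower)
    show "\<zero>\<^bsub>M\<^esub> \<in> \<Inter>?\<H>" using submodule_zero by blast
  next
    fix a assume a: "a \<in> \<Inter>?\<H>"
    show "\<ominus>\<^bsub>M\<^esub> a \<in> \<Inter>?\<H>"
      by (rule InterI) (use M.submoduleE(3) a in blast)
    show "c \<odot>\<^bsub>M\<^esub> a \<in> \<Inter>?\<H>" if "c \<in> carrier K" for c
      by (rule InterI) (use M.submoduleE(4) a that in blast)
    show "a \<oplus>\<^bsub>M\<^esub> b \<in> \<Inter>?\<H>" if "b \<in> \<Inter>?\<H>" for b
      by (rule InterI) (use M.submoduleE(5) a that in blast)
  qed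
qed

lemma gen_submodule_least: "submodule H K M \<Longrightarrow> E \<subseteq> H \<Longrightarrow> gen_submodule K M E \<subseteq> H"
  by (auto simp: gen_submodule_def)

lemma gen_submodule_incl: "E \<subseteq> gen_submodule K M E"
  by (auto simp: gen_submodule_def)

lemma kernel_submodule:
  assumes "module K M" "module K N" "linear_map K M N f"
  shows "submodule {x \<in> carrier M. f x = \<zero>\<^bsub>N\<^esub>} K M"
proof -
  interpret M: module K M by fact
  interpret N: module K N by fact
  show ?thesis
    by (rule M.submoduleI)
      (auto simp: linear_mapD[OF assms(3)] linear_map_zero[OF assms] linear_map_neg[OF assms])
qed

context
  fixes K :: "('k, 'r) ring_scheme" and S :: "'b set" and E
  assumes K: "cring K" and E: "E \<subseteq> carrier (free_module K S)"
begin

text \<open>The interface of the construction: tensor products, symmetric squares and tensor powers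
  read their defining identities off such a \<open>p\<close> without unfolding cosets.\<close>

lemma presented_proj:
  "\<exists>p. linear_map K (free_module K S) (presented_module K S E) p \<and>
    (\<forall>x. p (free_gen K x) = presented_gen K S E x) \<and> (\<forall>e\<in>E. p e = \<zero>\<^bsub>presented_module K S E\<^esub>)"
proof (intro exI conjI)
  note F = free_module_module[OF K, of S]
  note H = gen_submodule_submodule[OF F E]
  show "linear_map K (free_module K S) (presented_module K S E)
    (\<lambda>x. gen_submodule K (free_module K S) E +>\<^bsub>free_module K S\<^esub> x)"
    unfolding presented_module_def by (rule coset_linear[OF F H])
  show "\<forall>e\<in>E. gen_submodule K (free_module K S) E +>\<^bsub>free_module K S\<^esub> e = \<zero>\<^bsub>presented_module K S E\<^esub>"
  proof
    fix e assume "e \<in> E"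
    then have "e \<in> carrier (free_module K S)" "e \<in> gen_submodule K (free_module K S) E"
      using E gen_submodule_incl[of E K "free_module K S"] by auto
    then show "gen_submodule K (free_module K S) E +>\<^bsub>free_module K S\<^esub> e = \<zero>\<^bsub>presented_module K S E\<^esub>"
      unfolding presented_module_def quot_module_simps(3) using coset_zero_iff[OF F H] by simp
  qed
qed (simp add: presented_gen_def)

lemma presented_module_module: "module K (presented_module K S E)"
  unfolding presented_module_def
  by (intro quot_module_module gen_submodule_submodule free_module_module K E)

lemma presented_spans: "spans K (presented_module K S E) (presented_gen K S E ` S)"
proof -
  note F = free_module_module[OF K, of S]
  show ?thesis
    using coset_spans[OF F gen_submodule_submodule[OF F E] free_module_spans[OF K]]
    unfolding presented_module_def presented_gen_def image_image .
qed

text \<open>\<open>rel\<close> quantifies over every linear extension \<open>l\<close> of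
  \<open>\<phi>\<close> to the free module: a relation is then checked by linearity and the values
  of \<open>\<phi>\<close> alone, whatever the construction of \<open>l\<close>.\<close>

lemma presented_ext:
  assumes P: "module K P" and \<phi>: "\<And>s. s \<in> S \<Longrightarrow> \<phi> s \<in> carrier P"
    and rel: "\<And>l e. linear_map K (free_module K S) P l \<Longrightarrow> (\<And>s. s \<in> S \<Longrightarrow> l (free_gen K s) = \<phi> s) \<Longrightarrow>
      e \<in> E \<Longrightarrow> l e = \<zero>\<^bsub>P\<^esub>"
  shows "lin_ext K (presented_module K S E) P (presented_gen K S E) S \<phi>"
proof -
  note F = free_module_module[OF K, of S]
  note H = gen_submodule_submodule[OF F E]
  obtain l where l: "linear_map K (free_module K S) P l" "\<And>s. s \<in> S \<Longrightarrow> l (free_gen K s) = \<phi> s"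
    using free_module_ext[of K P S \<phi>] P \<phi> unfolding lin_ext_def by metis
  have "gen_submodule K (free_module K S) E \<subseteq> {x \<in> carrier (free_module K S). l x = \<zero>\<^bsub>P\<^esub>}"
    using rel[OF l] E by (intro gen_submodule_least kernel_submodule[OF F P l(1)]) auto
  then have "lin_ext K (presented_module K S E) P
      (\<lambda>x. gen_submodule K (free_module K S) E +>\<^bsub>free_module K S\<^esub> x) (carrier (free_module K S)) l"
    unfolding presented_module_def by (intro coset_lin_ext[OF F H P l(1)]) auto
  then show ?thesis
    using l(2) free_gen_closed[OF K] unfolding lin_ext_def presented_gen_def by metis
qed

end

subsection \<open>Tensor products and tensor powers\<close>

context
  fixes K :: "('k, 'r) ring_scheme" and P :: "('k, 'c, 'n) module_scheme" and S :: "'b set" and l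
  assumes K: "cring K" and P: "module K P" and l: "linear_map K (free_module K S) P l"
begin

text \<open>One equation for each shape of relation in use: additivity, homogeneity and
  symmetry.\<close>

lemma linear_map_free_gen:
  shows "s \<in> S \<Longrightarrow> t \<in> S \<Longrightarrow> u \<in> S \<Longrightarrow>
      l (free_gen K s \<ominus>\<^bsub>free_module K S\<^esub> (free_gen K t \<oplus>\<^bsub>free_module K S\<^esub> free_gen K u)) =
      l (free_gen K s) \<ominus>\<^bsub>P\<^esub> (l (free_gen K t) \<oplus>\<^bsub>P\<^esub> l (free_gen K u))"
    and "s \<in> S \<Longrightarrow> t \<in> S \<Longrightarrow> c \<in> carrier K \<Longrightarrow>
      l (free_gen K s \<ominus>\<^bsub>free_module K S\<^esub> c \<odot>\<^bsub>free_module K S\<^esub> free_gen K t) =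
      l (free_gen K s) \<ominus>\<^bsub>P\<^esub> c \<odot>\<^bsub>P\<^esub> l (free_gen K t)"
    and "s \<in> S \<Longrightarrow> t \<in> S \<Longrightarrow>
      l (free_gen K s \<ominus>\<^bsub>free_module K S\<^esub> free_gen K t) = l (free_gen K s) \<ominus>\<^bsub>P\<^esub> l (free_gen K t)"
proof -
  note F = free_module_module[OF K, of S]
  interpret F: module K "free_module K S" by (rule F)
  note g = free_gen_closed[OF K, of _ S]
  note r = linear_map_minus[OF F P l] linear_mapD(2,3)[OF l]
  show "s \<in> S \<Longrightarrow> t \<in> S \<Longrightarrow> u \<in> S \<Longrightarrow>
      l (free_gen K s \<ominus>\<^bsub>free_module K S\<^esub> (free_gen K t \<oplus>\<^bsub>free_module K S\<^esub> free_gen K u)) =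
      l (free_gen K s) \<ominus>\<^bsub>P\<^esub> (l (free_gen K t) \<oplus>\<^bsub>P\<^esub> l (free_gen K u))"
    by (simp add: r g)
  show "s \<in> S \<Longrightarrow> t \<in> S \<Longrightarrow> c \<in> carrier K \<Longrightarrow>
      l (free_gen K s \<ominus>\<^bsub>free_module K S\<^esub> c \<odot>\<^bsub>free_module K S\<^esub> free_gen K t) =
      l (free_gen K s) \<ominus>\<^bsub>P\<^esub> c \<odot>\<^bsub>P\<^esub> l (free_gen K t)"
    by (simp add: r g)
  show "s \<in> S \<Longrightarrow> t \<in> S \<Longrightarrow>
      l (free_gen K s \<ominus>\<^bsub>free_module K S\<^esub> free_gen K t) = l (free_gen K s) \<ominus>\<^bsub>P\<^esub> l (free_gen K t)"
    by (simp add: r g)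
qed

end

lemma minus_self: "abelian_group G \<Longrightarrow> x \<in> carrier G \<Longrightarrow> x \<ominus>\<^bsub>G\<^esub> x = \<zero>\<^bsub>G\<^esub>"
  by (simp add: a_minus_def abelian_group.r_neg)

lemma bilinear_rels_subset:
  assumes "module K M" "module K N"
  shows "bilinear_rels K M N \<subseteq> carrier (free_module K (carrier M \<times> carrier N))"
proof -
  interpret M: module K M by fact
  interpret N: module K N by fact
  note K = M.R.cring_axioms
  interpret F: module K "free_module K (carrier M \<times> carrier N)" by (rule free_module_module[OF K])
  note g = free_gen_closed[OF K, of _ "carrier M \<times> carrier N"]
  show ?thesis
    unfolding bilinear_rels_def Let_def
    by (auto intro!: F.M.minus_closed F.M.a_closed F.smult_closed g)
qed

lemma bilinear_rels_zero:
  assumes M: "module K M" and N: "module K N" and P: "module K P"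
    and l: "linear_map K (free_module K (carrier M \<times> carrier N)) P l"
    and b: "bilinear_map K M N P b" "\<And>x y. x \<in> carrier M \<Longrightarrow> y \<in> carrier N \<Longrightarrow> l (free_gen K (x, y)) = b x y"
    and e: "e \<in> bilinear_rels K M N"
  shows "l e = \<zero>\<^bsub>P\<^esub>"
proof -
  interpret M: module K M by fact
  interpret N: module K N by fact
  interpret P: module K P by fact
  note r = linear_map_free_gen[OF M.R.cring_axioms P l]
  show ?thesis
    using e unfolding bilinear_rels_def Let_def
    by (auto simp: r b(2) linear_mapD[OF bilinear_mapD(1)[OF b(1)]]
        linear_mapD[OF bilinear_mapD(2)[OF b(1)]] intro!: minus_self P.M.abelian_group_axioms
        P.M.a_closed P.smult_closed bilinear_map_closed[OF b(1)])
qed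

lemma tensor_prod_module: "module K M \<Longrightarrow> module K N \<Longrightarrow> module K (tensor_prod K M N)"
  unfolding tensor_prod_def
  by (intro presented_module_module bilinear_rels_subset) (simp_all add: module_def)

text \<open>Serves the tensor product and the symmetric square alike, because the relations of the
  latter contain those of the former.\<close>

lemma bilinear_map_of_rels:
  assumes M: "module K M" and N: "module K N" and P: "module K P"
    and p: "linear_map K (free_module K (carrier M \<times> carrier N)) P p"
    and rel: "\<And>e. e \<in> bilinear_rels K M N \<Longrightarrow> p e = \<zero>\<^bsub>P\<^esub>"
  shows "bilinear_map K M N P (\<lambda>x y. p (free_gen K (x, y)))"
proof -
  interpret M: module K M by fact
  interpret N: module K N by fact
  interpret P: module K P by fact
  note K = M.R.cring_axioms
  let ?S = "carrier M \<times> carrier N"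
  let ?b = "\<lambda>x y. p (free_gen K (x, y))"
  note r = linear_map_free_gen[OF K P p]
  have cl: "?b x y \<in> carrier P" if "x \<in> carrier M" "y \<in> carrier N" for x y
    using linear_mapD(1)[OF p free_gen_closed[OF K], of "(x, y)"] that by simp
  note z = abelian_group_eqI[OF P.M.abelian_group_axioms]
  show ?thesis
    unfolding bilinear_map_def
  proof (intro conjI ballI linear_mapI)
    fix x y y' assume x: "x \<in> carrier M" "y \<in> carrier N" "y' \<in> carrier N"
    show "?b x (y \<oplus>\<^bsub>N\<^esub> y') = ?b x y \<oplus>\<^bsub>P\<^esub> ?b x y'"
    proof -
      have "free_gen K (x, y \<oplus>\<^bsub>N\<^esub> y') \<ominus>\<^bsub>free_module K ?S\<^esub> (free_gen K (x, y) \<oplus>\<^bsub>free_module K ?S\<^esub> free_gen K (x, y')) \<in> bilinear_rels K M N"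
        unfolding bilinear_rels_def Let_def using x by blast
      note e = rel[OF this]
      show ?thesis
        using x e by - (rule z, simp_all add: r cl)
    qed
  next
    fix x x' y assume x: "x \<in> carrier M" "x' \<in> carrier M" "y \<in> carrier N"
    show "?b (x \<oplus>\<^bsub>M\<^esub> x') y = ?b x y \<oplus>\<^bsub>P\<^esub> ?b x' y"
    proof -
      have "free_gen K (x \<oplus>\<^bsub>M\<^esub> x', y) \<ominus>\<^bsub>free_module K ?S\<^esub> (free_gen K (x, y) \<oplus>\<^bsub>free_module K ?S\<^esub> free_gen K (x', y)) \<in> bilinear_rels K M N"
        unfolding bilinear_rels_def Let_def using x by blast
      note e = rel[OF this]
      show ?thesis
        using x e by - (rule z, simp_all add: r cl)
    qed
  next
    fix x c y assume x: "x \<in> carrier M" "c \<in> carrier K" "y \<in> carrier N"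
    show "?b x (c \<odot>\<^bsub>N\<^esub> y) = c \<odot>\<^bsub>P\<^esub> ?b x y"
    proof -
      have "free_gen K (x, c \<odot>\<^bsub>N\<^esub> y) \<ominus>\<^bsub>free_module K ?S\<^esub> c \<odot>\<^bsub>free_module K ?S\<^esub> free_gen K (x, y) \<in> bilinear_rels K M N"
        unfolding bilinear_rels_def Let_def using x by blast
      note e = rel[OF this]
      show ?thesis
        using x e by - (rule z, simp_all add: r cl)
    qed
    show "?b (c \<odot>\<^bsub>M\<^esub> x) y = c \<odot>\<^bsub>P\<^esub> ?b x y"
    proof -
      have "free_gen K (c \<odot>\<^bsub>M\<^esub> x, y) \<ominus>\<^bsub>free_module K ?S\<^esub> c \<odot>\<^bsub>free_module K ?S\<^esub> free_gen K (x, y) \<in> bilinear_rels K M N"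
        unfolding bilinear_rels_def Let_def using x by blast
      note e = rel[OF this]
      show ?thesis
        using x e by - (rule z, simp_all add: r cl)
    qed
  qed (auto intro: cl)
qed

lemma tens_bilinear:
  assumes M: "module K M" and N: "module K N"
  shows "bilinear_map K M N (tensor_prod K M N) (tens K M N)"
proof -
  interpret M: module K M by fact
  obtain p where p: "linear_map K (free_module K (carrier M \<times> carrier N)) (tensor_prod K M N) p"
    "\<And>x. p (free_gen K x) = presented_gen K (carrier M \<times> carrier N) (bilinear_rels K M N) x"
    "\<And>e. e \<in> bilinear_rels K M N \<Longrightarrow> p e = \<zero>\<^bsub>tensor_prod K M N\<^esub>"
    using presented_proj[OF M.R.cring_axioms bilinear_rels_subset[OF M N]]
    unfolding tensor_prod_def by metis
  from bilinear_map_of_rels[OF M N tensor_prod_module[OF M N] p(1,3)]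
  show ?thesis by (simp add: p(2) tens_def[abs_def])
qed

subsection \<open>Symmetric squares\<close>

lemma sym_square_rels_subset:
  assumes M: "module K M"
  shows "sym_square_rels K M \<subseteq> carrier (free_module K (carrier M \<times> carrier M))"
proof -
  interpret M: module K M by fact
  interpret F: module K "free_module K (carrier M \<times> carrier M)"
    by (rule free_module_module[OF M.R.cring_axioms])
  show ?thesis
    unfolding sym_square_rels_def using bilinear_rels_subset[OF M M]
    by (auto intro!: F.M.minus_closed free_gen_closed M.R.cring_axioms)
qed

lemma
  assumes M: "module K M"
  shows sym_square_module: "module K (sym_square K M)"
    and sym_tens_bilinear: "bilinear_map K M M (sym_square K M) (sym_tens K M)"
    and sym_tens_commute: "x \<in> carrier M \<Longrightarrow> y \<in> carrier M \<Longrightarrow> sym_tens K M x y = sym_tens K M y x"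
proof -
  interpret M: module K M by fact
  note K = M.R.cring_axioms
  show Q: "module K (sym_square K M)"
    unfolding sym_square_def by (rule presented_module_module[OF K sym_square_rels_subset[OF M]])
  interpret Q: module K "sym_square K M" by (rule Q)
  obtain p where p: "linear_map K (free_module K (carrier M \<times> carrier M)) (sym_square K M) p"
    "\<And>x. p (free_gen K x) = presented_gen K (carrier M \<times> carrier M) (sym_square_rels K M) x"
    "\<And>e. e \<in> sym_square_rels K M \<Longrightarrow> p e = \<zero>\<^bsub>sym_square K M\<^esub>"
    using presented_proj[OF K sym_square_rels_subset[OF M]]
    unfolding sym_square_def by metis
  have "p e = \<zero>\<^bsub>sym_square K M\<^esub>" if "e \<in> bilinear_rels K M M" for e
    by (rule p(3)) (simp add: sym_square_rels_def that)
  from bilinear_map_of_rels[OF M M Q p(1) this]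
  show b: "bilinear_map K M M (sym_square K M) (sym_tens K M)"
    by (simp add: p(2) sym_tens_def[abs_def])
  assume xy: "x \<in> carrier M" "y \<in> carrier M"
  have "free_gen K (x, y) \<ominus>\<^bsub>free_module K (carrier M \<times> carrier M)\<^esub> free_gen K (y, x) \<in> sym_square_rels K M"
    unfolding sym_square_rels_def using xy by blast
  from p(3)[OF this] have "p (free_gen K (x, y)) \<ominus>\<^bsub>sym_square K M\<^esub> p (free_gen K (y, x)) = \<zero>\<^bsub>sym_square K M\<^esub>"
    using xy by (simp add: linear_map_free_gen[OF K Q p(1)])
  then show "sym_tens K M x y = sym_tens K M y x"
    using abelian_group_eqI[OF Q.M.abelian_group_axioms] bilinear_map_closed[OF b] xy
    by (simp add: p(2) sym_tens_def)
qed

lemma spans_product: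
  assumes M: "module K M" "spans K M G" and N: "module K N" "spans K N H" and P: "module K P"
    and b: "bilinear_map K M N P b"
    and s: "spans K P {b x y | x y. x \<in> carrier M \<and> y \<in> carrier N}"
  shows "spans K P {b x y | x y. x \<in> G \<and> y \<in> H}"
  unfolding spans_def
proof (intro conjI allI impI)
  interpret M: module K M by fact
  interpret N: module K N by fact
  interpret P: module K P by fact
  show "{b x y | x y. x \<in> G \<and> y \<in> H} \<subseteq> carrier P"
    using bilinear_map_closed[OF b] span_closed[OF M(2)] span_closed[OF N(2)] by auto
  fix X assume X: "submodule X K P" "{b x y | x y. x \<in> G \<and> y \<in> H} \<subseteq> X"
  have "b x y \<in> X" if "x \<in> carrier M" "y \<in> carrier N" for x y
    using M that(1)
  proof (induction rule: span_induct)
    case (gen x)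
    have x: "x \<in> carrier M" using gen span_closed[OF M(2)] by blast
    note l = bilinear_mapD(1)[OF b x]
    show ?case using N that(2)
    proof (induction rule: span_induct)
      case zero
      then show ?case using linear_map_zero[OF N(1) P l] submodule_zero[OF X(1)] by simp
    qed (use gen X P.submoduleE(4,5)[OF X(1)] in \<open>auto simp: linear_mapD(2,3)[OF l]\<close>)
  next
    case zero
    then show ?case
      using linear_map_zero[OF M(1) P bilinear_mapD(2)[OF b that(2)]] submodule_zero[OF X(1)] by simp
  qed (use X P.submoduleE(4,5)[OF X(1)] in \<open>auto simp: linear_mapD(2,3)[OF bilinear_mapD(2)[OF b that(2)]]\<close>)
  then show "carrier P \<subseteq> X"
    using s X(1) unfolding spans_def by blast
qed

lemma tens_spans:
  assumes M: "module K M" "spans K M G" and N: "module K N" "spans K N H"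
  shows "spans K (tensor_prod K M N) {tens K M N x y | x y. x \<in> G \<and> y \<in> H}"
proof (rule spans_product[OF M N tensor_prod_module[OF M(1) N(1)] tens_bilinear[OF M(1) N(1)]])
  interpret M: module K M by fact
  have "{tens K M N x y | x y. x \<in> carrier M \<and> y \<in> carrier N} =
      presented_gen K (carrier M \<times> carrier N) (bilinear_rels K M N) ` (carrier M \<times> carrier N)"
    unfolding tens_def by force
  then show "spans K (tensor_prod K M N) {tens K M N x y | x y. x \<in> carrier M \<and> y \<in> carrier N}"
    using presented_spans[OF M.R.cring_axioms bilinear_rels_subset[OF M(1) N(1)]]
    unfolding tensor_prod_def by simp
qed

text \<open>By \<open>bilinear_ext\<close> it is enough to extend in each variable with the other
  one fixed at a generator. Nested tensor products can thus be treated factor by factor.\<close>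

lemma tensor_ext:
  assumes M: "module K M" "spans K M (g ` S)" and N: "module K N" "spans K N (h ` T)"
    and P: "module K P"
    and l: "\<And>t. t \<in> T \<Longrightarrow> lin_ext K M P g S (\<lambda>s. b s t)"
    and r: "\<And>s. s \<in> S \<Longrightarrow> lin_ext K N P h T (\<lambda>t. b s t)"
  shows "\<exists>L. linear_map K (tensor_prod K M N) P L \<and>
    (\<forall>s\<in>S. \<forall>t\<in>T. L (tens K M N (g s) (h t)) = b s t)"
proof -
  interpret M: module K M by fact
  have gS: "s \<in> S \<Longrightarrow> g s \<in> carrier M" for s using span_closed[OF M(2)] by blast
  have hT: "t \<in> T \<Longrightarrow> h t \<in> carrier N" for t using span_closed[OF N(2)] by blast
  obtain B where B: "bilinear_map K M N P B" "\<And>s t. s \<in> S \<Longrightarrow> t \<in> T \<Longrightarrow> B (g s) (h t) = b s t"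
    using bilinear_ext[of K M g S N h T P b] assms by blast
  have "lin_ext K (tensor_prod K M N) P
      (presented_gen K (carrier M \<times> carrier N) (bilinear_rels K M N)) (carrier M \<times> carrier N)
      (\<lambda>(x, y). B x y)"
    unfolding tensor_prod_def
  proof (rule presented_ext[OF M.R.cring_axioms bilinear_rels_subset[OF M(1) N(1)] P])
    fix l e assume "linear_map K (free_module K (carrier M \<times> carrier N)) P l"
      "\<And>s. s \<in> carrier M \<times> carrier N \<Longrightarrow> l (free_gen K s) = (case s of (x, y) \<Rightarrow> B x y)"
      "e \<in> bilinear_rels K M N"
    then show "l e = \<zero>\<^bsub>P\<^esub>" by - (rule bilinear_rels_zero[OF M(1) N(1) P _ B(1), of l e], simp_all)
  qed (auto intro: bilinear_map_closed[OF B(1)])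
  then obtain L where "linear_map K (tensor_prod K M N) P L"
    "\<And>x y. x \<in> carrier M \<Longrightarrow> y \<in> carrier N \<Longrightarrow> L (tens K M N x y) = B x y"
    by (auto simp: lin_ext_def tens_def)
  with B(2) gS hT show ?thesis by metis
qed

section \<open>Tensor powers and multilinear functions on words\<close>

text \<open>Treats all lengths at once: for a word of length n it demands linearity in each of the n
  letters, and at the empty word only a value in \<open>P\<close>.\<close>

definition multilinear ::
  "('k, 'r) ring_scheme \<Rightarrow> ('k, 'b, 'm) module_scheme \<Rightarrow> ('k, 'c, 'n) module_scheme
    \<Rightarrow> ('b list \<Rightarrow> 'c) \<Rightarrow> bool"
  where "multilinear K M P \<phi> \<longleftrightarrow> (\<forall>f\<in>lists (carrier M). \<phi> f \<in> carrier P) \<and>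
    (\<forall>f\<in>lists (carrier M). \<forall>g\<in>lists (carrier M). linear_map K M P (\<lambda>x. \<phi> (f @ x # g)))"

lemma multilinearI:
  assumes "\<And>f. f \<in> lists (carrier M) \<Longrightarrow> \<phi> f \<in> carrier P"
    and "\<And>f g. f \<in> lists (carrier M) \<Longrightarrow> g \<in> lists (carrier M) \<Longrightarrow> linear_map K M P (\<lambda>x. \<phi> (f @ x # g))"
  shows "multilinear K M P \<phi>"
  using assms by (simp add: multilinear_def)

lemma multilinearD:
  assumes "multilinear K M P \<phi>"
  shows "f \<in> lists (carrier M) \<Longrightarrow> \<phi> f \<in> carrier P"
    and "f \<in> lists (carrier M) \<Longrightarrow> g \<in> lists (carrier M) \<Longrightarrow> linear_map K M P (\<lambda>x. \<phi> (f @ x # g))"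
  using assms by (simp_all add: multilinear_def)

lemma multilinear_head:
  "multilinear K M P \<phi> \<Longrightarrow> g \<in> lists (carrier M) \<Longrightarrow> linear_map K M P (\<lambda>x. \<phi> (x # g))"
  using multilinearD(2)[of K M P \<phi> "[]" g] by simp

lemma multilinear_tail:
  assumes "multilinear K M P \<phi>" "a \<in> carrier M"
  shows "multilinear K M P (\<lambda>f. \<phi> (a # f))"
proof (rule multilinearI)
  fix f g assume f: "f \<in> lists (carrier M)"
  show "\<phi> (a # f) \<in> carrier P" using multilinearD(1)[OF assms(1), of "a # f"] f assms(2) by simp
  assume "g \<in> lists (carrier M)"
  then show "linear_map K M P (\<lambda>x. \<phi> (a # f @ x # g))"
    using multilinearD(2)[OF assms(1), of "a # f" g] f assms(2) by simp
qed

lemma multilinear_compose: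
  "multilinear K M N \<phi> \<Longrightarrow> linear_map K N P l \<Longrightarrow> multilinear K M P (\<lambda>f. l (\<phi> f))"
  by (rule multilinearI) (simp_all add: multilinearD(1) linear_mapD(1) linear_map_compose[OF _ multilinearD(2)])

lemma multilinear_const_Nil:
  assumes c: "c \<in> carrier P" and \<phi>: "multilinear K M P \<phi>"
  shows "multilinear K M P (\<lambda>f. if f = [] then c else \<phi> f)"
  by (rule multilinearI) (use c \<phi> in \<open>simp_all add: multilinearD\<close>)

lemma multilinear_zero: "module K P \<Longrightarrow> multilinear K M P (\<lambda>_. \<zero>\<^bsub>P\<^esub>)"
  by (rule multilinearI) (auto intro: linear_map_const_zero abelian_monoid.zero_closed
      simp: module_def abelian_group_def)

lemma multilinear_rels_subset:
  assumes "module K M"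
  shows "multilinear_rels K M \<subseteq> carrier (free_module K (lists (carrier M)))"
proof -
  interpret M: module K M by fact
  note K = M.R.cring_axioms
  interpret F: module K "free_module K (lists (carrier M))" by (rule free_module_module[OF K])
  note g = free_gen_closed[OF K, of _ "lists (carrier M)"]
  show ?thesis
    unfolding multilinear_rels_def Let_def
    by (auto intro!: F.M.minus_closed F.M.a_closed F.smult_closed g)
qed

lemma tensor_powers_module: "module K M \<Longrightarrow> module K (tensor_powers K M)"
  unfolding tensor_powers_def
  by (intro presented_module_module multilinear_rels_subset) (simp_all add: module_def)

lemma pure_tensor_spans:
  "module K M \<Longrightarrow> spans K (tensor_powers K M) (pure_tensor K M ` lists (carrier M))"
  unfolding tensor_powers_def pure_tensor_def
  by (intro presented_spans multilinear_rels_subset) (simp_all add: module_def)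

lemma pure_tensor_multilinear:
  assumes M: "module K M"
  shows "multilinear K M (tensor_powers K M) (pure_tensor K M)"
proof -
  interpret M: module K M by fact
  note K = M.R.cring_axioms
  let ?S = "lists (carrier M)"
  let ?T = "tensor_powers K M"
  interpret T: module K ?T by (rule tensor_powers_module[OF M])
  obtain p where p: "linear_map K (free_module K ?S) ?T p"
    "\<And>x. p (free_gen K x) = pure_tensor K M x" "\<And>e. e \<in> multilinear_rels K M \<Longrightarrow> p e = \<zero>\<^bsub>?T\<^esub>"
    using presented_proj[OF K multilinear_rels_subset[OF M]]
    unfolding tensor_powers_def pure_tensor_def by metis
  note r = linear_map_free_gen[OF K T.module_axioms p(1)]
  have cl: "pure_tensor K M x \<in> carrier ?T" if "x \<in> ?S" for x
    using linear_mapD(1)[OF p(1) free_gen_closed[OF K], of x] that by (simp add: p(2))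
  note z = abelian_group_eqI[OF T.M.abelian_group_axioms]
  show ?thesis
  proof (intro multilinearI linear_mapI)
    fix f g x y assume x: "f \<in> ?S" "g \<in> ?S" "x \<in> carrier M" "y \<in> carrier M"
    show "pure_tensor K M (f @ (x \<oplus>\<^bsub>M\<^esub> y) # g) =
        pure_tensor K M (f @ x # g) \<oplus>\<^bsub>?T\<^esub> pure_tensor K M (f @ y # g)"
    proof -
      have "free_gen K (f @ (x \<oplus>\<^bsub>M\<^esub> y) # g) \<ominus>\<^bsub>free_module K ?S\<^esub> (free_gen K (f @ x # g) \<oplus>\<^bsub>free_module K ?S\<^esub> free_gen K (f @ y # g)) \<in> multilinear_rels K M"
        unfolding multilinear_rels_def Let_def using x by blast
      note e = p(3)[OF this]
      show ?thesis
        using x e by - (rule z, simp_all add: r p(2) cl)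
    qed
  next
    fix f g c x assume x: "f \<in> ?S" "g \<in> ?S" "c \<in> carrier K" "x \<in> carrier M"
    show "pure_tensor K M (f @ (c \<odot>\<^bsub>M\<^esub> x) # g) = c \<odot>\<^bsub>?T\<^esub> pure_tensor K M (f @ x # g)"
    proof -
      have "free_gen K (f @ (c \<odot>\<^bsub>M\<^esub> x) # g) \<ominus>\<^bsub>free_module K ?S\<^esub> c \<odot>\<^bsub>free_module K ?S\<^esub> free_gen K (f @ x # g) \<in> multilinear_rels K M"
        unfolding multilinear_rels_def Let_def using x by blast
      note e = p(3)[OF this]
      show ?thesis
        using x e by - (rule z, simp_all add: r p(2) cl)
    qed
  qed (simp_all add: cl)
qed

lemma pure_tensor_ext:
  assumes M: "module K M" and P: "module K P" and \<phi>: "multilinear K M P \<phi>"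
  shows "lin_ext K (tensor_powers K M) P (pure_tensor K M) (lists (carrier M)) \<phi>"
  unfolding tensor_powers_def pure_tensor_def
proof (rule presented_ext[OF _ multilinear_rels_subset[OF M] P])
  interpret M: module K M by fact
  interpret P: module K P by fact
  show "cring K" by (rule M.R.cring_axioms)
  fix l e assume l: "linear_map K (free_module K (lists (carrier M))) P l"
    "\<And>f. f \<in> lists (carrier M) \<Longrightarrow> l (free_gen K f) = \<phi> f" and e: "e \<in> multilinear_rels K M"
  note r = linear_map_free_gen[OF M.R.cring_axioms P l(1)]
  show "l e = \<zero>\<^bsub>P\<^esub>"
  proof -
    let ?S = "lists (carrier M)"
    note D = linear_mapD[OF multilinearD(2)[OF \<phi>]]
    from e consider (add) f x y g where "f \<in> ?S" "x \<in> carrier M" "y \<in> carrier M" "g \<in> ?S"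
        "e = free_gen K (f @ (x \<oplus>\<^bsub>M\<^esub> y) # g) \<ominus>\<^bsub>free_module K ?S\<^esub>
          (free_gen K (f @ x # g) \<oplus>\<^bsub>free_module K ?S\<^esub> free_gen K (f @ y # g))"
      | (smult) f c x g where "f \<in> ?S" "c \<in> carrier K" "x \<in> carrier M" "g \<in> ?S"
        "e = free_gen K (f @ (c \<odot>\<^bsub>M\<^esub> x) # g) \<ominus>\<^bsub>free_module K ?S\<^esub>
          c \<odot>\<^bsub>free_module K ?S\<^esub> free_gen K (f @ x # g)"
      unfolding multilinear_rels_def Let_def
      by (elim UnE CollectE exE conjE) (rule that; assumption)+
    then show ?thesis
    proof cases
      case add
      then have "l e = \<phi> (f @ (x \<oplus>\<^bsub>M\<^esub> y) # g) \<ominus>\<^bsub>P\<^esub> (\<phi> (f @ x # g) \<oplus>\<^bsub>P\<^esub> \<phi> (f @ y # g))"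
        by (simp add: r l(2))
      with add show ?thesis
        by (simp add: D(2) minus_self[OF P.M.abelian_group_axioms] D(1))
    next
      case smult
      then have "l e = \<phi> (f @ (c \<odot>\<^bsub>M\<^esub> x) # g) \<ominus>\<^bsub>P\<^esub> c \<odot>\<^bsub>P\<^esub> \<phi> (f @ x # g)"
        by (simp add: r l(2))
      with smult show ?thesis
        by (simp add: D(3) minus_self[OF P.M.abelian_group_axioms] D(1))
    qed
  qed
qed (rule multilinearD(1)[OF \<phi>])

subsection \<open>Algebras\<close>

text \<open>A layer below the locale \<open>algebra\<close>, which includes commutativity: the
  tensor algebra is not commutative in general, and its quotient \<open>sym_algebra\<close> has to
  be proved so.\<close>

definition assoc_algebra :: "('k, 'r) ring_scheme \<Rightarrow> ('k, 'b, 'm) module_scheme \<Rightarrow> bool"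
  where "assoc_algebra K A \<longleftrightarrow> module K A \<and> ring A \<and> bilinear_map K A A A (\<lambda>x y. x \<otimes>\<^bsub>A\<^esub> y)"

text \<open>Associativity spreads from generators to the carrier one argument at a time, because
  both bracketings are linear in each argument.\<close>

lemma assoc_algebraI:
  assumes A: "module K A" and b: "bilinear_map K A A A (\<lambda>x y. x \<otimes>\<^bsub>A\<^esub> y)" and G: "spans K A G"
    and one: "\<one>\<^bsub>A\<^esub> \<in> carrier A"
    and l: "\<And>x. x \<in> G \<Longrightarrow> \<one>\<^bsub>A\<^esub> \<otimes>\<^bsub>A\<^esub> x = x" and r: "\<And>x. x \<in> G \<Longrightarrow> x \<otimes>\<^bsub>A\<^esub> \<one>\<^bsub>A\<^esub> = x"
    and as: "\<And>x y z. x \<in> G \<Longrightarrow> y \<in> G \<Longrightarrow> z \<in> G \<Longrightarrow> (x \<otimes>\<^bsub>A\<^esub> y) \<otimes>\<^bsub>A\<^esub> z = x \<otimes>\<^bsub>A\<^esub> (y \<otimes>\<^bsub>A\<^esub> z)"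
  shows "assoc_algebra K A"
proof -
  interpret A: module K A by fact
  note cl = bilinear_map_closed[OF b]
  note br = bilinear_mapD(1)[OF b] and bl = bilinear_mapD(2)[OF b]
  note Gc = span_closed[OF G]
  note ext = linear_map_eq[OF A A G]
  have 1: "(x \<otimes>\<^bsub>A\<^esub> y) \<otimes>\<^bsub>A\<^esub> z = x \<otimes>\<^bsub>A\<^esub> (y \<otimes>\<^bsub>A\<^esub> z)" if "x \<in> G" "y \<in> G" "z \<in> carrier A" for x y z
    by (rule ext[where x = z]) (use that as in \<open>auto intro: br cl Gc linear_map_compose[OF br br]\<close>)
  have 2: "(x \<otimes>\<^bsub>A\<^esub> y) \<otimes>\<^bsub>A\<^esub> z = x \<otimes>\<^bsub>A\<^esub> (y \<otimes>\<^bsub>A\<^esub> z)" if "x \<in> G" "y \<in> carrier A" "z \<in> carrier A" for x y z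
    by (rule ext[where x = y])
      (use that 1 in \<open>auto intro: cl Gc linear_map_compose[OF bl br] linear_map_compose[OF br bl]\<close>)
  have 3: "(x \<otimes>\<^bsub>A\<^esub> y) \<otimes>\<^bsub>A\<^esub> z = x \<otimes>\<^bsub>A\<^esub> (y \<otimes>\<^bsub>A\<^esub> z)"
    if "x \<in> carrier A" "y \<in> carrier A" "z \<in> carrier A" for x y z
    by (rule ext[where x = x])
      (use that 2 in \<open>auto intro: bl cl Gc linear_map_compose[OF bl bl]\<close>)
  have l': "\<one>\<^bsub>A\<^esub> \<otimes>\<^bsub>A\<^esub> x = x" if "x \<in> carrier A" for x
    by (rule ext[OF _ _ _ that]) (use l one in \<open>auto intro: br linear_map_id\<close>)
  have r': "x \<otimes>\<^bsub>A\<^esub> \<one>\<^bsub>A\<^esub> = x" if "x \<in> carrier A" for x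
    by (rule ext[OF _ _ _ that]) (use r one in \<open>auto intro: bl linear_map_id\<close>)
  have "ring A"
  proof (rule ringI)
    show "abelian_group A" by (rule A.M.abelian_group_axioms)
    show "Group.monoid A" by (rule monoidI) (simp_all add: cl one 3 l' r')
  qed (simp_all add: linear_mapD(2)[OF br] linear_mapD(2)[OF bl])
  with A b show ?thesis by (simp add: assoc_algebra_def)
qed

lemma assoc_algebraD:
  assumes "assoc_algebra K A"
  shows "module K A" "ring A" "bilinear_map K A A A (\<lambda>x y. x \<otimes>\<^bsub>A\<^esub> y)"
  using assms by (simp_all add: assoc_algebra_def)

lemma algebra_of_commute:
  assumes A: "assoc_algebra K A" and G: "spans K A G"
    and c: "\<And>x y. x \<in> G \<Longrightarrow> y \<in> G \<Longrightarrow> x \<otimes>\<^bsub>A\<^esub> y = y \<otimes>\<^bsub>A\<^esub> x"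
  shows "algebra K A"
proof -
  note A' = assoc_algebraD[OF A]
  interpret A: module K A by (rule A')
  interpret R: ring A by (rule A')
  note br = bilinear_mapD(1)[OF A'(3)] and bl = bilinear_mapD(2)[OF A'(3)]
  note Gc = span_closed[OF G]
  note ext = linear_map_eq[OF A'(1) A'(1) G]
  have 1: "x \<otimes>\<^bsub>A\<^esub> y = y \<otimes>\<^bsub>A\<^esub> x" if "x \<in> G" "y \<in> carrier A" for x y
    by (rule ext[where x = y]) (use that c Gc br bl in auto)
  have 2: "x \<otimes>\<^bsub>A\<^esub> y = y \<otimes>\<^bsub>A\<^esub> x" if "x \<in> carrier A" "y \<in> carrier A" for x y
    by (rule ext[where x = x]) (use that 1 br bl in auto)
  have "cring A"
    by (intro cring.intro R.ring_axioms comm_monoid.intro comm_monoid_axioms.intro R.monoid_axioms 2)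
  then show ?thesis
    by (intro algebra.intro A'(1) algebra_axioms.intro) (simp_all add: linear_mapD(3)[OF bl])
qed

lemma algebraD:
  assumes "algebra K A"
  shows "module K A" "cring A" "bilinear_map K A A A (\<lambda>x y. x \<otimes>\<^bsub>A\<^esub> y)" "assoc_algebra K A"
proof -
  interpret A: algebra K A by fact
  show 1: "module K A" by (rule A.module_axioms)
  show "cring A" by (rule A.M_cring)
  have "linear_map K A A (\<lambda>y. x \<otimes>\<^bsub>A\<^esub> y)" if x: "x \<in> carrier A" for x
  proof (rule linear_mapI)
    fix c y assume "c \<in> carrier K" "y \<in> carrier A"
    then show "x \<otimes>\<^bsub>A\<^esub> (c \<odot>\<^bsub>A\<^esub> y) = c \<odot>\<^bsub>A\<^esub> (x \<otimes>\<^bsub>A\<^esub> y)"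
      using x A.smult_assoc2[of c y x] A.m_comm[of x] by simp
  qed (simp_all add: x A.r_distr)
  moreover have "linear_map K A A (\<lambda>x. x \<otimes>\<^bsub>A\<^esub> y)" if y: "y \<in> carrier A" for y
    by (rule linear_mapI) (simp_all add: y A.l_distr A.smult_assoc2)
  ultimately show 2: "bilinear_map K A A A (\<lambda>x y. x \<otimes>\<^bsub>A\<^esub> y)"
    by (simp add: bilinear_map_def)
  show "assoc_algebra K A"
    using 1 2 A.ring_axioms by (simp add: assoc_algebra_def)
qed

lemma (in algebra) smult_assoc_right:
  "\<lbrakk>a \<in> carrier R; x \<in> carrier M; y \<in> carrier M\<rbrakk> \<Longrightarrow> x \<otimes>\<^bsub>M\<^esub> (a \<odot>\<^bsub>M\<^esub> y) = a \<odot>\<^bsub>M\<^esub> (x \<otimes>\<^bsub>M\<^esub> y)"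
  using smult_assoc2[of a y x] by (simp add: m_comm)

text \<open>Algebra tensor products, tensor algebras, \<open>TT\<close> and \<open>CT\<close>
  overwrite only \<open>mult\<close> and \<open>one\<close> of a module record; this lemma and the
  next three carry the module facts across such updates.\<close>

lemma module_cong:
  fixes M :: "('k, 'b, 'm) module_scheme" and M' :: "('k, 'b, 'm) module_scheme"
  assumes M: "module K M" and eq: "carrier M' = carrier M" "add M' = add M" "zero M' = zero M" "smult M' = smult M"
  shows "module K M'"
proof -
  interpret M: module K M by fact
  have "abelian_group M'"
    using M.M.abelian_group_axioms
    by (simp add: abelian_group_def abelian_monoid_def abelian_group_axioms_def eq)
  then show ?thesis
    by (rule moduleI[OF M.R.cring_axioms]) (simp_all add: eq M.smult_l_distr M.smult_r_distr M.smult_assoc1)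
qed

lemma linear_map_module_cong:
  assumes "carrier M' = carrier M" "add M' = add M" "smult M' = smult M"
  shows "linear_map K M' = linear_map K M" and "linear_map K N M' = linear_map K N M"
  by (auto simp: linear_map_def assms fun_eq_iff)

lemma submodule_cong:
  fixes M :: "('k, 'b, 'm) module_scheme" and M' :: "('k, 'b, 'm) module_scheme"
  assumes "carrier M' = carrier M" "add M' = add M" "zero M' = zero M" "smult M' = smult M"
  shows "submodule H K M' \<longleftrightarrow> submodule H K M"
  by (simp add: submodule_def submodule_axioms_def assms)

lemma spans_cong:
  fixes M :: "('k, 'b, 'm) module_scheme" and M' :: "('k, 'b, 'm) module_scheme"
  assumes "carrier M' = carrier M" "add M' = add M" "zero M' = zero M" "smult M' = smult M"
  shows "spans K M' G \<longleftrightarrow> spans K M G"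
  unfolding spans_def by (simp add: submodule_cong[OF assms] assms(1))

lemma ideal_submodule:
  assumes A: "assoc_algebra K A" and I: "ideal I A"
  shows "submodule I K A"
proof -
  note A' = assoc_algebraD[OF A]
  interpret A: module K A by (rule A')
  interpret R: ring A by (rule A')
  interpret I: ideal I A by fact
  show ?thesis
  proof (rule A.submoduleI)
    fix c x assume c: "c \<in> carrier K" and x: "x \<in> I"
    \<comment> \<open>A scalar acts as multiplication by its multiple of the unit, and an ideal is
      closed under that.\<close>
    then have "c \<odot>\<^bsub>A\<^esub> x = (c \<odot>\<^bsub>A\<^esub> \<one>\<^bsub>A\<^esub>) \<otimes>\<^bsub>A\<^esub> x"
      by (simp add: linear_mapD(3)[OF bilinear_mapD(2)[OF A'(3)]])
    with c x show "c \<odot>\<^bsub>A\<^esub> x \<in> I" by (simp add: I.I_l_closed)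
  qed (use I.a_subset in auto)
qed

lemma quot_algebra:
  assumes A: "assoc_algebra K A" and I: "ideal I A"
  shows "assoc_algebra K (quot_module A I)"
    and "x \<in> carrier A \<Longrightarrow> y \<in> carrier A \<Longrightarrow>
      (I +>\<^bsub>A\<^esub> x) \<otimes>\<^bsub>quot_module A I\<^esub> (I +>\<^bsub>A\<^esub> y) = I +>\<^bsub>A\<^esub> (x \<otimes>\<^bsub>A\<^esub> y)"
proof -
  note A' = assoc_algebraD[OF A]
  interpret A: module K A by (rule A')
  interpret R: ring A by (rule A')
  interpret I: ideal I A by fact
  note H = ideal_submodule[OF A I]
  let ?Q = "quot_module A I"
  note l = coset_linear[OF A'(1) H]
  have m: "(I +>\<^bsub>A\<^esub> x) \<otimes>\<^bsub>?Q\<^esub> (I +>\<^bsub>A\<^esub> y) = I +>\<^bsub>A\<^esub> (x \<otimes>\<^bsub>A\<^esub> y)"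
    if "x \<in> carrier A" "y \<in> carrier A" for x y
    unfolding quot_module_simps(4) using that by (rule I.rcoset_mult_add)
  then show "x \<in> carrier A \<Longrightarrow> y \<in> carrier A \<Longrightarrow>
      (I +>\<^bsub>A\<^esub> x) \<otimes>\<^bsub>quot_module A I\<^esub> (I +>\<^bsub>A\<^esub> y) = I +>\<^bsub>A\<^esub> (x \<otimes>\<^bsub>A\<^esub> y)" .
  note br = bilinear_mapD(1)[OF A'(3)] and bl = bilinear_mapD(2)[OF A'(3)]
  have cl: "I +>\<^bsub>A\<^esub> x \<in> carrier ?Q" if "x \<in> carrier A" for x
    using that by (rule linear_mapD(1)[OF l])
  have ex: "\<exists>x. x \<in> carrier A \<and> X = I +>\<^bsub>A\<^esub> x" if "X \<in> carrier ?Q" for X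
    using that by (auto simp: quot_module_simps(1))
  have b: "bilinear_map K ?Q ?Q ?Q (\<lambda>x y. x \<otimes>\<^bsub>?Q\<^esub> y)"
    unfolding bilinear_map_def
  proof (intro conjI ballI linear_mapI)
    fix X Y Z assume "X \<in> carrier ?Q" "Y \<in> carrier ?Q" "Z \<in> carrier ?Q"
    then obtain x y z where x: "x \<in> carrier A" "X = I +>\<^bsub>A\<^esub> x" and y: "y \<in> carrier A" "Y = I +>\<^bsub>A\<^esub> y"
      and z: "z \<in> carrier A" "Z = I +>\<^bsub>A\<^esub> z" using ex by metis
    show "X \<otimes>\<^bsub>?Q\<^esub> (Y \<oplus>\<^bsub>?Q\<^esub> Z) = X \<otimes>\<^bsub>?Q\<^esub> Y \<oplus>\<^bsub>?Q\<^esub> X \<otimes>\<^bsub>?Q\<^esub> Z"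
      "(Y \<oplus>\<^bsub>?Q\<^esub> Z) \<otimes>\<^bsub>?Q\<^esub> X = Y \<otimes>\<^bsub>?Q\<^esub> X \<oplus>\<^bsub>?Q\<^esub> Z \<otimes>\<^bsub>?Q\<^esub> X"
      unfolding x(2) y(2) z(2) using x(1) y(1) z(1)
      by (simp_all add: m R.r_distr R.l_distr flip: linear_mapD(2)[OF l])
  next
    fix X Y c assume "X \<in> carrier ?Q" "Y \<in> carrier ?Q" and c: "c \<in> carrier K"
    then obtain x y where x: "x \<in> carrier A" "X = I +>\<^bsub>A\<^esub> x" and y: "y \<in> carrier A" "Y = I +>\<^bsub>A\<^esub> y"
      using ex by metis
    show "X \<otimes>\<^bsub>?Q\<^esub> (c \<odot>\<^bsub>?Q\<^esub> Y) = c \<odot>\<^bsub>?Q\<^esub> (X \<otimes>\<^bsub>?Q\<^esub> Y)"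
      "(c \<odot>\<^bsub>?Q\<^esub> Y) \<otimes>\<^bsub>?Q\<^esub> X = c \<odot>\<^bsub>?Q\<^esub> (Y \<otimes>\<^bsub>?Q\<^esub> X)"
      unfolding x(2) y(2) using x(1) y(1) c
      by (simp_all add: m cl linear_mapD(3)[OF br] linear_mapD(3)[OF bl] flip: linear_mapD(3)[OF l])
  next
    fix X Y assume "X \<in> carrier ?Q" "Y \<in> carrier ?Q"
    then obtain x y where x: "x \<in> carrier A" "X = I +>\<^bsub>A\<^esub> x" and y: "y \<in> carrier A" "Y = I +>\<^bsub>A\<^esub> y"
      using ex by metis
    show "X \<otimes>\<^bsub>?Q\<^esub> Y \<in> carrier ?Q" "X \<otimes>\<^bsub>?Q\<^esub> Y \<in> carrier ?Q"
      unfolding x(2) y(2) using x(1) y(1) by (simp_all add: m cl)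
  qed
  show "assoc_algebra K ?Q"
  proof (rule assoc_algebraI[OF quot_module_module[OF A'(1) H] b spans_carrier])
    fix X Y Z assume "X \<in> carrier ?Q" "Y \<in> carrier ?Q" "Z \<in> carrier ?Q"
    then obtain x y z where x: "x \<in> carrier A" "X = I +>\<^bsub>A\<^esub> x" and y: "y \<in> carrier A" "Y = I +>\<^bsub>A\<^esub> y"
      and z: "z \<in> carrier A" "Z = I +>\<^bsub>A\<^esub> z" using ex by metis
    show "X \<otimes>\<^bsub>?Q\<^esub> Y \<otimes>\<^bsub>?Q\<^esub> Z = X \<otimes>\<^bsub>?Q\<^esub> (Y \<otimes>\<^bsub>?Q\<^esub> Z)"
      unfolding x(2) y(2) z(2) using x(1) y(1) z(1) by (simp add: m R.m_assoc)
  next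
    fix X assume "X \<in> carrier ?Q"
    then obtain x where x: "x \<in> carrier A" "X = I +>\<^bsub>A\<^esub> x" using ex by metis
    show "\<one>\<^bsub>?Q\<^esub> \<otimes>\<^bsub>?Q\<^esub> X = X" "X \<otimes>\<^bsub>?Q\<^esub> \<one>\<^bsub>?Q\<^esub> = X"
      unfolding x(2) quot_module_simps(5) using x(1) by (simp_all add: m)
  qed (simp add: quot_module_simps(5) cl)
qed

lemma quot_commutative_algebra:
  assumes A: "algebra K A" and I: "ideal I A"
  shows "algebra K (quot_module A I)"
proof (rule algebra_of_commute[OF quot_algebra(1)[OF algebraD(4)[OF A] I] spans_carrier])
  interpret A: algebra K A by fact
  fix X Y assume "X \<in> carrier (quot_module A I)" "Y \<in> carrier (quot_module A I)"
  then obtain x y where x: "x \<in> carrier A" "X = I +>\<^bsub>A\<^esub> x" and y: "y \<in> carrier A" "Y = I +>\<^bsub>A\<^esub> y"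
    by (auto simp: quot_module_simps(1))
  show "X \<otimes>\<^bsub>quot_module A I\<^esub> Y = Y \<otimes>\<^bsub>quot_module A I\<^esub> X"
    unfolding x(2) y(2) using x(1) y(1)
    by (simp add: quot_algebra(2)[OF algebraD(4)[OF A] I] A.m_comm)
qed

text \<open>Membership of words is left atomic; unfolding it elementwise makes classical reasoning diverge.\<close>

declare in_listsD [rule del] in_listsI [rule del]

lemma cring_fields:
  assumes "cring R" and eq: "carrier R' = carrier R" "monoid.mult R' = monoid.mult R" "one R' = one R"
    "zero R' = zero R" "add R' = add R"
  shows "cring R'"
proof -
  interpret R: cring R by fact
  have "\<exists>y\<in>carrier R. y \<oplus>\<^bsub>R\<^esub> x = \<zero>\<^bsub>R\<^esub>" if "x \<in> carrier R" for x
    using that by (intro bexI[of _ "\<ominus>\<^bsub>R\<^esub> x"]) (simp_all add: R.l_neg)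
  then have "abelian_group R'"
    by (intro abelian_groupI) (simp_all add: eq R.a_ac)
  moreover have "Group.comm_monoid R'"
    by (rule comm_monoidI) (simp_all add: eq R.m_ac)
  ultimately show ?thesis
    by (rule cringI) (simp add: eq R.l_distr)
qed

lemma self_module_fields [simp]:
  "carrier (self_module R) = carrier R" "monoid.mult (self_module R) = monoid.mult R"
  "one (self_module R) = one R" "zero (self_module R) = zero R" "add (self_module R) = add R"
  "smult (self_module R) = monoid.mult R"
  by (simp_all add: self_module_def)

lemma self_module_algebra:
  assumes K: "cring K" and R: "cring R" and sub: "carrier K \<subseteq> carrier R"
    and eq: "monoid.mult K = monoid.mult R" "one K = one R" "add K = add R"
  shows "algebra K (self_module R)"
proof -
  interpret R: cring R by fact
  show ?thesis
    by (rule algebraI[OF K cring_fields[OF R]])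
      (use sub in \<open>simp_all add: eq subset_iff R.l_distr R.r_distr R.m_assoc\<close>)
qed

lemma kernel_ideal:
  assumes A: "assoc_algebra K A" and B: "assoc_algebra K B" and l: "linear_map K A B l"
    and m: "\<And>x y. x \<in> carrier A \<Longrightarrow> y \<in> carrier A \<Longrightarrow> l (x \<otimes>\<^bsub>A\<^esub> y) = l x \<otimes>\<^bsub>B\<^esub> l y"
  shows "ideal {x \<in> carrier A. l x = \<zero>\<^bsub>B\<^esub>} A"
proof -
  interpret A: ring A by (rule assoc_algebraD[OF A])
  interpret B: ring B by (rule assoc_algebraD[OF B])
  have s: "submodule {x \<in> carrier A. l x = \<zero>\<^bsub>B\<^esub>} K A"
    by (rule kernel_submodule[OF assoc_algebraD(1)[OF A] assoc_algebraD(1)[OF B] l])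
  show ?thesis
    by (rule idealI[OF A.ring_axioms submodule.axioms(1)[OF s]]) (simp_all add: m linear_mapD(1)[OF l])
qed

lemma multiplicative_of_span:
  assumes A: "assoc_algebra K A" and B: "assoc_algebra K B" and l: "linear_map K A B l"
    and G: "spans K A G"
    and m: "\<And>x y. x \<in> G \<Longrightarrow> y \<in> G \<Longrightarrow> l (x \<otimes>\<^bsub>A\<^esub> y) = l x \<otimes>\<^bsub>B\<^esub> l y"
    and x: "x \<in> carrier A" and y: "y \<in> carrier A"
  shows "l (x \<otimes>\<^bsub>A\<^esub> y) = l x \<otimes>\<^bsub>B\<^esub> l y"
proof -
  note A' = assoc_algebraD[OF A] and B' = assoc_algebraD[OF B]
  note ext = linear_map_eq[OF A'(1) B'(1) G]
  have 1: "l (x \<otimes>\<^bsub>A\<^esub> y) = l x \<otimes>\<^bsub>B\<^esub> l y" if x: "x \<in> G" and y: "y \<in> carrier A" for x y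
  proof (rule ext[where x = y, OF _ _ _ y])
    have x': "x \<in> carrier A" using x by (rule span_closed[OF G])
    show "linear_map K A B (\<lambda>y. l (x \<otimes>\<^bsub>A\<^esub> y))"
      by (rule linear_map_compose[OF l bilinear_mapD(1)[OF A'(3) x']])
    show "linear_map K A B (\<lambda>y. l x \<otimes>\<^bsub>B\<^esub> l y)"
      by (rule bilinear_map_compose_right[OF B'(3) linear_mapD(1)[OF l x'] l])
  qed (use x m in auto)
  show ?thesis
  proof (rule ext[where x = x, OF _ _ _ x])
    show "linear_map K A B (\<lambda>x. l (x \<otimes>\<^bsub>A\<^esub> y))"
      by (rule linear_map_compose[OF l bilinear_mapD(2)[OF A'(3) y]])
    show "linear_map K A B (\<lambda>x. l x \<otimes>\<^bsub>B\<^esub> l y)"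
      by (rule bilinear_map_compose_left[OF B'(3) linear_mapD(1)[OF l y] l])
  qed (use y 1 in auto)
qed

subsection \<open>Tensor products of commutative algebras\<close>

lemma alg_tensor_fields [simp]:
  "carrier (alg_tensor K A B) = carrier (tensor_prod K A B)"
  "add (alg_tensor K A B) = add (tensor_prod K A B)"
  "zero (alg_tensor K A B) = zero (tensor_prod K A B)"
  "smult (alg_tensor K A B) = smult (tensor_prod K A B)"
  "one (alg_tensor K A B) = tens K A B \<one>\<^bsub>A\<^esub> \<one>\<^bsub>B\<^esub>"
  by (simp_all add: alg_tensor_def)

lemma linear_map_alg_tensor [simp]:
  "linear_map K (alg_tensor K A B) = linear_map K (tensor_prod K A B)"
  "linear_map K N (alg_tensor K A B) = linear_map K N (tensor_prod K A B)"
  by (rule linear_map_module_cong; simp)+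

lemma bilinear_map_alg_tensor:
  "bilinear_map K (alg_tensor K A B) (alg_tensor K A B) (alg_tensor K A B) =
    bilinear_map K (tensor_prod K A B) (tensor_prod K A B) (tensor_prod K A B)"
  by (auto simp: bilinear_map_def fun_eq_iff)

lemma tensor_lin_ext:
  assumes "module K M" "spans K M (g ` S)" and "module K N" "spans K N (h ` T)"
    and "module K P"
    and "\<And>t. t \<in> T \<Longrightarrow> lin_ext K M P g S (\<lambda>s. b s t)"
    and "\<And>s. s \<in> S \<Longrightarrow> lin_ext K N P h T (\<lambda>t. b s t)"
  shows "lin_ext K (tensor_prod K M N) P (\<lambda>(s, t). tens K M N (g s) (h t)) (S \<times> T) (\<lambda>(s, t). b s t)"
  using tensor_ext[OF assms] unfolding lin_ext_def by auto

lemma bilinear_map_compose: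
  assumes b: "bilinear_map K M N P b" and f: "linear_map K M' M f" and g: "linear_map K N' N g"
  shows "bilinear_map K M' N' P (\<lambda>x y. b (f x) (g y))"
  unfolding bilinear_map_def
proof (intro conjI ballI)
  fix x assume "x \<in> carrier M'"
  then show "linear_map K N' P (\<lambda>y. b (f x) (g y))"
    by (rule bilinear_map_compose_right[OF b linear_mapD(1)[OF f] g])
next
  fix y assume "y \<in> carrier N'"
  then show "linear_map K M' P (\<lambda>x. b (f x) (g y))"
    by (rule bilinear_map_compose_left[OF b linear_mapD(1)[OF g] f])
qed

lemma image_case_prod: "(\<lambda>(x, y). f x y) ` (A \<times> B) = {f x y | x y. x \<in> A \<and> y \<in> B}"
  by (auto simp: image_def)

lemma tens_spans_image:
  assumes M: "module K M" "spans K M (g ` S)" and N: "module K N" "spans K N (h ` T)"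
  shows "spans K (tensor_prod K M N) ((\<lambda>(s, t). tens K M N (g s) (h t)) ` (S \<times> T))"
proof -
  have "(\<lambda>(s, t). tens K M N (g s) (h t)) ` (S \<times> T) = {tens K M N x y | x y. x \<in> g ` S \<and> y \<in> h ` T}"
    by (auto simp: image_def)
  with tens_spans[OF assms] show ?thesis by simp
qed

lemma tensor_bilinear_ext:
  assumes M: "module K M" and N: "module K N" and P: "module K P" and b: "bilinear_map K M N P b"
  shows "lin_ext K (tensor_prod K M N) P (\<lambda>(x, y). tens K M N x y) (carrier M \<times> carrier N) (\<lambda>(x, y). b x y)"
proof (rule tensor_lin_ext[OF M _ N _ P])
  show "lin_ext K M P (\<lambda>x. x) (carrier M) (\<lambda>x. b x y)" if "y \<in> carrier N" for y
    by (rule lin_ext_linear[OF bilinear_mapD(2)[OF b that]])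
  show "lin_ext K N P (\<lambda>x. x) (carrier N) (b x)" if "x \<in> carrier M" for x
    by (rule lin_ext_linear[OF bilinear_mapD(1)[OF b that]])
qed (simp_all add: spans_carrier)

lemma alg_tensor_mult_ex:
  assumes A: "algebra K A" and B: "algebra K B"
  shows "\<exists>p. bilinear_map K (tensor_prod K A B) (tensor_prod K A B) (tensor_prod K A B) p \<and>
    (\<forall>a\<in>carrier A. \<forall>b\<in>carrier B. \<forall>a'\<in>carrier A. \<forall>b'\<in>carrier B.
      p (tens K A B a b) (tens K A B a' b') = tens K A B (a \<otimes>\<^bsub>A\<^esub> a') (b \<otimes>\<^bsub>B\<^esub> b'))"
proof -
  note A' = algebraD[OF A] and B' = algebraD[OF B]
  let ?T = "tensor_prod K A B"
  let ?S = "carrier A \<times> carrier B"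
  let ?g = "\<lambda>(a, b). tens K A B a b"
  let ?b = "\<lambda>s u. tens K A B (fst s \<otimes>\<^bsub>A\<^esub> fst u) (snd s \<otimes>\<^bsub>B\<^esub> snd u)"
  note T = tensor_prod_module[OF A'(1) B'(1)]
  note t = tens_bilinear[OF A'(1) B'(1)]
  have sp: "spans K ?T (?g ` ?S)"
    using tens_spans[OF A'(1) spans_carrier B'(1) spans_carrier] by (simp add: image_case_prod)
  have "\<exists>p. bilinear_map K ?T ?T ?T p \<and> (\<forall>s\<in>?S. \<forall>u\<in>?S. p (?g s) (?g u) = ?b s u)"
  proof (rule bilinear_ext[OF T sp T sp T])
    fix u assume u: "u \<in> ?S"
    have "bilinear_map K A B ?T (\<lambda>a b. tens K A B (a \<otimes>\<^bsub>A\<^esub> fst u) (b \<otimes>\<^bsub>B\<^esub> snd u))"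
      using u by (intro bilinear_map_compose[OF t] bilinear_mapD(2)[OF A'(3)] bilinear_mapD(2)[OF B'(3)])
        (simp_all add: mem_Times_iff)
    from tensor_bilinear_ext[OF A'(1) B'(1) T this]
    show "lin_ext K ?T ?T ?g ?S (\<lambda>s. ?b s u)" by (simp add: case_prod_unfold)
    have "bilinear_map K A B ?T (\<lambda>a b. tens K A B (fst u \<otimes>\<^bsub>A\<^esub> a) (snd u \<otimes>\<^bsub>B\<^esub> b))"
      using u by (intro bilinear_map_compose[OF t] bilinear_mapD(1)[OF A'(3)] bilinear_mapD(1)[OF B'(3)])
        (simp_all add: mem_Times_iff)
    from tensor_bilinear_ext[OF A'(1) B'(1) T this]
    show "lin_ext K ?T ?T ?g ?S (\<lambda>s. ?b u s)" by (simp add: case_prod_unfold)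
  qed
  then obtain p where "bilinear_map K ?T ?T ?T p" "\<forall>s\<in>?S. \<forall>u\<in>?S. p (?g s) (?g u) = ?b s u"
    by blast
  then show ?thesis by (intro exI[of _ p]) simp
qed

lemma
  assumes A: "algebra K A" and B: "algebra K B"
  shows alg_tensor_mult: "\<lbrakk>a \<in> carrier A; b \<in> carrier B; a' \<in> carrier A; b' \<in> carrier B\<rbrakk> \<Longrightarrow>
      tens K A B a b \<otimes>\<^bsub>alg_tensor K A B\<^esub> tens K A B a' b' = tens K A B (a \<otimes>\<^bsub>A\<^esub> a') (b \<otimes>\<^bsub>B\<^esub> b')"
    and alg_tensor_algebra: "algebra K (alg_tensor K A B)"
proof -
  note A' = algebraD[OF A] and B' = algebraD[OF B]
  interpret A: algebra K A by fact
  interpret B: algebra K B by fact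
  let ?T = "tensor_prod K A B" and ?U = "alg_tensor K A B"
  let ?G = "{tens K A B x y | x y. x \<in> carrier A \<and> y \<in> carrier B}"
  note T = tensor_prod_module[OF A'(1) B'(1)]
  note t = tens_bilinear[OF A'(1) B'(1)]
  have "monoid.mult ?U = (SOME p. bilinear_map K ?T ?T ?T p \<and>
    (\<forall>a\<in>carrier A. \<forall>b\<in>carrier B. \<forall>a'\<in>carrier A. \<forall>b'\<in>carrier B.
      p (tens K A B a b) (tens K A B a' b') = tens K A B (a \<otimes>\<^bsub>A\<^esub> a') (b \<otimes>\<^bsub>B\<^esub> b')))"
    by (simp add: alg_tensor_def)
  from someI_ex[OF alg_tensor_mult_ex[OF A B], folded this]
  have b: "bilinear_map K ?U ?U ?U (\<lambda>x y. x \<otimes>\<^bsub>?U\<^esub> y)" and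
    m: "\<And>a b a' b'. \<lbrakk>a \<in> carrier A; b \<in> carrier B; a' \<in> carrier A; b' \<in> carrier B\<rbrakk> \<Longrightarrow>
      tens K A B a b \<otimes>\<^bsub>alg_tensor K A B\<^esub> tens K A B a' b' = tens K A B (a \<otimes>\<^bsub>A\<^esub> a') (b \<otimes>\<^bsub>B\<^esub> b')"
    unfolding bilinear_map_alg_tensor by blast+
  from m show "\<lbrakk>a \<in> carrier A; b \<in> carrier B; a' \<in> carrier A; b' \<in> carrier B\<rbrakk> \<Longrightarrow>
      tens K A B a b \<otimes>\<^bsub>alg_tensor K A B\<^esub> tens K A B a' b' = tens K A B (a \<otimes>\<^bsub>A\<^esub> a') (b \<otimes>\<^bsub>B\<^esub> b')" .
  have U: "module K ?U" by (rule module_cong[OF T]) simp_all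
  have G: "spans K ?U ?G"
    using tens_spans[OF A'(1) spans_carrier B'(1) spans_carrier]
    by (subst spans_cong[of _ ?T]) simp_all
  have "assoc_algebra K ?U"
  proof (rule assoc_algebraI[OF U b G])
    show "\<one>\<^bsub>?U\<^esub> \<in> carrier ?U" by (simp add: bilinear_map_closed[OF t])
  qed (auto simp: m A.m_assoc B.m_assoc)
  then show "algebra K ?U"
    by (rule algebra_of_commute[OF _ G]) (auto simp: m A.m_comm B.m_comm)
qed

subsection \<open>The tensor algebra and the symmetric algebra\<close>

context
  fixes K :: "('k, 'r) ring_scheme" and M :: "('k, 'b, 'm) module_scheme"
  assumes M: "module K M"
begin

interpretation M: module K M by (rule M)

lemma tensor_algebra_fields [simp]:
  "carrier (tensor_algebra K M) = carrier (tensor_powers K M)"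
  "add (tensor_algebra K M) = add (tensor_powers K M)"
  "zero (tensor_algebra K M) = zero (tensor_powers K M)"
  "smult (tensor_algebra K M) = smult (tensor_powers K M)"
  "one (tensor_algebra K M) = pure_tensor K M []"
  by (simp_all add: tensor_algebra_def)

lemma tensor_algebra_module: "module K (tensor_algebra K M)"
  by (rule module_cong[OF tensor_powers_module[OF M]]) simp_all

lemma tensor_algebra_spans: "spans K (tensor_algebra K M) (pure_tensor K M ` lists (carrier M))"
  using pure_tensor_spans[OF M] by (subst spans_cong[of _ "tensor_powers K M"]) simp_all

lemma linear_map_tensor_algebra:
  "linear_map K (tensor_algebra K M) = linear_map K (tensor_powers K M)"
  "linear_map K N (tensor_algebra K M) = linear_map K N (tensor_powers K M)"
  by (rule linear_map_module_cong; simp)+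

lemma pure_tensor_closed [simp]:
  "f \<in> lists (carrier M) \<Longrightarrow> pure_tensor K M f \<in> carrier (tensor_powers K M)"
  by (rule multilinearD(1)[OF pure_tensor_multilinear[OF M]])

lemma words_bilinear_ext:
  assumes P: "module K P"
    and l: "\<And>g. g \<in> lists (carrier M) \<Longrightarrow> multilinear K M P (\<lambda>f. b f g)"
    and r: "\<And>f. f \<in> lists (carrier M) \<Longrightarrow> multilinear K M P (\<lambda>g. b f g)"
  shows "\<exists>p. bilinear_map K (tensor_powers K M) (tensor_powers K M) P p \<and>
    (\<forall>f\<in>lists (carrier M). \<forall>g\<in>lists (carrier M). p (pure_tensor K M f) (pure_tensor K M g) = b f g)"
  by (rule bilinear_ext[OF tensor_powers_module[OF M] pure_tensor_spans[OF M]
      tensor_powers_module[OF M] pure_tensor_spans[OF M] P])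
    (rule pure_tensor_ext[OF M P], erule l r)+

lemma
  shows tensor_algebra_mult: "f \<in> lists (carrier M) \<Longrightarrow> g \<in> lists (carrier M) \<Longrightarrow>
      pure_tensor K M f \<otimes>\<^bsub>tensor_algebra K M\<^esub> pure_tensor K M g = pure_tensor K M (f @ g)"
    and tensor_algebra_assoc_algebra: "assoc_algebra K (tensor_algebra K M)"
proof -
  let ?P = "tensor_powers K M" and ?A = "tensor_algebra K M" and ?W = "lists (carrier M)"
  note ml = multilinearD[OF pure_tensor_multilinear[OF M]]
  have ex: "\<exists>p. bilinear_map K ?P ?P ?P p \<and>
      (\<forall>f\<in>?W. \<forall>g\<in>?W. p (pure_tensor K M f) (pure_tensor K M g) = pure_tensor K M (f @ g))"
  proof (rule words_bilinear_ext[OF tensor_powers_module[OF M]])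
    fix g assume g: "g \<in> ?W"
    show "multilinear K M ?P (\<lambda>f. pure_tensor K M (f @ g))"
    proof (rule multilinearI)
      fix f h assume f: "f \<in> ?W" "h \<in> ?W"
      have "linear_map K M ?P (\<lambda>x. pure_tensor K M (f @ x # (h @ g)))" using f g by (intro ml) auto
      then show "linear_map K M ?P (\<lambda>x. pure_tensor K M ((f @ x # h) @ g))" by simp
    qed (use g in simp)
    show "multilinear K M ?P (\<lambda>f. pure_tensor K M (g @ f))"
    proof (rule multilinearI)
      fix f h assume f: "f \<in> ?W" "h \<in> ?W"
      have "linear_map K M ?P (\<lambda>x. pure_tensor K M ((g @ f) @ x # h))" using f g by (intro ml) auto
      then show "linear_map K M ?P (\<lambda>x. pure_tensor K M (g @ f @ x # h))" by simp
    qed (use g in simp)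
  qed
  have "monoid.mult ?A = (SOME p. bilinear_map K ?P ?P ?P p \<and>
      (\<forall>f\<in>?W. \<forall>g\<in>?W. p (pure_tensor K M f) (pure_tensor K M g) = pure_tensor K M (f @ g)))"
    by (simp add: tensor_algebra_def)
  from someI_ex[OF ex, folded this]
  have b: "bilinear_map K ?A ?A ?A (\<lambda>x y. x \<otimes>\<^bsub>?A\<^esub> y)"
    and m: "\<And>f g. f \<in> ?W \<Longrightarrow> g \<in> ?W \<Longrightarrow>
      pure_tensor K M f \<otimes>\<^bsub>?A\<^esub> pure_tensor K M g = pure_tensor K M (f @ g)"
    by (simp_all add: bilinear_map_def linear_map_tensor_algebra)
  show "f \<in> ?W \<Longrightarrow> g \<in> ?W \<Longrightarrow> pure_tensor K M f \<otimes>\<^bsub>?A\<^esub> pure_tensor K M g = pure_tensor K M (f @ g)"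
    by (rule m)
  have Nil: "[] \<in> ?W" by simp
  show "assoc_algebra K ?A"
    by (rule assoc_algebraI[OF tensor_algebra_module b tensor_algebra_spans])
      ((elim imageE)?, simp add: m m[OF Nil] m[OF _ Nil])+
qed

interpretation A: ring "tensor_algebra K M"
  by (rule assoc_algebraD[OF tensor_algebra_assoc_algebra])

lemma commutators_closed:
  "{pure_tensor K M [x] \<otimes>\<^bsub>tensor_algebra K M\<^esub> pure_tensor K M [y] \<ominus>\<^bsub>tensor_algebra K M\<^esub>
    pure_tensor K M [y] \<otimes>\<^bsub>tensor_algebra K M\<^esub> pure_tensor K M [x] | x y. x \<in> carrier M \<and> y \<in> carrier M}
    \<subseteq> carrier (tensor_algebra K M)"
proof -
  have "pure_tensor K M [x] \<in> carrier (tensor_algebra K M)" if "x \<in> carrier M" for x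
    using that by simp
  then show ?thesis by (blast intro: A.minus_closed A.m_closed)
qed

lemma commutator_ideal_ideal: "ideal (commutator_ideal K M) (tensor_algebra K M)"
  unfolding commutator_ideal_def Let_def by (rule A.genideal_ideal[OF commutators_closed])

lemma sym_incl_linear: "linear_map K M (sym_algebra K M) (sym_incl K M)"
proof -
  note I = ideal_submodule[OF tensor_algebra_assoc_algebra commutator_ideal_ideal]
  have "linear_map K M (tensor_algebra K M) (\<lambda>x. pure_tensor K M [x])"
    using multilinearD(2)[OF pure_tensor_multilinear[OF M], of "[]" "[]"]
    by (simp add: linear_map_tensor_algebra)
  from linear_map_compose[OF coset_linear[OF tensor_algebra_module I] this]
  show ?thesis unfolding sym_algebra_def sym_incl_def .
qed

text \<open>The ideal makes letters commute; moving a letter past a word, and then a word past a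
  word, gives commutativity. The spanning set, with the unit apart from the multiples of generators,
  is what later separates scalars from elements that die modulo \<open>J\<close>.\<close>

lemma sym_algebra_algebra: "algebra K (sym_algebra K M)"
  and sym_algebra_spans: "spans K (sym_algebra K M) ({\<one>\<^bsub>sym_algebra K M\<^esub>} \<union>
    {sym_incl K M x \<otimes>\<^bsub>sym_algebra K M\<^esub> y | x y. x \<in> carrier M \<and> y \<in> carrier (sym_algebra K M)})"
proof -
  let ?A = "tensor_algebra K M" and ?W = "lists (carrier M)" and ?I = "commutator_ideal K M"
  let ?Q = "sym_algebra K M"
  note ia = ideal_submodule[OF tensor_algebra_assoc_algebra commutator_ideal_ideal]
  let ?c = "\<lambda>f. ?I +>\<^bsub>?A\<^esub> pure_tensor K M f"
  have Q: "assoc_algebra K ?Q"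
    unfolding sym_algebra_def by (rule quot_algebra[OF tensor_algebra_assoc_algebra commutator_ideal_ideal])
  interpret Q: ring ?Q by (rule assoc_algebraD[OF Q])
  note mult = quot_algebra(2)[OF tensor_algebra_assoc_algebra commutator_ideal_ideal, folded sym_algebra_def]
  have cl: "?c f \<in> carrier ?Q" if "f \<in> ?W" for f
    using that unfolding sym_algebra_def by (simp add: quot_module_simps(1))
  have m: "?c f \<otimes>\<^bsub>?Q\<^esub> ?c g = ?c (f @ g)" if "f \<in> ?W" "g \<in> ?W" for f g
    using that by (simp add: mult tensor_algebra_mult)
  have one: "\<one>\<^bsub>?Q\<^esub> = ?c []" unfolding sym_algebra_def by (simp add: quot_module_simps(5))
  have comm1: "?c [x] \<otimes>\<^bsub>?Q\<^esub> ?c [y] = ?c [y] \<otimes>\<^bsub>?Q\<^esub> ?c [x]" if x: "x \<in> carrier M" "y \<in> carrier M" for x y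
  proof -
    have "pure_tensor K M [x] \<otimes>\<^bsub>?A\<^esub> pure_tensor K M [y] \<ominus>\<^bsub>?A\<^esub> pure_tensor K M [y] \<otimes>\<^bsub>?A\<^esub> pure_tensor K M [x] \<in> ?I"
      unfolding commutator_ideal_def Let_def
      by (rule subsetD[OF A.genideal_self[OF commutators_closed]]) (use x in blast)
    then have "?c ([x] @ [y]) = ?c ([y] @ [x])"
      using x by (subst coset_eq_iff[OF tensor_algebra_module ia]) (simp_all add: tensor_algebra_mult)
    then show ?thesis using m[of "[x]" "[y]"] m[of "[y]" "[x]"] x by simp
  qed
  have cons: "?c (a # f) = ?c [a] \<otimes>\<^bsub>?Q\<^esub> ?c f" if "a \<in> carrier M" "f \<in> ?W" for a f
    using m[of "[a]" f] that by simp
  have comm2: "?c [x] \<otimes>\<^bsub>?Q\<^esub> ?c f = ?c f \<otimes>\<^bsub>?Q\<^esub> ?c [x]" if x: "x \<in> carrier M" and "f \<in> ?W" for x f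
    using that(2)
  proof (induction f)
    case Nil
    show ?case using cl[of "[x]"] x unfolding one[symmetric] by simp
  next
    case (Cons a f)
    note c = cl[of "[x]"] cl[of "[a]"] cl[OF Cons(2)]
    have "?c [x] \<otimes>\<^bsub>?Q\<^esub> ?c (a # f) = (?c [x] \<otimes>\<^bsub>?Q\<^esub> ?c [a]) \<otimes>\<^bsub>?Q\<^esub> ?c f"
      using c x Cons(1,2) by (simp add: cons[OF Cons(1,2)] Q.m_assoc)
    also have "\<dots> = ?c [a] \<otimes>\<^bsub>?Q\<^esub> (?c [x] \<otimes>\<^bsub>?Q\<^esub> ?c f)"
      unfolding comm1[OF x Cons(1)] using c x Cons(1) by (simp add: Q.m_assoc)
    also have "\<dots> = ?c (a # f) \<otimes>\<^bsub>?Q\<^esub> ?c [x]"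
      unfolding Cons.IH using c x Cons(1,2) by (simp add: cons[OF Cons(1,2)] Q.m_assoc)
    finally show ?case .
  qed
  have comm3: "?c f \<otimes>\<^bsub>?Q\<^esub> ?c g = ?c g \<otimes>\<^bsub>?Q\<^esub> ?c f" if "f \<in> ?W" and g: "g \<in> ?W" for f g
    using that(1)
  proof (induction f)
    case Nil
    show ?case using cl[OF g] unfolding one[symmetric] by simp
  next
    case (Cons a f)
    note c = cl[OF g] cl[of "[a]"] cl[OF Cons(2)]
    have "?c (a # f) \<otimes>\<^bsub>?Q\<^esub> ?c g = ?c [a] \<otimes>\<^bsub>?Q\<^esub> (?c g \<otimes>\<^bsub>?Q\<^esub> ?c f)"
      using c Cons by (simp add: cons[OF Cons(1,2)] Q.m_assoc)
    also have "\<dots> = (?c g \<otimes>\<^bsub>?Q\<^esub> ?c [a]) \<otimes>\<^bsub>?Q\<^esub> ?c f"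
      unfolding comm2[OF Cons(1) g, symmetric] using c Cons(1) by (simp add: Q.m_assoc)
    also have "\<dots> = ?c g \<otimes>\<^bsub>?Q\<^esub> ?c (a # f)"
      using c Cons(1,2) by (simp add: cons[OF Cons(1,2)] Q.m_assoc)
    finally show ?case .
  qed
  have sp: "spans K ?Q (?c ` ?W)"
    using coset_spans[OF tensor_algebra_module ia tensor_algebra_spans]
    unfolding sym_algebra_def image_image .
  show "algebra K ?Q" by (rule algebra_of_commute[OF Q sp]) (use comm3 in auto)
  show "spans K ?Q ({\<one>\<^bsub>?Q\<^esub>} \<union> {sym_incl K M x \<otimes>\<^bsub>?Q\<^esub> y | x y. x \<in> carrier M \<and> y \<in> carrier ?Q})"
  proof (rule spans_mono[OF sp])
    show "?c ` ?W \<subseteq> {\<one>\<^bsub>?Q\<^esub>} \<union> {sym_incl K M x \<otimes>\<^bsub>?Q\<^esub> y | x y. x \<in> carrier M \<and> y \<in> carrier ?Q}"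
    proof
      fix z assume "z \<in> ?c ` ?W"
      then obtain f where f: "f \<in> ?W" "z = ?c f" by blast
      show "z \<in> {\<one>\<^bsub>?Q\<^esub>} \<union> {sym_incl K M x \<otimes>\<^bsub>?Q\<^esub> y | x y. x \<in> carrier M \<and> y \<in> carrier ?Q}"
      proof (cases f)
        case (Cons a g)
        then have "a \<in> carrier M" "?c g \<in> carrier ?Q" "z = sym_incl K M a \<otimes>\<^bsub>?Q\<^esub> ?c g"
          using f cl[of g] cons[of a g] by (simp_all add: sym_incl_def)
        then show ?thesis by blast
      qed (simp add: f one)
    qed
  qed (use linear_mapD(1)[OF sym_incl_linear] Q.m_closed Q.one_closed in blast)
qed

text \<open>Comes from the function on words that is one at the empty word and zero elsewhere. Both
  terms of a commutator are words of length two, so the commutator ideal is killed and the map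
  descends.\<close>

lemma sym_algebra_aug:
  "\<exists>\<alpha>. linear_map K (sym_algebra K M) (self_module K) \<alpha> \<and> \<alpha> \<one>\<^bsub>sym_algebra K M\<^esub> = \<one>\<^bsub>K\<^esub> \<and>
    (\<forall>x\<in>carrier M. \<alpha> (sym_incl K M x) = \<zero>\<^bsub>K\<^esub>) \<and>
    (\<forall>x\<in>carrier (sym_algebra K M). \<forall>y\<in>carrier (sym_algebra K M).
      \<alpha> (x \<otimes>\<^bsub>sym_algebra K M\<^esub> y) = \<alpha> x \<otimes>\<^bsub>K\<^esub> \<alpha> y)"
proof -
  let ?A = "tensor_algebra K M" and ?W = "lists (carrier M)" and ?I = "commutator_ideal K M"
  let ?Q = "sym_algebra K M" and ?K = "self_module K"
  note ia = ideal_submodule[OF tensor_algebra_assoc_algebra commutator_ideal_ideal]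
  have K: "algebra K ?K" by (rule self_module_algebra) (auto intro: M.R.cring_axioms)
  note K' = algebraD[OF K]
  have "multilinear K M ?K (\<lambda>f. if f = [] then \<one>\<^bsub>K\<^esub> else \<zero>\<^bsub>?K\<^esub>)"
    by (rule multilinear_const_Nil[OF _ multilinear_zero[OF K'(1)]]) simp
  from pure_tensor_ext[OF M K'(1) this]
  obtain \<beta> where \<beta>: "linear_map K ?A ?K \<beta>"
    "\<And>f. f \<in> ?W \<Longrightarrow> \<beta> (pure_tensor K M f) = (if f = [] then \<one>\<^bsub>K\<^esub> else \<zero>\<^bsub>K\<^esub>)"
    by (auto simp: lin_ext_def linear_map_tensor_algebra)
  have m: "\<beta> (x \<otimes>\<^bsub>?A\<^esub> y) = \<beta> x \<otimes>\<^bsub>?K\<^esub> \<beta> y" if "x \<in> carrier ?A" "y \<in> carrier ?A" for x y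
    by (rule multiplicative_of_span[OF tensor_algebra_assoc_algebra K'(4) \<beta>(1) tensor_algebra_spans _ that])
      (auto simp: \<beta>(2) tensor_algebra_mult)
  have "?I \<subseteq> {x \<in> carrier ?A. \<beta> x = \<zero>\<^bsub>?K\<^esub>}"
    unfolding commutator_ideal_def Let_def
  proof (rule A.genideal_minimal[OF kernel_ideal[OF tensor_algebra_assoc_algebra K'(4) \<beta>(1) m]], assumption, assumption)
    have "\<beta> (pure_tensor K M [x] \<otimes>\<^bsub>?A\<^esub> pure_tensor K M [y] \<ominus>\<^bsub>?A\<^esub>
      pure_tensor K M [y] \<otimes>\<^bsub>?A\<^esub> pure_tensor K M [x]) = \<zero>\<^bsub>?K\<^esub>"
      if "x \<in> carrier M" "y \<in> carrier M" for x y
      using that linear_map_minus[OF tensor_algebra_module K'(1) \<beta>(1), of "pure_tensor K M [x, y]" "pure_tensor K M [y, x]"]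
        minus_self[of ?K "\<zero>\<^bsub>?K\<^esub>"] K'(1)
      by (simp add: tensor_algebra_mult \<beta>(2) module_def)
    with commutators_closed
    show "{pure_tensor K M [x] \<otimes>\<^bsub>?A\<^esub> pure_tensor K M [y] \<ominus>\<^bsub>?A\<^esub>
      pure_tensor K M [y] \<otimes>\<^bsub>?A\<^esub> pure_tensor K M [x] | x y. x \<in> carrier M \<and> y \<in> carrier M}
      \<subseteq> {x \<in> carrier ?A. \<beta> x = \<zero>\<^bsub>?K\<^esub>}" by blast
  qed
  then have "lin_ext K ?Q ?K (\<lambda>x. ?I +>\<^bsub>?A\<^esub> x) (carrier ?A) \<beta>"
    unfolding sym_algebra_def by (intro coset_lin_ext[OF tensor_algebra_module ia K'(1) \<beta>(1)]) blast
  then obtain \<alpha> where \<alpha>: "linear_map K ?Q ?K \<alpha>" "\<And>x. x \<in> carrier ?A \<Longrightarrow> \<alpha> (?I +>\<^bsub>?A\<^esub> x) = \<beta> x"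
    by (auto simp: lin_ext_def)
  have "\<alpha> (X \<otimes>\<^bsub>?Q\<^esub> Y) = \<alpha> X \<otimes>\<^bsub>K\<^esub> \<alpha> Y" if XY: "X \<in> carrier ?Q" "Y \<in> carrier ?Q" for X Y
  proof -
    obtain x y where x: "x \<in> carrier ?A" "X = ?I +>\<^bsub>?A\<^esub> x" and y: "y \<in> carrier ?A" "Y = ?I +>\<^bsub>?A\<^esub> y"
      using XY unfolding sym_algebra_def quot_module_simps(1) by blast
    have "x \<otimes>\<^bsub>?A\<^esub> y \<in> carrier ?A" using x y by (intro A.m_closed)
    then show ?thesis
      unfolding x(2) y(2) using x(1) y(1) m[OF x(1) y(1)]
      by (simp only: \<alpha>(2) quot_algebra(2)[OF tensor_algebra_assoc_algebra commutator_ideal_ideal, folded sym_algebra_def]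
          self_module_fields)
  qed
  moreover have "\<alpha> \<one>\<^bsub>?Q\<^esub> = \<one>\<^bsub>K\<^esub>"
    unfolding sym_algebra_def quot_module_simps(5) by (simp add: \<alpha>(2) \<beta>(2))
  moreover have "\<forall>x\<in>carrier M. \<alpha> (sym_incl K M x) = \<zero>\<^bsub>K\<^esub>"
    unfolding sym_incl_def by (simp add: \<alpha>(2) \<beta>(2))
  ultimately show ?thesis using \<alpha>(1) by blast
qed

end

text \<open>For functions that peel off the first letter, such as the values of the derivations. No
  condition ties \<open>c\<close> to \<open>\<phi>\<close>, since a word with a variable letter is
  never empty.\<close>

lemma multilinear_case:
  assumes c: "c \<in> carrier P" and l: "\<And>f. f \<in> lists (carrier M) \<Longrightarrow> linear_map K M P (\<lambda>a. \<phi> a f)"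
    and m: "\<And>a. a \<in> carrier M \<Longrightarrow> multilinear K M P (\<phi> a)"
  shows "multilinear K M P (\<lambda>f. case f of [] \<Rightarrow> c | a # f \<Rightarrow> \<phi> a f)"
proof (rule multilinearI)
  fix f assume f: "f \<in> lists (carrier M)"
  then show "(case f of [] \<Rightarrow> c | a # f \<Rightarrow> \<phi> a f) \<in> carrier P"
    using c by (cases f) (simp_all add: multilinearD(1)[OF m])
  fix g assume "g \<in> lists (carrier M)"
  with f show "linear_map K M P (\<lambda>x. case f @ x # g of [] \<Rightarrow> c | a # f \<Rightarrow> \<phi> a f)"
    by (cases f) (simp_all add: l multilinearD(2)[OF m])
qed

lemma multilinear_add:
  assumes P: "module K P" and \<phi>: "multilinear K M P \<phi>" and \<psi>: "multilinear K M P \<psi>"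
  shows "multilinear K M P (\<lambda>f. \<phi> f \<oplus>\<^bsub>P\<^esub> \<psi> f)"
proof (rule multilinearI)
  interpret P: module K P by fact
  show "\<phi> f \<oplus>\<^bsub>P\<^esub> \<psi> f \<in> carrier P" if "f \<in> lists (carrier M)" for f
    using that by (simp add: multilinearD(1)[OF \<phi>] multilinearD(1)[OF \<psi>])
qed (intro linear_map_add P multilinearD(2)[OF \<phi>] multilinearD(2)[OF \<psi>])

lemma bilinear_map_eq:
  assumes M: "module K M" "spans K M G" and N: "module K N" "spans K N H" and P: "module K P"
    and b: "bilinear_map K M N P b" and b': "bilinear_map K M N P b'"
    and eq: "\<And>x y. x \<in> G \<Longrightarrow> y \<in> H \<Longrightarrow> b x y = b' x y" and x: "x \<in> carrier M" and y: "y \<in> carrier N"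
  shows "b x y = b' x y"
proof (rule linear_map_eq[OF M(1) P M(2) bilinear_mapD(2)[OF b y] bilinear_mapD(2)[OF b' y] _ x])
  fix z assume z: "z \<in> G"
  have z': "z \<in> carrier M" by (rule span_closed[OF M(2) z])
  show "b z y = b' z y"
    by (rule linear_map_eq[OF N(1) P N(2) bilinear_mapD(1)[OF b z'] bilinear_mapD(1)[OF b' z'] eq[OF z] y])
qed

subsection \<open>The shuffle algebra\<close>

lemma self_module_minus [simp]:
  "\<ominus>\<^bsub>self_module R\<^esub> x = \<ominus>\<^bsub>R\<^esub> x" "x \<ominus>\<^bsub>self_module R\<^esub> y = x \<ominus>\<^bsub>R\<^esub> y"
  by (simp_all add: a_minus_def a_inv_def m_inv_def)

context comm_diff_ring
begin

lemma d_closed' [simp]: "x \<in> carrier R \<Longrightarrow> d x \<in> carrier R"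
  using d_closed by blast

lemma d_zero [simp]: "d \<zero> = \<zero>"
  using d_add[of \<zero> \<zero>] by (metis add.r_cancel_one' d_closed' r_zero zero_closed)

lemma d_one [simp]: "d \<one> = \<zero>"
  using d_mult[of \<one> \<one>] by (metis add.r_cancel_one' d_closed' l_one one_closed r_one)

lemma d_neg: "x \<in> carrier R \<Longrightarrow> d (\<ominus> x) = \<ominus> d x"
  using d_add[of "\<ominus> x" x] by (simp add: l_neg minus_equality)

lemma constants_fields [simp]:
  "carrier (constants R d) = {c \<in> carrier R. d c = \<zero>}" "monoid.mult (constants R d) = monoid.mult R"
  "one (constants R d) = one R" "zero (constants R d) = zero R" "add (constants R d) = add R"
  by (simp_all add: constants_def)

lemma constants_cring: "cring (constants R d)"
proof -
  have "\<exists>y. y \<in> carrier R \<and> d y = \<zero> \<and> x \<oplus> y = \<zero>" if "x \<in> carrier R" "d x = \<zero>" for x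
    using that by (intro exI[of _ "\<ominus> x"]) (simp add: d_neg r_neg)
  then have "abelian_group (constants R d)"
    by (intro abelian_groupI) (simp_all add: d_add a_ac Bex_def conj_assoc)
  moreover have "Group.comm_monoid (constants R d)"
    by (rule comm_monoidI) (simp_all add: m_ac d_mult)
  ultimately show ?thesis
    by (rule cringI) (simp add: l_distr)
qed

lemma self_algebra: "algebra (constants R d) (self_module R)"
  by (rule self_module_algebra[OF constants_cring cring_axioms]) auto

lemma d_linear: "linear_map (constants R d) (self_module R) (self_module R) d"
  by (rule linear_mapI) (simp_all add: d_add d_mult)

end

context quasi_integration
begin

section \<open>The decomposition given by the quasi-integration\<close>

lemmas C_cring = constants_cring
lemmas RR_algebra = self_algebra
lemmas RR' = algebraD[OF RR_algebra]

lemma Q_closed [simp]: "x \<in> carrier R \<Longrightarrow> Q x \<in> carrier R"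
  using linear_mapD(1)[OF Q_linear, of x] by simp

lemma RT_carrier: "carrier RT = {r \<in> carrier R. Q r = \<zero>}"
  by (simp add: RT_def)

lemma RT_closed [simp]: "a \<in> carrier RT \<Longrightarrow> a \<in> carrier R"
  unfolding RT_carrier by blast

lemma Q_RT [simp]: "a \<in> carrier RT \<Longrightarrow> Q a = \<zero>"
  unfolding RT_carrier by blast

lemma RT_memI: "r \<in> carrier R \<Longrightarrow> Q r = \<zero> \<Longrightarrow> r \<in> carrier RT"
  unfolding RT_carrier by blast

lemma RT_module: "module C RT"
proof -
  have "submodule {x \<in> carrier RR. Q x = \<zero>\<^bsub>RR\<^esub>} C RR"
    by (rule kernel_submodule[OF RR'(1) RR'(1) Q_linear])
  from submodule.submodule_is_module[OF this RR'(1)] show ?thesis by (simp only: RT_def self_module_fields)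
qed

lemma RT_fields [simp]:
  "add RT = add R" "zero RT = zero R" "smult RT = monoid.mult R"
  unfolding RT_def by simp_all

lemma RT_incl: "linear_map C RT RR (\<lambda>x. x)"
  by (rule linear_mapI) simp_all

lemma linear_map_RT: "linear_map C L RR f \<Longrightarrow> (\<And>x. x \<in> carrier L \<Longrightarrow> Q (f x) = \<zero>) \<Longrightarrow> linear_map C L RT f"
  by (rule linear_mapI) (use linear_mapD[of C L RR f] in \<open>auto intro: RT_memI\<close>)

lemma linear_map_RR: "linear_map C L RT f \<Longrightarrow> linear_map C L RR f"
  by (rule linear_map_compose[OF RT_incl])

lemma Q_lin: "linear_map C L RR f \<Longrightarrow> linear_map C L RR (\<lambda>x. Q (f x))"
  by (rule linear_map_compose[OF Q_linear])

lemma d_lin: "linear_map C L RR f \<Longrightarrow> linear_map C L RR (\<lambda>x. d (f x))"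
  by (rule linear_map_compose[OF d_linear])

lemma mult_lin: "r \<in> carrier R \<Longrightarrow> linear_map C L RR f \<Longrightarrow> linear_map C L RR (\<lambda>x. r \<otimes> f x)"
  "r \<in> carrier R \<Longrightarrow> linear_map C L RR f \<Longrightarrow> linear_map C L RR (\<lambda>x. f x \<otimes> r)"
  using bilinear_map_compose_right[OF RR'(3), of r L f] bilinear_map_compose_left[OF RR'(3), of r L f]
  by simp_all

text \<open>This is the component of \<open>r\<close> in the kernel of \<open>Q\<close>,
  complementary to the image of \<open>d\<close>; it is killed by \<open>Q\<close> because Q d Q =
  Q.\<close>

lemma rest_closed [simp]: "r \<in> carrier R \<Longrightarrow> r \<ominus> d (Q r) \<in> carrier RT"
proof -
  assume r: "r \<in> carrier R"
  then have "Q (r \<ominus> d (Q r)) = Q r \<ominus>\<^bsub>RR\<^esub> Q (d (Q r))"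
    using linear_map_minus[OF RR'(1) RR'(1) Q_linear, of r "d (Q r)"] by simp
  then have "Q (r \<ominus> d (Q r)) = Q r \<ominus> Q r"
    using r by (simp add: Q_d_Q)
  then show ?thesis using r minus_self[of R "Q r"] abelian_group_axioms
    by (intro RT_memI) simp_all
qed

lemma rest_lin: "linear_map C L RR f \<Longrightarrow> linear_map C L RT (\<lambda>x. f x \<ominus> d (Q (f x)))"
proof (rule linear_map_RT)
  assume f: "linear_map C L RR f"
  have "linear_map C L RR (\<lambda>x. f x \<ominus>\<^bsub>RR\<^esub> d (Q (f x)))"
    by (intro linear_map_sub RR'(1) d_lin Q_lin f)
  then show "linear_map C L RR (\<lambda>x. f x \<ominus> d (Q (f x)))"
    by simp
  fix x assume "x \<in> carrier L"
  then have "f x \<in> carrier R" using linear_mapD(1)[OF f] by simp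
  from rest_closed[OF this] show "Q (f x \<ominus> d (Q (f x))) = \<zero>" by (rule Q_RT)
qed

section \<open>Words and their shuffle product\<close>

lemma one_TA [simp]: "one TA = word []"
  by (simp add: TA_def word_def RT_module)

lemma TA_module: "module C TA"
  unfolding TA_def by (rule tensor_algebra_module[OF RT_module])

lemma TA_assoc: "assoc_algebra C TA"
  unfolding TA_def by (rule tensor_algebra_assoc_algebra[OF RT_module])

lemma TT_fields [simp]:
  "carrier TT = carrier TA" "add TT = add TA" "zero TT = zero TA" "smult TT = smult TA"
  "one TT = word []" "monoid.mult TT = shuffle"
  by (simp_all add: TT_def)

lemma TT_module: "module C TT"
  by (rule module_cong[OF TA_module]) simp_all

lemma linear_map_TT: "linear_map C TT = linear_map C TA" "linear_map C L TT = linear_map C L TA"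
  by (rule linear_map_module_cong; simp)+

lemma word_multilinear: "multilinear C RT TA word"
  using pure_tensor_multilinear[OF RT_module]
  by (simp add: multilinear_def word_def[abs_def] TA_def RT_module linear_map_tensor_algebra)

lemma word_closed [simp]: "f \<in> words \<Longrightarrow> word f \<in> carrier TA"
  by (rule multilinearD(1)[OF word_multilinear])

lemma word_spans: "spans C TA (word ` words)"
  using tensor_algebra_spans[OF RT_module] by (simp add: TA_def word_def)

lemma word_spans': "spans C TT (word ` words)"
  by (subst spans_cong[of TT TA]) (simp_all add: word_spans)

lemma word_ext: "module C P \<Longrightarrow> multilinear C RT P \<phi> \<Longrightarrow> lin_ext C TT P word words \<phi>"
  using pure_tensor_ext[OF RT_module, of P \<phi>]
  by (simp add: linear_map_TT lin_ext_def word_def linear_map_tensor_algebra TA_def RT_module)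

lemma TA_mult: "f \<in> words \<Longrightarrow> g \<in> words \<Longrightarrow> word f \<otimes>\<^bsub>TA\<^esub> word g = word (f @ g)"
  unfolding TA_def word_def by (rule tensor_algebra_mult[OF RT_module])

lemma word_lin:
  "g \<in> words \<Longrightarrow> linear_map C L RT f \<Longrightarrow> linear_map C L TA (\<lambda>x. word (f x # g))"
  by (rule linear_map_compose[OF multilinear_head[OF word_multilinear]])

text \<open>Prefixing a letter, available on all of \<open>TA\<close> and not only on words, so that
  the shuffle recursion can be applied to sums of words.\<close>

definition "letter a t = word [a] \<otimes>\<^bsub>TA\<^esub> t"

lemma letter_linear: "a \<in> carrier RT \<Longrightarrow> linear_map C TA TA (letter a)"
  unfolding letter_def[abs_def] by (rule bilinear_mapD(1)[OF assoc_algebraD(3)[OF TA_assoc]]) simp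

lemma letter_lin: "t \<in> carrier TA \<Longrightarrow> linear_map C L RT f \<Longrightarrow> linear_map C L TA (\<lambda>x. letter (f x) t)"
  unfolding letter_def
  by (rule bilinear_map_compose_left[OF assoc_algebraD(3)[OF TA_assoc]]) (simp_all add: word_lin)

lemma letter_word: "a \<in> carrier RT \<Longrightarrow> f \<in> words \<Longrightarrow> letter a (word f) = word (a # f)"
  by (simp add: letter_def TA_mult)

interpretation TA: module C TA by (rule TA_module)

definition "shuf_sum f g = msum TA word (shuf f g)"

lemma shuf_sum_closed [simp]: "shuf_sum f g \<in> carrier TA"
  unfolding shuf_sum_def by (rule TA.M.msum_closed)

lemma shuf_sum_Nil [simp]: "f \<in> words \<Longrightarrow> shuf_sum [] f = word f" "f \<in> words \<Longrightarrow> shuf_sum f [] = word f"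
  by (simp_all add: shuf_sum_def)

lemma shuf_sum_Cons:
  assumes a: "a \<in> carrier RT" "f \<in> words" and b: "b \<in> carrier RT" "g \<in> words"
  shows "shuf_sum (a # f) (b # g) = letter a (shuf_sum f (b # g)) \<oplus>\<^bsub>TA\<^esub> letter b (shuf_sum (a # f) g)"
proof -
  have 1: "letter c (shuf_sum u v) = msum TA (\<lambda>w. word (c # w)) (shuf u v)"
    if "c \<in> carrier RT" "u \<in> words" "v \<in> words" for c u v
  proof -
    note w = shuf_in_lists[OF that(2,3)]
    have "letter c (shuf_sum u v) = msum TA (\<lambda>w. letter c (word w)) (shuf u v)"
      unfolding shuf_sum_def
      by (rule linear_map_msum[OF TA_module TA_module letter_linear[OF that(1)]]) (rule word_closed[OF w])
    also have "\<dots> = msum TA (\<lambda>w. word (c # w)) (shuf u v)"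
      by (rule TA.M.msum_cong) (rule letter_word[OF that(1) w])
    finally show ?thesis .
  qed
  show ?thesis using 1[of a f "b # g"] 1[of b "a # f" g] a b
    by (simp add: shuf_sum_def)
qed

lemma shuf_sum_commute: "shuf_sum f g = shuf_sum g f"
  by (simp add: shuf_sum_def shuf_commute)

text \<open>If the variable letter comes first, one summand of the shuffle recursion is linear
  through \<open>letter\<close> and in the other the second word is shorter. Otherwise both summands
  are shorter instances, whence the induction on total length.\<close>

lemma shuf_sum_linear:
  "f \<in> words \<Longrightarrow> f' \<in> words \<Longrightarrow> g \<in> words \<Longrightarrow> linear_map C RT TA (\<lambda>x. shuf_sum (f @ x # f') g)"
proof (induction "length f + length g" arbitrary: f g rule: less_induct)
  case less
  show ?case
  proof (cases g)
    case Nil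
    have "linear_map C RT TA (\<lambda>x. word (f @ x # f'))"
      using less.prems by (intro multilinearD(2)[OF word_multilinear])
    then show ?thesis
      by (rule linear_map_cong[OF RT_module]) (use less.prems in \<open>simp add: Nil\<close>)
  next
    case g: (Cons b g')
    show ?thesis
    proof (cases f)
      case Nil
      have "linear_map C RT TA (\<lambda>x. letter x (shuf_sum f' g) \<oplus>\<^bsub>TA\<^esub> letter b (shuf_sum ([] @ x # f') g'))"
        using less.prems g Nil
        by (intro linear_map_add TA_module letter_lin linear_map_id shuf_sum_closed
            linear_map_compose[OF letter_linear] less.hyps) simp_all
      then show ?thesis
        by (rule linear_map_cong[OF RT_module]) (use less.prems in \<open>simp add: Nil g shuf_sum_Cons\<close>)
    next
      case (Cons a f'')
      have "linear_map C RT TA (\<lambda>x. letter a (shuf_sum (f'' @ x # f') g) \<oplus>\<^bsub>TA\<^esub> letter b (shuf_sum (f @ x # f') g'))"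
        using less.prems g Cons
        by (intro linear_map_add TA_module linear_map_compose[OF letter_linear] less.hyps) simp_all
      then show ?thesis
        by (rule linear_map_cong[OF RT_module]) (use less.prems in \<open>simp add: Cons g shuf_sum_Cons\<close>)
    qed
  qed
qed

lemma shuf_sum_multilinear: "g \<in> words \<Longrightarrow> multilinear C RT TA (\<lambda>f. shuf_sum f g)"
  by (rule multilinearI) (simp_all add: shuf_sum_linear)

lemma shuffle_spec:
  "bilinear_map C TA TA TA shuffle \<and>
  (\<forall>f\<in>words. shuffle (word []) (word f) = word f \<and> shuffle (word f) (word []) = word f) \<and>
  (\<forall>a\<in>carrier RT. \<forall>f\<in>words. \<forall>b\<in>carrier RT. \<forall>g\<in>words.
    shuffle (word (a # f)) (word (b # g)) =
      word [a] \<otimes>\<^bsub>TA\<^esub> shuffle (word f) (word (b # g)) \<oplus>\<^bsub>TA\<^esub> word [b] \<otimes>\<^bsub>TA\<^esub> shuffle (word (a # f)) (word g))"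
proof -
  have r: "multilinear C RT TA (shuf_sum f)" if "f \<in> words" for f
    using shuf_sum_multilinear[OF that] unfolding shuf_sum_commute[of _ f] .
  obtain p where p: "bilinear_map C TA TA TA p"
    "\<And>f g. f \<in> words \<Longrightarrow> g \<in> words \<Longrightarrow> p (word f) (word g) = shuf_sum f g"
    using words_bilinear_ext[OF RT_module TA_module shuf_sum_multilinear r]
    by (auto simp: bilinear_map_def linear_map_tensor_algebra TA_def word_def RT_module)
  have "\<exists>p. bilinear_map C TA TA TA p \<and>
  (\<forall>f\<in>words. p (word []) (word f) = word f \<and> p (word f) (word []) = word f) \<and>
  (\<forall>a\<in>carrier RT. \<forall>f\<in>words. \<forall>b\<in>carrier RT. \<forall>g\<in>words.
    p (word (a # f)) (word (b # g)) =
      word [a] \<otimes>\<^bsub>TA\<^esub> p (word f) (word (b # g)) \<oplus>\<^bsub>TA\<^esub> word [b] \<otimes>\<^bsub>TA\<^esub> p (word (a # f)) (word g))"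
    using p(1) by (intro exI[of _ p]) (simp add: p(2) shuf_sum_Cons letter_def)
  from someI_ex[OF this, folded shuffle_def] show ?thesis .
qed

lemma shuffle_bilinear: "bilinear_map C TA TA TA shuffle"
  using shuffle_spec by blast

lemma shuffle_word: "f \<in> words \<Longrightarrow> g \<in> words \<Longrightarrow> shuffle (word f) (word g) = shuf_sum f g"
proof (induction f g rule: shuf.induct)
  case (1 g)
  then show ?case using shuffle_spec by simp
next
  case (2 a f)
  then show ?case using shuffle_spec by simp
next
  case (3 a f b g)
  then show ?case using shuffle_spec by (simp add: shuf_sum_Cons letter_def)
qed

lemma shuffle_word_sum:
  assumes f: "f \<in> words" and g: "\<And>w. w \<in># A \<Longrightarrow> w \<in> words"
  shows "shuffle (word f) (msum TA word A) = msum TA word (\<Sum>w\<in>#A. shuf f w)"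
proof -
  have "shuffle (word f) (msum TA word A) = msum TA (\<lambda>w. shuffle (word f) (word w)) A"
    by (rule linear_map_msum[OF TA_module TA_module bilinear_mapD(1)[OF shuffle_bilinear]])
      (simp_all add: f g)
  also have "\<dots> = msum TA (\<lambda>w. msum TA word (shuf f w)) A"
    by (rule TA.M.msum_cong) (simp add: shuffle_word f g shuf_sum_def)
  finally show ?thesis by (simp add: TA.M.msum_sum)
qed

lemma TT_algebra: "algebra C TT"
proof (rule algebra_of_commute[OF _ word_spans'])
  have b: "bilinear_map C TT TT TT (\<lambda>x y. x \<otimes>\<^bsub>TT\<^esub> y)"
    using shuffle_bilinear by (simp add: bilinear_map_def linear_map_TT)
  have c: "shuffle (word f) (word g) = shuffle (word g) (word f)" if "f \<in> words" "g \<in> words" for f g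
    using that by (simp add: shuffle_word shuf_sum_commute)
  show "assoc_algebra C TT"
  proof (rule assoc_algebraI[OF TT_module b word_spans'])
    fix x y z assume "x \<in> word ` words" "y \<in> word ` words" "z \<in> word ` words"
    then obtain f g h where w: "x = word f" "y = word g" "z = word h" "f \<in> words" "g \<in> words" "h \<in> words"
      by blast
    have cl: "w \<in> words" if "w \<in># shuf u v" "u \<in> words" "v \<in> words" for u v w
      using shuf_in_lists that by blast
    \<comment> \<open>Commutativity brings \<open>word h\<close> to the left, so that expansion in
      the right argument suffices for both bracketings.\<close>
    have "shuffle (shuffle (word f) (word g)) (word h) = shuffle (word h) (msum TA word (shuf f g))"
    proof -
      have "shuffle t (word h) = shuffle (word h) t" if "t \<in> carrier TA" for t
        by (rule linear_map_eq[OF TA_module TA_module word_spans bilinear_mapD(2)[OF shuffle_bilinear]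
              bilinear_mapD(1)[OF shuffle_bilinear] _ that]) (use w c in auto)
      then show ?thesis using w by (simp add: shuffle_word shuf_sum_def)
    qed
    also have "\<dots> = msum TA word (\<Sum>w\<in>#shuf f g. shuf w h)"
      using shuffle_word_sum[OF w(6), of "shuf f g"] w cl by (simp add: shuf_commute[of h])
    also have "\<dots> = msum TA word (\<Sum>w\<in>#shuf g h. shuf f w)" by (simp add: shuf_assoc)
    also have "\<dots> = shuffle (word f) (shuffle (word g) (word h))"
      using shuffle_word_sum[OF w(4), of "shuf g h"] w cl by (simp add: shuffle_word shuf_sum_def)
    finally show "x \<otimes>\<^bsub>TT\<^esub> y \<otimes>\<^bsub>TT\<^esub> z = x \<otimes>\<^bsub>TT\<^esub> (y \<otimes>\<^bsub>TT\<^esub> z)" using w by simp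
  next
    fix x assume "x \<in> word ` words"
    then obtain f where w: "x = word f" "f \<in> words" by blast
    then show "\<one>\<^bsub>TT\<^esub> \<otimes>\<^bsub>TT\<^esub> x = x" "x \<otimes>\<^bsub>TT\<^esub> \<one>\<^bsub>TT\<^esub> = x"
      by (simp_all add: shuffle_word)
  qed simp
  fix x y assume "x \<in> word ` words" "y \<in> word ` words"
  then show "x \<otimes>\<^bsub>TT\<^esub> y = y \<otimes>\<^bsub>TT\<^esub> x"
    by (elim imageE) (simp add: c)
qed

end

lemma bilinear_map_add:
  assumes P: "module K P" and b: "bilinear_map K M N P b" and b': "bilinear_map K M N P b'"
  shows "bilinear_map K M N P (\<lambda>x y. b x y \<oplus>\<^bsub>P\<^esub> b' x y)"
  using linear_map_add[OF P bilinear_mapD(1)[OF b] bilinear_mapD(1)[OF b']]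
    linear_map_add[OF P bilinear_mapD(2)[OF b] bilinear_mapD(2)[OF b']]
  by (simp add: bilinear_map_def)

lemma bilinear_map_post:
  "bilinear_map K M N P b \<Longrightarrow> linear_map K P P' l \<Longrightarrow> bilinear_map K M N P' (\<lambda>x y. l (b x y))"
  unfolding bilinear_map_def by (auto intro: linear_map_compose)

context quasi_integration
begin

subsection \<open>The ring with shuffle product\<close>

lemma IDRQ_algebra: "algebra C IDRQ"
  unfolding IDRQ_def by (rule alg_tensor_algebra[OF RR_algebra TT_algebra])

lemmas IDRQ' = algebraD[OF IDRQ_algebra]

lemma tensQ_bilinear: "bilinear_map C RR TA IDRQ tensQ"
  using tens_bilinear[OF RR'(1) TT_module]
  by (simp add: bilinear_map_def IDRQ_def tensQ_def[abs_def] linear_map_TT)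

lemma tensQ_closed [simp]: "r \<in> carrier R \<Longrightarrow> t \<in> carrier TA \<Longrightarrow> tensQ r t \<in> carrier IDRQ"
  using bilinear_map_closed[OF tensQ_bilinear, of r t] by simp

lemma tensQ_lin1: "t \<in> carrier TA \<Longrightarrow> linear_map C L RR f \<Longrightarrow> linear_map C L IDRQ (\<lambda>x. tensQ (f x) t)"
  by (rule bilinear_map_compose_left[OF tensQ_bilinear])

lemma tensQ_lin2: "r \<in> carrier R \<Longrightarrow> linear_map C L TA f \<Longrightarrow> linear_map C L IDRQ (\<lambda>x. tensQ r (f x))"
  by (rule bilinear_map_compose_right[OF tensQ_bilinear]) simp_all

lemma tensQ_spans: "spans C IDRQ {tensQ r (word f) | r f. r \<in> carrier R \<and> f \<in> words}"
proof -
  have "spans C (tensor_prod C RR TT) {tens C RR TT x y | x y. x \<in> carrier RR \<and> y \<in> word ` words}"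
    by (rule tens_spans[OF RR'(1) spans_carrier TT_module word_spans'])
  moreover have "{tens C RR TT x y | x y. x \<in> carrier RR \<and> y \<in> word ` words} =
      {tensQ r (word f) | r f. r \<in> carrier R \<and> f \<in> words}"
    by (auto simp: tensQ_def)
  ultimately show ?thesis
    unfolding IDRQ_def by (subst spans_cong[of _ "tensor_prod C RR TT"]) simp_all
qed

lemma tensQ_ext:
  assumes P: "module C P"
    and l: "\<And>f. f \<in> words \<Longrightarrow> linear_map C RR P (\<lambda>r. b r f)"
    and m: "\<And>r. r \<in> carrier R \<Longrightarrow> multilinear C RT P (b r)"
  shows "\<exists>L. linear_map C IDRQ P L \<and> (\<forall>r\<in>carrier R. \<forall>f\<in>words. L (tensQ r (word f)) = b r f)"
proof -
  have "\<exists>L. linear_map C (tensor_prod C RR TT) P L \<and>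
    (\<forall>r\<in>carrier R. \<forall>f\<in>words. L (tens C RR TT r (word f)) = b r f)"
    by (rule tensor_ext[OF RR'(1) _ TT_module word_spans' P])
      (simp_all add: spans_carrier[of C RR, simplified] lin_ext_linear l word_ext[OF P m])
  then show ?thesis by (simp add: IDRQ_def tensQ_def)
qed

lemma tensQ_mult:
  "\<lbrakk>r \<in> carrier R; s \<in> carrier TA; r' \<in> carrier R; s' \<in> carrier TA\<rbrakk> \<Longrightarrow>
    tensQ r s \<otimes>\<^bsub>IDRQ\<^esub> tensQ r' s' = tensQ (r \<otimes> r') (shuffle s s')"
  using alg_tensor_mult[OF RR_algebra TT_algebra, of r s r' s'] by (simp add: IDRQ_def tensQ_def)

lemma one_IDRQ: "\<one>\<^bsub>IDRQ\<^esub> = tensQ \<one> (word [])"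
  by (simp add: IDRQ_def tensQ_def)

interpretation S: algebra C IDRQ by (rule IDRQ_algebra)

section \<open>Derivation\<close>

lemma derivQ_spec: "linear_map C IDRQ IDRQ derivQ \<and>
  (\<forall>f0\<in>carrier R. derivQ (tensQ f0 (word [])) = tensQ (d f0) (word [])) \<and>
  (\<forall>f0\<in>carrier R. \<forall>f1\<in>carrier RT. \<forall>f\<in>words.
    derivQ (tensQ f0 (word (f1 # f))) = tensQ (d f0) (word (f1 # f)) \<oplus>\<^bsub>IDRQ\<^esub> tensQ (f0 \<otimes> f1) (word f))"
proof -
  \<comment> \<open>With the value zero for the missing letter of the empty word, the two clauses
    become one formula that is linear in \<open>r\<close> and in each letter.\<close>
  let ?b = "\<lambda>r f. tensQ (d r) (word f) \<oplus>\<^bsub>IDRQ\<^esub> (case f of [] \<Rightarrow> \<zero>\<^bsub>IDRQ\<^esub> | a # f \<Rightarrow> tensQ (r \<otimes> a) (word f))"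
  have "\<exists>L. linear_map C IDRQ IDRQ L \<and> (\<forall>r\<in>carrier R. \<forall>f\<in>words. L (tensQ r (word f)) = ?b r f)"
  proof (rule tensQ_ext[OF IDRQ'(1)])
    fix f assume f: "f \<in> words"
    show "linear_map C RR IDRQ (\<lambda>r. ?b r f)"
    proof (cases f)
      case Nil
      then show ?thesis
        using f by (simp, intro linear_map_add IDRQ'(1) tensQ_lin1 linear_map_const_zero d_lin linear_map_id) simp
    next
      case (Cons a g)
      then show ?thesis
        using f by (simp, intro linear_map_add IDRQ'(1) tensQ_lin1 mult_lin d_lin linear_map_id) simp_all
    qed
  next
    fix r assume r: "r \<in> carrier R"
    show "multilinear C RT IDRQ (?b r)"
      by (intro multilinear_add IDRQ'(1) multilinear_case S.M.zero_closed
          tensQ_lin1 tensQ_lin2 multilinear_compose[OF word_multilinear] mult_lin linear_map_RR linear_map_id)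
        (simp_all add: r)
  qed
  then obtain L where L: "linear_map C IDRQ IDRQ L"
    "\<And>r f. r \<in> carrier R \<Longrightarrow> f \<in> words \<Longrightarrow> L (tensQ r (word f)) = ?b r f" by blast
  then have "\<exists>D. linear_map C IDRQ IDRQ D \<and>
    (\<forall>f0\<in>carrier R. D (tensQ f0 (word [])) = tensQ (d f0) (word [])) \<and>
    (\<forall>f0\<in>carrier R. \<forall>f1\<in>carrier RT. \<forall>f\<in>words.
      D (tensQ f0 (word (f1 # f))) = tensQ (d f0) (word (f1 # f)) \<oplus>\<^bsub>IDRQ\<^esub> tensQ (f0 \<otimes> f1) (word f))"
    by (intro exI[of _ L]) simp
  from someI_ex[OF this, folded derivQ_def] show ?thesis .
qed

lemma derivQ_linear: "linear_map C IDRQ IDRQ derivQ"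
  using derivQ_spec by blast

lemma derivQ_closed [simp]: "x \<in> carrier IDRQ \<Longrightarrow> derivQ x \<in> carrier IDRQ"
  by (rule linear_mapD(1)[OF derivQ_linear])

lemma derivQ_Nil [simp]: "r \<in> carrier R \<Longrightarrow> derivQ (tensQ r (word [])) = tensQ (d r) (word [])"
  using derivQ_spec by blast

lemma derivQ_Cons [simp]:
  "r \<in> carrier R \<Longrightarrow> a \<in> carrier RT \<Longrightarrow> f \<in> words \<Longrightarrow>
    derivQ (tensQ r (word (a # f))) = tensQ (d r) (word (a # f)) \<oplus>\<^bsub>IDRQ\<^esub> tensQ (r \<otimes> a) (word f)"
  using derivQ_spec by blast

text \<open>The product of two words is a sum of words; allowing an arbitrary tail \<open>t\<close>
  lets the rule act on each half of the shuffle recursion as a whole.\<close>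

lemma derivQ_letter:
  assumes r: "r \<in> carrier R" and a: "a \<in> carrier RT" and t: "t \<in> carrier TA"
  shows "derivQ (tensQ r (letter a t)) = tensQ (d r) (letter a t) \<oplus>\<^bsub>IDRQ\<^esub> tensQ (r \<otimes> a) t"
proof (rule linear_map_eq[OF TA_module IDRQ'(1) word_spans _ _ _ t])
  show "linear_map C TA IDRQ (\<lambda>t. derivQ (tensQ r (letter a t)))"
    by (intro linear_map_compose[OF derivQ_linear] tensQ_lin2 letter_linear r a)
  show "linear_map C TA IDRQ (\<lambda>t. tensQ (d r) (letter a t) \<oplus>\<^bsub>IDRQ\<^esub> tensQ (r \<otimes> a) t)"
    by (intro linear_map_add IDRQ'(1) tensQ_lin2 letter_linear linear_map_id a) (simp_all add: r a)
qed (auto simp: r a letter_word)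

section \<open>Integration\<close>

text \<open>The recursive call changes the coefficient to \<open>Q r \<otimes> a\<close>, so the
  recursion over the word has to produce a function of the coefficient.\<close>

definition iQ_word :: "'a \<Rightarrow> 'a list \<Rightarrow> ('a \<times> ('a list \<Rightarrow> 'a) set \<Rightarrow> 'a) set" where
  "iQ_word r f = rec_list
    (\<lambda>r. tensQ (Q r) (word []) \<oplus>\<^bsub>IDRQ\<^esub> tensQ \<one> (word [r \<ominus> d (Q r)]))
    (\<lambda>a f rec r. tensQ (Q r) (word (a # f)) \<ominus>\<^bsub>IDRQ\<^esub> rec (Q r \<otimes> a)
      \<oplus>\<^bsub>IDRQ\<^esub> tensQ \<one> (word ((r \<ominus> d (Q r)) # a # f))) f r"

lemma iQ_word_simps [simp]:
  "iQ_word r [] = tensQ (Q r) (word []) \<oplus>\<^bsub>IDRQ\<^esub> tensQ \<one> (word [r \<ominus> d (Q r)])"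
  "iQ_word r (a # f) = tensQ (Q r) (word (a # f)) \<ominus>\<^bsub>IDRQ\<^esub> iQ_word (Q r \<otimes> a) f
      \<oplus>\<^bsub>IDRQ\<^esub> tensQ \<one> (word ((r \<ominus> d (Q r)) # a # f))"
  by (simp_all add: iQ_word_def)

lemma iQ_word_linear: "f \<in> words \<Longrightarrow> linear_map C RR IDRQ (\<lambda>r. iQ_word r f)"
proof (induction f)
  case Nil
  show ?case
    by (simp, intro linear_map_add IDRQ'(1) tensQ_lin1 tensQ_lin2 word_lin rest_lin Q_lin linear_map_id) simp_all
next
  case (Cons a f)
  then have IH: "linear_map C RR IDRQ (\<lambda>r. iQ_word r f)" by simp
  have "linear_map C RR IDRQ (\<lambda>r. iQ_word (Q r \<otimes> a) f)"
    using Cons(2) by (intro linear_map_compose[OF IH] mult_lin Q_lin linear_map_id) simp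
  then show ?case
    using Cons(2) by (simp, intro linear_map_add linear_map_sub IDRQ'(1) tensQ_lin1 tensQ_lin2 word_lin
        rest_lin Q_lin linear_map_id) simp_all
qed

lemma iQ_word_closed [simp]: "f \<in> words \<Longrightarrow> r \<in> carrier R \<Longrightarrow> iQ_word r f \<in> carrier IDRQ"
  using linear_mapD(1)[OF iQ_word_linear, of f r] by simp

lemma word_lin_middle:
  "f \<in> words \<Longrightarrow> g \<in> words \<Longrightarrow> linear_map C RT TA (\<lambda>x. word (f @ x # g))"
  by (rule multilinearD(2)[OF word_multilinear])

text \<open>Induction over the letters in front of the variable one, for all coefficients. Once the
  variable letter is reached it moves into the coefficient \<open>Q r \<otimes> x\<close>, where
  linearity in the coefficient takes over.\<close>

lemma iQ_word_multilinear: "r \<in> carrier R \<Longrightarrow> multilinear C RT IDRQ (iQ_word r)"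
proof (rule multilinearI)
  fix f g assume "r \<in> carrier R" "f \<in> words" and g: "g \<in> words"
  then show "linear_map C RT IDRQ (\<lambda>x. iQ_word r (f @ x # g))"
  proof (induction f arbitrary: r)
    case Nil
    have "linear_map C RT IDRQ (\<lambda>x. iQ_word (Q r \<otimes> x) g)"
      using Nil by (intro linear_map_compose[OF iQ_word_linear] mult_lin linear_map_RR linear_map_id) simp_all
    moreover have "linear_map C RT TA (\<lambda>x. word ([r \<ominus> d (Q r)] @ x # g))"
      using Nil by (intro word_lin_middle) simp_all
    ultimately show ?case
      using Nil by (simp, intro linear_map_add linear_map_sub IDRQ'(1) tensQ_lin2 word_lin linear_map_id) simp_all
  next
    case (Cons a f)
    have "linear_map C RT TA (\<lambda>x. word (((r \<ominus> d (Q r)) # a # f) @ x # g))"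
      "linear_map C RT TA (\<lambda>x. word ((a # f) @ x # g))"
      using Cons by (intro word_lin_middle; simp)+
    then show ?case
      using Cons by (simp, intro linear_map_add linear_map_sub IDRQ'(1) tensQ_lin2 Cons.IH) simp_all
  qed
qed simp

lemma intQ_spec: "linear_map C IDRQ IDRQ intQ \<and>
  (\<forall>f0\<in>carrier R. intQ (tensQ f0 (word [])) =
    tensQ (Q f0) (word []) \<oplus>\<^bsub>IDRQ\<^esub> tensQ \<one> (word [f0 \<ominus> d (Q f0)])) \<and>
  (\<forall>f0\<in>carrier R. \<forall>f1\<in>carrier RT. \<forall>f\<in>words. intQ (tensQ f0 (word (f1 # f))) =
    tensQ (Q f0) (word (f1 # f)) \<ominus>\<^bsub>IDRQ\<^esub> intQ (tensQ (Q f0 \<otimes> f1) (word f))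
      \<oplus>\<^bsub>IDRQ\<^esub> tensQ \<one> (word ((f0 \<ominus> d (Q f0)) # f1 # f)))"
proof -
  obtain L where L: "linear_map C IDRQ IDRQ L"
    "\<And>r f. r \<in> carrier R \<Longrightarrow> f \<in> words \<Longrightarrow> L (tensQ r (word f)) = iQ_word r f"
    using tensQ_ext[OF IDRQ'(1) iQ_word_linear iQ_word_multilinear] by blast
  then have "\<exists>I. linear_map C IDRQ IDRQ I \<and>
  (\<forall>f0\<in>carrier R. I (tensQ f0 (word [])) =
    tensQ (Q f0) (word []) \<oplus>\<^bsub>IDRQ\<^esub> tensQ \<one> (word [f0 \<ominus> d (Q f0)])) \<and>
  (\<forall>f0\<in>carrier R. \<forall>f1\<in>carrier RT. \<forall>f\<in>words. I (tensQ f0 (word (f1 # f))) =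
    tensQ (Q f0) (word (f1 # f)) \<ominus>\<^bsub>IDRQ\<^esub> I (tensQ (Q f0 \<otimes> f1) (word f))
      \<oplus>\<^bsub>IDRQ\<^esub> tensQ \<one> (word ((f0 \<ominus> d (Q f0)) # f1 # f)))"
    by (intro exI[of _ L]) simp
  from someI_ex[OF this, folded intQ_def] show ?thesis .
qed

lemma intQ_linear: "linear_map C IDRQ IDRQ intQ"
  using intQ_spec by blast

lemma intQ_closed [simp]: "x \<in> carrier IDRQ \<Longrightarrow> intQ x \<in> carrier IDRQ"
  by (rule linear_mapD(1)[OF intQ_linear])

lemma intQ_Nil: "r \<in> carrier R \<Longrightarrow> intQ (tensQ r (word [])) =
    tensQ (Q r) (word []) \<oplus>\<^bsub>IDRQ\<^esub> tensQ \<one> (word [r \<ominus> d (Q r)])"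
  using intQ_spec by blast

lemma intQ_Cons: "r \<in> carrier R \<Longrightarrow> a \<in> carrier RT \<Longrightarrow> f \<in> words \<Longrightarrow>
    intQ (tensQ r (word (a # f))) =
    tensQ (Q r) (word (a # f)) \<ominus>\<^bsub>IDRQ\<^esub> intQ (tensQ (Q r \<otimes> a) (word f))
      \<oplus>\<^bsub>IDRQ\<^esub> tensQ \<one> (word ((r \<ominus> d (Q r)) # a # f))"
  using intQ_spec by blast

lemma tensQ_zero [simp]: "t \<in> carrier TA \<Longrightarrow> tensQ \<zero> t = \<zero>\<^bsub>IDRQ\<^esub>"
  using linear_map_zero[OF RR'(1) IDRQ'(1) bilinear_mapD(2)[OF tensQ_bilinear, of t]] by simp

lemma tensQ_word_zero [simp]: "r \<in> carrier R \<Longrightarrow> f \<in> words \<Longrightarrow> tensQ r (word (\<zero> # f)) = \<zero>\<^bsub>IDRQ\<^esub>"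
  using linear_map_zero[OF RT_module IDRQ'(1) tensQ_lin2[OF _ word_lin[OF _ linear_map_id]], of r f] by simp

lemma derivQ_mult:
  assumes x: "x \<in> carrier IDRQ" and y: "y \<in> carrier IDRQ"
  shows "derivQ (x \<otimes>\<^bsub>IDRQ\<^esub> y) = derivQ x \<otimes>\<^bsub>IDRQ\<^esub> y \<oplus>\<^bsub>IDRQ\<^esub> x \<otimes>\<^bsub>IDRQ\<^esub> derivQ y"
proof (rule bilinear_map_eq[OF IDRQ'(1) tensQ_spans IDRQ'(1) tensQ_spans IDRQ'(1) _ _ _ x y])
  show "bilinear_map C IDRQ IDRQ IDRQ (\<lambda>x y. derivQ (x \<otimes>\<^bsub>IDRQ\<^esub> y))"
    by (rule bilinear_map_post[OF IDRQ'(3) derivQ_linear])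
  show "bilinear_map C IDRQ IDRQ IDRQ (\<lambda>x y. derivQ x \<otimes>\<^bsub>IDRQ\<^esub> y \<oplus>\<^bsub>IDRQ\<^esub> x \<otimes>\<^bsub>IDRQ\<^esub> derivQ y)"
    by (intro bilinear_map_add IDRQ'(1) bilinear_map_compose[OF IDRQ'(3)] derivQ_linear linear_map_id)
next
  fix x y assume "x \<in> {tensQ r (word f) | r f. r \<in> carrier R \<and> f \<in> words}"
    "y \<in> {tensQ r (word f) | r f. r \<in> carrier R \<and> f \<in> words}"
  then obtain r f s g where x: "x = tensQ r (word f)" "r \<in> carrier R" "f \<in> words"
    and y: "y = tensQ s (word g)" "s \<in> carrier R" "g \<in> words" by blast
  note b1 = linear_mapD(2)[OF bilinear_mapD(1)[OF tensQ_bilinear], simplified]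
  note b2 = linear_mapD(2)[OF bilinear_mapD(2)[OF tensQ_bilinear], simplified]
  note mult = tensQ_mult shuffle_word shuffle_word[of "[]", simplified] shuffle_word[of _ "[]", simplified]
  have cm: "r \<otimes> s \<otimes> a = r \<otimes> a \<otimes> s" "r \<otimes> (s \<otimes> a) = r \<otimes> s \<otimes> a" if "a \<in> carrier R" for a
    using that x(2) y(2) by (simp_all add: m_ac)
  show "derivQ (x \<otimes>\<^bsub>IDRQ\<^esub> y) = derivQ x \<otimes>\<^bsub>IDRQ\<^esub> y \<oplus>\<^bsub>IDRQ\<^esub> x \<otimes>\<^bsub>IDRQ\<^esub> derivQ y"
  proof (cases f)
    case f: Nil
    show ?thesis
    proof (cases g)
      case Nil
      then show ?thesis using x y f by (simp add: mult d_mult b2)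
    next
      case (Cons b g')
      then show ?thesis using x y f
        by (simp add: mult d_mult b2 S.r_distr cm S.M.a_ac)
    qed
  next
    case f: (Cons a f')
    show ?thesis
    proof (cases g)
      case Nil
      then show ?thesis using x y f
        by (simp add: mult d_mult b2 S.l_distr cm S.M.a_ac)
    next
      case (Cons b g')
      with x y f have ab: "a \<in> carrier RT" "f' \<in> words" "b \<in> carrier RT" "g' \<in> words" by auto
      have rs: "r \<otimes> s \<in> carrier R" using x y by simp
      \<comment> \<open>The derivation strips the leading letter from each half of the shuffle
        recursion; what remains are the two Leibniz terms that come from the letters.\<close>
      have "derivQ (x \<otimes>\<^bsub>IDRQ\<^esub> y) = tensQ (d (r \<otimes> s)) (shuf_sum f g) \<oplus>\<^bsub>IDRQ\<^esub>
          (tensQ (r \<otimes> s \<otimes> a) (shuf_sum f' g) \<oplus>\<^bsub>IDRQ\<^esub> tensQ (r \<otimes> s \<otimes> b) (shuf_sum f g'))"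
        using x y ab rs linear_mapD(1)[OF letter_linear]
        by (simp add: mult f Cons shuf_sum_Cons b1 linear_mapD(2)[OF derivQ_linear] derivQ_letter S.M.a_ac)
      also have "\<dots> = derivQ x \<otimes>\<^bsub>IDRQ\<^esub> y \<oplus>\<^bsub>IDRQ\<^esub> x \<otimes>\<^bsub>IDRQ\<^esub> derivQ y"
        using x y ab f Cons
        by (simp add: mult d_mult b2 S.l_distr S.r_distr cm S.M.a_ac)
      finally show ?thesis .
    qed
  qed
qed

lemma derivQ_intQ: "x \<in> carrier IDRQ \<Longrightarrow> derivQ (intQ x) = x"
proof (rule linear_map_eq[OF IDRQ'(1) IDRQ'(1) tensQ_spans])
  show "linear_map C IDRQ IDRQ (\<lambda>x. derivQ (intQ x))"
    by (rule linear_map_compose[OF derivQ_linear intQ_linear])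
  fix x assume "x \<in> {tensQ r (word f) | r f. r \<in> carrier R \<and> f \<in> words}"
  then obtain r f where x: "x = tensQ r (word f)" "r \<in> carrier R" "f \<in> words" by blast
  note b2 = linear_mapD(2)[OF bilinear_mapD(2)[OF tensQ_bilinear], simplified, symmetric]
  have dr: "d (Q r) \<oplus> (r \<ominus> d (Q r)) = r" if "r \<in> carrier R" for r
  proof -
    from that have "d (Q r) \<in> carrier R" by simp
    with that show ?thesis by algebra
  qed
  from x(3,2) show "derivQ (intQ x) = x" unfolding x(1)
  proof (induction f arbitrary: r)
    case Nil
    then show ?case
      by (simp add: intQ_Nil linear_mapD(2)[OF derivQ_linear] b2 dr)
  next
    case (Cons a f)
    let ?a = "tensQ (Q r) (word (a # f))" and ?b = "tensQ (Q r \<otimes> a) (word f)"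
    have c: "?b \<in> carrier IDRQ" "tensQ (d (Q r)) (word (a # f)) \<in> carrier IDRQ"
      "tensQ (r \<ominus> d (Q r)) (word (a # f)) \<in> carrier IDRQ" using Cons by simp_all
    \<comment> \<open>By induction the subtracted integral differentiates to \<open>?b\<close>,
      which cancels the term produced by stripping \<open>a\<close> from \<open>?a\<close>.\<close>
    have "derivQ (intQ (tensQ r (word (a # f)))) =
      (tensQ (d (Q r)) (word (a # f)) \<oplus>\<^bsub>IDRQ\<^esub> ?b) \<ominus>\<^bsub>IDRQ\<^esub> ?b \<oplus>\<^bsub>IDRQ\<^esub> tensQ (r \<ominus> d (Q r)) (word (a # f))"
      using Cons.prems Cons.hyps
      by (simp add: intQ_Cons linear_mapD(2)[OF derivQ_linear] linear_map_minus[OF IDRQ'(1) IDRQ'(1) derivQ_linear] Cons.IH)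
    also have "\<dots> = tensQ (d (Q r)) (word (a # f)) \<oplus>\<^bsub>IDRQ\<^esub> tensQ (r \<ominus> d (Q r)) (word (a # f))"
      using c by algebra
    also have "\<dots> = tensQ r (word (a # f))" using Cons by (simp add: b2 dr)
    finally show ?case .
  qed
qed (simp_all add: linear_map_id)

text \<open>Since \<open>Q a\<close> is zero, only the last term of the formula survives:
  integration turns a coefficient from \<open>RT\<close> into a new first letter. This is why nested
  integrals of such elements are words.\<close>

lemma intQ_RT: "a \<in> carrier RT \<Longrightarrow> f \<in> words \<Longrightarrow> intQ (tensQ a (word f)) = tensQ \<one> (word (a # f))"
proof (cases f)
  assume a: "a \<in> carrier RT" "f \<in> words"
  have r: "a \<ominus> d (Q a) = a" using a by (simp add: a_minus_def)
  case Nil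
  then show ?thesis using a r by (simp add: intQ_Nil)
next
  assume a: "a \<in> carrier RT" "f \<in> words"
  have r: "a \<ominus> d (Q a) = a" using a by (simp add: a_minus_def)
  case (Cons b g)
  have "intQ \<zero>\<^bsub>IDRQ\<^esub> = \<zero>\<^bsub>IDRQ\<^esub>" by (rule linear_map_zero[OF IDRQ'(1) IDRQ'(1) intQ_linear])
  then show ?thesis using a r Cons by (simp add: intQ_Cons minus_self[OF S.M.abelian_group_axioms])
qed

section \<open>Evaluation and constants\<close>

abbreviation "evalQ \<equiv> evaluation IDRQ derivQ intQ"

lemma evalQ_linear: "linear_map C IDRQ IDRQ evalQ"
  unfolding evaluation_def[abs_def]
  by (intro linear_map_sub IDRQ'(1) linear_map_id linear_map_compose[OF intQ_linear derivQ_linear])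

lemma evalQ_Nil: "r \<in> carrier R \<Longrightarrow> evalQ (tensQ r (word [])) = tensQ (r \<ominus> Q (d r)) (word [])"
  using linear_map_minus[OF RR'(1) IDRQ'(1) bilinear_mapD(2)[OF tensQ_bilinear], of "word []" r "Q (d r)"]
    minus_self[OF abelian_group_axioms, of "d r"]
  by (simp add: evaluation_def intQ_Nil d_Q_d)

text \<open>By d Q d = d; the element is the component of \<open>r\<close> in the constants,
  complementary to the image of \<open>Q\<close>.\<close>

lemma rest_constant: "r \<in> carrier R \<Longrightarrow> d (r \<ominus> Q (d r)) = \<zero>"
  using linear_map_minus[OF RR'(1) RR'(1) d_linear, of r "Q (d r)"] minus_self[OF abelian_group_axioms, of "d r"]
  by (simp add: d_Q_d)

lemma tensQ_constant: "c \<in> carrier C \<Longrightarrow> t \<in> carrier TA \<Longrightarrow> tensQ c t = c \<odot>\<^bsub>IDRQ\<^esub> tensQ \<one> t"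
  using linear_mapD(3)[OF bilinear_mapD(2)[OF tensQ_bilinear], of t c \<one>] by simp

text \<open>With the constant \<open>?c\<close>, all terms collect to \<open>?c\<close> times the
  word minus the integral of \<open>?c \<otimes> a\<close> with the shortened word. The scalar comes
  out of the integral, and \<open>intQ_RT\<close> restores the word, so the two cancel.\<close>

lemma evalQ_Cons:
  assumes r: "r \<in> carrier R" and a: "a \<in> carrier RT" and f: "f \<in> words"
  shows "evalQ (tensQ r (word (a # f))) = \<zero>\<^bsub>IDRQ\<^esub>"
proof -
  let ?c = "r \<ominus> Q (d r)"
  have c: "?c \<in> carrier C" using r rest_constant by simp
  let ?w = "tensQ r (word (a # f))" and ?u = "tensQ (Q (d r)) (word (a # f))"
  let ?x = "intQ (tensQ (r \<otimes> a) (word f))" and ?y = "intQ (tensQ (Q (d r) \<otimes> a) (word f))"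
  have cl: "?w \<in> carrier IDRQ" "?u \<in> carrier IDRQ" "?x \<in> carrier IDRQ" "?y \<in> carrier IDRQ"
    using r a f by simp_all
  have "evalQ ?w = ?w \<ominus>\<^bsub>IDRQ\<^esub> ((?u \<ominus>\<^bsub>IDRQ\<^esub> ?y) \<oplus>\<^bsub>IDRQ\<^esub> ?x)"
    using r a f minus_self[OF abelian_group_axioms, of "d r"]
    by (simp add: evaluation_def linear_mapD(2)[OF intQ_linear] intQ_Cons d_Q_d)
  also have "\<dots> = (?w \<ominus>\<^bsub>IDRQ\<^esub> ?u) \<ominus>\<^bsub>IDRQ\<^esub> (?x \<ominus>\<^bsub>IDRQ\<^esub> ?y)" using cl by algebra
  also have "?w \<ominus>\<^bsub>IDRQ\<^esub> ?u = tensQ ?c (word (a # f))"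
    using linear_map_minus[OF RR'(1) IDRQ'(1) bilinear_mapD(2)[OF tensQ_bilinear], of "word (a # f)" r "Q (d r)"] r a f
    by simp
  also have "?x \<ominus>\<^bsub>IDRQ\<^esub> ?y = intQ (tensQ (?c \<otimes> a) (word f))"
  proof -
    have "linear_map C RR IDRQ (\<lambda>r. intQ (tensQ (r \<otimes> a) (word f)))"
      by (intro linear_map_compose[OF intQ_linear] tensQ_lin1 mult_lin linear_map_id) (simp_all add: a f)
    from linear_map_minus[OF RR'(1) IDRQ'(1) this, of r "Q (d r)"] r show ?thesis by simp
  qed
  also have "\<dots> = ?c \<odot>\<^bsub>IDRQ\<^esub> intQ (tensQ a (word f))"
  proof -
    have "linear_map C RR IDRQ (\<lambda>r. intQ (tensQ r (word f)))"
      by (intro linear_map_compose[OF intQ_linear] tensQ_lin1 linear_map_id) (simp add: f)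
    from linear_mapD(3)[OF this c, of a] a show ?thesis by simp
  qed
  also have "\<dots> = tensQ ?c (word (a # f))"
    using a f c by (simp only: intQ_RT tensQ_constant word_closed Cons_in_lists_iff)
  finally show ?thesis using r a f minus_self[OF S.M.abelian_group_axioms] by simp
qed

lemma evalQ_scalar: "x \<in> carrier IDRQ \<Longrightarrow> \<exists>c\<in>carrier C. evalQ x = c \<odot>\<^bsub>IDRQ\<^esub> \<one>\<^bsub>IDRQ\<^esub>"
  using IDRQ'(1) tensQ_spans
proof (induction x rule: span_induct)
  case (gen x)
  then obtain r f where x: "x = tensQ r (word f)" "r \<in> carrier R" "f \<in> words" by blast
  show ?case
  proof (cases f)
    case Nil
    show ?thesis
    proof (rule bexI)
      show c: "r \<ominus> Q (d r) \<in> carrier C" using x rest_constant by simp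
      then show "evalQ x = (r \<ominus> Q (d r)) \<odot>\<^bsub>IDRQ\<^esub> \<one>\<^bsub>IDRQ\<^esub>"
        using x Nil tensQ_constant[OF c, of "word []"] by (simp add: evalQ_Nil one_IDRQ)
    qed
  next
    case (Cons a g)
    then have "evalQ x = \<zero> \<odot>\<^bsub>IDRQ\<^esub> \<one>\<^bsub>IDRQ\<^esub>"
      using x S.smult_l_null[OF S.one_closed] by (simp add: evalQ_Cons)
    then show ?thesis using S.R.zero_closed by force
  qed
next
  case (add x y)
  then obtain a b where a: "a \<in> carrier C" "evalQ x = a \<odot>\<^bsub>IDRQ\<^esub> \<one>\<^bsub>IDRQ\<^esub>"
    and b: "b \<in> carrier C" "evalQ y = b \<odot>\<^bsub>IDRQ\<^esub> \<one>\<^bsub>IDRQ\<^esub>" by blast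
  have "evalQ (x \<oplus>\<^bsub>IDRQ\<^esub> y) = (a \<oplus>\<^bsub>C\<^esub> b) \<odot>\<^bsub>IDRQ\<^esub> \<one>\<^bsub>IDRQ\<^esub>"
    using linear_mapD(2)[OF evalQ_linear add(1,2)] S.smult_l_distr[OF a(1) b(1) S.one_closed] a(2) b(2) by simp
  with S.R.a_closed[OF a(1) b(1)] show ?case by blast
next
  case (smult c x)
  then obtain a where a: "a \<in> carrier C" "evalQ x = a \<odot>\<^bsub>IDRQ\<^esub> \<one>\<^bsub>IDRQ\<^esub>" by blast
  have "evalQ (c \<odot>\<^bsub>IDRQ\<^esub> x) = (c \<otimes>\<^bsub>C\<^esub> a) \<odot>\<^bsub>IDRQ\<^esub> \<one>\<^bsub>IDRQ\<^esub>"
    using linear_mapD(3)[OF evalQ_linear smult(1,2)] S.smult_assoc1[OF smult(1) a(1) S.one_closed] a(2) by simp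
  with S.R.m_closed[OF smult(1) a(1)] show ?case by blast
next
  case zero
  have "evalQ \<zero>\<^bsub>IDRQ\<^esub> = \<zero> \<odot>\<^bsub>IDRQ\<^esub> \<one>\<^bsub>IDRQ\<^esub>"
    using linear_map_zero[OF IDRQ'(1) IDRQ'(1) evalQ_linear] S.smult_l_null[OF S.one_closed] by simp
  then show ?case using S.R.zero_closed by force
qed

lemma IDRQ_comm_diff_ring: "comm_diff_ring IDRQ derivQ"
  by (intro comm_diff_ring.intro IDRQ'(2) comm_diff_ring_axioms.intro)
    (simp_all add: linear_mapD(2)[OF derivQ_linear] derivQ_mult)

lemma IDRQ_comm_int_diff_ring: "comm_int_diff_ring IDRQ derivQ intQ"
proof (intro comm_int_diff_ring.intro IDRQ_comm_diff_ring comm_int_diff_ring_axioms.intro derivQ_intQ)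
  interpret D: comm_diff_ring IDRQ derivQ by (rule IDRQ_comm_diff_ring)
  show "linear_map (constants IDRQ derivQ) (self_module IDRQ) (self_module IDRQ) intQ"
  proof (rule linear_mapI)
    fix c x assume "c \<in> carrier (constants IDRQ derivQ)" "x \<in> carrier (self_module IDRQ)"
    then have c: "c \<in> carrier IDRQ" "derivQ c = \<zero>\<^bsub>IDRQ\<^esub>" and x: "x \<in> carrier IDRQ" by simp_all
    have "evalQ c = c"
      using c linear_map_zero[OF IDRQ'(1) IDRQ'(1) intQ_linear]
        S.M.minus_equality[of "\<zero>\<^bsub>IDRQ\<^esub>" "\<zero>\<^bsub>IDRQ\<^esub>"] by (simp add: evaluation_def a_minus_def)
    with evalQ_scalar[OF c(1)] obtain k where k: "k \<in> carrier C" "c = k \<odot>\<^bsub>IDRQ\<^esub> \<one>\<^bsub>IDRQ\<^esub>" by metis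
    \<comment> \<open>Multiplication by the constant \<open>c\<close> is the action of the scalar
      \<open>k\<close>, for which \<open>intQ\<close> is linear by construction.\<close>
    have m: "c \<otimes>\<^bsub>IDRQ\<^esub> y = k \<odot>\<^bsub>IDRQ\<^esub> y" if "y \<in> carrier IDRQ" for y
      unfolding k(2) using S.smult_assoc2[OF k(1) S.one_closed that] that by simp
    show "intQ (c \<odot>\<^bsub>self_module IDRQ\<^esub> x) = c \<odot>\<^bsub>self_module IDRQ\<^esub> intQ x"
      using m[OF x] m[OF intQ_closed[OF x]] linear_mapD(3)[OF intQ_linear k(1) x] by simp
  qed (simp_all add: linear_mapD(2)[OF intQ_linear])
qed

section \<open>The embedding and nested integrals\<close>

lemma inclQ_hom: "diff_ring_hom R d IDRQ derivQ inclQ"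
  unfolding diff_ring_hom_def
proof (intro conjI ballI comm_diff_ring_axioms IDRQ_comm_diff_ring)
  show "inclQ \<in> ring_hom R IDRQ"
    by (rule ring_hom_memI)
      (simp_all add: inclQ_def tensQ_mult shuffle_word one_IDRQ
        linear_mapD(2)[OF bilinear_mapD(2)[OF tensQ_bilinear], simplified])
qed (simp add: inclQ_def)

text \<open>The projection to the component of the empty word is a left inverse.\<close>

lemma inclQ_inj: "inj_on inclQ (carrier R)"
proof -
  let ?b = "\<lambda>r f. if f = [] then r else \<zero>\<^bsub>RR\<^esub>"
  have l: "linear_map C RR RR (\<lambda>r. ?b r f)" for f
    using linear_map_id linear_map_const_zero[OF RR'(1)] by (cases "f = []") simp_all
  have m: "multilinear C RT RR (?b r)" if "r \<in> carrier R" for r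
    using that by (intro multilinear_const_Nil multilinear_zero RR'(1)) simp
  obtain L where L: "\<And>r f. r \<in> carrier R \<Longrightarrow> f \<in> words \<Longrightarrow> L (tensQ r (word f)) = ?b r f"
    using tensQ_ext[OF RR'(1) l m] by blast
  have "L (inclQ r) = r" if "r \<in> carrier R" for r
    using L[OF that, of "[]"] by (simp add: inclQ_def)
  then show ?thesis by (rule inj_on_inverseI)
qed

lemma intQ_inclQ: "f \<in> d ` carrier R \<Longrightarrow> intQ (inclQ f) = inclQ (Q f)"
  using minus_self[OF abelian_group_axioms] by (auto simp: inclQ_def intQ_Nil d_Q_d)

lemma nested_intQ: "f \<in> words \<Longrightarrow> f \<noteq> [] \<Longrightarrow> nested_int IDRQ intQ inclQ f = tensQ \<one> (word f)"
proof (induction f rule: induct_list012)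
  case (2 a)
  then show ?case by (simp add: inclQ_def intQ_RT)
next
  case (3 a b f)
  then show ?case by (simp add: inclQ_def intQ_RT tensQ_mult shuffle_word)
qed simp

lemma evalQ_incl_nested:
  assumes "r \<in> carrier R" "f \<in> words" "f \<noteq> []"
  shows "evalQ (inclQ r \<otimes>\<^bsub>IDRQ\<^esub> nested_int IDRQ intQ inclQ f) = \<zero>\<^bsub>IDRQ\<^esub>"
proof -
  obtain a g where f: "f = a # g" using assms(3) by (cases f) simp_all
  show ?thesis
    unfolding nested_intQ[OF assms(2,3)] using assms by (simp add: f inclQ_def tensQ_mult shuffle_word evalQ_Cons)
qed

text \<open>A shuffle of nonempty words consists of nonempty words, and the evaluation vanishes on
  each of them.\<close>

lemma evalQ_nested_nested:
  assumes "f \<in> words" "f \<noteq> []" "g \<in> words" "g \<noteq> []"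
  shows "evalQ (nested_int IDRQ intQ inclQ f \<otimes>\<^bsub>IDRQ\<^esub> nested_int IDRQ intQ inclQ g) = \<zero>\<^bsub>IDRQ\<^esub>"
proof -
  have w: "w \<in> words" "w \<noteq> []" if "w \<in># shuf f g" for w
    using shuf_in_lists[OF assms(1,3) that] shuf_ne_Nil[OF that] assms by auto
  have l: "linear_map C TA IDRQ (\<lambda>t. evalQ (tensQ \<one> t))"
    by (intro linear_map_compose[OF evalQ_linear] tensQ_lin2 linear_map_id) simp
  have "evalQ (tensQ \<one> (shuf_sum f g)) = msum IDRQ (\<lambda>w. evalQ (tensQ \<one> (word w))) (shuf f g)"
    unfolding shuf_sum_def by (rule linear_map_msum[OF TA_module IDRQ'(1) l]) (simp add: w)
  also have "\<dots> = \<zero>\<^bsub>IDRQ\<^esub>"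
  proof (rule S.M.msum_zero)
    fix u assume "u \<in># shuf f g"
    from w[OF this] show "evalQ (tensQ \<one> (word u)) = \<zero>\<^bsub>IDRQ\<^esub>"
      by (cases u) (simp_all add: evalQ_Cons)
  qed
  finally show ?thesis using assms by (simp add: nested_intQ tensQ_mult shuffle_word)
qed

end

lemma (in ring) add_diff_exchange:
  assumes "a \<in> carrier R" "b \<in> carrier R" "x \<in> carrier R" "y \<in> carrier R"
  shows "(a \<oplus> x) \<ominus> (b \<oplus> y) = a \<ominus> b \<oplus> (x \<ominus> y)"
  using assms by algebra

lemma (in module) msum_submodule:
  assumes "submodule H R M" "\<And>x. x \<in># A \<Longrightarrow> f x \<in> H"
  shows "msum M f A \<in> H"
  using assms(2)
proof (induction A)
  case empty
  show ?case using submodule_zero[OF assms(1)] by simp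
next
  case (add x A)
  then have "f x \<in> H" "msum M f A \<in> H" by simp_all
  then show ?case using submoduleE(1,5)[OF assms(1)] by (simp add: msum_add_mset)
qed

lemma (in abelian_monoid) msum_twist:
  "msum G F (twist f g) = msum G (\<lambda>(f1, f2). msum G (\<lambda>(g1, g2). msum G (\<lambda>w. F (f2, g2, w)) (shuf f1 g1)) (splits g)) (splits f)"
  by (simp add: twist_def msum_sum case_prod_unfold)

text \<open>Isolates the cut with empty tail when all nonempty tails contribute zero. The term
  \<open>take (length f - length v) f\<close> is the head that belongs to the tail
  \<open>v\<close>.\<close>

lemma (in abelian_monoid) msum_splits:
  assumes "\<And>v. v \<noteq> [] \<Longrightarrow> (\<exists>u. u @ v = f) \<Longrightarrow> F (take (length f - length v) f) v = \<zero>" "F f [] \<in> carrier G"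
  shows "msum G (\<lambda>(u, v). F u v) (splits f) = F f []"
proof -
  have "msum G (\<lambda>i. F (take i f) (drop i f)) (mset_set {..<length f}) = \<zero>"
  proof (rule msum_zero)
    fix i assume "i \<in># mset_set {..<length f}"
    then have i: "i < length f" by simp
    from assms(1)[of "drop i f"] i show "F (take i f) (drop i f) = \<zero>"
      by (metis append_take_drop_id diff_diff_cancel drop_eq_Nil length_drop less_imp_le_nat not_le)
  qed
  then show ?thesis using assms(2) by (simp add: splits_take_drop)
qed

context quasi_integration
begin

subsection \<open>The constants of the free integro-differential ring\<close>

definition "pos_part = gen_submodule C TT {word f | f. f \<in> words \<and> f \<noteq> []}"

lemma pos_part_submodule: "submodule pos_part C TT"
  unfolding pos_part_def by (rule gen_submodule_submodule[OF TT_module]) auto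

lemma T_pos_fields [simp]:
  "carrier T_pos = pos_part" "add T_pos = add TA" "zero T_pos = zero TA" "smult T_pos = smult TA"
  by (simp_all add: T_pos_def pos_part_def)

lemma T_pos_module: "module C T_pos"
  using submodule.submodule_is_module[OF pos_part_submodule TT_module]
  by (simp add: T_pos_def pos_part_def)

lemma word_pos_part [simp]: "f \<in> words \<Longrightarrow> f \<noteq> [] \<Longrightarrow> word f \<in> pos_part"
  unfolding pos_part_def by (rule subsetD[OF gen_submodule_incl]) blast

lemma linear_map_T_pos:
  "linear_map C L TA f \<Longrightarrow> (\<And>x. x \<in> carrier L \<Longrightarrow> f x \<in> pos_part) \<Longrightarrow> linear_map C L T_pos f"
  by (rule linear_mapI) (simp_all add: linear_mapD)

lemma pos_part_closed [simp]: "t \<in> pos_part \<Longrightarrow> t \<in> carrier TA"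
  using subgroup.subset[OF submodule.axioms(1)[OF pos_part_submodule]] by auto

interpretation TT: module C TT by (rule TT_module)

lemma shuf_sum_pos_part [simp]:
  assumes "f \<in> words" "g \<in> words" "f \<noteq> [] \<or> g \<noteq> []"
  shows "shuf_sum f g \<in> pos_part"
proof -
  have w: "w \<in> words" "w \<noteq> []" if "w \<in># shuf f g" for w
    using shuf_in_lists[OF assms(1,2) that] shuf_ne_Nil[OF that] assms by auto
  have "msum TT word (shuf f g) \<in> pos_part"
    by (rule TT.msum_submodule[OF pos_part_submodule]) (simp add: w)
  then show ?thesis unfolding shuf_sum_def msum_def TT_fields .
qed

lemma M2_module: "module C M2"
  unfolding M2_def by (rule sym_square_module[OF T_pos_module])

lemma RJ_module: "module C RJ"
proof -
  interpret RR: algebra C RR by (rule RR_algebra)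
  have "submodule (Q ` carrier R) C RR"
  proof (rule RR.submoduleI)
    have "Q \<zero> = \<zero>" using linear_map_zero[OF RR'(1) RR'(1) Q_linear] by simp
    then show "\<zero>\<^bsub>RR\<^esub> \<in> Q ` carrier R" using zero_closed by (simp, metis imageI)
    show "\<ominus>\<^bsub>RR\<^esub> x \<in> Q ` carrier R" if x: "x \<in> Q ` carrier R" for x
    proof -
      from x obtain y where y: "y \<in> carrier R" "x = Q y" by blast
      then have "\<ominus>\<^bsub>RR\<^esub> x = Q (\<ominus> y)"
        using linear_map_neg[OF RR'(1) RR'(1) Q_linear, of y] by simp
      then show ?thesis using y by simp
    qed
    show "x \<oplus>\<^bsub>RR\<^esub> y \<in> Q ` carrier R" if xy: "x \<in> Q ` carrier R" "y \<in> Q ` carrier R" for x y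
    proof -
      from xy obtain u v where u: "u \<in> carrier R" "x = Q u" "v \<in> carrier R" "y = Q v" by blast
      then have "x \<oplus>\<^bsub>RR\<^esub> y = Q (u \<oplus> v)" using linear_mapD(2)[OF Q_linear, of u v] by simp
      then show ?thesis using u by simp
    qed
    show "c \<odot>\<^bsub>RR\<^esub> x \<in> Q ` carrier R" if c: "c \<in> carrier C" "x \<in> Q ` carrier R" for c x
    proof -
      from c(2) obtain y where y: "y \<in> carrier R" "x = Q y" by blast
      then have "c \<odot>\<^bsub>RR\<^esub> x = Q (c \<otimes> y)" using linear_mapD(3)[OF Q_linear c(1), of y] by simp
      then show ?thesis using y c(1) by simp
    qed
  qed auto
  from submodule.submodule_is_module[OF this RR'(1)] show ?thesis by (simp add: RJ_def)
qed

lemma M1_module: "module C M1"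
  unfolding M1_def by (rule tensor_prod_module[OF RJ_module TT_module])

lemma C1_algebra: "algebra C C1"
  unfolding C1_def by (rule sym_algebra_algebra[OF M1_module])

lemma S2_algebra: "algebra C S2"
  unfolding S2_def by (rule sym_algebra_algebra[OF M2_module])

lemmas C1' = algebraD[OF C1_algebra]
lemmas S2' = algebraD[OF S2_algebra]

lemma epsS_bilinear: "bilinear_map C T_pos T_pos S2 epsS"
  using bilinear_map_post[OF sym_tens_bilinear[OF T_pos_module] sym_incl_linear[OF M2_module, unfolded M2_def]]
  by (simp add: S2_def M2_def epsS_def[abs_def])

lemma epsS_closed [simp]: "s \<in> pos_part \<Longrightarrow> t \<in> pos_part \<Longrightarrow> epsS s t \<in> carrier S2"
  using bilinear_map_closed[OF epsS_bilinear, of s t] by simp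

interpretation S2: algebra C S2 by (rule S2_algebra)

lemma drop_in_lists [simp]: "f \<in> lists A \<Longrightarrow> drop i f \<in> lists A"
  by (auto simp: lists_eq_set dest: in_set_dropD)

lemma take_in_lists [simp]: "f \<in> lists A \<Longrightarrow> take i f \<in> lists A"
  by (auto simp: lists_eq_set dest: in_set_takeD)

section \<open>The ideal of relations\<close>

definition "J2_left f g h j = (\<Oplus>\<^bsub>S2\<^esub>i\<in>{1 - j..<length f}.
      epsS (word (drop i f)) (word (drop j g)) \<otimes>\<^bsub>S2\<^esub>
      epsS (word (take i f) \<otimes>\<^bsub>TT\<^esub> word (take j g)) (word h))"

definition "J2_right f g h j = (\<Oplus>\<^bsub>S2\<^esub>k\<in>{1 - j..<length h}.
      epsS (word f) (word (take j g) \<otimes>\<^bsub>TT\<^esub> word (take k h)) \<otimes>\<^bsub>S2\<^esub>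
      epsS (word (drop j g)) (word (drop k h)))"

text \<open>The bound \<open>1 - j\<close> excludes \<open>i = j = 0\<close>, where both heads would
  be empty and their product would be the unit instead of an element of \<open>pos_part\<close>; the
  upper bounds keep the tails nonempty. The last two facts serve \<open>J2_right\<close>, with the
  roles of \<open>f\<close> and \<open>h\<close> exchanged.\<close>

lemma J2_summand_closed:
  assumes "f \<in> words" "g \<in> words" "h \<in> words" "h \<noteq> []" "j < length g" "i \<in> {1 - j..<length f}"
  shows "epsS (word (drop i f)) (word (drop j g)) \<in> carrier S2"
    "epsS (word (take i f) \<otimes>\<^bsub>TT\<^esub> word (take j g)) (word h) \<in> carrier S2"
    "epsS (word h) (word (take j g) \<otimes>\<^bsub>TT\<^esub> word (take i f)) \<in> carrier S2"
    "epsS (word (drop j g)) (word (drop i f)) \<in> carrier S2"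
proof -
  from assms have "drop i f \<noteq> []" "drop j g \<noteq> []" "take i f \<noteq> [] \<or> take j g \<noteq> []"
    by auto
  then show "epsS (word (drop i f)) (word (drop j g)) \<in> carrier S2"
    "epsS (word (take i f) \<otimes>\<^bsub>TT\<^esub> word (take j g)) (word h) \<in> carrier S2"
    "epsS (word h) (word (take j g) \<otimes>\<^bsub>TT\<^esub> word (take i f)) \<in> carrier S2"
    "epsS (word (drop j g)) (word (drop i f)) \<in> carrier S2"
    using assms by (auto simp: shuffle_word simp del: take_eq_Nil drop_eq_Nil)
qed

lemma J2_left_closed:
  assumes "f \<in> words" "g \<in> words" "h \<in> words" "h \<noteq> []" "j < length g"
  shows "J2_left f g h j \<in> carrier S2" "J2_right h g f j \<in> carrier S2"
  unfolding J2_left_def J2_right_def using J2_summand_closed[OF assms]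
  by (intro S2.M.finsum_closed Pi_I S2.m_closed; simp)+

lemma J2_gen_alt: "J2_gen f g h =
  epsS (word f \<otimes>\<^bsub>TT\<^esub> word g) (word h) \<ominus>\<^bsub>S2\<^esub> epsS (word f) (word g \<otimes>\<^bsub>TT\<^esub> word h) \<oplus>\<^bsub>S2\<^esub>
  (\<Oplus>\<^bsub>S2\<^esub>j\<in>{..<length g}. J2_left f g h j \<ominus>\<^bsub>S2\<^esub> J2_right f g h j)"
  by (simp add: J2_gen_def J2_left_def J2_right_def)

lemma J2_gen_closed:
  assumes "f \<in> words" "g \<in> words" "h \<in> words" "f \<noteq> []" "g \<noteq> []" "h \<noteq> []"
  shows "J2_gen f g h \<in> carrier S2"
  unfolding J2_gen_alt using assms
  by (intro S2.M.a_closed S2.M.minus_closed S2.M.finsum_closed Pi_I)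
    (simp_all add: J2_left_closed shuffle_word)

lemma J2_ideal: "ideal J2 S2"
  unfolding J2_def by (rule S2.genideal_ideal) (auto intro: J2_gen_closed)

lemma J2_gen_J2:
  "\<lbrakk>f \<in> words; g \<in> words; h \<in> words; f \<noteq> []; g \<noteq> []; h \<noteq> []\<rbrakk> \<Longrightarrow> J2_gen f g h \<in> J2"
  unfolding J2_def
  by (rule subsetD[OF S2.genideal_self]) (auto intro: J2_gen_closed)

lemmas J2_submodule = ideal_submodule[OF S2'(4) J2_ideal]

lemma C2_algebra: "algebra C C2"
  unfolding C2_def by (rule quot_commutative_algebra[OF S2_algebra J2_ideal])

lemmas C2' = algebraD[OF C2_algebra]

definition "pr2 x = J2 +>\<^bsub>S2\<^esub> x"

lemma pr2_linear: "linear_map C S2 C2 pr2"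
  unfolding C2_def pr2_def[abs_def] by (rule coset_linear[OF S2'(1) J2_submodule])

lemma pr2_mult: "x \<in> carrier S2 \<Longrightarrow> y \<in> carrier S2 \<Longrightarrow> pr2 (x \<otimes>\<^bsub>S2\<^esub> y) = pr2 x \<otimes>\<^bsub>C2\<^esub> pr2 y"
  unfolding C2_def pr2_def by (rule quot_algebra(2)[OF S2'(4) J2_ideal, symmetric])

lemma pr2_one: "pr2 \<one>\<^bsub>S2\<^esub> = \<one>\<^bsub>C2\<^esub>"
  by (simp add: C2_def pr2_def quot_module_simps(5))

lemma pr2_surj: "X \<in> carrier C2 \<Longrightarrow> \<exists>x\<in>carrier S2. X = pr2 x"
  by (auto simp: C2_def pr2_def quot_module_simps(1))

lemma eps2_pr2: "eps2 s t = pr2 (epsS s t)"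
  by (simp add: eps2_def pr2_def)

lemma eps2_bilinear: "bilinear_map C T_pos T_pos C2 eps2"
  using bilinear_map_post[OF epsS_bilinear pr2_linear] by (simp add: eps2_pr2[abs_def])

lemma eps2_commute: "s \<in> pos_part \<Longrightarrow> t \<in> pos_part \<Longrightarrow> eps2 s t = eps2 t s"
  using sym_tens_commute[OF T_pos_module, of s t] by (simp add: eps2_def epsS_def)

lemma eps2_closed [simp]: "s \<in> pos_part \<Longrightarrow> t \<in> pos_part \<Longrightarrow> eps2 s t \<in> carrier C2"
  using bilinear_map_closed[OF eps2_bilinear, of s t] by simp

interpretation C2: algebra C C2 by (rule C2_algebra)

text \<open>With \<open>\<omega>\<close> extended to empty words, the product of \<open>C\<^sub>2 \<otimes> T\<close> is the shuffle product twisted by \<open>\<omega>\<close>,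
  and the relations defining \<open>J\<^sub>2\<close> say exactly that \<open>\<omega>\<close> is a 2-cocycle.\<close>

definition \<omega> :: "'a list \<Rightarrow> 'a list \<Rightarrow> _" where
  "\<omega> f g = (if f = [] then (if g = [] then \<one>\<^bsub>C2\<^esub> else \<zero>\<^bsub>C2\<^esub>)
    else if g = [] then \<zero>\<^bsub>C2\<^esub> else eps2 (word f) (word g))"

lemma \<omega>_simps [simp]:
  "\<omega> [] [] = \<one>\<^bsub>C2\<^esub>" "g \<noteq> [] \<Longrightarrow> \<omega> [] g = \<zero>\<^bsub>C2\<^esub>" "f \<noteq> [] \<Longrightarrow> \<omega> f [] = \<zero>\<^bsub>C2\<^esub>"
  by (simp_all add: \<omega>_def)

lemma \<omega>_eps2: "f \<noteq> [] \<Longrightarrow> g \<noteq> [] \<Longrightarrow> \<omega> f g = eps2 (word f) (word g)"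
  by (simp add: \<omega>_def)

lemma \<omega>_closed [simp]: "f \<in> words \<Longrightarrow> g \<in> words \<Longrightarrow> \<omega> f g \<in> carrier C2"
  by (simp add: \<omega>_def)

lemma \<omega>_commute: "f \<in> words \<Longrightarrow> g \<in> words \<Longrightarrow> \<omega> f g = \<omega> g f"
  by (simp add: \<omega>_def eps2_commute)

section \<open>The 2-cocycle identity\<close>

definition "\<omega>_shuf u v h = msum C2 (\<lambda>w. \<omega> w h) (shuf u v)"

lemma \<omega>_shuf_closed [simp]: "\<omega>_shuf u v h \<in> carrier C2"
  by (simp add: \<omega>_shuf_def)

lemma \<omega>_shuf_commute: "\<omega>_shuf u v h = \<omega>_shuf v u h"
  by (simp add: \<omega>_shuf_def shuf_commute)

lemma \<omega>_shuf_Nil [simp]: "v \<in> words \<Longrightarrow> h \<in> words \<Longrightarrow> \<omega>_shuf [] v h = \<omega> v h"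
  "v \<in> words \<Longrightarrow> h \<in> words \<Longrightarrow> \<omega>_shuf v [] h = \<omega> v h"
  by (simp_all add: \<omega>_shuf_def)

lemma \<omega>_shuf_Nil3: "u \<noteq> [] \<or> v \<noteq> [] \<Longrightarrow> \<omega>_shuf u v [] = \<zero>\<^bsub>C2\<^esub>"
  unfolding \<omega>_shuf_def
proof (rule C2.M.msum_zero)
  fix w assume "u \<noteq> [] \<or> v \<noteq> []" "w \<in># shuf u v"
  then have "w \<noteq> []" using shuf_ne_Nil by blast
  then show "\<omega> w [] = \<zero>\<^bsub>C2\<^esub>" by simp
qed

lemma \<omega>_shuf_eps2:
  assumes u: "u \<in> words" "v \<in> words" "u \<noteq> [] \<or> v \<noteq> []" and h: "h \<in> words" "h \<noteq> []"
  shows "\<omega>_shuf u v h = eps2 (shuf_sum u v) (word h)"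
proof -
  interpret P: module C T_pos by (rule T_pos_module)
  have w: "w \<in> words" "w \<noteq> []" if "w \<in># shuf u v" for w
    using shuf_in_lists[OF u(1,2) that] shuf_ne_Nil[OF that] u by auto
  \<comment> \<open>\<open>eps2\<close> is linear on \<open>T_pos\<close> only, so the sum has to be
    read in that module before it is pulled out.\<close>
  have s: "shuf_sum u v = msum T_pos word (shuf u v)"
  proof -
    have "(\<lambda>x. x) (msum T_pos word (shuf u v)) = msum TA word (shuf u v)"
      by (rule linear_map_msum[OF T_pos_module TA_module linear_mapI]) (simp_all add: w)
    then show ?thesis by (simp add: shuf_sum_def)
  qed
  have "linear_map C T_pos C2 (\<lambda>t. eps2 t (word h))"
    using h by (intro bilinear_mapD(2)[OF eps2_bilinear]) simp
  from linear_map_msum[OF T_pos_module C2'(1) this, of "shuf u v" word] w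
  have "eps2 (shuf_sum u v) (word h) = msum C2 (\<lambda>w. eps2 (word w) (word h)) (shuf u v)"
    by (simp add: s)
  also have "\<dots> = \<omega>_shuf u v h"
    unfolding \<omega>_shuf_def by (rule C2.M.msum_cong) (simp add: \<omega>_eps2 w h)
  finally show ?thesis by simp
qed

text \<open>The convolution of \<open>\<omega>\<close> on the tails of \<open>f\<close> and
  \<open>g\<close> with \<open>\<omega>\<close> on the product of their heads and \<open>h\<close>:
  one side of the cocycle identity. By symmetry the other side is the same expression for
  \<open>g\<close>, \<open>h\<close>, \<open>f\<close>.\<close>

definition "\<zeta> f g h = msum C2 (\<lambda>(f2, g2, w). \<omega> f2 g2 \<otimes>\<^bsub>C2\<^esub> \<omega> w h) (twist f g)"

lemma \<zeta>_splits:
  assumes f: "f \<in> words" and g: "g \<in> words" and h: "h \<in> words"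
  shows "\<zeta> f g h = msum C2 (\<lambda>(f1, f2). msum C2 (\<lambda>(g1, g2). \<omega> f2 g2 \<otimes>\<^bsub>C2\<^esub> \<omega>_shuf f1 g1 h) (splits g)) (splits f)"
  unfolding \<zeta>_def C2.M.msum_twist case_prod_unfold
proof (intro C2.M.msum_cong)
  fix p q assume p: "p \<in># splits f" and q: "q \<in># splits g"
  have w: "fst p \<in> words" "snd p \<in> words" "fst q \<in> words" "snd q \<in> words"
    using splits_in_lists[OF f, of "fst p" "snd p"] splits_in_lists[OF g, of "fst q" "snd q"] p q by simp_all
  have "linear_map C C2 C2 (\<lambda>z. \<omega> (snd p) (snd q) \<otimes>\<^bsub>C2\<^esub> z)"
    using w by (intro bilinear_mapD(1)[OF C2'(3)]) simp
  from linear_map_msum[OF C2'(1) C2'(1) this, of "shuf (fst p) (fst q)" "\<lambda>w. \<omega> w h"]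
  show "msum C2 (\<lambda>w. \<omega> (fst (snd p, snd q, w)) (fst (snd (snd p, snd q, w))) \<otimes>\<^bsub>C2\<^esub> \<omega> (snd (snd (snd p, snd q, w))) h) (shuf (fst p) (fst q)) =
    \<omega> (snd p) (snd q) \<otimes>\<^bsub>C2\<^esub> \<omega>_shuf (fst p) (fst q) h"
    using shuf_in_lists[OF w(1,3)] h by (simp add: \<omega>_shuf_def)
qed

text \<open>\<open>\<omega> [] g2\<close> is zero unless \<open>g2\<close> is empty, so a single cut
  of \<open>g\<close> remains.\<close>

lemma \<zeta>_Nil1:
  assumes g: "g \<in> words" and h: "h \<in> words"
  shows "\<zeta> [] g h = \<omega> g h"
proof -
  have "\<zeta> [] g h = msum C2 (\<lambda>(g1, g2). \<omega> [] g2 \<otimes>\<^bsub>C2\<^esub> \<omega>_shuf [] g1 h) (splits g)"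
    using g h by (simp add: \<zeta>_splits case_prod_unfold)
  also have "\<dots> = \<omega> [] [] \<otimes>\<^bsub>C2\<^esub> \<omega>_shuf [] g h"
    using g h by (intro C2.M.msum_splits) simp_all
  finally show ?thesis using g h by simp
qed

lemma \<zeta>_commute:
  assumes "f \<in> words" "g \<in> words"
  shows "\<zeta> f g h = \<zeta> g f h"
proof -
  have "\<zeta> g f h = msum C2 (\<lambda>(f2, g2, w). \<omega> g2 f2 \<otimes>\<^bsub>C2\<^esub> \<omega> w h) (twist f g)"
    unfolding \<zeta>_def twist_commute[of g f] by (simp add: case_prod_unfold)
  also have "\<dots> = \<zeta> f g h"
    unfolding \<zeta>_def
  proof (rule C2.M.msum_cong)
    fix p assume "p \<in># twist f g"
    then show "(case p of (f2, g2, w) \<Rightarrow> \<omega> g2 f2 \<otimes>\<^bsub>C2\<^esub> \<omega> w h) = (case p of (f2, g2, w) \<Rightarrow> \<omega> f2 g2 \<otimes>\<^bsub>C2\<^esub> \<omega> w h)"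
      using twist_in_lists[OF assms, of "fst p" "fst (snd p)" "snd (snd p)"] \<omega>_commute[of "fst p" "fst (snd p)"]
      by (simp add: case_prod_unfold)
  qed
  finally show ?thesis by simp
qed

text \<open>With an empty last argument \<open>\<omega>_shuf\<close> is zero as soon as a head is
  nonempty, so only the cuts that put everything into the tails remain.\<close>

lemma \<zeta>_Nil3:
  assumes f: "f \<in> words" and g: "g \<in> words"
  shows "\<zeta> f g [] = \<omega> f g"
proof -
  let ?F = "\<lambda>f1 f2 g1 g2. \<omega> f2 g2 \<otimes>\<^bsub>C2\<^esub> \<omega>_shuf f1 g1 []"
  have z: "?F f1 f2 g1 g2 = \<zero>\<^bsub>C2\<^esub>" if "f1 \<noteq> [] \<or> g1 \<noteq> []" "f2 \<in> words" "g2 \<in> words" for f1 f2 g1 g2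
    using that by (simp add: \<omega>_shuf_Nil3)
  \<comment> \<open>The counterpart of \<open>msum_splits\<close>: here the cut with empty head is
    isolated.\<close>
  have s: "msum C2 (\<lambda>(v1, v2). G v1 v2) (splits v) = G [] v"
    if "v \<in> words" "\<And>v1 v2. v1 \<noteq> [] \<Longrightarrow> v2 \<in> words \<Longrightarrow> G v1 v2 = \<zero>\<^bsub>C2\<^esub>" "G [] v \<in> carrier C2" for G v
  proof (cases v)
    case Nil
    then show ?thesis using that(3) by simp
  next
    case (Cons a u)
    have "msum C2 (\<lambda>p. G (a # fst p) (snd p)) (splits u) = \<zero>\<^bsub>C2\<^esub>"
    proof (rule C2.M.msum_zero)
      fix p assume "p \<in># splits u"
      then show "G (a # fst p) (snd p) = \<zero>\<^bsub>C2\<^esub>"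
        using splits_in_lists[of u "carrier RT" "fst p" "snd p"] that(1) Cons
        by (intro that(2)) simp_all
    qed
    then show ?thesis using Cons that(3) by (simp add: case_prod_unfold)
  qed
  have "\<zeta> f g [] = msum C2 (\<lambda>(f1, f2). msum C2 (\<lambda>(g1, g2). ?F f1 f2 g1 g2) (splits g)) (splits f)"
    using f g by (simp add: \<zeta>_splits)
  also have "\<dots> = msum C2 (\<lambda>(g1, g2). ?F [] f g1 g2) (splits g)"
  proof (rule s[OF f])
    fix f1 f2 :: "'a list" assume f1: "f1 \<noteq> []" "f2 \<in> words"
    show "msum C2 (\<lambda>(g1, g2). ?F f1 f2 g1 g2) (splits g) = \<zero>\<^bsub>C2\<^esub>"
    proof (rule C2.M.msum_zero)
      fix p assume "p \<in># splits g"
      then show "(case p of (g1, g2) \<Rightarrow> ?F f1 f2 g1 g2) = \<zero>\<^bsub>C2\<^esub>"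
        using z[of f1 "fst p" f2 "snd p"] f1 splits_in_lists[OF g, of "fst p" "snd p"]
        by (simp add: case_prod_unfold)
    qed
  qed simp
  also have "\<dots> = ?F [] f [] g"
    by (rule s[OF g]) (use f g z in simp_all)
  finally show ?thesis using f g by (simp add: \<omega>_shuf_def)
qed

text \<open>The cuts are sorted by their tails: both empty gives the first term, exactly one empty
  gives zero, and none empty gives the summands of \<open>J2_left\<close>.\<close>

lemma \<zeta>_ne_Nil:
  assumes f: "f \<in> words" "f \<noteq> []" and g: "g \<in> words" "g \<noteq> []" and h: "h \<in> words" "h \<noteq> []"
  shows "\<zeta> f g h = eps2 (shuf_sum f g) (word h) \<oplus>\<^bsub>C2\<^esub> msum C2 (\<lambda>j. pr2 (J2_left f g h j)) (mset_set {..<length g})"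
proof -
  let ?F = "\<lambda>f1 f2 g1 g2. \<omega> f2 g2 \<otimes>\<^bsub>C2\<^esub> \<omega>_shuf f1 g1 h"
  let ?G = "\<lambda>j i. ?F (take i f) (drop i f) (take j g) (drop j g)"
  let ?n = "mset_set {..<length f}" and ?m = "mset_set {..<length g}"
  have cl: "?G j i \<in> carrier C2" for i j using f g by simp
  \<comment> \<open>The relations have the cuts of \<open>g\<close> as their outer sum; exchanging
    the arguments puts these cuts outside here as well.\<close>
  have "\<zeta> f g h = \<zeta> g f h" by (rule \<zeta>_commute[OF f(1) g(1)])
  also have "\<dots> = msum C2 (\<lambda>(g1, g2). msum C2 (\<lambda>(f1, f2). ?F f1 f2 g1 g2) (splits f)) (splits g)"
    unfolding \<zeta>_splits[OF g(1) f(1) h(1)] case_prod_unfold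
  proof (intro C2.M.msum_cong)
    fix p q assume "p \<in># splits g" "q \<in># splits f"
    then show "\<omega> (snd p) (snd q) \<otimes>\<^bsub>C2\<^esub> \<omega>_shuf (fst p) (fst q) h = \<omega> (snd q) (snd p) \<otimes>\<^bsub>C2\<^esub> \<omega>_shuf (fst q) (fst p) h"
      using splits_in_lists[OF f(1), of "fst q" "snd q"] splits_in_lists[OF g(1), of "fst p" "snd p"]
        \<omega>_commute[of "snd p" "snd q"] \<omega>_shuf_commute[of "fst p" "fst q" h] by simp
  qed
  also have "\<dots> = msum C2 (\<lambda>(f1, f2). ?F f1 f2 g []) (splits f) \<oplus>\<^bsub>C2\<^esub>
      msum C2 (\<lambda>j. msum C2 (\<lambda>(f1, f2). ?F f1 f2 (take j g) (drop j g)) (splits f)) ?m"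
    by (simp add: splits_take_drop[of g])
  also have "msum C2 (\<lambda>(f1, f2). ?F f1 f2 g []) (splits f) = ?F f [] g []"
    by (rule C2.M.msum_splits) simp_all
  also have "?F f [] g [] = eps2 (shuf_sum f g) (word h)"
    using f g h by (simp add: \<omega>_shuf_eps2)
  also have "msum C2 (\<lambda>j. msum C2 (\<lambda>(f1, f2). ?F f1 f2 (take j g) (drop j g)) (splits f)) ?m =
      msum C2 (\<lambda>j. pr2 (J2_left f g h j)) ?m"
  proof (rule C2.M.msum_cong)
    fix j assume "j \<in># ?m"
    then have j: "j < length g" by simp
    then have dj: "drop j g \<noteq> []" by simp
    have "msum C2 (\<lambda>(f1, f2). ?F f1 f2 (take j g) (drop j g)) (splits f) = msum C2 (?G j) ?n"
      using f g dj by (simp add: splits_take_drop[of f] del: drop_eq_Nil)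
    also have "\<dots> = msum C2 (?G j) (mset_set {1 - j..<length f})"
    \<comment> \<open>For \<open>j = 0\<close> the range on the right starts at 1. The extra term at
      0 vanishes, since both heads are empty and \<open>\<omega> [] h\<close> is zero.\<close>
    proof (cases "j = 0")
      case True
      have "{..<length f} = insert 0 {1..<length f}" using f(2) by (auto simp: Suc_le_eq)
      then have "?n = add_mset 0 (mset_set {1..<length f})" by simp
      moreover have "?G 0 0 = \<zero>\<^bsub>C2\<^esub>" using f g h by (simp add: \<omega>_def[of "[]"])
      ultimately show ?thesis using True cl[of 0 0] by simp
    qed (simp add: lessThan_atLeast0)
    also have "\<dots> = pr2 (J2_left f g h j)"
    proof -
      let ?X = "\<lambda>i. epsS (word (drop i f)) (word (drop j g)) \<otimes>\<^bsub>S2\<^esub>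
        epsS (word (take i f) \<otimes>\<^bsub>TT\<^esub> word (take j g)) (word h)"
      note Jc = J2_summand_closed[OF f(1) g(1) h j]
      have "pr2 (J2_left f g h j) = msum C2 (\<lambda>i. pr2 (?X i)) (mset_set {1 - j..<length f})"
        unfolding J2_left_def using Jc
        by (subst S2.M.finsum_msum)
          (simp_all, intro linear_map_msum[OF S2'(1) C2'(1) pr2_linear], simp)
      also have "\<dots> = msum C2 (?G j) (mset_set {1 - j..<length f})"
      proof (rule C2.M.msum_cong)
        fix i assume "i \<in># mset_set {1 - j..<length f}"
        then have i: "i \<in> {1 - j..<length f}" by simp
        then have di: "drop i f \<noteq> []" "take i f \<noteq> [] \<or> take j g \<noteq> []" using f g by auto
        have "pr2 (?X i) = eps2 (word (drop i f)) (word (drop j g)) \<otimes>\<^bsub>C2\<^esub>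
            eps2 (word (take i f) \<otimes>\<^bsub>TT\<^esub> word (take j g)) (word h)"
          unfolding eps2_pr2 by (rule pr2_mult[OF Jc(1,2)[OF i]])
        then show "pr2 (?X i) = ?G j i"
          using f g h by (simp add: \<omega>_eps2[OF di(1) dj] \<omega>_shuf_eps2[OF _ _ di(2)] shuffle_word)
      qed
      finally show ?thesis by simp
    qed
    finally show "msum C2 (\<lambda>(f1, f2). ?F f1 f2 (take j g) (drop j g)) (splits f) = pr2 (J2_left f g h j)" .
  qed
  finally show ?thesis .
qed

text \<open>\<open>epsS\<close> is symmetric and \<open>S2\<close> commutative, so the second inner
  sum of a relation is the first one for the words in reverse order.\<close>

lemma J2_right_left:
  assumes "f \<in> words" "g \<in> words" "h \<in> words" "f \<noteq> []" "g \<noteq> []" "h \<noteq> []" "j < length g"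
  shows "pr2 (J2_right f g h j) = pr2 (J2_left h g f j)"
proof -
  let ?X = "\<lambda>i. epsS (word (drop i h)) (word (drop j g)) \<otimes>\<^bsub>S2\<^esub>
        epsS (word (take i h) \<otimes>\<^bsub>TT\<^esub> word (take j g)) (word f)"
  let ?Y = "\<lambda>k. epsS (word f) (word (take j g) \<otimes>\<^bsub>TT\<^esub> word (take k h)) \<otimes>\<^bsub>S2\<^esub>
      epsS (word (drop j g)) (word (drop k h))"
  note Jc = J2_summand_closed[OF assms(3,2,1,4,7)]
  have "?X i = ?Y i" if i: "i \<in> {1 - j..<length h}" for i
  proof -
    from i assms have ne: "drop i h \<noteq> []" "drop j g \<noteq> []" "take i h \<noteq> [] \<or> take j g \<noteq> []" by auto
    have 1: "epsS (word (drop i h)) (word (drop j g)) = epsS (word (drop j g)) (word (drop i h))"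
      using ne assms unfolding epsS_def by (subst sym_tens_commute[OF T_pos_module]) simp_all
    have 2: "epsS (shuf_sum (take i h) (take j g)) (word f) = epsS (word f) (shuf_sum (take i h) (take j g))"
      using ne(3) assms shuf_sum_pos_part[OF _ _ ne(3)] unfolding epsS_def
      by (subst sym_tens_commute[OF T_pos_module]) simp_all
    show ?thesis
      using Jc[OF i] assms(1-3) 1 2
      by (simp add: shuffle_word shuf_sum_commute[of "take j g"] S2.m_comm)
  qed
  then have "J2_right f g h j = J2_left h g f j"
    unfolding J2_right_def J2_left_def using Jc
    by (intro S2.M.finsum_cong') auto
  then show ?thesis by simp
qed

text \<open>If a word is empty, both sides reduce to the same value of \<open>\<omega>\<close> by
  symmetry. Otherwise their difference is the class of \<open>J2_gen f g h\<close>, which is zero in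
  \<open>C2\<close>.\<close>

lemma \<zeta>_rotate:
  assumes w: "f \<in> words" "g \<in> words" "h \<in> words"
  shows "\<zeta> f g h = \<zeta> g h f"
proof (cases "f = [] \<or> g = [] \<or> h = []")
  case True
  then show ?thesis
    using w \<zeta>_Nil1[of g h] \<zeta>_Nil1[of f h] \<zeta>_Nil1[of h f] \<zeta>_Nil3[of g h] \<zeta>_Nil3[of f g] \<zeta>_Nil1[of g f]
      \<zeta>_commute[of f "[]" h] \<zeta>_commute[of g "[]" f] \<omega>_commute[of f g] \<omega>_commute[of f h]
    by auto
next
  case False
  then have ne: "f \<noteq> []" "g \<noteq> []" "h \<noteq> []" by auto
  let ?m = "mset_set {..<length g}"
  let ?a = "eps2 (shuf_sum f g) (word h)" and ?b = "eps2 (word f) (shuf_sum g h)"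
  let ?L = "msum C2 (\<lambda>j. pr2 (J2_left f g h j)) ?m" and ?R = "msum C2 (\<lambda>j. pr2 (J2_right f g h j)) ?m"
  have lc: "J2_left f g h j \<in> carrier S2" "J2_right f g h j \<in> carrier S2" if "j < length g" for j
    using J2_left_closed[OF w ne(3) that] J2_left_closed[OF w(3,2,1) ne(1) that] by simp_all
  note p = linear_mapD[OF pr2_linear] linear_map_minus[OF S2'(1) C2'(1) pr2_linear]
  have cl: "?a \<in> carrier C2" "?b \<in> carrier C2" "?L \<in> carrier C2" "?R \<in> carrier C2"
    using w ne by simp_all
  have "pr2 (J2_gen f g h) = \<zero>\<^bsub>C2\<^esub>"
    using coset_zero_iff[OF S2'(1) J2_submodule J2_gen_closed[OF w ne]] J2_gen_J2[OF w ne]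
    by (simp add: pr2_def C2_def quot_module_simps(3))
  moreover have "pr2 (\<Oplus>\<^bsub>S2\<^esub>j\<in>{..<length g}. J2_left f g h j \<ominus>\<^bsub>S2\<^esub> J2_right f g h j) =
      msum C2 (\<lambda>j. pr2 (J2_left f g h j) \<ominus>\<^bsub>C2\<^esub> pr2 (J2_right f g h j)) ?m"
  proof -
    have "pr2 (\<Oplus>\<^bsub>S2\<^esub>j\<in>{..<length g}. J2_left f g h j \<ominus>\<^bsub>S2\<^esub> J2_right f g h j) =
      msum C2 (\<lambda>j. pr2 (J2_left f g h j \<ominus>\<^bsub>S2\<^esub> J2_right f g h j)) ?m"
      using lc by (subst S2.M.finsum_msum)
        (simp_all, intro linear_map_msum[OF S2'(1) C2'(1) pr2_linear], simp)
    also have "\<dots> = msum C2 (\<lambda>j. pr2 (J2_left f g h j) \<ominus>\<^bsub>C2\<^esub> pr2 (J2_right f g h j)) ?m"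
      by (rule C2.M.msum_cong) (simp add: p lc)
    finally show ?thesis .
  qed
  moreover have "msum C2 (\<lambda>j. pr2 (J2_left f g h j) \<ominus>\<^bsub>C2\<^esub> pr2 (J2_right f g h j)) ?m = ?L \<ominus>\<^bsub>C2\<^esub> ?R"
  proof -
    have "msum C2 (\<lambda>j. \<ominus>\<^bsub>C2\<^esub> pr2 (J2_right f g h j)) ?m = \<ominus>\<^bsub>C2\<^esub> ?R"
      by (rule linear_map_msum[OF C2'(1) C2'(1) linear_map_uminus[OF C2'(1) linear_map_id], symmetric])
        (simp add: p lc)
    moreover have "msum C2 (\<lambda>j. pr2 (J2_left f g h j) \<oplus>\<^bsub>C2\<^esub> \<ominus>\<^bsub>C2\<^esub> pr2 (J2_right f g h j)) ?m =
        ?L \<oplus>\<^bsub>C2\<^esub> msum C2 (\<lambda>j. \<ominus>\<^bsub>C2\<^esub> pr2 (J2_right f g h j)) ?m"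
      by (rule C2.M.msum_add) (simp_all add: p lc)
    ultimately show ?thesis by (simp add: a_minus_def)
  qed
  moreover have "pr2 (J2_gen f g h) = ?a \<ominus>\<^bsub>C2\<^esub> ?b \<oplus>\<^bsub>C2\<^esub>
      pr2 (\<Oplus>\<^bsub>S2\<^esub>j\<in>{..<length g}. J2_left f g h j \<ominus>\<^bsub>S2\<^esub> J2_right f g h j)"
  proof -
    have "(\<Oplus>\<^bsub>S2\<^esub>j\<in>{..<length g}. J2_left f g h j \<ominus>\<^bsub>S2\<^esub> J2_right f g h j) \<in> carrier S2"
      by (intro S2.M.finsum_closed Pi_I S2.M.minus_closed) (simp_all add: lc)
    then show ?thesis using w ne by (simp add: J2_gen_alt p eps2_pr2 shuffle_word)
  qed
  ultimately have "?a \<ominus>\<^bsub>C2\<^esub> ?b \<oplus>\<^bsub>C2\<^esub> (?L \<ominus>\<^bsub>C2\<^esub> ?R) = \<zero>\<^bsub>C2\<^esub>" by simp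
  then have "(?a \<oplus>\<^bsub>C2\<^esub> ?L) \<ominus>\<^bsub>C2\<^esub> (?b \<oplus>\<^bsub>C2\<^esub> ?R) = \<zero>\<^bsub>C2\<^esub>"
    using C2.add_diff_exchange[OF cl] by simp
  then have "?a \<oplus>\<^bsub>C2\<^esub> ?L = ?b \<oplus>\<^bsub>C2\<^esub> ?R"
    by (rule abelian_group_eqI[OF C2.M.abelian_group_axioms]) (simp_all add: cl)
  moreover have "\<zeta> f g h = ?a \<oplus>\<^bsub>C2\<^esub> ?L" by (rule \<zeta>_ne_Nil[OF w(1) ne(1) w(2) ne(2) w(3) ne(3)])
  moreover have "\<zeta> g h f = ?b \<oplus>\<^bsub>C2\<^esub> ?R"
  proof -
    \<comment> \<open>In this order \<open>g\<close> is again the middle word, so that both sides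
      have the cuts of \<open>g\<close> as outer index.\<close>
    have "\<zeta> g h f = \<zeta> h g f" by (rule \<zeta>_commute[OF w(2,3)])
    also have "\<dots> = eps2 (shuf_sum h g) (word f) \<oplus>\<^bsub>C2\<^esub> msum C2 (\<lambda>j. pr2 (J2_left h g f j)) ?m"
      by (rule \<zeta>_ne_Nil[OF w(3) ne(3) w(2) ne(2) w(1) ne(1)])
    also have "msum C2 (\<lambda>j. pr2 (J2_left h g f j)) ?m = ?R"
      by (rule C2.M.msum_cong) (simp add: J2_right_left[OF w ne])
    also have "eps2 (shuf_sum h g) (word f) = ?b"
      using w ne by (simp add: eps2_commute shuf_sum_commute[of h g])
    finally show ?thesis .
  qed
  ultimately show ?thesis by simp
qed

end

section \<open>Indices of triple products and multilinearity over cuts\<close>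

definition "twist3 f g h = (\<Sum>(f1, f2)\<in>#splits f. \<Sum>(g1, g2)\<in>#splits g. \<Sum>(h1, h2)\<in>#splits h.
  image_mset (\<lambda>v. (f2, g2, h2, v)) (\<Sum>w\<in>#shuf f1 g1. shuf w h1))"

lemma twist3_in_lists:
  assumes "f \<in> lists A" "g \<in> lists A" "h \<in> lists A" "(u, v, w, x) \<in># twist3 f g h"
  shows "u \<in> lists A" "v \<in> lists A" "w \<in> lists A" "x \<in> lists A"
proof -
  from assms(4) obtain f1 g1 h1 y where s: "(f1, u) \<in># splits f" "(g1, v) \<in># splits g" "(h1, w) \<in># splits h"
    "y \<in># shuf f1 g1" "x \<in># shuf y h1"
    unfolding twist3_def by auto
  note 1 = splits_in_lists[OF assms(1) s(1)] splits_in_lists[OF assms(2) s(2)] splits_in_lists[OF assms(3) s(3)]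
  then have "y \<in> lists A" using shuf_in_lists s(4) by blast
  then show "u \<in> lists A" "v \<in> lists A" "w \<in> lists A" "x \<in> lists A"
    using 1 shuf_in_lists s(5) by blast+
qed

text \<open>The multiset of triple interleavings does not depend on the order of the three heads, by
  associativity and commutativity of \<open>shuf\<close>.\<close>

lemma twist3_rotate:
  fixes f g h :: "'a list"
  shows "twist3 g h f = image_mset (\<lambda>(f2, g2, h2, v). (g2, h2, f2, v)) (twist3 f g h)"
proof -
  have s: "(\<Sum>w\<in>#shuf g1 h1. image_mset k (shuf w f1)) = (\<Sum>w\<in>#shuf f1 g1. image_mset k (shuf w h1))"
    for f1 g1 h1 and k :: "'a list \<Rightarrow> 'a list \<times> 'a list \<times> 'a list \<times> 'a list"
    unfolding image_mset_sum_mset[symmetric] by (simp add: shuf_assoc shuf_commute[of _ f1])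
  show ?thesis
    unfolding twist3_def case_prod_unfold
    by (subst sum_swap3, simp add: image_mset_sum_mset image_mset.compositionality o_def)
      (intro sum_mset_cong s)
qed

lemma multilinear_cong:
  assumes M: "module K M" and \<phi>: "multilinear K M P \<phi>"
    and eq: "\<And>f. f \<in> lists (carrier M) \<Longrightarrow> \<psi> f = \<phi> f"
  shows "multilinear K M P \<psi>"
proof (rule multilinearI)
  show "\<psi> f \<in> carrier P" if "f \<in> lists (carrier M)" for f
    using that by (simp add: eq multilinearD(1)[OF \<phi>])
  show "linear_map K M P (\<lambda>x. \<psi> (f @ x # g))" if "f \<in> lists (carrier M)" "g \<in> lists (carrier M)" for f g
    by (rule linear_map_cong[OF M multilinearD(2)[OF \<phi> that]]) (use that in \<open>simp add: eq\<close>)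
qed

lemma multilinear_msum:
  assumes P: "module K P" and \<phi>: "\<And>x. x \<in># A \<Longrightarrow> multilinear K M P (\<phi> x)"
  shows "multilinear K M P (\<lambda>f. msum P (\<lambda>x. \<phi> x f) A)"
proof (rule multilinearI)
  interpret P: module K P by fact
  show "msum P (\<lambda>x. \<phi> x f) A \<in> carrier P" for f by simp
qed (intro msum_linear_map[OF P] multilinearD(2)[OF \<phi>])

text \<open>In every cut the variable letter lies either in the head or in the tail, where
  \<open>h\<close> is linear in it by \<open>l\<close> or \<open>r\<close>.\<close>

lemma multilinear_splits:
  assumes M: "module K M" and P: "module K P"
    and l: "\<And>v. v \<in> lists (carrier M) \<Longrightarrow> multilinear K M P (\<lambda>u. h u v)"
    and r: "\<And>u. u \<in> lists (carrier M) \<Longrightarrow> multilinear K M P (h u)"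
  shows "multilinear K M P (\<lambda>f. msum P (\<lambda>(u, v). h u v) (splits f))"
proof (rule multilinearI)
  interpret P: module K P by fact
  show "msum P (\<lambda>(u, v). h u v) (splits f) \<in> carrier P" for f by simp
  fix f g assume "f \<in> lists (carrier M)" and g: "g \<in> lists (carrier M)"
  then show "linear_map K M P (\<lambda>x. msum P (\<lambda>(u, v). h u v) (splits (f @ x # g)))"
    using l r
  proof (induction f arbitrary: h)
    case Nil
    have "linear_map K M P (\<lambda>x. h [] (x # g) \<oplus>\<^bsub>P\<^esub> msum P (\<lambda>p. h (x # fst p) (snd p)) (splits g))"
    proof (intro linear_map_add P msum_linear_map)
      show "linear_map K M P (\<lambda>x. h [] (x # g))"
        by (rule multilinear_head[OF Nil(3) g]) simp
      fix p assume "p \<in># splits g"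
      then have "fst p \<in> lists (carrier M)" "snd p \<in> lists (carrier M)"
        using splits_in_lists[OF g, of "fst p" "snd p"] by simp_all
      then show "linear_map K M P (\<lambda>x. h (x # fst p) (snd p))"
        by (intro multilinear_head[OF Nil(2)])
    qed
    moreover have c: "h [] (x # g) \<in> carrier P" if "x \<in> carrier M" for x
      using multilinearD(1)[OF Nil(3), of "[]" "x # g"] that g by simp
    ultimately show ?case
      by (elim linear_map_cong[OF M]) (simp add: case_prod_unfold c)
  next
    case (Cons a f)
    have "linear_map K M P (\<lambda>x. h [] (a # f @ x # g) \<oplus>\<^bsub>P\<^esub> msum P (\<lambda>(u, v). h (a # u) v) (splits (f @ x # g)))"
    proof (intro linear_map_add P)
      show "linear_map K M P (\<lambda>x. h [] (a # f @ x # g))"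
        using multilinearD(2)[OF Cons.prems(3), of "[]" "a # f" g] Cons(1,2) g by simp
      show "linear_map K M P (\<lambda>x. msum P (\<lambda>(u, v). h (a # u) v) (splits (f @ x # g)))"
      proof (rule Cons.IH)
        show "multilinear K M P (\<lambda>u. h (a # u) v)" if "v \<in> lists (carrier M)" for v
          by (rule multilinear_tail[OF Cons.prems(2)[OF that] Cons.hyps(1)])
        show "multilinear K M P (h (a # u))" if "u \<in> lists (carrier M)" for u
          using Cons.hyps(1) that by (intro Cons.prems(3)) simp
      qed (rule g)
    qed
    moreover have c: "h [] (a # f @ x # g) \<in> carrier P" if "x \<in> carrier M" for x
      using multilinearD(1)[OF Cons.prems(3), of "[]" "a # f @ x # g"] that g Cons(1,2) by simp
    ultimately show ?case
      by (elim linear_map_cong[OF M]) (simp add: case_prod_unfold c)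
  qed
qed

context quasi_integration
begin

lemma \<omega>_multilinear: "g \<in> words \<Longrightarrow> multilinear C RT C2 (\<lambda>f. \<omega> f g)"
proof (rule multilinearI)
  interpret C2: algebra C C2 by (rule C2_algebra)
  fix f f' assume w: "g \<in> words" "f \<in> words" "f' \<in> words"
  then show "\<omega> f g \<in> carrier C2" by simp
  show "linear_map C RT C2 (\<lambda>x. \<omega> (f @ x # f') g)"
  proof (cases "g = []")
    case True
    then show ?thesis using linear_map_const_zero[OF C2'(1)] by simp
  next
    case False
    have "linear_map C RT C2 (\<lambda>x. eps2 (word (f @ x # f')) (word g))"
      using w False
      by (intro bilinear_map_compose_left[OF eps2_bilinear] linear_map_T_pos word_lin_middle) simp_all
    then show ?thesis using False by (simp add: \<omega>_eps2)
  qed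
qed

section \<open>The twisted product\<close>

lemma CT_module_module: "module C CT_module"
  unfolding CT_module_def by (rule tensor_prod_module[OF C2'(1) TT_module])

lemma tensCT_bilinear: "bilinear_map C C2 TA CT_module tensCT"
  using tens_bilinear[OF C2'(1) TT_module]
  by (simp add: bilinear_map_def CT_module_def tensCT_def[abs_def] linear_map_TT)

lemma tensCT_closed [simp]: "c \<in> carrier C2 \<Longrightarrow> t \<in> carrier TA \<Longrightarrow> tensCT c t \<in> carrier CT_module"
  by (rule bilinear_map_closed[OF tensCT_bilinear])

lemma tensCT_lin1: "t \<in> carrier TA \<Longrightarrow> linear_map C L C2 f \<Longrightarrow> linear_map C L CT_module (\<lambda>x. tensCT (f x) t)"
  by (rule bilinear_map_compose_left[OF tensCT_bilinear])

lemma tensCT_lin2: "c \<in> carrier C2 \<Longrightarrow> linear_map C L TA f \<Longrightarrow> linear_map C L CT_module (\<lambda>x. tensCT c (f x))"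
  by (rule bilinear_map_compose_right[OF tensCT_bilinear])

abbreviation "CT_gens \<equiv> carrier C2 \<times> words"

abbreviation "CT_gen \<equiv> \<lambda>(c, f). tensCT c (word f)"

lemma tensCT_spans: "spans C CT_module (CT_gen ` CT_gens)"
proof -
  have "spans C C2 ((\<lambda>x. x) ` carrier C2)" by (simp add: spans_carrier)
  from tens_spans_image[OF C2'(1) this TT_module word_spans'] show ?thesis
    by (simp add: CT_module_def tensCT_def)
qed

lemma tensCT_ext:
  assumes P: "module C P" and l: "\<And>f. f \<in> words \<Longrightarrow> linear_map C C2 P (\<lambda>c. b c f)"
    and m: "\<And>c. c \<in> carrier C2 \<Longrightarrow> multilinear C RT P (b c)"
  shows "lin_ext C CT_module P CT_gen CT_gens (\<lambda>(c, f). b c f)"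
proof -
  have "spans C C2 ((\<lambda>x. x) ` carrier C2)" by (simp add: spans_carrier)
  from tensor_lin_ext[OF C2'(1) this TT_module word_spans' P lin_ext_linear[OF l] word_ext[OF P m]]
  show ?thesis by (simp add: CT_module_def tensCT_def)
qed

interpretation C2: algebra C C2 by (rule C2_algebra)

interpretation CTm: module C CT_module by (rule CT_module_module)

lemma tensCT_zero [simp]: "t \<in> carrier TA \<Longrightarrow> tensCT \<zero>\<^bsub>C2\<^esub> t = \<zero>\<^bsub>CT_module\<^esub>"
  by (rule linear_map_zero[OF C2'(1) CT_module_module bilinear_mapD(2)[OF tensCT_bilinear]])

definition "ct_prod c f e g =
  msum CT_module (\<lambda>(f2, g2, w). tensCT (c \<otimes>\<^bsub>C2\<^esub> e \<otimes>\<^bsub>C2\<^esub> \<omega> f2 g2) (word w)) (twist f g)"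

lemma ct_prod_commute:
  assumes "c \<in> carrier C2" "e \<in> carrier C2" "f \<in> words" "g \<in> words"
  shows "ct_prod c f e g = ct_prod e g c f"
proof -
  have "ct_prod e g c f = msum CT_module (\<lambda>(f2, g2, w). tensCT (e \<otimes>\<^bsub>C2\<^esub> c \<otimes>\<^bsub>C2\<^esub> \<omega> g2 f2) (word w)) (twist f g)"
    unfolding ct_prod_def twist_commute[of g f] by (simp add: case_prod_unfold)
  also have "\<dots> = ct_prod c f e g"
    unfolding ct_prod_def
  proof (rule CTm.M.msum_cong)
    fix p assume "p \<in># twist f g"
    then have "fst p \<in> words" "fst (snd p) \<in> words"
      using twist_in_lists[OF assms(3,4), of "fst p" "fst (snd p)" "snd (snd p)"] by simp_all
    then show "(case p of (f2, g2, w) \<Rightarrow> tensCT (e \<otimes>\<^bsub>C2\<^esub> c \<otimes>\<^bsub>C2\<^esub> \<omega> g2 f2) (word w)) =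
        (case p of (f2, g2, w) \<Rightarrow> tensCT (c \<otimes>\<^bsub>C2\<^esub> e \<otimes>\<^bsub>C2\<^esub> \<omega> f2 g2) (word w))"
      using \<omega>_commute[of "fst p" "fst (snd p)"] assms(1,2)
      by (simp add: case_prod_unfold C2.m_comm[of e c])
  qed
  finally show ?thesis by simp
qed

lemma ct_prod_splits:
  assumes c: "c \<in> carrier C2" "e \<in> carrier C2" and f: "f \<in> words" and g: "g \<in> words"
  shows "ct_prod c f e g = msum CT_module (\<lambda>(f1, f2). msum CT_module (\<lambda>(g1, g2).
    tensCT (c \<otimes>\<^bsub>C2\<^esub> e \<otimes>\<^bsub>C2\<^esub> \<omega> f2 g2) (shuf_sum f1 g1)) (splits g)) (splits f)"
  unfolding ct_prod_def CTm.M.msum_twist case_prod_unfold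
proof (intro CTm.M.msum_cong)
  fix p q assume p: "p \<in># splits f" and q: "q \<in># splits g"
  have w: "fst p \<in> words" "snd p \<in> words" "fst q \<in> words" "snd q \<in> words"
    using splits_in_lists[OF f, of "fst p" "snd p"] splits_in_lists[OF g, of "fst q" "snd q"] p q by simp_all
  let ?c = "c \<otimes>\<^bsub>C2\<^esub> e \<otimes>\<^bsub>C2\<^esub> \<omega> (snd p) (snd q)"
  have "linear_map C TA CT_module (tensCT ?c)"
    using w c by (intro bilinear_mapD(1)[OF tensCT_bilinear]) simp
  from linear_map_msum[OF TA_module CT_module_module this, of "shuf (fst p) (fst q)" word]
  show "msum CT_module (\<lambda>w. tensCT (c \<otimes>\<^bsub>C2\<^esub> e \<otimes>\<^bsub>C2\<^esub> \<omega> (fst (snd p, snd q, w)) (fst (snd (snd p, snd q, w))))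
      (word (snd (snd (snd p, snd q, w))))) (shuf (fst p) (fst q)) = tensCT ?c (shuf_sum (fst p) (fst q))"
    using shuf_in_lists[OF w(1,3)] by (simp add: shuf_sum_def)
qed

lemma ct_prod_linear:
  assumes e: "e \<in> carrier C2" and f: "f \<in> words" and g: "g \<in> words"
  shows "linear_map C C2 CT_module (\<lambda>c. ct_prod c f e g)"
  unfolding ct_prod_def case_prod_unfold
proof (rule msum_linear_map[OF CT_module_module])
  fix p assume "p \<in># twist f g"
  then have w: "fst p \<in> words" "fst (snd p) \<in> words" "snd (snd p) \<in> words"
    using twist_in_lists[OF f g, of "fst p" "fst (snd p)" "snd (snd p)"] by simp_all
  show "linear_map C C2 CT_module (\<lambda>c. tensCT (c \<otimes>\<^bsub>C2\<^esub> e \<otimes>\<^bsub>C2\<^esub> \<omega> (fst p) (fst (snd p))) (word (snd (snd p))))"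
    using w e
    by (intro tensCT_lin1 bilinear_map_compose_left[OF C2'(3)] linear_map_id) simp_all
qed

lemma ct_prod_multilinear:
  assumes c: "c \<in> carrier C2" "e \<in> carrier C2" and g: "g \<in> words"
  shows "multilinear C RT CT_module (\<lambda>f. ct_prod c f e g)"
proof -
  let ?h = "\<lambda>u v. msum CT_module (\<lambda>p. tensCT (c \<otimes>\<^bsub>C2\<^esub> e \<otimes>\<^bsub>C2\<^esub> \<omega> v (snd p)) (shuf_sum u (fst p))) (splits g)"
  have w: "fst p \<in> words" "snd p \<in> words" if "p \<in># splits g" for p
    using splits_in_lists[OF g, of "fst p" "snd p"] that by simp_all
  have "multilinear C RT CT_module (\<lambda>f. msum CT_module (\<lambda>(u, v). ?h u v) (splits f))"
  proof (rule multilinear_splits[OF RT_module CT_module_module]; rule multilinear_msum[OF CT_module_module])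
    fix v p assume "v \<in> words" "p \<in># splits g"
    then show "multilinear C RT CT_module (\<lambda>u. tensCT (c \<otimes>\<^bsub>C2\<^esub> e \<otimes>\<^bsub>C2\<^esub> \<omega> v (snd p)) (shuf_sum u (fst p)))"
      using c w by (intro multilinear_compose[OF shuf_sum_multilinear] bilinear_mapD(1)[OF tensCT_bilinear]) simp_all
    show "multilinear C RT CT_module (\<lambda>u. tensCT (c \<otimes>\<^bsub>C2\<^esub> e \<otimes>\<^bsub>C2\<^esub> \<omega> u (snd p)) (shuf_sum v (fst p)))"
      using c w[OF \<open>p \<in># splits g\<close>]
      by (intro multilinear_compose[OF \<omega>_multilinear] tensCT_lin1 bilinear_map_compose_right[OF C2'(3)] linear_map_id)
        simp_all
  qed
  then show ?thesis
    by (rule multilinear_cong[OF RT_module]) (simp add: ct_prod_splits c g case_prod_unfold)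
qed

lemma ct_prod_spec:
  assumes c: "c \<in> carrier C2" "e \<in> carrier C2" and f: "f \<in> words" and g: "g \<in> words"
  shows "ct_prod c f e g = tensCT (c \<otimes>\<^bsub>C2\<^esub> e) (word f \<otimes>\<^bsub>TT\<^esub> word g) \<oplus>\<^bsub>CT_module\<^esub>
      (\<Oplus>\<^bsub>CT_module\<^esub>i\<in>{..<length f}. \<Oplus>\<^bsub>CT_module\<^esub>j\<in>{..<length g}.
        tensCT (c \<otimes>\<^bsub>C2\<^esub> e \<otimes>\<^bsub>C2\<^esub> eps2 (word (drop i f)) (word (drop j g)))
          (word (take i f) \<otimes>\<^bsub>TT\<^esub> word (take j g)))"
proof -
  let ?X = "\<lambda>f1 f2 g1 g2. tensCT (c \<otimes>\<^bsub>C2\<^esub> e \<otimes>\<^bsub>C2\<^esub> \<omega> f2 g2) (shuf_sum f1 g1)"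
  let ?Y = "\<lambda>i j. tensCT (c \<otimes>\<^bsub>C2\<^esub> e \<otimes>\<^bsub>C2\<^esub> eps2 (word (drop i f)) (word (drop j g)))
          (word (take i f) \<otimes>\<^bsub>TT\<^esub> word (take j g))"
  let ?n = "mset_set {..<length f}" and ?m = "mset_set {..<length g}"
  let ?G = "\<lambda>f1 f2. msum CT_module (\<lambda>(g1, g2). ?X f1 f2 g1 g2) (splits g)"
  have "ct_prod c f e g = ?G f [] \<oplus>\<^bsub>CT_module\<^esub> msum CT_module (\<lambda>i. ?G (take i f) (drop i f)) ?n"
    using c f g by (simp add: ct_prod_splits splits_take_drop[of f])
  also have "?G f [] = ?X f [] g []"
    by (rule CTm.M.msum_splits) (use c in simp_all)
  also have "?X f [] g [] = tensCT (c \<otimes>\<^bsub>C2\<^esub> e) (word f \<otimes>\<^bsub>TT\<^esub> word g)"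
    using c f g by (simp add: shuffle_word)
  also have "msum CT_module (\<lambda>i. ?G (take i f) (drop i f)) ?n =
      (\<Oplus>\<^bsub>CT_module\<^esub>i\<in>{..<length f}. \<Oplus>\<^bsub>CT_module\<^esub>j\<in>{..<length g}. ?Y i j)"
  proof -
    have i: "?G (take i f) (drop i f) = (\<Oplus>\<^bsub>CT_module\<^esub>j\<in>{..<length g}. ?Y i j)" if "i \<in># ?n" for i
    proof -
      from that have i: "drop i f \<noteq> []" by simp
      have Y: "?X (take i f) (drop i f) (take j g) (drop j g) = ?Y i j" "?Y i j \<in> carrier CT_module"
        if j: "j < length g" for j
      proof -
        from j have "drop j g \<noteq> []" by simp
        then show "?X (take i f) (drop i f) (take j g) (drop j g) = ?Y i j" "?Y i j \<in> carrier CT_module"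
          using i c f g by (simp_all add: \<omega>_eps2 shuffle_word del: drop_eq_Nil)
      qed
      have "?G (take i f) (drop i f) = msum CT_module (\<lambda>j. ?X (take i f) (drop i f) (take j g) (drop j g)) ?m"
        using i c f g by (simp add: splits_take_drop[of g] del: drop_eq_Nil)
      also have "\<dots> = msum CT_module (?Y i) ?m"
        by (rule CTm.M.msum_cong) (simp only: Y(1) finite_set_mset_mset_set[OF finite_lessThan] lessThan_iff)
      also have "\<dots> = (\<Oplus>\<^bsub>CT_module\<^esub>j\<in>{..<length g}. ?Y i j)"
        by (rule CTm.M.finsum_msum[symmetric]) (use Y(2) in simp_all)
      finally show ?thesis .
    qed
    have cl: "(\<Oplus>\<^bsub>CT_module\<^esub>j\<in>{..<length g}. ?Y i j) \<in> carrier CT_module" if "i < length f" for i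
      using that by (subst i[symmetric]) simp_all
    have "msum CT_module (\<lambda>i. ?G (take i f) (drop i f)) ?n =
        msum CT_module (\<lambda>i. \<Oplus>\<^bsub>CT_module\<^esub>j\<in>{..<length g}. ?Y i j) ?n"
      by (rule CTm.M.msum_cong) (rule i)
    also have "\<dots> = (\<Oplus>\<^bsub>CT_module\<^esub>i\<in>{..<length f}. \<Oplus>\<^bsub>CT_module\<^esub>j\<in>{..<length g}. ?Y i j)"
      by (rule CTm.M.finsum_msum[symmetric]) (use cl in simp_all)
    finally show ?thesis .
  qed
  finally show ?thesis .
qed

lemma ct_prod_ex:
  "\<exists>p. bilinear_map C CT_module CT_module CT_module p \<and>
    (\<forall>c\<in>carrier C2. \<forall>e\<in>carrier C2. \<forall>f\<in>words. \<forall>g\<in>words.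
      p (tensCT c (word f)) (tensCT e (word g)) = ct_prod c f e g)"
proof -
  have "\<exists>p. bilinear_map C CT_module CT_module CT_module p \<and>
    (\<forall>s\<in>CT_gens. \<forall>t\<in>CT_gens. p (CT_gen s) (CT_gen t) = ct_prod (fst s) (snd s) (fst t) (snd t))"
  proof (rule bilinear_ext[OF CT_module_module tensCT_spans CT_module_module tensCT_spans CT_module_module])
    fix t assume t: "t \<in> CT_gens"
    have l: "lin_ext C CT_module CT_module CT_gen CT_gens (\<lambda>(c, f). ct_prod c f (fst t) (snd t))"
      using t by (intro tensCT_ext CT_module_module ct_prod_linear ct_prod_multilinear) (auto simp: mem_Times_iff)
    then show "lin_ext C CT_module CT_module CT_gen CT_gens (\<lambda>s. ct_prod (fst s) (snd s) (fst t) (snd t))"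
      by (simp add: case_prod_unfold)
    \<comment> \<open>By the symmetry of \<open>ct_prod\<close>, the extension in the other variable
      is the same one.\<close>
    from l show "lin_ext C CT_module CT_module CT_gen CT_gens (\<lambda>s. ct_prod (fst t) (snd t) (fst s) (snd s))"
      using t by (simp add: lin_ext_def case_prod_unfold mem_Times_iff ct_prod_commute)
  qed
  then obtain p where "bilinear_map C CT_module CT_module CT_module p"
    "\<forall>s\<in>CT_gens. \<forall>t\<in>CT_gens. p (CT_gen s) (CT_gen t) = ct_prod (fst s) (snd s) (fst t) (snd t)"
    by blast
  then show ?thesis by (intro exI[of _ p]) simp
qed

lemma CT_mult_bilinear: "bilinear_map C CT_module CT_module CT_module CT_mult"
  and CT_mult_word: "\<lbrakk>c \<in> carrier C2; e \<in> carrier C2; f \<in> words; g \<in> words\<rbrakk> \<Longrightarrow>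
    CT_mult (tensCT c (word f)) (tensCT e (word g)) = ct_prod c f e g"
proof -
  let ?P = "\<lambda>p. bilinear_map C CT_module CT_module CT_module p \<and>
  (\<forall>c\<in>carrier C2. \<forall>e\<in>carrier C2. \<forall>f\<in>words. \<forall>g\<in>words.
    p (tensCT c (word f)) (tensCT e (word g)) =
      tensCT (c \<otimes>\<^bsub>C2\<^esub> e) (word f \<otimes>\<^bsub>TT\<^esub> word g) \<oplus>\<^bsub>CT_module\<^esub>
      (\<Oplus>\<^bsub>CT_module\<^esub>i\<in>{..<length f}. \<Oplus>\<^bsub>CT_module\<^esub>j\<in>{..<length g}.
        tensCT (c \<otimes>\<^bsub>C2\<^esub> e \<otimes>\<^bsub>C2\<^esub> eps2 (word (drop i f)) (word (drop j g)))
          (word (take i f) \<otimes>\<^bsub>TT\<^esub> word (take j g))))"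
  obtain p where p: "bilinear_map C CT_module CT_module CT_module p"
    "\<forall>c\<in>carrier C2. \<forall>e\<in>carrier C2. \<forall>f\<in>words. \<forall>g\<in>words.
      p (tensCT c (word f)) (tensCT e (word g)) = ct_prod c f e g"
    using ct_prod_ex by blast
  have "?P p" using p(1) p(2)[rule_format] ct_prod_spec by (simp only: simp_thms ball_simps) simp
  from someI[of ?P, OF this, folded CT_mult_def]
  have P: "?P CT_mult" .
  then show "bilinear_map C CT_module CT_module CT_module CT_mult" by blast
  show "\<lbrakk>c \<in> carrier C2; e \<in> carrier C2; f \<in> words; g \<in> words\<rbrakk> \<Longrightarrow>
    CT_mult (tensCT c (word f)) (tensCT e (word g)) = ct_prod c f e g"
    using P by (simp only: ct_prod_spec)
qed

lemma CT_fields [simp]: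
  "carrier CT = carrier CT_module" "add CT = add CT_module" "zero CT = zero CT_module"
  "smult CT = smult CT_module" "one CT = tensCT \<one>\<^bsub>C2\<^esub> (word [])" "monoid.mult CT = CT_mult"
  by (simp_all add: CT_def)

lemma CT_is_module: "module C CT"
  by (rule module_cong[OF CT_module_module]) simp_all

lemma linear_map_CT: "linear_map C CT = linear_map C CT_module" "linear_map C L CT = linear_map C L CT_module"
  by (rule linear_map_module_cong; simp)+

lemma CT_spans: "spans C CT (CT_gen ` CT_gens)"
  using tensCT_spans by (subst spans_cong[of _ CT_module]) simp_all

text \<open>The left-bracketed triple product, evaluated through the coassociativity of deconcatenation and its
  compatibility with shuffles.\<close>

lemma CT_mult_triple:
  assumes c: "c \<in> carrier C2" "e \<in> carrier C2" "k \<in> carrier C2"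
    and f: "f \<in> words" and g: "g \<in> words" and h: "h \<in> words"
  shows "CT_mult (CT_mult (tensCT c (word f)) (tensCT e (word g))) (tensCT k (word h)) =
    msum CT_module (\<lambda>(f2, g2, h2, v). tensCT (c \<otimes>\<^bsub>C2\<^esub> e \<otimes>\<^bsub>C2\<^esub> k \<otimes>\<^bsub>C2\<^esub> \<zeta> f2 g2 h2) (word v)) (twist3 f g h)"
proof -
  let ?x = "tensCT k (word h)"
  let ?F = "\<lambda>(f2, g2, w2, h2, v). tensCT (c \<otimes>\<^bsub>C2\<^esub> e \<otimes>\<^bsub>C2\<^esub> k \<otimes>\<^bsub>C2\<^esub> (\<omega> f2 g2 \<otimes>\<^bsub>C2\<^esub> \<omega> w2 h2)) (word v)"
  have l: "linear_map C CT_module CT_module (\<lambda>y. CT_mult y ?x)"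
    using c h by (intro bilinear_mapD(2)[OF CT_mult_bilinear]) simp
  have w: "fst p \<in> words" "fst (snd p) \<in> words" "snd (snd p) \<in> words"
    if "p \<in># twist u v" "u \<in> words" "v \<in> words" for p u v
    using twist_in_lists[OF that(2,3), of "fst p" "fst (snd p)" "snd (snd p)"] that(1) by simp_all
  have "CT_mult (CT_mult (tensCT c (word f)) (tensCT e (word g))) ?x =
      msum CT_module (\<lambda>p. CT_mult (tensCT (c \<otimes>\<^bsub>C2\<^esub> e \<otimes>\<^bsub>C2\<^esub> \<omega> (fst p) (fst (snd p))) (word (snd (snd p)))) ?x) (twist f g)"
    unfolding CT_mult_word[OF c(1,2) f g] ct_prod_def case_prod_unfold
    by (rule linear_map_msum[OF CT_module_module CT_module_module l]) (use c w[OF _ f g] in simp)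
  also have "\<dots> = msum CT_module (\<lambda>p. msum CT_module (\<lambda>q. ?F (fst p, fst (snd p), q)) (twist (snd (snd p)) h)) (twist f g)"
  proof (rule CTm.M.msum_cong)
    fix p assume p: "p \<in># twist f g"
    note wp = w[OF p f g]
    have "CT_mult (tensCT (c \<otimes>\<^bsub>C2\<^esub> e \<otimes>\<^bsub>C2\<^esub> \<omega> (fst p) (fst (snd p))) (word (snd (snd p)))) ?x =
        ct_prod (c \<otimes>\<^bsub>C2\<^esub> e \<otimes>\<^bsub>C2\<^esub> \<omega> (fst p) (fst (snd p))) (snd (snd p)) k h"
      using c wp h by (intro CT_mult_word) simp_all
    also have "\<dots> = msum CT_module (\<lambda>q. ?F (fst p, fst (snd p), q)) (twist (snd (snd p)) h)"
      unfolding ct_prod_def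
    proof (rule CTm.M.msum_cong)
      fix q assume q: "q \<in># twist (snd (snd p)) h"
      note wq = w[OF q wp(3) h]
      have "c \<otimes>\<^bsub>C2\<^esub> e \<otimes>\<^bsub>C2\<^esub> \<omega> (fst p) (fst (snd p)) \<otimes>\<^bsub>C2\<^esub> k \<otimes>\<^bsub>C2\<^esub> \<omega> (fst q) (fst (snd q)) =
        c \<otimes>\<^bsub>C2\<^esub> e \<otimes>\<^bsub>C2\<^esub> k \<otimes>\<^bsub>C2\<^esub> (\<omega> (fst p) (fst (snd p)) \<otimes>\<^bsub>C2\<^esub> \<omega> (fst q) (fst (snd q)))"
        using c wp wq by (simp add: C2.m_ac)
      then show "(case q of (f2, g2, w) \<Rightarrow>
          tensCT (c \<otimes>\<^bsub>C2\<^esub> e \<otimes>\<^bsub>C2\<^esub> \<omega> (fst p) (fst (snd p)) \<otimes>\<^bsub>C2\<^esub> k \<otimes>\<^bsub>C2\<^esub> \<omega> f2 g2) (word w)) =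
          ?F (fst p, fst (snd p), q)"
        by (simp add: case_prod_unfold)
    qed
    finally show "CT_mult (tensCT (c \<otimes>\<^bsub>C2\<^esub> e \<otimes>\<^bsub>C2\<^esub> \<omega> (fst p) (fst (snd p))) (word (snd (snd p)))) ?x =
      msum CT_module (\<lambda>q. ?F (fst p, fst (snd p), q)) (twist (snd (snd p)) h)" .
  qed
  \<comment> \<open>All indices are gathered in one multiset: \<open>twist_twist\<close> speaks of
    types that are commutative monoids, which applies to multisets but not to
    \<open>CT_module\<close> with its explicit carrier.\<close>
  also have "\<dots> = msum CT_module ?F
      (\<Sum>(f2, g2, w)\<in>#twist f g. \<Sum>(w2, h2, v)\<in>#twist w h. {#(f2, g2, w2, h2, v)#})"
    by (simp add: CTm.M.msum_sum case_prod_unfold)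
  also have "\<dots> = msum CT_module (\<lambda>(f2, g2, h2, v). msum CT_module (\<lambda>(f3, g3, w). ?F (f3, g3, w, h2, v)) (twist f2 g2))
      (twist3 f g h)"
    unfolding twist_twist twist3_def
    by (simp add: CTm.M.msum_sum case_prod_unfold)
  also have "\<dots> = msum CT_module (\<lambda>(f2, g2, h2, v). tensCT (c \<otimes>\<^bsub>C2\<^esub> e \<otimes>\<^bsub>C2\<^esub> k \<otimes>\<^bsub>C2\<^esub> \<zeta> f2 g2 h2) (word v)) (twist3 f g h)"
  proof (rule CTm.M.msum_cong)
    fix p assume "p \<in># twist3 f g h"
    moreover obtain f2 g2 h2 v where p: "p = (f2, g2, h2, v)" by (cases p)
    ultimately have w3: "f2 \<in> words" "g2 \<in> words" "h2 \<in> words" "v \<in> words"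
      using twist3_in_lists[OF f g h, of f2 g2 h2 v] by simp_all
    have "linear_map C C2 CT_module (\<lambda>z. tensCT (c \<otimes>\<^bsub>C2\<^esub> e \<otimes>\<^bsub>C2\<^esub> k \<otimes>\<^bsub>C2\<^esub> z) (word v))"
      using c w3 by (intro tensCT_lin1 bilinear_map_compose_right[OF C2'(3)] linear_map_id) simp_all
    from linear_map_msum[OF C2'(1) CT_module_module this, of "twist f2 g2" "\<lambda>(f3, g3, w). \<omega> f3 g3 \<otimes>\<^bsub>C2\<^esub> \<omega> w h2"]
    have "tensCT (c \<otimes>\<^bsub>C2\<^esub> e \<otimes>\<^bsub>C2\<^esub> k \<otimes>\<^bsub>C2\<^esub> \<zeta> f2 g2 h2) (word v) =
      msum CT_module (\<lambda>(f3, g3, w). ?F (f3, g3, w, h2, v)) (twist f2 g2)"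
      using w[OF _ w3(1,2)] w3 by (simp add: \<zeta>_def case_prod_unfold)
    then show "(case p of (f2, g2, h2, v) \<Rightarrow> msum CT_module (\<lambda>(f3, g3, w). ?F (f3, g3, w, h2, v)) (twist f2 g2)) =
        (case p of (f2, g2, h2, v) \<Rightarrow> tensCT (c \<otimes>\<^bsub>C2\<^esub> e \<otimes>\<^bsub>C2\<^esub> k \<otimes>\<^bsub>C2\<^esub> \<zeta> f2 g2 h2) (word v))"
      by (simp add: p)
  qed
  finally show ?thesis .
qed

lemma CT_mult_commute:
  assumes x: "x \<in> carrier CT_module" and y: "y \<in> carrier CT_module"
  shows "CT_mult x y = CT_mult y x"
proof (rule bilinear_map_eq[OF CT_module_module tensCT_spans CT_module_module tensCT_spans CT_module_module
      CT_mult_bilinear _ _ x y])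
  show "bilinear_map C CT_module CT_module CT_module (\<lambda>x y. CT_mult y x)"
    using CT_mult_bilinear by (simp add: bilinear_map_def)
qed (elim imageE, clarsimp simp: CT_mult_word ct_prod_commute)

lemma CT_algebra: "algebra C CT"
proof (rule algebra_of_commute[OF _ CT_spans])
  have b: "bilinear_map C CT CT CT (\<lambda>x y. x \<otimes>\<^bsub>CT\<^esub> y)"
    using CT_mult_bilinear by (simp add: bilinear_map_def linear_map_CT)
  show "assoc_algebra C CT"
  proof (rule assoc_algebraI[OF CT_is_module b CT_spans])
    fix x assume "x \<in> CT_gen ` CT_gens"
    then obtain c f where x: "x = tensCT c (word f)" "c \<in> carrier C2" "f \<in> words" by auto
    then show 1: "\<one>\<^bsub>CT\<^esub> \<otimes>\<^bsub>CT\<^esub> x = x"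
      by (simp add: CT_mult_word ct_prod_spec shuffle_word)
    then show "x \<otimes>\<^bsub>CT\<^esub> \<one>\<^bsub>CT\<^esub> = x" using x CT_mult_commute[of x "\<one>\<^bsub>CT\<^esub>"] by simp
  next
    fix x y z assume "x \<in> CT_gen ` CT_gens" "y \<in> CT_gen ` CT_gens" "z \<in> CT_gen ` CT_gens"
    then obtain c f e g k h where x: "x = tensCT c (word f)" "y = tensCT e (word g)" "z = tensCT k (word h)"
      and c: "c \<in> carrier C2" "e \<in> carrier C2" "k \<in> carrier C2" and w: "f \<in> words" "g \<in> words" "h \<in> words"
      by auto
    have "CT_mult x (CT_mult y z) = CT_mult (CT_mult y z) x"
      using x c w bilinear_map_closed[OF CT_mult_bilinear] by (intro CT_mult_commute) simp_all
    also have "\<dots> = msum CT_module (\<lambda>(g2, h2, f2, v). tensCT (e \<otimes>\<^bsub>C2\<^esub> k \<otimes>\<^bsub>C2\<^esub> c \<otimes>\<^bsub>C2\<^esub> \<zeta> g2 h2 f2) (word v)) (twist3 g h f)"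
      unfolding x by (rule CT_mult_triple[OF c(2,3,1) w(2,3,1)])
    \<comment> \<open>After this rotation of indices both bracketings are sums over
      \<open>twist3 f g h\<close>, and they differ only by a cyclic shift of the arguments of
      \<open>\<zeta>\<close>; this is where the relations of \<open>J2\<close> enter.\<close>
    also have "\<dots> = msum CT_module (\<lambda>(f2, g2, h2, v). tensCT (e \<otimes>\<^bsub>C2\<^esub> k \<otimes>\<^bsub>C2\<^esub> c \<otimes>\<^bsub>C2\<^esub> \<zeta> g2 h2 f2) (word v)) (twist3 f g h)"
      unfolding twist3_rotate[of g h f] by (simp add: case_prod_unfold)
    also have "\<dots> = msum CT_module (\<lambda>(f2, g2, h2, v). tensCT (c \<otimes>\<^bsub>C2\<^esub> e \<otimes>\<^bsub>C2\<^esub> k \<otimes>\<^bsub>C2\<^esub> \<zeta> f2 g2 h2) (word v)) (twist3 f g h)"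
    proof (rule CTm.M.msum_cong)
      fix p assume "p \<in># twist3 f g h"
      moreover obtain f2 g2 h2 v where p: "p = (f2, g2, h2, v)" by (cases p)
      ultimately have "\<zeta> f2 g2 h2 = \<zeta> g2 h2 f2"
        using twist3_in_lists[OF w, of f2 g2 h2 v] by (intro \<zeta>_rotate) simp_all
      moreover have "e \<otimes>\<^bsub>C2\<^esub> k \<otimes>\<^bsub>C2\<^esub> c = c \<otimes>\<^bsub>C2\<^esub> e \<otimes>\<^bsub>C2\<^esub> k" using c by (simp add: C2.m_ac)
      ultimately show "(case p of (f2, g2, h2, v) \<Rightarrow> tensCT (e \<otimes>\<^bsub>C2\<^esub> k \<otimes>\<^bsub>C2\<^esub> c \<otimes>\<^bsub>C2\<^esub> \<zeta> g2 h2 f2) (word v)) =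
          (case p of (f2, g2, h2, v) \<Rightarrow> tensCT (c \<otimes>\<^bsub>C2\<^esub> e \<otimes>\<^bsub>C2\<^esub> k \<otimes>\<^bsub>C2\<^esub> \<zeta> f2 g2 h2) (word v))"
        by (simp add: p)
    qed
    also have "\<dots> = CT_mult (CT_mult x y) z"
      unfolding x by (rule CT_mult_triple[OF c w, symmetric])
    finally show "x \<otimes>\<^bsub>CT\<^esub> y \<otimes>\<^bsub>CT\<^esub> z = x \<otimes>\<^bsub>CT\<^esub> (y \<otimes>\<^bsub>CT\<^esub> z)" by simp
  qed simp
  fix x y assume "x \<in> CT_gen ` CT_gens" "y \<in> CT_gen ` CT_gens"
  then have "x \<in> carrier CT_module" "y \<in> carrier CT_module"
    by (auto intro: span_closed[OF tensCT_spans])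
  then show "x \<otimes>\<^bsub>CT\<^esub> y = y \<otimes>\<^bsub>CT\<^esub> x" using CT_mult_commute by simp
qed

end

lemma linear_map_scalar:
  assumes N: "module K N" and g: "linear_map K L (self_module K) g" and x: "x \<in> carrier N"
  shows "linear_map K L N (\<lambda>y. g y \<odot>\<^bsub>N\<^esub> x)"
proof -
  interpret N: module K N by fact
  show ?thesis
    using linear_mapD[OF g] x
    by (intro linear_mapI) (simp_all add: N.smult_l_distr N.smult_assoc1)
qed

context quasi_integration
begin

subsection \<open>The free integro-differential ring\<close>

abbreviation "CC \<equiv> alg_tensor C C1 CT"

lemma CC_algebra: "algebra C CC"
  by (rule alg_tensor_algebra[OF C1_algebra CT_algebra])

lemma IDR_algebra: "algebra C IDR"
  unfolding IDR_def by (rule alg_tensor_algebra[OF RR_algebra CC_algebra])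

lemmas CT' = algebraD[OF CT_algebra]
lemmas CC' = algebraD[OF CC_algebra]
lemmas IDR' = algebraD[OF IDR_algebra]

interpretation C1: algebra C C1 by (rule C1_algebra)
interpretation C2: algebra C C2 by (rule C2_algebra)
interpretation CTm: module C CT_module by (rule CT_module_module)
interpretation A: algebra C IDR by (rule IDR_algebra)
interpretation S: algebra C IDRQ by (rule IDRQ_algebra)

definition "tensCC c x = tens C C1 CT c x"

definition "tensA r x = tens C RR CC r x"

lemma tens4_tensA: "tens4 r c1 c2 t = tensA r (tensCC c1 (tensCT c2 t))"
  by (simp add: tens4_def tensA_def tensCC_def)

lemma tensCC_bilinear: "bilinear_map C C1 CT_module CC tensCC"
  using tens_bilinear[OF C1'(1) CT'(1)]
  by (simp add: bilinear_map_def tensCC_def[abs_def] linear_map_CT)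

lemma tensA_bilinear: "bilinear_map C RR CC IDR tensA"
  using tens_bilinear[OF RR'(1) CC'(1)]
  by (simp add: bilinear_map_def tensA_def[abs_def] IDR_def)

lemma tensCC_closed [simp]: "c \<in> carrier C1 \<Longrightarrow> x \<in> carrier CT_module \<Longrightarrow> tensCC c x \<in> carrier CC"
  by (rule bilinear_map_closed[OF tensCC_bilinear])

lemma tensA_closed [simp]: "r \<in> carrier R \<Longrightarrow> x \<in> carrier CC \<Longrightarrow> tensA r x \<in> carrier IDR"
  by (rule bilinear_map_closed[OF tensA_bilinear]) simp

lemma tens4_closed [simp]:
  "\<lbrakk>r \<in> carrier R; c1 \<in> carrier C1; c2 \<in> carrier C2; t \<in> carrier TA\<rbrakk> \<Longrightarrow> tens4 r c1 c2 t \<in> carrier IDR"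
  unfolding tens4_tensA by (intro tensA_closed tensCC_closed tensCT_closed)

lemma tens4_lin1:
  "\<lbrakk>c1 \<in> carrier C1; c2 \<in> carrier C2; t \<in> carrier TA; linear_map C L RR f\<rbrakk> \<Longrightarrow>
    linear_map C L IDR (\<lambda>x. tens4 (f x) c1 c2 t)"
  unfolding tens4_tensA by (intro bilinear_map_compose_left[OF tensA_bilinear] tensCC_closed tensCT_closed)

lemma tens4_lin2:
  "\<lbrakk>r \<in> carrier R; c2 \<in> carrier C2; t \<in> carrier TA; linear_map C L C1 f\<rbrakk> \<Longrightarrow>
    linear_map C L IDR (\<lambda>x. tens4 r (f x) c2 t)"
  unfolding tens4_tensA
  by (intro bilinear_map_compose_right[OF tensA_bilinear] bilinear_map_compose_left[OF tensCC_bilinear]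
      tensCT_closed) simp_all

lemma tens4_lin3:
  "\<lbrakk>r \<in> carrier R; c1 \<in> carrier C1; t \<in> carrier TA; linear_map C L C2 f\<rbrakk> \<Longrightarrow>
    linear_map C L IDR (\<lambda>x. tens4 r c1 (f x) t)"
  unfolding tens4_tensA
  by (intro bilinear_map_compose_right[OF tensA_bilinear] bilinear_map_compose_right[OF tensCC_bilinear]
      tensCT_lin1) simp_all

lemma tens4_lin4:
  "\<lbrakk>r \<in> carrier R; c1 \<in> carrier C1; c2 \<in> carrier C2; linear_map C L TA f\<rbrakk> \<Longrightarrow>
    linear_map C L IDR (\<lambda>x. tens4 r c1 c2 (f x))"
  unfolding tens4_tensA
  by (intro bilinear_map_compose_right[OF tensA_bilinear] bilinear_map_compose_right[OF tensCC_bilinear]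
      tensCT_lin2) simp_all

text \<open>The spanning sets stay parameters: with the unit and the multiples of generators
  inserted, each spanning tensor either is a value of \<open>\<sigma>\<close> or lies in
  \<open>J\<close>.\<close>

lemma tens4_spans:
  assumes G1: "spans C C1 G1" and G2: "spans C C2 G2"
  shows "spans C IDR {tens4 r c1 c2 (word f) | r c1 c2 f. r \<in> carrier R \<and> c1 \<in> G1 \<and> c2 \<in> G2 \<and> f \<in> words}"
proof -
  let ?H = "{tens C C2 TT x y | x y. x \<in> G2 \<and> y \<in> word ` words}"
  let ?K = "{tens C C1 CT x y | x y. x \<in> G1 \<and> y \<in> ?H}"
  let ?L = "{tens C RR CC x y | x y. x \<in> carrier RR \<and> y \<in> ?K}"
  have "spans C CT_module ?H"
    unfolding CT_module_def by (rule tens_spans[OF C2'(1) G2 TT_module word_spans'])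
  then have "spans C CT ?H" by (subst spans_cong[of _ CT_module]) simp_all
  from tens_spans[OF C1'(1) G1 CT'(1) this]
  have "spans C CC ?K" by (subst spans_cong[of _ "tensor_prod C C1 CT"]) simp_all
  from tens_spans[OF RR'(1) spans_carrier CC'(1) this]
  have "spans C IDR ?L"
    unfolding IDR_def by (subst spans_cong[of _ "tensor_prod C RR CC"]) simp_all
  moreover have "?L = {tens4 r c1 c2 (word f) | r c1 c2 f. r \<in> carrier R \<and> c1 \<in> G1 \<and> c2 \<in> G2 \<and> f \<in> words}"
    unfolding tens4_def tensCT_def self_module_fields by blast
  ultimately show ?thesis by simp
qed

lemmas tens4_spans_all = tens4_spans[OF spans_carrier spans_carrier]

lemma tens4_ext:
  assumes P: "module C P"
    and l1: "\<And>c1 c2 f. \<lbrakk>c1 \<in> carrier C1; c2 \<in> carrier C2; f \<in> words\<rbrakk> \<Longrightarrow> linear_map C RR P (\<lambda>r. b r c1 c2 f)"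
    and l2: "\<And>r c2 f. \<lbrakk>r \<in> carrier R; c2 \<in> carrier C2; f \<in> words\<rbrakk> \<Longrightarrow> linear_map C C1 P (\<lambda>c1. b r c1 c2 f)"
    and l3: "\<And>r c1 f. \<lbrakk>r \<in> carrier R; c1 \<in> carrier C1; f \<in> words\<rbrakk> \<Longrightarrow> linear_map C C2 P (\<lambda>c2. b r c1 c2 f)"
    and l4: "\<And>r c1 c2. \<lbrakk>r \<in> carrier R; c1 \<in> carrier C1; c2 \<in> carrier C2\<rbrakk> \<Longrightarrow> multilinear C RT P (b r c1 c2)"
  shows "\<exists>L. linear_map C IDR P L \<and> (\<forall>r\<in>carrier R. \<forall>c1\<in>carrier C1. \<forall>c2\<in>carrier C2. \<forall>f\<in>words.
    L (tens4 r c1 c2 (word f)) = b r c1 c2 f)"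
proof -
  have s1: "spans C C1 ((\<lambda>x. x) ` carrier C1)" by (simp add: spans_carrier)
  have s0: "spans C RR ((\<lambda>x. x) ` carrier RR)" using spans_carrier[of C RR] by simp
  let ?g = "\<lambda>(c1, s). tens C C1 CT c1 (CT_gen s)"
  have sp: "spans C CC (?g ` (carrier C1 \<times> CT_gens))"
    using tens_spans_image[OF C1'(1) s1 CT'(1) CT_spans]
    by (subst spans_cong[of _ "tensor_prod C C1 CT"]) simp_all
  have "\<exists>L. linear_map C (tensor_prod C RR CC) P L \<and> (\<forall>r\<in>carrier RR. \<forall>t\<in>carrier C1 \<times> CT_gens.
      L (tens C RR CC r (?g t)) = b r (fst t) (fst (snd t)) (snd (snd t)))"
  proof (rule tensor_ext[OF RR'(1) s0 CC'(1) sp P])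
    fix t assume "t \<in> carrier C1 \<times> CT_gens"
    then show "lin_ext C RR P (\<lambda>x. x) (carrier RR) (\<lambda>s. b s (fst t) (fst (snd t)) (snd (snd t)))"
      by (intro lin_ext_linear l1) auto
  next
    fix r assume "r \<in> carrier RR"
    then have r: "r \<in> carrier R" by simp
    have "lin_ext C (tensor_prod C C1 CT) P ?g (carrier C1 \<times> CT_gens)
        (\<lambda>(c1, s). b r c1 (fst s) (snd s))"
    proof (rule tensor_lin_ext[OF C1'(1) s1 CT'(1) CT_spans P])
      fix t assume "t \<in> CT_gens"
      then show "lin_ext C C1 P (\<lambda>x. x) (carrier C1) (\<lambda>s. b r s (fst t) (snd t))"
        using r by (intro lin_ext_linear l2) auto
    next
      fix c1 assume c1: "c1 \<in> carrier C1"
      have "lin_ext C CT_module P CT_gen CT_gens (\<lambda>(c2, f). b r c1 c2 f)"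
        by (intro tensCT_ext P l3 l4 r c1)
      then show "lin_ext C CT P CT_gen CT_gens (\<lambda>t. b r c1 (fst t) (snd t))"
        by (simp add: lin_ext_def linear_map_CT case_prod_unfold)
    qed
    then show "lin_ext C CC P ?g (carrier C1 \<times> CT_gens) (\<lambda>t. b r (fst t) (fst (snd t)) (snd (snd t)))"
      by (simp add: lin_ext_def case_prod_unfold)
  qed
  then obtain L where L: "linear_map C (tensor_prod C RR CC) P L" and
    e: "\<And>r t. r \<in> carrier RR \<Longrightarrow> t \<in> carrier C1 \<times> CT_gens \<Longrightarrow>
      L (tens C RR CC r (?g t)) = b r (fst t) (fst (snd t)) (snd (snd t))" by blast
  show ?thesis
  proof (intro exI conjI ballI)
    show "linear_map C IDR P L" using L by (simp add: IDR_def)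
    show "L (tens4 r c1 c2 (word f)) = b r c1 c2 f"
      if "r \<in> carrier R" "c1 \<in> carrier C1" "c2 \<in> carrier C2" "f \<in> words" for r c1 c2 f
      using e[of r "(c1, (c2, f))"] that by (simp add: tens4_def)
  qed
qed

section \<open>The derivation\<close>

lemma deriv_spec: "linear_map C IDR IDR deriv \<and>
  (\<forall>f0\<in>carrier R. \<forall>c1\<in>carrier C1. \<forall>c2\<in>carrier C2.
    deriv (tens4 f0 c1 c2 (word [])) = tens4 (d f0) c1 c2 (word [])) \<and>
  (\<forall>f0\<in>carrier R. \<forall>c1\<in>carrier C1. \<forall>c2\<in>carrier C2. \<forall>f1\<in>carrier RT. \<forall>f\<in>words.
    deriv (tens4 f0 c1 c2 (word (f1 # f))) =
      tens4 (d f0) c1 c2 (word (f1 # f)) \<oplus>\<^bsub>IDR\<^esub> tens4 (f0 \<otimes> f1) c1 c2 (word f))"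
proof -
  let ?b = "\<lambda>r c1 c2 f. tens4 (d r) c1 c2 (word f) \<oplus>\<^bsub>IDR\<^esub>
    (case f of [] \<Rightarrow> \<zero>\<^bsub>IDR\<^esub> | a # f \<Rightarrow> tens4 (r \<otimes> a) c1 c2 (word f))"
  have "\<exists>L. linear_map C IDR IDR L \<and> (\<forall>r\<in>carrier R. \<forall>c1\<in>carrier C1. \<forall>c2\<in>carrier C2. \<forall>f\<in>words.
      L (tens4 r c1 c2 (word f)) = ?b r c1 c2 f)"
  proof (rule tens4_ext[OF IDR'(1)])
    fix c1 c2 f assume c: "c1 \<in> carrier C1" "c2 \<in> carrier C2" and f: "f \<in> words"
    show "linear_map C RR IDR (\<lambda>r. ?b r c1 c2 f)"
      by (rule linear_map_add[OF IDR'(1)], intro tens4_lin1 d_lin linear_map_id)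
        (use c f in \<open>(cases f; simp add: linear_map_const_zero[OF IDR'(1)] tens4_lin1 mult_lin linear_map_id)+\<close>)
  next
    fix r c2 f assume c: "r \<in> carrier R" "c2 \<in> carrier C2" and f: "f \<in> words"
    show "linear_map C C1 IDR (\<lambda>c1. ?b r c1 c2 f)"
      by (rule linear_map_add[OF IDR'(1)], intro tens4_lin2 linear_map_id)
        (use c f in \<open>(cases f; simp add: linear_map_const_zero[OF IDR'(1)] tens4_lin2 linear_map_id)+\<close>)
  next
    fix r c1 f assume c: "r \<in> carrier R" "c1 \<in> carrier C1" and f: "f \<in> words"
    show "linear_map C C2 IDR (\<lambda>c2. ?b r c1 c2 f)"
      by (rule linear_map_add[OF IDR'(1)], intro tens4_lin3 linear_map_id)
        (use c f in \<open>(cases f; simp add: linear_map_const_zero[OF IDR'(1)] tens4_lin3 linear_map_id)+\<close>)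
  next
    fix r c1 c2 assume c: "r \<in> carrier R" "c1 \<in> carrier C1" "c2 \<in> carrier C2"
    show "multilinear C RT IDR (?b r c1 c2)"
      by (intro multilinear_add IDR'(1) multilinear_case A.M.zero_closed
          tens4_lin1 tens4_lin4 multilinear_compose[OF word_multilinear] mult_lin linear_map_RR linear_map_id)
        (simp_all add: c)
  qed
  then obtain L where L: "linear_map C IDR IDR L"
    "\<And>r c1 c2 f. \<lbrakk>r \<in> carrier R; c1 \<in> carrier C1; c2 \<in> carrier C2; f \<in> words\<rbrakk> \<Longrightarrow>
      L (tens4 r c1 c2 (word f)) = ?b r c1 c2 f" by blast
  then have "\<exists>D. linear_map C IDR IDR D \<and>
  (\<forall>f0\<in>carrier R. \<forall>c1\<in>carrier C1. \<forall>c2\<in>carrier C2.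
    D (tens4 f0 c1 c2 (word [])) = tens4 (d f0) c1 c2 (word [])) \<and>
  (\<forall>f0\<in>carrier R. \<forall>c1\<in>carrier C1. \<forall>c2\<in>carrier C2. \<forall>f1\<in>carrier RT. \<forall>f\<in>words.
    D (tens4 f0 c1 c2 (word (f1 # f))) =
      tens4 (d f0) c1 c2 (word (f1 # f)) \<oplus>\<^bsub>IDR\<^esub> tens4 (f0 \<otimes> f1) c1 c2 (word f))"
    by (intro exI[of _ L]) simp
  from someI_ex[OF this, folded deriv_def] show ?thesis .
qed

lemma deriv_linear: "linear_map C IDR IDR deriv"
  using deriv_spec by blast

lemma deriv_tens4:
  assumes "r \<in> carrier R" "c1 \<in> carrier C1" "c2 \<in> carrier C2"
  shows "deriv (tens4 r c1 c2 (word [])) = tens4 (d r) c1 c2 (word [])"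
    and "a \<in> carrier RT \<Longrightarrow> f \<in> words \<Longrightarrow> deriv (tens4 r c1 c2 (word (a # f))) =
      tens4 (d r) c1 c2 (word (a # f)) \<oplus>\<^bsub>IDR\<^esub> tens4 (r \<otimes> a) c1 c2 (word f)"
  using deriv_spec assms by blast+

section \<open>The integration\<close>

lemma eps1_bilinear: "bilinear_map C RJ TA C1 eps1"
  using bilinear_map_post[OF tens_bilinear[OF RJ_module TT_module] sym_incl_linear[OF M1_module, unfolded M1_def]]
  by (simp add: bilinear_map_def C1_def M1_def eps1_def[abs_def] linear_map_TT)

lemma RJ_fields [simp]:
  "carrier RJ = Q ` carrier R" "add RJ = add R" "zero RJ = zero R" "smult RJ = monoid.mult R"
  by (simp_all add: RJ_def)

lemma Q_lin_RJ: "linear_map C L RR f \<Longrightarrow> linear_map C L RJ (\<lambda>x. Q (f x))"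
  using Q_lin[of L f] linear_mapD(1)[of C L RR f] by (auto simp: linear_map_def)

lemma eps1_closed [simp]: "r \<in> carrier R \<Longrightarrow> t \<in> carrier TA \<Longrightarrow> eps1 (Q r) t \<in> carrier C1"
  by (rule bilinear_map_closed[OF eps1_bilinear]) simp_all

lemma eps1_lin1: "t \<in> carrier TA \<Longrightarrow> linear_map C L RR f \<Longrightarrow> linear_map C L C1 (\<lambda>x. eps1 (Q (f x)) t)"
  by (intro bilinear_map_compose_left[OF eps1_bilinear] Q_lin_RJ)

lemma eps1_lin2: "r \<in> carrier R \<Longrightarrow> linear_map C L TA f \<Longrightarrow> linear_map C L C1 (\<lambda>x. eps1 (Q r) (f x))"
  by (intro bilinear_map_compose_right[OF eps1_bilinear]) simp_all

lemma C1_lin1: "c \<in> carrier C1 \<Longrightarrow> linear_map C L C1 f \<Longrightarrow> linear_map C L C1 (\<lambda>x. f x \<otimes>\<^bsub>C1\<^esub> c)"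
  by (intro bilinear_map_compose_left[OF C1'(3)])

lemma C1_lin2: "c \<in> carrier C1 \<Longrightarrow> linear_map C L C1 f \<Longrightarrow> linear_map C L C1 (\<lambda>x. c \<otimes>\<^bsub>C1\<^esub> f x)"
  by (intro bilinear_map_compose_right[OF C1'(3)])

text \<open>As in \<open>iQ_word\<close>, the coefficient changes along the recursion over the word;
  \<open>c1\<close> and \<open>c2\<close> are constants for the integration and stay fixed.\<close>

definition "i4_word c1 c2 f r = rec_list
  (\<lambda>r. tens4 (Q r) c1 c2 (word [])
      \<ominus>\<^bsub>IDR\<^esub> tens4 \<one> (c1 \<otimes>\<^bsub>C1\<^esub> eps1 (Q r) (word [])) c2 (word [])
      \<oplus>\<^bsub>IDR\<^esub> tens4 \<one> c1 c2 (word [r \<ominus> d (Q r)]))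
  (\<lambda>a f rec r. tens4 (Q r) c1 c2 (word (a # f))
        \<ominus>\<^bsub>IDR\<^esub> tens4 \<one> (c1 \<otimes>\<^bsub>C1\<^esub> eps1 (Q r) (word (a # f))) c2 (word [])
        \<ominus>\<^bsub>IDR\<^esub> rec (Q r \<otimes> a)
        \<oplus>\<^bsub>IDR\<^esub> tens4 \<one> c1 c2 (word ((r \<ominus> d (Q r)) # a # f))) f r"

lemma i4_word_simps [simp]:
  "i4_word c1 c2 [] r = tens4 (Q r) c1 c2 (word [])
      \<ominus>\<^bsub>IDR\<^esub> tens4 \<one> (c1 \<otimes>\<^bsub>C1\<^esub> eps1 (Q r) (word [])) c2 (word [])
      \<oplus>\<^bsub>IDR\<^esub> tens4 \<one> c1 c2 (word [r \<ominus> d (Q r)])"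
  "i4_word c1 c2 (a # f) r = tens4 (Q r) c1 c2 (word (a # f))
        \<ominus>\<^bsub>IDR\<^esub> tens4 \<one> (c1 \<otimes>\<^bsub>C1\<^esub> eps1 (Q r) (word (a # f))) c2 (word [])
        \<ominus>\<^bsub>IDR\<^esub> i4_word c1 c2 f (Q r \<otimes> a)
        \<oplus>\<^bsub>IDR\<^esub> tens4 \<one> c1 c2 (word ((r \<ominus> d (Q r)) # a # f))"
  by (simp_all add: i4_word_def)

lemmas i4_lin = linear_map_add linear_map_sub IDR'(1) tens4_lin1 tens4_lin2 tens4_lin3 tens4_lin4
  C1_lin1 C1_lin2 eps1_lin1 eps1_lin2 rest_lin Q_lin linear_map_id

lemma i4_word_linear1:
  "f \<in> words \<Longrightarrow> c1 \<in> carrier C1 \<Longrightarrow> c2 \<in> carrier C2 \<Longrightarrow> linear_map C RR IDR (i4_word c1 c2 f)"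
proof (induction f)
  case Nil
  have "linear_map C RR IDR (\<lambda>r. i4_word c1 c2 [] r)"
    unfolding i4_word_simps using Nil by (intro i4_lin word_lin) simp_all
  then show ?case .
next
  case (Cons a f)
  then have IH: "linear_map C RR IDR (i4_word c1 c2 f)" by simp
  have "linear_map C RR IDR (\<lambda>r. i4_word c1 c2 f (Q r \<otimes> a))"
    using Cons.prems by (intro linear_map_compose[OF IH] mult_lin Q_lin linear_map_id) simp
  then have "linear_map C RR IDR (\<lambda>r. i4_word c1 c2 (a # f) r)"
    unfolding i4_word_simps using Cons.prems by (intro i4_lin word_lin) simp_all
  then show ?case .
qed

lemma i4_word_closed [simp]:
  "\<lbrakk>f \<in> words; c1 \<in> carrier C1; c2 \<in> carrier C2; r \<in> carrier R\<rbrakk> \<Longrightarrow> i4_word c1 c2 f r \<in> carrier IDR"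
  using linear_mapD(1)[OF i4_word_linear1, of f c1 c2 r] by simp

lemma i4_word_linear2:
  "f \<in> words \<Longrightarrow> r \<in> carrier R \<Longrightarrow> c2 \<in> carrier C2 \<Longrightarrow> linear_map C C1 IDR (\<lambda>c1. i4_word c1 c2 f r)"
proof (induction f arbitrary: r)
  case Nil
  show ?case unfolding i4_word_simps using Nil by (intro i4_lin) simp_all
next
  case (Cons a f)
  show ?case unfolding i4_word_simps using Cons.prems by (intro i4_lin Cons.IH) simp_all
qed

lemma i4_word_linear3:
  "f \<in> words \<Longrightarrow> r \<in> carrier R \<Longrightarrow> c1 \<in> carrier C1 \<Longrightarrow> linear_map C C2 IDR (\<lambda>c2. i4_word c1 c2 f r)"
proof (induction f arbitrary: r)
  case Nil
  show ?case unfolding i4_word_simps using Nil by (intro i4_lin) simp_all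
next
  case (Cons a f)
  show ?case unfolding i4_word_simps using Cons.prems by (intro i4_lin Cons.IH) simp_all
qed

lemma i4_word_multilinear:
  assumes c: "c1 \<in> carrier C1" "c2 \<in> carrier C2"
  shows "r \<in> carrier R \<Longrightarrow> multilinear C RT IDR (\<lambda>f. i4_word c1 c2 f r)"
proof (rule multilinearI)
  fix f g assume "r \<in> carrier R" "f \<in> words" and g: "g \<in> words"
  then show "linear_map C RT IDR (\<lambda>x. i4_word c1 c2 (f @ x # g) r)"
  proof (induction f arbitrary: r)
    case Nil
    have "linear_map C RT IDR (\<lambda>x. i4_word c1 c2 g (Q r \<otimes> x))"
      using Nil c by (intro linear_map_compose[OF i4_word_linear1] mult_lin linear_map_RR linear_map_id) simp_all
    moreover have "linear_map C RT TA (\<lambda>x. word ([r \<ominus> d (Q r)] @ x # g))"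
      using Nil by (intro word_lin_middle) simp_all
    ultimately show ?case
      using Nil c by (simp, intro i4_lin word_lin) simp_all
  next
    case (Cons a f)
    have "linear_map C RT TA (\<lambda>x. word (((r \<ominus> d (Q r)) # a # f) @ x # g))"
      "linear_map C RT TA (\<lambda>x. word ((a # f) @ x # g))"
      using Cons by (intro word_lin_middle; simp)+
    then show ?case
      using Cons c by (simp, intro i4_lin Cons.IH) simp_all
  qed
qed (use c in simp)

lemma integ_spec: "linear_map C IDR IDR integ \<and>
  (\<forall>f0\<in>carrier R. \<forall>c1\<in>carrier C1. \<forall>c2\<in>carrier C2. integ (tens4 f0 c1 c2 (word [])) =
    tens4 (Q f0) c1 c2 (word [])
      \<ominus>\<^bsub>IDR\<^esub> tens4 \<one> (c1 \<otimes>\<^bsub>C1\<^esub> eps1 (Q f0) (word [])) c2 (word [])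
      \<oplus>\<^bsub>IDR\<^esub> tens4 \<one> c1 c2 (word [f0 \<ominus> d (Q f0)])) \<and>
  (\<forall>f0\<in>carrier R. \<forall>c1\<in>carrier C1. \<forall>c2\<in>carrier C2. \<forall>f1\<in>carrier RT. \<forall>f\<in>words.
    integ (tens4 f0 c1 c2 (word (f1 # f))) =
      tens4 (Q f0) c1 c2 (word (f1 # f))
        \<ominus>\<^bsub>IDR\<^esub> tens4 \<one> (c1 \<otimes>\<^bsub>C1\<^esub> eps1 (Q f0) (word (f1 # f))) c2 (word [])
        \<ominus>\<^bsub>IDR\<^esub> integ (tens4 (Q f0 \<otimes> f1) c1 c2 (word f))
        \<oplus>\<^bsub>IDR\<^esub> tens4 \<one> c1 c2 (word ((f0 \<ominus> d (Q f0)) # f1 # f)))"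
proof -
  have "\<exists>L. linear_map C IDR IDR L \<and> (\<forall>r\<in>carrier R. \<forall>c1\<in>carrier C1. \<forall>c2\<in>carrier C2. \<forall>f\<in>words.
      L (tens4 r c1 c2 (word f)) = i4_word c1 c2 f r)"
    by (rule tens4_ext[OF IDR'(1)])
      (simp_all add: i4_word_linear1 i4_word_linear2 i4_word_linear3 i4_word_multilinear)
  then obtain L where L: "linear_map C IDR IDR L"
    "\<And>r c1 c2 f. \<lbrakk>r \<in> carrier R; c1 \<in> carrier C1; c2 \<in> carrier C2; f \<in> words\<rbrakk> \<Longrightarrow>
      L (tens4 r c1 c2 (word f)) = i4_word c1 c2 f r" by blast
  then have "\<exists>I. linear_map C IDR IDR I \<and>
  (\<forall>f0\<in>carrier R. \<forall>c1\<in>carrier C1. \<forall>c2\<in>carrier C2. I (tens4 f0 c1 c2 (word [])) =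
    tens4 (Q f0) c1 c2 (word [])
      \<ominus>\<^bsub>IDR\<^esub> tens4 \<one> (c1 \<otimes>\<^bsub>C1\<^esub> eps1 (Q f0) (word [])) c2 (word [])
      \<oplus>\<^bsub>IDR\<^esub> tens4 \<one> c1 c2 (word [f0 \<ominus> d (Q f0)])) \<and>
  (\<forall>f0\<in>carrier R. \<forall>c1\<in>carrier C1. \<forall>c2\<in>carrier C2. \<forall>f1\<in>carrier RT. \<forall>f\<in>words.
    I (tens4 f0 c1 c2 (word (f1 # f))) =
      tens4 (Q f0) c1 c2 (word (f1 # f))
        \<ominus>\<^bsub>IDR\<^esub> tens4 \<one> (c1 \<otimes>\<^bsub>C1\<^esub> eps1 (Q f0) (word (f1 # f))) c2 (word [])
        \<ominus>\<^bsub>IDR\<^esub> I (tens4 (Q f0 \<otimes> f1) c1 c2 (word f))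
        \<oplus>\<^bsub>IDR\<^esub> tens4 \<one> c1 c2 (word ((f0 \<ominus> d (Q f0)) # f1 # f)))"
    by (intro exI[of _ L]) simp
  from someI_ex[OF this, folded integ_def] show ?thesis .
qed

lemma integ_linear: "linear_map C IDR IDR integ"
  using integ_spec by blast

lemma integ_tens4:
  assumes "f \<in> words" "r \<in> carrier R" "c1 \<in> carrier C1" "c2 \<in> carrier C2"
  shows "integ (tens4 r c1 c2 (word f)) = i4_word c1 c2 f r"
  using assms
proof (induction f arbitrary: r)
  case Nil
  then show ?case using integ_spec by simp
next
  case (Cons a f)
  then show ?case using integ_spec by simp
qed

section \<open>Products of pure tensors\<close>

text \<open>Keeps \<open>x\<close> and \<open>y\<close> general: the product of two pure tensors in
  \<open>CT\<close> is in general a sum, which \<open>tens4\<close> cannot express.\<close>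

lemma tens4_mult:
  assumes r: "r \<in> carrier R" "s \<in> carrier R" and c: "c1 \<in> carrier C1" "e1 \<in> carrier C1"
    and x: "x \<in> carrier CT_module" "y \<in> carrier CT_module"
  shows "tensA r (tensCC c1 x) \<otimes>\<^bsub>IDR\<^esub> tensA s (tensCC e1 y) =
    tensA (r \<otimes> s) (tensCC (c1 \<otimes>\<^bsub>C1\<^esub> e1) (CT_mult x y))"
proof -
  have "tensCC c1 x \<otimes>\<^bsub>CC\<^esub> tensCC e1 y = tensCC (c1 \<otimes>\<^bsub>C1\<^esub> e1) (CT_mult x y)"
    using alg_tensor_mult[OF C1_algebra CT_algebra c(1) _ c(2), of x y] x by (simp add: tensCC_def)
  then show ?thesis
    using alg_tensor_mult[OF RR_algebra CC_algebra, of r "tensCC c1 x" s "tensCC e1 y"]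
      tensCC_closed[OF c(1) x(1)] tensCC_closed[OF c(2) x(2)] r
    by (simp add: IDR_def tensA_def)
qed

lemma one_IDR: "\<one>\<^bsub>IDR\<^esub> = tens4 \<one> \<one>\<^bsub>C1\<^esub> \<one>\<^bsub>C2\<^esub> (word [])"
  by (simp add: IDR_def tens4_def)

text \<open>The empty word has no nonempty tail, so no correction term arises. Since the generators
  of \<open>J\<close> carry multiples of the empty word, this case suffices for multiplying
  them.\<close>

lemma CT_mult_Nil:
  "\<lbrakk>c \<in> carrier C2; e \<in> carrier C2; f \<in> words\<rbrakk> \<Longrightarrow>
    CT_mult (tensCT c (word [])) (tensCT e (word f)) = tensCT (c \<otimes>\<^bsub>C2\<^esub> e) (word f)"
  using ct_prod_spec[of c e "[]" f] by (simp add: CT_mult_word shuffle_word)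

lemma tens4_mult_Nil:
  "\<lbrakk>r \<in> carrier R; s \<in> carrier R; c1 \<in> carrier C1; e1 \<in> carrier C1; c2 \<in> carrier C2; e2 \<in> carrier C2; f \<in> words\<rbrakk> \<Longrightarrow>
    tens4 r c1 c2 (word []) \<otimes>\<^bsub>IDR\<^esub> tens4 s e1 e2 (word f) =
    tens4 (r \<otimes> s) (c1 \<otimes>\<^bsub>C1\<^esub> e1) (c2 \<otimes>\<^bsub>C2\<^esub> e2) (word f)"
  by (simp add: tens4_tensA tens4_mult CT_mult_Nil)

end

lemma quot_map_coset:
  assumes J: "ideal J R" and add: "\<And>x y. x \<in> carrier R \<Longrightarrow> y \<in> carrier R \<Longrightarrow> g (x \<oplus>\<^bsub>R\<^esub> y) = g x \<oplus>\<^bsub>R\<^esub> g y"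
    and cl: "\<And>x. x \<in> carrier R \<Longrightarrow> g x \<in> carrier R" and gJ: "g ` J \<subseteq> J" and y: "y \<in> carrier R"
  shows "quot_map R J g (J +>\<^bsub>R\<^esub> y) = J +>\<^bsub>R\<^esub> g y"
proof -
  interpret ideal J R by fact
  have "J +>\<^bsub>R\<^esub> g x = J +>\<^bsub>R\<^esub> g y" if "x \<in> J +>\<^bsub>R\<^esub> y" for x
  proof -
    from that obtain j where j: "j \<in> J" "x = j \<oplus>\<^bsub>R\<^esub> y" by (auto simp: a_r_coset_def')
    then have "g x = g j \<oplus>\<^bsub>R\<^esub> g y" using add y a_Hcarr by simp
    moreover have "g j \<in> J" using gJ j by blast
    ultimately have "g x \<in> J +>\<^bsub>R\<^esub> g y" by (auto simp: a_r_coset_def')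
    then show ?thesis using a_repr_independence'[of "g x" "g y"] cl[OF y] by simp
  qed
  moreover have "y \<in> J +>\<^bsub>R\<^esub> y" by (rule a_rcos_self[OF y])
  ultimately show ?thesis unfolding quot_map_def by (intro SUP_eq_const) blast+
qed

text \<open>Each law holds after applying the injective \<open>h\<close>; for the linearity of
  \<open>I\<close> it matters that \<open>h\<close> takes constants to constants.\<close>

lemma comm_int_diff_ring_transport:
  assumes S: "comm_int_diff_ring S d' I'" and T: "cring T"
    and h: "h \<in> ring_hom T S" and inj: "inj_on h (carrier T)"
    and D: "\<And>x. x \<in> carrier T \<Longrightarrow> D x \<in> carrier T \<and> h (D x) = d' (h x)"
    and I: "\<And>x. x \<in> carrier T \<Longrightarrow> I x \<in> carrier T \<and> h (I x) = I' (h x)"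
  shows "comm_int_diff_ring T D I"
proof -
  interpret S: comm_int_diff_ring S d' I' by fact
  interpret T: cring T by fact
  interpret h: ring_hom_cring T S h
    by (intro ring_hom_cringI ring_hom_ringI2 T.ring_axioms S.ring_axioms h T S.is_cring)
  note injD = inj_onD[OF inj]
  interpret T: comm_diff_ring T D
  proof (intro comm_diff_ring.intro T.is_cring comm_diff_ring_axioms.intro)
    fix x y assume x: "x \<in> carrier T" and y: "y \<in> carrier T"
    show "D (x \<oplus>\<^bsub>T\<^esub> y) = D x \<oplus>\<^bsub>T\<^esub> D y"
      by (rule injD) (use x y D in \<open>simp_all add: S.d_add\<close>)
    show "D (x \<otimes>\<^bsub>T\<^esub> y) = D x \<otimes>\<^bsub>T\<^esub> y \<oplus>\<^bsub>T\<^esub> x \<otimes>\<^bsub>T\<^esub> D y"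
      by (rule injD) (use x y D in \<open>simp_all add: S.d_mult\<close>)
  qed (use D in auto)
  show ?thesis
  proof (intro comm_int_diff_ring.intro T.comm_diff_ring_axioms comm_int_diff_ring_axioms.intro linear_mapI)
    fix x assume x: "x \<in> carrier T"
    show "D (I x) = x"
      by (rule injD) (use x D I in \<open>simp_all add: S.d_int\<close>)
  next
    fix c x assume "c \<in> carrier (constants T D)" "x \<in> carrier (self_module T)"
    then have c: "c \<in> carrier T" "D c = \<zero>\<^bsub>T\<^esub>" and x: "x \<in> carrier T" by simp_all
    have "h c \<in> carrier (constants S d')" using c D[OF c(1)] h.hom_zero by simp
    from linear_mapD(3)[OF S.int_linear this, of "h x"] x
    have "I' (h c \<otimes>\<^bsub>S\<^esub> h x) = h c \<otimes>\<^bsub>S\<^esub> I' (h x)" by simp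
    then have "I (c \<otimes>\<^bsub>T\<^esub> x) = c \<otimes>\<^bsub>T\<^esub> I x"
      by (intro injD) (use x c I in simp_all)
    then show "I (c \<odot>\<^bsub>self_module T\<^esub> x) = c \<odot>\<^bsub>self_module T\<^esub> I x" by simp
  next
    fix x y assume "x \<in> carrier (self_module T)" "y \<in> carrier (self_module T)"
    then have x: "x \<in> carrier T" and y: "y \<in> carrier T" by simp_all
    have "I (x \<oplus>\<^bsub>T\<^esub> y) = I x \<oplus>\<^bsub>T\<^esub> I y"
      using linear_mapD(2)[OF S.int_linear, of "h x" "h y"]
      by (intro injD) (use x y I in simp_all)
    then show "I (x \<oplus>\<^bsub>self_module T\<^esub> y) = I x \<oplus>\<^bsub>self_module T\<^esub> I y" by simp
  qed (use I in simp)
qed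

context quasi_integration
begin

subsection \<open>The quotient by the ideal\<close>

interpretation CR: cring C by (rule C_cring)
interpretation C1: algebra C C1 by (rule C1_algebra)
interpretation S2: algebra C S2 by (rule S2_algebra)
interpretation C2: algebra C C2 by (rule C2_algebra)
interpretation CTm: module C CT_module by (rule CT_module_module)
interpretation TT: algebra C TT by (rule TT_algebra)
interpretation A: algebra C IDR by (rule IDR_algebra)
interpretation S: algebra C IDRQ by (rule IDRQ_algebra)

lemma C_module: "module C (self_module C)" "algebra C (self_module C)"
  using self_module_algebra[OF C_cring C_cring] algebraD(1) by auto

lemma sym_tens_M2: "s \<in> pos_part \<Longrightarrow> t \<in> pos_part \<Longrightarrow> sym_tens C T_pos s t \<in> carrier M2"
  using bilinear_map_closed[OF sym_tens_bilinear[OF T_pos_module], of s t] by (simp add: M2_def)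

lemmas incl_M1_closed = linear_mapD(1)[OF sym_incl_linear[OF M1_module, folded C1_def]]

lemmas incl_M2_closed = linear_mapD(1)[OF sym_incl_linear[OF M2_module, folded S2_def]]

lemmas pr2_closed = linear_mapD(1)[OF pr2_linear]

section \<open>Augmentations\<close>

text \<open>The augmentation of \<open>S2\<close> kills every \<open>epsS\<close>, and each term of
  a relation has such a factor. Hence \<open>J2\<close> lies in the kernel \<open>N\<close> and the
  augmentation descends to the quotient.\<close>

lemma C2_aug_ex: "\<exists>\<alpha>. linear_map C C2 (self_module C) \<alpha> \<and> \<alpha> \<one>\<^bsub>C2\<^esub> = \<one> \<and>
    (\<forall>m\<in>carrier M2. \<alpha> (pr2 (sym_incl C M2 m)) = \<zero>) \<and>
    (\<forall>x\<in>carrier C2. \<forall>y\<in>carrier C2. \<alpha> (x \<otimes>\<^bsub>C2\<^esub> y) = \<alpha> x \<otimes> \<alpha> y)"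
proof -
  obtain \<beta> where \<beta>: "linear_map C S2 (self_module C) \<beta>" "\<beta> \<one>\<^bsub>S2\<^esub> = \<one>"
    "\<And>m. m \<in> carrier M2 \<Longrightarrow> \<beta> (sym_incl C M2 m) = \<zero>"
    "\<And>x y. x \<in> carrier S2 \<Longrightarrow> y \<in> carrier S2 \<Longrightarrow> \<beta> (x \<otimes>\<^bsub>S2\<^esub> y) = \<beta> x \<otimes> \<beta> y"
    using sym_algebra_aug[OF M2_module, folded S2_def, unfolded constants_fields] by blast
  define N where "N = {x \<in> carrier S2. \<beta> x = \<zero>\<^bsub>self_module C\<^esub>}"
  have N: "ideal N S2"
    unfolding N_def by (rule kernel_ideal[OF S2'(4) algebraD(4)[OF C_module(2)] \<beta>(1)]) (simp add: \<beta>(4))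
  interpret N: ideal N S2 by (rule N)
  have eps: "epsS s t \<in> N" if "s \<in> pos_part" "t \<in> pos_part" for s t
  proof -
    have "\<beta> (epsS s t) = \<zero>\<^bsub>self_module C\<^esub>"
      unfolding epsS_def self_module_fields constants_fields by (rule \<beta>(3)) (rule sym_tens_M2[OF that])
    then show ?thesis using epsS_closed[OF that] unfolding N_def by blast
  qed
  have sm: "submodule N C S2" unfolding N_def by (rule kernel_submodule[OF S2'(1) C_module(1) \<beta>(1)])
  have sum: "finsum S2 F X \<in> N" if "finite X" "\<And>x. x \<in> X \<Longrightarrow> F x \<in> N" for F and X :: "nat set"
  proof -
    have "finsum S2 F X = msum S2 F (mset_set X)"
      by (rule S2.M.finsum_msum[OF that(1)]) (rule N.a_Hcarr[OF that(2)])
    moreover have "msum S2 F (mset_set X) \<in> N"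
      by (rule S2.msum_submodule[OF sm]) (use that in auto)
    ultimately show ?thesis by simp
  qed
  have gen: "J2_gen f g h \<in> N"
    if w: "f \<in> words" "g \<in> words" "h \<in> words" and ne: "f \<noteq> []" "g \<noteq> []" "h \<noteq> []" for f g h
  proof -
    have l: "J2_left u g v j \<in> N" if "u \<in> words" "v \<in> words" "v \<noteq> []" "j < length g" for u v j
      unfolding J2_left_def
    proof (rule sum)
      fix i assume i: "i \<in> {1 - j..<length u}"
      then have "drop i u \<noteq> []" "drop j g \<noteq> []" using that by auto
      then have "epsS (word (drop i u)) (word (drop j g)) \<in> N"
        using that w by (intro eps word_pos_part) simp_all
      then show "epsS (word (drop i u)) (word (drop j g)) \<otimes>\<^bsub>S2\<^esub>
          epsS (word (take i u) \<otimes>\<^bsub>TT\<^esub> word (take j g)) (word v) \<in> N"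
        using J2_summand_closed[OF that(1) w(2) that(2,3,4) i] by (intro N.I_r_closed)
    qed simp
    have r: "J2_right u g v j \<in> N" if "u \<in> words" "v \<in> words" "u \<noteq> []" "j < length g" for u v j
      unfolding J2_right_def
    proof (rule sum)
      fix i assume i: "i \<in> {1 - j..<length v}"
      then have "drop i v \<noteq> []" "drop j g \<noteq> []" using that by auto
      then have "epsS (word (drop j g)) (word (drop i v)) \<in> N"
        using that w by (intro eps word_pos_part) simp_all
      then show "epsS (word u) (word (take j g) \<otimes>\<^bsub>TT\<^esub> word (take i v)) \<otimes>\<^bsub>S2\<^esub>
          epsS (word (drop j g)) (word (drop i v)) \<in> N"
        using J2_summand_closed[OF that(2) w(2) that(1,3,4) i] by (intro N.I_l_closed)
    qed simp
    have m: "x \<ominus>\<^bsub>S2\<^esub> y \<in> N" if "x \<in> N" "y \<in> N" for x y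
      unfolding a_minus_def by (rule N.a_closed[OF that(1) N.a_inv_closed[OF that(2)]])
    show ?thesis
      unfolding J2_gen_alt
    proof (rule N.a_closed)
      show "epsS (word f \<otimes>\<^bsub>TT\<^esub> word g) (word h) \<ominus>\<^bsub>S2\<^esub> epsS (word f) (word g \<otimes>\<^bsub>TT\<^esub> word h) \<in> N"
        using w ne by (intro m eps) (simp_all add: shuffle_word)
      show "(\<Oplus>\<^bsub>S2\<^esub>j\<in>{..<length g}. J2_left f g h j \<ominus>\<^bsub>S2\<^esub> J2_right f g h j) \<in> N"
        using w ne by (intro sum m l r) simp_all
    qed
  qed
  have J2N: "J2 \<subseteq> N"
    unfolding J2_def by (rule S2.genideal_minimal[OF N]) (use gen in blast)
  have "lin_ext C C2 (self_module C) pr2 (carrier S2) \<beta>"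
    unfolding C2_def pr2_def[abs_def]
    by (rule coset_lin_ext[OF S2'(1) J2_submodule C_module(1) \<beta>(1)]) (use J2N in \<open>unfold N_def, blast\<close>)
  then obtain \<alpha> where \<alpha>: "linear_map C C2 (self_module C) \<alpha>" "\<And>x. x \<in> carrier S2 \<Longrightarrow> \<alpha> (pr2 x) = \<beta> x"
    unfolding lin_ext_def by blast
  show ?thesis
  proof (intro exI[of _ \<alpha>] conjI ballI)
    show "\<alpha> \<one>\<^bsub>C2\<^esub> = \<one>" using \<alpha>(2)[of "\<one>\<^bsub>S2\<^esub>"] by (simp add: pr2_one \<beta>(2))
    show "\<alpha> (pr2 (sym_incl C M2 m)) = \<zero>" if "m \<in> carrier M2" for m
      unfolding \<alpha>(2)[OF incl_M2_closed[OF that]] by (rule \<beta>(3)[OF that])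
    fix X Y assume "X \<in> carrier C2" "Y \<in> carrier C2"
    then obtain x y where x: "x \<in> carrier S2" "X = pr2 x" and y: "y \<in> carrier S2" "Y = pr2 y"
      using pr2_surj by metis
    have "\<alpha> (pr2 (x \<otimes>\<^bsub>S2\<^esub> y)) = \<beta> x \<otimes> \<beta> y"
      using x(1) y(1) by (simp only: \<alpha>(2) \<beta>(4) S2.m_closed)
    then show "\<alpha> (X \<otimes>\<^bsub>C2\<^esub> Y) = \<alpha> X \<otimes> \<alpha> Y"
      unfolding x(2) y(2) using x(1) y(1) by (simp only: pr2_mult \<alpha>(2))
  qed (rule \<alpha>(1))
qed

definition "aug1 = (SOME \<alpha>. linear_map C C1 (self_module C) \<alpha> \<and> \<alpha> \<one>\<^bsub>C1\<^esub> = \<one> \<and>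
    (\<forall>m\<in>carrier M1. \<alpha> (sym_incl C M1 m) = \<zero>) \<and>
    (\<forall>x\<in>carrier C1. \<forall>y\<in>carrier C1. \<alpha> (x \<otimes>\<^bsub>C1\<^esub> y) = \<alpha> x \<otimes> \<alpha> y))"

definition "aug2 = (SOME \<alpha>. linear_map C C2 (self_module C) \<alpha> \<and> \<alpha> \<one>\<^bsub>C2\<^esub> = \<one> \<and>
    (\<forall>m\<in>carrier M2. \<alpha> (pr2 (sym_incl C M2 m)) = \<zero>) \<and>
    (\<forall>x\<in>carrier C2. \<forall>y\<in>carrier C2. \<alpha> (x \<otimes>\<^bsub>C2\<^esub> y) = \<alpha> x \<otimes> \<alpha> y))"

lemma aug1: "linear_map C C1 (self_module C) aug1" "aug1 \<one>\<^bsub>C1\<^esub> = \<one>"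
    "m \<in> carrier M1 \<Longrightarrow> aug1 (sym_incl C M1 m) = \<zero>"
    "x \<in> carrier C1 \<Longrightarrow> y \<in> carrier C1 \<Longrightarrow> aug1 (x \<otimes>\<^bsub>C1\<^esub> y) = aug1 x \<otimes> aug1 y"
  using someI_ex[OF sym_algebra_aug[OF M1_module, folded C1_def], simplified, folded aug1_def] by blast+

lemma aug2: "linear_map C C2 (self_module C) aug2" "aug2 \<one>\<^bsub>C2\<^esub> = \<one>"
    "m \<in> carrier M2 \<Longrightarrow> aug2 (pr2 (sym_incl C M2 m)) = \<zero>"
    "x \<in> carrier C2 \<Longrightarrow> y \<in> carrier C2 \<Longrightarrow> aug2 (x \<otimes>\<^bsub>C2\<^esub> y) = aug2 x \<otimes> aug2 y"
  using someI_ex[OF C2_aug_ex, folded aug2_def] by blast+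

lemma aug1_closed: "x \<in> carrier C1 \<Longrightarrow> aug1 x \<in> carrier C"
  using linear_mapD(1)[OF aug1(1), of x] unfolding self_module_fields .

lemma aug2_closed: "x \<in> carrier C2 \<Longrightarrow> aug2 x \<in> carrier C"
  using linear_mapD(1)[OF aug2(1), of x] unfolding self_module_fields .

lemma aug1_eps1: "r \<in> carrier R \<Longrightarrow> t \<in> carrier TA \<Longrightarrow> aug1 (eps1 (Q r) t) = \<zero>"
  unfolding eps1_def M1_def[symmetric]
  by (rule aug1(3), unfold M1_def, rule bilinear_map_closed[OF tens_bilinear[OF RJ_module TT_module]]) simp_all

lemma aug2_eps2: "s \<in> pos_part \<Longrightarrow> t \<in> pos_part \<Longrightarrow> aug2 (eps2 s t) = \<zero>"
  using aug2(3)[OF sym_tens_M2] by (simp add: eps2_pr2 epsS_def)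

lemma aug2_\<omega>: "f \<in> words \<Longrightarrow> g \<in> words \<Longrightarrow> f \<noteq> [] \<or> g \<noteq> [] \<Longrightarrow> aug2 (\<omega> f g) = \<zero>"
  using linear_map_zero[OF C2'(1) C_module(1) aug2(1)] by (auto simp: \<omega>_def aug2_eps2)

definition "augCT = (SOME \<theta>. linear_map C CT_module TA \<theta> \<and>
  (\<forall>c\<in>carrier C2. \<forall>t\<in>carrier TA. \<theta> (tensCT c t) = aug2 c \<odot>\<^bsub>TA\<^esub> t))"

lemma augCT: "linear_map C CT_module TA augCT"
    "c \<in> carrier C2 \<Longrightarrow> t \<in> carrier TA \<Longrightarrow> augCT (tensCT c t) = aug2 c \<odot>\<^bsub>TA\<^esub> t"
proof -
  have "bilinear_map C C2 TT TA (\<lambda>c t. aug2 c \<odot>\<^bsub>TA\<^esub> t)"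
    unfolding bilinear_map_def
  proof (intro conjI ballI)
    show "linear_map C TT TA (\<lambda>t. aug2 c \<odot>\<^bsub>TA\<^esub> t)" if "c \<in> carrier C2" for c
      using linear_map_smult[OF TA_module linear_map_id aug2_closed[OF that]] by (simp add: linear_map_TT)
    show "linear_map C C2 TA (\<lambda>c. aug2 c \<odot>\<^bsub>TA\<^esub> t)" if "t \<in> carrier TT" for t
      using that by (intro linear_map_scalar[OF TA_module aug2(1)]) simp
  qed
  from tensor_bilinear_ext[OF C2'(1) TT_module TA_module this]
  have "\<exists>\<theta>. linear_map C CT_module TA \<theta> \<and>
      (\<forall>c\<in>carrier C2. \<forall>t\<in>carrier TA. \<theta> (tensCT c t) = aug2 c \<odot>\<^bsub>TA\<^esub> t)"
    by (auto simp: lin_ext_def CT_module_def tensCT_def)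
  from someI_ex[OF this, folded augCT_def]
  show "linear_map C CT_module TA augCT"
    "c \<in> carrier C2 \<Longrightarrow> t \<in> carrier TA \<Longrightarrow> augCT (tensCT c t) = aug2 c \<odot>\<^bsub>TA\<^esub> t" by blast+
qed

interpretation TA: module C TA by (rule TA_module)

lemma augCT_closed: "x \<in> carrier CT_module \<Longrightarrow> augCT x \<in> carrier TA"
  by (rule linear_mapD(1)[OF augCT(1)])

text \<open>\<open>aug2\<close> kills \<open>\<omega>\<close> unless both arguments are empty, so of
  all cuts only the one with two empty tails is left.\<close>

lemma augCT_ct_prod:
  assumes c: "c \<in> carrier C2" "e \<in> carrier C2" and f: "f \<in> words" and g: "g \<in> words"
  shows "augCT (ct_prod c f e g) = (aug2 c \<otimes> aug2 e) \<odot>\<^bsub>TA\<^esub> shuf_sum f g"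
proof -
  let ?c = "aug2 c \<otimes> aug2 e"
  have cc: "?c \<in> carrier C" using CR.m_closed[OF aug2_closed[OF c(1)] aug2_closed[OF c(2)]] by simp
  let ?X = "\<lambda>f1 f2 g1 g2. tensCT (c \<otimes>\<^bsub>C2\<^esub> e \<otimes>\<^bsub>C2\<^esub> \<omega> f2 g2) (shuf_sum f1 g1)"
  have w: "fst p \<in> words" "snd p \<in> words" if "p \<in># splits u" "u \<in> words" for p u
    using splits_in_lists[OF that(2), of "fst p" "snd p"] that(1) by simp_all
  have X: "augCT (?X f1 f2 g1 g2) = (?c \<otimes> aug2 (\<omega> f2 g2)) \<odot>\<^bsub>TA\<^esub> shuf_sum f1 g1"
    if "f2 \<in> words" "g2 \<in> words" for f1 f2 g1 g2
    using that c by (simp add: augCT(2) aug2(4))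
  have X0: "augCT (?X f1 f2 g1 g2) = \<zero>\<^bsub>TA\<^esub>"
    if "f2 \<in> words" "g2 \<in> words" "f2 \<noteq> [] \<or> g2 \<noteq> []" for f1 f2 g1 g2
    using X[OF that(1,2)] aug2_\<omega>[OF that] cc TA.smult_l_null[of "shuf_sum f1 g1"] by simp
  have "augCT (ct_prod c f e g) = msum TA (\<lambda>p. augCT (msum CT_module (\<lambda>q. ?X (fst p) (snd p) (fst q) (snd q)) (splits g))) (splits f)"
    unfolding ct_prod_splits[OF c f g] case_prod_unfold
    by (rule linear_map_msum[OF CT_module_module TA_module augCT(1)]) simp
  also have "\<dots> = msum TA (\<lambda>p. msum TA (\<lambda>q. augCT (?X (fst p) (snd p) (fst q) (snd q))) (splits g)) (splits f)"
    by (rule TA.M.msum_cong, rule linear_map_msum[OF CT_module_module TA_module augCT(1)])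
      (use c w[OF _ f] w[OF _ g] in simp)
  also have "\<dots> = msum TA (\<lambda>(f1, f2). msum TA (\<lambda>(g1, g2). augCT (?X f1 f2 g1 g2)) (splits g)) (splits f)"
    by (simp add: case_prod_unfold)
  also have "\<dots> = msum TA (\<lambda>(g1, g2). augCT (?X f [] g1 g2)) (splits g)"
  proof (rule TA.M.msum_splits)
    fix v assume v: "v \<noteq> []" "\<exists>u. u @ v = f"
    then have "v \<in> words" using f by auto
    show "msum TA (\<lambda>(g1, g2). augCT (?X (take (length f - length v) f) v g1 g2)) (splits g) = \<zero>\<^bsub>TA\<^esub>"
    proof (rule TA.M.msum_zero)
      fix p assume "p \<in># splits g"
      from X0[OF \<open>v \<in> words\<close> w(2)[OF this g]] v(1)
      show "(case p of (g1, g2) \<Rightarrow> augCT (?X (take (length f - length v) f) v g1 g2)) = \<zero>\<^bsub>TA\<^esub>"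
        by (simp add: case_prod_unfold)
    qed
  qed simp
  also have "\<dots> = augCT (?X f [] g [])"
  proof (rule TA.M.msum_splits)
    fix v assume v: "v \<noteq> []" "\<exists>u. u @ v = g"
    then have "v \<in> words" using g by auto
    then show "augCT (?X f [] (take (length g - length v) g) v) = \<zero>\<^bsub>TA\<^esub>"
      using v(1) by (intro X0) simp_all
  qed (use c in \<open>simp add: augCT_closed\<close>)
  also have "\<dots> = ?c \<odot>\<^bsub>TA\<^esub> shuf_sum f g"
    using X[of "[]" "[]" f g] cc by (simp add: aug2(2))
  finally show ?thesis .
qed

lemma augCT_mult:
  assumes x: "x \<in> carrier CT_module" and y: "y \<in> carrier CT_module"
  shows "augCT (CT_mult x y) = shuffle (augCT x) (augCT y)"
proof (rule bilinear_map_eq[OF CT_module_module tensCT_spans CT_module_module tensCT_spans TA_module _ _ _ x y])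
  show "bilinear_map C CT_module CT_module TA (\<lambda>x y. augCT (CT_mult x y))"
    by (rule bilinear_map_post[OF CT_mult_bilinear augCT(1)])
  show "bilinear_map C CT_module CT_module TA (\<lambda>x y. shuffle (augCT x) (augCT y))"
    by (rule bilinear_map_compose[OF shuffle_bilinear augCT(1) augCT(1)])
  fix x y assume "x \<in> CT_gen ` CT_gens" "y \<in> CT_gen ` CT_gens"
  then obtain c f e g where x: "x = tensCT c (word f)" "y = tensCT e (word g)"
    and c: "c \<in> carrier C2" "e \<in> carrier C2" and w: "f \<in> words" "g \<in> words" by auto
  have a: "aug2 c \<in> carrier C" "aug2 e \<in> carrier C" using c by (simp_all only: aug2_closed)
  have "shuffle (aug2 c \<odot>\<^bsub>TA\<^esub> word f) (aug2 e \<odot>\<^bsub>TA\<^esub> word g) =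
      aug2 c \<odot>\<^bsub>TA\<^esub> (aug2 e \<odot>\<^bsub>TA\<^esub> shuffle (word f) (word g))"
    using linear_mapD(3)[OF bilinear_mapD(2)[OF shuffle_bilinear TA.smult_closed[OF a(2)]] a(1), of "word g" "word f"]
      linear_mapD(3)[OF bilinear_mapD(1)[OF shuffle_bilinear] a(2), of "word f" "word g"] w by simp
  then show "augCT (CT_mult x y) = shuffle (augCT x) (augCT y)"
    using x c w TA.smult_assoc1[OF a, of "shuf_sum f g"]
    by (simp add: CT_mult_word augCT_ct_prod augCT(2) shuffle_word)
qed

section \<open>The homomorphism onto the ring with shuffle product\<close>

definition "\<Psi> = (SOME L. linear_map C IDR IDRQ L \<and>
  (\<forall>r\<in>carrier R. \<forall>c1\<in>carrier C1. \<forall>c2\<in>carrier C2. \<forall>f\<in>words.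
    L (tens4 r c1 c2 (word f)) = aug1 c1 \<odot>\<^bsub>IDRQ\<^esub> (aug2 c2 \<odot>\<^bsub>IDRQ\<^esub> tensQ r (word f))))"

lemma \<Psi>_spec: "linear_map C IDR IDRQ \<Psi> \<and>
  (\<forall>r\<in>carrier R. \<forall>c1\<in>carrier C1. \<forall>c2\<in>carrier C2. \<forall>f\<in>words.
    \<Psi> (tens4 r c1 c2 (word f)) = aug1 c1 \<odot>\<^bsub>IDRQ\<^esub> (aug2 c2 \<odot>\<^bsub>IDRQ\<^esub> tensQ r (word f)))"
proof -
  have "\<exists>L. linear_map C IDR IDRQ L \<and>
  (\<forall>r\<in>carrier R. \<forall>c1\<in>carrier C1. \<forall>c2\<in>carrier C2. \<forall>f\<in>words.
    L (tens4 r c1 c2 (word f)) = aug1 c1 \<odot>\<^bsub>IDRQ\<^esub> (aug2 c2 \<odot>\<^bsub>IDRQ\<^esub> tensQ r (word f)))"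
  proof (rule tens4_ext[OF IDRQ'(1)])
    fix c1 c2 f assume c: "c1 \<in> carrier C1" "c2 \<in> carrier C2" "f \<in> words"
    then show "linear_map C RR IDRQ (\<lambda>r. aug1 c1 \<odot>\<^bsub>IDRQ\<^esub> (aug2 c2 \<odot>\<^bsub>IDRQ\<^esub> tensQ r (word f)))"
      by (intro linear_map_smult IDRQ'(1) tensQ_lin1 linear_map_id aug1_closed aug2_closed word_closed)
  next
    fix r c2 f assume c: "r \<in> carrier R" "c2 \<in> carrier C2" "f \<in> words"
    then show "linear_map C C1 IDRQ (\<lambda>c1. aug1 c1 \<odot>\<^bsub>IDRQ\<^esub> (aug2 c2 \<odot>\<^bsub>IDRQ\<^esub> tensQ r (word f)))"
      by (intro linear_map_scalar[OF IDRQ'(1) aug1(1)] S.smult_closed tensQ_closed aug2_closed word_closed)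
  next
    fix r c1 f assume c: "r \<in> carrier R" "c1 \<in> carrier C1" "f \<in> words"
    then show "linear_map C C2 IDRQ (\<lambda>c2. aug1 c1 \<odot>\<^bsub>IDRQ\<^esub> (aug2 c2 \<odot>\<^bsub>IDRQ\<^esub> tensQ r (word f)))"
      by (intro linear_map_smult[OF IDRQ'(1)] linear_map_scalar[OF IDRQ'(1) aug2(1)] tensQ_closed aug1_closed word_closed)
  next
    fix r c1 c2 assume c: "r \<in> carrier R" "c1 \<in> carrier C1" "c2 \<in> carrier C2"
    then show "multilinear C RT IDRQ (\<lambda>f. aug1 c1 \<odot>\<^bsub>IDRQ\<^esub> (aug2 c2 \<odot>\<^bsub>IDRQ\<^esub> tensQ r (word f)))"
      by (intro multilinear_compose[OF word_multilinear] linear_map_smult IDRQ'(1) tensQ_lin2 linear_map_id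
          aug1_closed aug2_closed)
  qed
  from someI_ex[OF this, folded \<Psi>_def] show ?thesis .
qed

lemma \<Psi>_linear: "linear_map C IDR IDRQ \<Psi>"
  using \<Psi>_spec by blast

lemma \<Psi>_tens4: "\<lbrakk>r \<in> carrier R; c1 \<in> carrier C1; c2 \<in> carrier C2; f \<in> words\<rbrakk> \<Longrightarrow>
    \<Psi> (tens4 r c1 c2 (word f)) = aug1 c1 \<odot>\<^bsub>IDRQ\<^esub> (aug2 c2 \<odot>\<^bsub>IDRQ\<^esub> tensQ r (word f))"
  using \<Psi>_spec by blast

lemma \<Psi>_tens4_one: "\<lbrakk>r \<in> carrier R; f \<in> words\<rbrakk> \<Longrightarrow>
    \<Psi> (tens4 r \<one>\<^bsub>C1\<^esub> \<one>\<^bsub>C2\<^esub> (word f)) = tensQ r (word f)"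
  using S.smult_one by (simp add: \<Psi>_tens4 aug1(2) aug2(2))

text \<open>Prepares multiplicativity: a product in \<open>CT\<close> is a sum of pure tensors, so
  the formula on pure tensors has to be extended to all of \<open>CT_module\<close>.\<close>

lemma \<Psi>_tensA:
  assumes r: "r \<in> carrier R" and c: "c \<in> carrier C1" and x: "x \<in> carrier CT_module"
  shows "\<Psi> (tensA r (tensCC c x)) = aug1 c \<odot>\<^bsub>IDRQ\<^esub> tensQ r (augCT x)"
proof (rule linear_map_eq[OF CT_module_module IDRQ'(1) tensCT_spans _ _ _ x])
  show "linear_map C CT_module IDRQ (\<lambda>x. \<Psi> (tensA r (tensCC c x)))"
    by (intro linear_map_compose[OF \<Psi>_linear] bilinear_map_compose_right[OF tensA_bilinear]
        bilinear_mapD(1)[OF tensCC_bilinear] c) (simp add: r)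
  show "linear_map C CT_module IDRQ (\<lambda>x. aug1 c \<odot>\<^bsub>IDRQ\<^esub> tensQ r (augCT x))"
    by (intro linear_map_smult IDRQ'(1) tensQ_lin2 augCT(1) aug1_closed r c)
  fix x assume "x \<in> CT_gen ` CT_gens"
  then obtain e f where x: "x = tensCT e (word f)" and e: "e \<in> carrier C2" and f: "f \<in> words" by auto
  have "tensQ r (aug2 e \<odot>\<^bsub>TA\<^esub> word f) = aug2 e \<odot>\<^bsub>IDRQ\<^esub> tensQ r (word f)"
    using linear_mapD(3)[OF bilinear_mapD(1)[OF tensQ_bilinear, of r] aug2_closed[OF e], of "word f"] r f by simp
  then show "\<Psi> (tensA r (tensCC c x)) = aug1 c \<odot>\<^bsub>IDRQ\<^esub> tensQ r (augCT x)"
    using \<Psi>_tens4[OF r c e f] e f by (simp add: x tens4_tensA augCT(2))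
qed

lemma \<Psi>_mult:
  assumes "x \<in> carrier IDR" "y \<in> carrier IDR"
  shows "\<Psi> (x \<otimes>\<^bsub>IDR\<^esub> y) = \<Psi> x \<otimes>\<^bsub>IDRQ\<^esub> \<Psi> y"
proof (rule multiplicative_of_span[OF IDR'(4) IDRQ'(4) \<Psi>_linear tens4_spans_all _ assms])
  fix x y
  assume "x \<in> {tens4 r c1 c2 (word f) | r c1 c2 f. r \<in> carrier R \<and> c1 \<in> carrier C1 \<and> c2 \<in> carrier C2 \<and> f \<in> words}"
    "y \<in> {tens4 r c1 c2 (word f) | r c1 c2 f. r \<in> carrier R \<and> c1 \<in> carrier C1 \<and> c2 \<in> carrier C2 \<and> f \<in> words}"
  then obtain r c1 X s e1 Y where x: "x = tensA r (tensCC c1 X)" "r \<in> carrier R" "c1 \<in> carrier C1" "X \<in> carrier CT_module"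
    and y: "y = tensA s (tensCC e1 Y)" "s \<in> carrier R" "e1 \<in> carrier C1" "Y \<in> carrier CT_module"
    unfolding tens4_tensA by (blast intro: tensCT_closed word_closed)
  have XY: "CT_mult X Y \<in> carrier CT_module" by (rule bilinear_map_closed[OF CT_mult_bilinear x(4) y(4)])
  have a: "aug1 c1 \<in> carrier C" "aug1 e1 \<in> carrier C" using aug1_closed x(3) y(3) by blast+
  have q: "tensQ r (augCT X) \<in> carrier IDRQ" "tensQ s (augCT Y) \<in> carrier IDRQ"
    using x y augCT_closed by simp_all
  have "\<Psi> (x \<otimes>\<^bsub>IDR\<^esub> y) = (aug1 c1 \<otimes> aug1 e1) \<odot>\<^bsub>IDRQ\<^esub> tensQ (r \<otimes> s) (shuffle (augCT X) (augCT Y))"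
    using x y XY by (simp add: tens4_mult \<Psi>_tensA aug1(4) augCT_mult)
  also have "\<dots> = (aug1 c1 \<otimes> aug1 e1) \<odot>\<^bsub>IDRQ\<^esub> (tensQ r (augCT X) \<otimes>\<^bsub>IDRQ\<^esub> tensQ s (augCT Y))"
    using x y by (simp add: tensQ_mult augCT_closed)
  also have "\<dots> = aug1 c1 \<odot>\<^bsub>IDRQ\<^esub> (aug1 e1 \<odot>\<^bsub>IDRQ\<^esub> (tensQ r (augCT X) \<otimes>\<^bsub>IDRQ\<^esub> tensQ s (augCT Y)))"
    using S.smult_assoc1[OF a S.m_closed[OF q]] by simp
  also have "\<dots> = \<Psi> x \<otimes>\<^bsub>IDRQ\<^esub> \<Psi> y"
    using x y S.smult_assoc2[OF a(1) q(1) S.smult_closed[OF a(2) q(2)]] S.smult_assoc_right[OF a(2) q]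
    by (simp add: \<Psi>_tensA)
  finally show "\<Psi> (x \<otimes>\<^bsub>IDR\<^esub> y) = \<Psi> x \<otimes>\<^bsub>IDRQ\<^esub> \<Psi> y" .
qed

lemma \<Psi>_ring_hom: "\<Psi> \<in> ring_hom IDR IDRQ"
  by (rule ring_hom_memI)
    (simp_all add: linear_mapD[OF \<Psi>_linear] \<Psi>_mult one_IDR one_IDRQ \<Psi>_tens4_one)

lemma \<Psi>_deriv: "x \<in> carrier IDR \<Longrightarrow> \<Psi> (deriv x) = derivQ (\<Psi> x)"
proof (rule linear_map_eq[OF IDR'(1) IDRQ'(1) tens4_spans_all])
  show "linear_map C IDR IDRQ (\<lambda>x. \<Psi> (deriv x))" "linear_map C IDR IDRQ (\<lambda>x. derivQ (\<Psi> x))"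
    by (intro linear_map_compose[OF \<Psi>_linear] linear_map_compose[OF derivQ_linear] deriv_linear \<Psi>_linear)+
  fix x assume "x \<in> {tens4 r c1 c2 (word f) | r c1 c2 f. r \<in> carrier R \<and> c1 \<in> carrier C1 \<and> c2 \<in> carrier C2 \<and> f \<in> words}"
  then obtain r c1 c2 f where x: "x = tens4 r c1 c2 (word f)" and c: "r \<in> carrier R" "c1 \<in> carrier C1" "c2 \<in> carrier C2"
    and f: "f \<in> words" by blast
  have a: "aug1 c1 \<in> carrier C" "aug2 c2 \<in> carrier C" using aug1_closed aug2_closed c by blast+
  note l = linear_mapD(3)[OF derivQ_linear]
  show "\<Psi> (deriv x) = derivQ (\<Psi> x)"
  proof (cases f)
    case Nil
    then show ?thesis
      using c a S.smult_closed[OF a(2)] by (simp only: x deriv_tens4 \<Psi>_tens4 l d_closed' derivQ_Nil f[unfolded Nil] tensQ_closed word_closed)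
  next
    case (Cons b g)
    with f have b: "b \<in> carrier RT" "g \<in> words" "b # g \<in> words" by simp_all
    then have rb: "r \<otimes> b \<in> carrier R" "d r \<in> carrier R" using c by simp_all
    have t: "tensQ r (word (b # g)) \<in> carrier IDRQ" "tensQ (d r) (word (b # g)) \<in> carrier IDRQ"
      "tensQ (r \<otimes> b) (word g) \<in> carrier IDRQ" using b c by simp_all
    have "\<Psi> (deriv x) = \<Psi> (tens4 (d r) c1 c2 (word (b # g))) \<oplus>\<^bsub>IDRQ\<^esub> \<Psi> (tens4 (r \<otimes> b) c1 c2 (word g))"
      unfolding x Cons deriv_tens4(2)[OF c b(1,2)]
      by (rule linear_mapD(2)[OF \<Psi>_linear]) (use c b in simp_all)
    also have "\<dots> = aug1 c1 \<odot>\<^bsub>IDRQ\<^esub> (aug2 c2 \<odot>\<^bsub>IDRQ\<^esub> tensQ (d r) (word (b # g))) \<oplus>\<^bsub>IDRQ\<^esub>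
        aug1 c1 \<odot>\<^bsub>IDRQ\<^esub> (aug2 c2 \<odot>\<^bsub>IDRQ\<^esub> tensQ (r \<otimes> b) (word g))"
      using \<Psi>_tens4[OF rb(2) c(2,3) b(3)] \<Psi>_tens4[OF rb(1) c(2,3) b(2)] by simp
    also have "\<dots> = aug1 c1 \<odot>\<^bsub>IDRQ\<^esub> (aug2 c2 \<odot>\<^bsub>IDRQ\<^esub> derivQ (tensQ r (word (b # g))))"
      using derivQ_Cons[OF c(1) b(1,2)] S.smult_r_distr[OF a(2) t(2,3)]
        S.smult_r_distr[OF a(1) S.smult_closed[OF a(2) t(2)] S.smult_closed[OF a(2) t(3)]] by simp
    also have "\<dots> = derivQ (\<Psi> x)"
      using \<Psi>_tens4[OF c b(3)] l[OF a(2) t(1)] l[OF a(1) S.smult_closed[OF a(2) t(1)]] by (simp add: x Cons)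
    finally show ?thesis .
  qed
qed

text \<open>The terms by which \<open>integ\<close> differs from \<open>intQ\<close> carry a factor
  \<open>eps1\<close>, which \<open>aug1\<close> kills; what remains is the recursion of
  \<open>intQ\<close>.\<close>

lemma \<Psi>_i4_word:
  assumes c: "c1 \<in> carrier C1" "c2 \<in> carrier C2"
  shows "f \<in> words \<Longrightarrow> r \<in> carrier R \<Longrightarrow>
    \<Psi> (i4_word c1 c2 f r) = aug1 c1 \<odot>\<^bsub>IDRQ\<^esub> (aug2 c2 \<odot>\<^bsub>IDRQ\<^esub> intQ (tensQ r (word f)))"
proof (induction f arbitrary: r)
  have a: "aug1 c1 \<in> carrier C" "aug2 c2 \<in> carrier C" using aug1_closed aug2_closed c by blast+
  let ?k = "\<lambda>x. aug1 c1 \<odot>\<^bsub>IDRQ\<^esub> (aug2 c2 \<odot>\<^bsub>IDRQ\<^esub> x)"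
  have k: "linear_map C IDRQ IDRQ ?k"
    by (intro linear_map_smult IDRQ'(1) linear_map_id a)
  note kD = linear_mapD[OF k] linear_map_minus[OF IDRQ'(1) IDRQ'(1) k]
  note P = linear_mapD(2)[OF \<Psi>_linear] linear_map_minus[OF IDR'(1) IDRQ'(1) \<Psi>_linear]
  have z: "\<Psi> (tens4 \<one> (c1 \<otimes>\<^bsub>C1\<^esub> eps1 (Q r) t) c2 (word [])) = \<zero>\<^bsub>IDRQ\<^esub>"
    if "r \<in> carrier R" "t \<in> carrier TA" for r t
  proof -
    have "aug1 (c1 \<otimes>\<^bsub>C1\<^esub> eps1 (Q r) t) = \<zero>"
      using a c that by (simp add: aug1(4) aug1_eps1)
    moreover have "aug2 c2 \<odot>\<^bsub>IDRQ\<^esub> tensQ \<one> (word []) \<in> carrier IDRQ" by (rule S.smult_closed[OF a(2)]) simp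
    ultimately show ?thesis
      using that c S.smult_l_null by (subst \<Psi>_tens4) simp_all
  qed
  have m0: "x \<ominus>\<^bsub>IDRQ\<^esub> \<zero>\<^bsub>IDRQ\<^esub> = x" if "x \<in> carrier IDRQ" for x
    using that S.M.minus_equality[of "\<zero>\<^bsub>IDRQ\<^esub>" "\<zero>\<^bsub>IDRQ\<^esub>"] by (simp add: a_minus_def)
  {
    case Nil
    have "\<Psi> (i4_word c1 c2 [] r) = ?k (tensQ (Q r) (word [])) \<ominus>\<^bsub>IDRQ\<^esub> \<zero>\<^bsub>IDRQ\<^esub> \<oplus>\<^bsub>IDRQ\<^esub> ?k (tensQ \<one> (word [r \<ominus> d (Q r)]))"
      using Nil c by (simp add: P z, simp add: \<Psi>_tens4)
    also have "\<dots> = ?k (intQ (tensQ r (word [])))"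
      using Nil by (simp add: m0 kD(1) intQ_Nil kD(2))
    finally show ?case .
  next
    case (Cons b f)
    have "\<Psi> (i4_word c1 c2 (b # f) r) = ?k (tensQ (Q r) (word (b # f))) \<ominus>\<^bsub>IDRQ\<^esub> \<zero>\<^bsub>IDRQ\<^esub>
        \<ominus>\<^bsub>IDRQ\<^esub> ?k (intQ (tensQ (Q r \<otimes> b) (word f))) \<oplus>\<^bsub>IDRQ\<^esub> ?k (tensQ \<one> (word ((r \<ominus> d (Q r)) # b # f)))"
      using Cons.prems c by (simp add: P z Cons.IH, simp add: \<Psi>_tens4)
    also have "\<dots> = ?k (intQ (tensQ r (word (b # f))))"
      using Cons.prems by (simp add: m0 kD(1) intQ_Cons kD)
    finally show ?case .
  }
qed

lemma \<Psi>_integ: "x \<in> carrier IDR \<Longrightarrow> \<Psi> (integ x) = intQ (\<Psi> x)"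
proof (rule linear_map_eq[OF IDR'(1) IDRQ'(1) tens4_spans_all])
  show "linear_map C IDR IDRQ (\<lambda>x. \<Psi> (integ x))" "linear_map C IDR IDRQ (\<lambda>x. intQ (\<Psi> x))"
    by (intro linear_map_compose[OF \<Psi>_linear] linear_map_compose[OF intQ_linear] integ_linear \<Psi>_linear)+
  fix x assume "x \<in> {tens4 r c1 c2 (word f) | r c1 c2 f. r \<in> carrier R \<and> c1 \<in> carrier C1 \<and> c2 \<in> carrier C2 \<and> f \<in> words}"
  then obtain r c1 c2 f where x: "x = tens4 r c1 c2 (word f)" and c: "r \<in> carrier R" "c1 \<in> carrier C1" "c2 \<in> carrier C2"
    and f: "f \<in> words" by blast
  have a: "aug1 c1 \<in> carrier C" "aug2 c2 \<in> carrier C" using aug1_closed aug2_closed c by blast+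
  have t: "tensQ r (word f) \<in> carrier IDRQ" using c f by simp
  show "\<Psi> (integ x) = intQ (\<Psi> x)"
    using linear_mapD(3)[OF intQ_linear a(2) t] linear_mapD(3)[OF intQ_linear a(1) S.smult_closed[OF a(2) t]]
    by (simp add: x integ_tens4[OF f c] \<Psi>_i4_word[OF c(2,3) f c(1)] \<Psi>_tens4[OF c f])
qed

section \<open>The linear section and the kernel\<close>

text \<open>Only a linear section: products of words in \<open>IDR\<close> have correction terms in
  general, so multiplicativity cannot be expected.\<close>

definition "\<sigma> = (SOME L. linear_map C IDRQ IDR L \<and>
  (\<forall>r\<in>carrier R. \<forall>f\<in>words. L (tensQ r (word f)) = tens4 r \<one>\<^bsub>C1\<^esub> \<one>\<^bsub>C2\<^esub> (word f)))"

lemma \<sigma>_spec: "linear_map C IDRQ IDR \<sigma> \<and>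
  (\<forall>r\<in>carrier R. \<forall>f\<in>words. \<sigma> (tensQ r (word f)) = tens4 r \<one>\<^bsub>C1\<^esub> \<one>\<^bsub>C2\<^esub> (word f))"
proof -
  have "\<exists>L. linear_map C IDRQ IDR L \<and>
    (\<forall>r\<in>carrier R. \<forall>f\<in>words. L (tensQ r (word f)) = tens4 r \<one>\<^bsub>C1\<^esub> \<one>\<^bsub>C2\<^esub> (word f))"
    by (rule tensQ_ext[OF IDR'(1)])
      (simp_all add: tens4_lin1 linear_map_id multilinear_compose[OF word_multilinear tens4_lin4[OF _ _ _ linear_map_id]])
  from someI_ex[OF this, folded \<sigma>_def] show ?thesis .
qed

lemma \<sigma>_linear: "linear_map C IDRQ IDR \<sigma>"
  using \<sigma>_spec by blast

lemma \<sigma>_tensQ: "r \<in> carrier R \<Longrightarrow> f \<in> words \<Longrightarrow> \<sigma> (tensQ r (word f)) = tens4 r \<one>\<^bsub>C1\<^esub> \<one>\<^bsub>C2\<^esub> (word f)"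
  using \<sigma>_spec by blast

lemma \<sigma>_closed: "s \<in> carrier IDRQ \<Longrightarrow> \<sigma> s \<in> carrier IDR"
  by (rule linear_mapD(1)[OF \<sigma>_linear])

lemma \<Psi>_closed: "x \<in> carrier IDR \<Longrightarrow> \<Psi> x \<in> carrier IDRQ"
  by (rule linear_mapD(1)[OF \<Psi>_linear])

lemma \<Psi>_\<sigma>: "s \<in> carrier IDRQ \<Longrightarrow> \<Psi> (\<sigma> s) = s"
  by (rule linear_map_eq[OF IDRQ'(1) IDRQ'(1) tensQ_spans linear_map_compose[OF \<Psi>_linear \<sigma>_linear] linear_map_id])
    (auto simp: \<sigma>_tensQ \<Psi>_tens4_one)

abbreviation "ker_\<Psi> \<equiv> {x \<in> carrier IDR. \<Psi> x = \<zero>\<^bsub>IDRQ\<^esub>}"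

lemma ker_\<Psi>_ideal: "int_diff_ideal IDR deriv integ ker_\<Psi>"
  unfolding int_diff_ideal_def
proof (intro conjI)
  show "ideal ker_\<Psi> IDR" by (rule kernel_ideal[OF IDR'(4) IDRQ'(4) \<Psi>_linear \<Psi>_mult])
  show "deriv ` ker_\<Psi> \<subseteq> ker_\<Psi>"
    using linear_map_zero[OF IDRQ'(1) IDRQ'(1) derivQ_linear] linear_mapD(1)[OF deriv_linear] \<Psi>_deriv by auto
  show "integ ` ker_\<Psi> \<subseteq> ker_\<Psi>"
    using linear_map_zero[OF IDRQ'(1) IDRQ'(1) intQ_linear] linear_mapD(1)[OF integ_linear] \<Psi>_integ by auto
qed

lemma J_gens_ker: "J_gens \<subseteq> ker_\<Psi>"
proof
  fix x assume "x \<in> J_gens"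
  then consider (1) a b c m where "x = tens4 a (sym_incl C M1 m) (b \<odot>\<^bsub>C2\<^esub> \<one>\<^bsub>C2\<^esub>) (c \<odot>\<^bsub>TT\<^esub> \<one>\<^bsub>TT\<^esub>)"
      "a \<in> carrier C" "b \<in> carrier C" "c \<in> carrier C" "m \<in> carrier M1"
    | (2) a b c m where "x = tens4 a (b \<odot>\<^bsub>C1\<^esub> \<one>\<^bsub>C1\<^esub>) (pr2 (sym_incl C M2 m)) (c \<odot>\<^bsub>TT\<^esub> \<one>\<^bsub>TT\<^esub>)"
      "a \<in> carrier C" "b \<in> carrier C" "c \<in> carrier C" "m \<in> carrier M2"
    unfolding J_gens_def pr2_def by blast
  then show "x \<in> ker_\<Psi>"
  proof cases
    case 1
    have m: "sym_incl C M1 m \<in> carrier C1"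
      by (rule incl_M1_closed[OF 1(5)])
    have b: "b \<odot>\<^bsub>C2\<^esub> \<one>\<^bsub>C2\<^esub> \<in> carrier C2" using 1 by (intro C2.smult_closed) auto
    have c: "c \<odot>\<^bsub>TT\<^esub> \<one>\<^bsub>TT\<^esub> \<in> carrier TA" using TT.smult_closed[OF 1(4) TT.one_closed] by simp
    have X: "tensCT (b \<odot>\<^bsub>C2\<^esub> \<one>\<^bsub>C2\<^esub>) (c \<odot>\<^bsub>TT\<^esub> \<one>\<^bsub>TT\<^esub>) \<in> carrier CT_module" by (rule tensCT_closed[OF b c])
    have a: "a \<in> carrier R" using 1 by simp
    have "\<Psi> x = \<zero>\<^bsub>IDRQ\<^esub>"
      unfolding 1(1) tens4_tensA \<Psi>_tensA[OF a m X]
      using S.smult_l_null[OF tensQ_closed[OF a augCT_closed[OF X]]] by (simp add: aug1(3)[OF 1(5)])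
    moreover have "x \<in> carrier IDR" unfolding 1(1) by (rule tens4_closed[OF a m b c])
    ultimately show ?thesis by simp
  next
    case 2
    have m: "pr2 (sym_incl C M2 m) \<in> carrier C2"
      by (rule pr2_closed[OF incl_M2_closed[OF 2(5)]])
    have b: "b \<odot>\<^bsub>C1\<^esub> \<one>\<^bsub>C1\<^esub> \<in> carrier C1" using 2 by (intro C1.smult_closed) auto
    have c: "c \<odot>\<^bsub>TT\<^esub> \<one>\<^bsub>TT\<^esub> \<in> carrier TA" using TT.smult_closed[OF 2(4) TT.one_closed] by simp
    have X: "tensCT (pr2 (sym_incl C M2 m)) (c \<odot>\<^bsub>TT\<^esub> \<one>\<^bsub>TT\<^esub>) \<in> carrier CT_module" by (rule tensCT_closed[OF m c])
    have a: "a \<in> carrier R" using 2 by simp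
    have "augCT (tensCT (pr2 (sym_incl C M2 m)) (c \<odot>\<^bsub>TT\<^esub> \<one>\<^bsub>TT\<^esub>)) = \<zero>\<^bsub>TA\<^esub>"
      unfolding augCT(2)[OF m c] aug2(3)[OF 2(5)] using TA.smult_l_null[OF c] by simp
    moreover have "tensQ a \<zero>\<^bsub>TA\<^esub> = \<zero>\<^bsub>IDRQ\<^esub>"
      by (rule linear_map_zero[OF TA_module IDRQ'(1) bilinear_mapD(1)[OF tensQ_bilinear]]) (simp add: a)
    ultimately have "\<Psi> x = \<zero>\<^bsub>IDRQ\<^esub>"
      unfolding 2(1) tens4_tensA \<Psi>_tensA[OF a b X]
      using S.smult_r_null[OF aug1_closed[OF b]] by simp
    moreover have "x \<in> carrier IDR" unfolding 2(1) by (rule tens4_closed[OF a b m c])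
    ultimately show ?thesis by simp
  qed
qed

text \<open>The kernel belongs to the family whose intersection is \<open>J\<close>. This gives the
  inclusion and, the family being nonempty, makes the intersection an ideal.\<close>

lemma J_ideal: "int_diff_ideal IDR deriv integ J" and J_gens_J: "J_gens \<subseteq> J" and J_ker: "J \<subseteq> ker_\<Psi>"
proof -
  let ?F = "{J. int_diff_ideal IDR deriv integ J \<and> J_gens \<subseteq> J}"
  have k: "ker_\<Psi> \<in> ?F" using ker_\<Psi>_ideal J_gens_ker by simp
  have J: "J = \<Inter>?F" by (simp add: J_def gen_int_diff_ideal_def)
  show "J \<subseteq> ker_\<Psi>" unfolding J by (rule Inter_lower[OF k])
  show "J_gens \<subseteq> J" unfolding J by blast
  have "ideal (\<Inter>?F) IDR"
    by (rule A.i_Intersect) (use k in \<open>auto simp: int_diff_ideal_def\<close>)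
  moreover have "deriv ` \<Inter>?F \<subseteq> \<Inter>?F" "integ ` \<Inter>?F \<subseteq> \<Inter>?F"
    unfolding int_diff_ideal_def by blast+
  ultimately show "int_diff_ideal IDR deriv integ J" by (simp add: J int_diff_ideal_def)
qed

interpretation J: ideal J IDR
  using J_ideal by (simp add: int_diff_ideal_def)

lemma J_submodule: "submodule J C IDR"
  by (rule ideal_submodule[OF IDR'(4) J.ideal_axioms])

text \<open>The tensor is a generator of \<open>J\<close>, with all scalars equal to one, times the
  tensor with the remaining factors.\<close>

lemma tens4_eps1_J:
  assumes "r \<in> carrier R" "m \<in> carrier M1" "y \<in> carrier C1" "c2 \<in> carrier C2" "f \<in> words"
  shows "tens4 r (sym_incl C M1 m \<otimes>\<^bsub>C1\<^esub> y) c2 (word f) \<in> J"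
proof -
  have m: "sym_incl C M1 m \<in> carrier C1"
    by (rule incl_M1_closed[OF assms(2)])
  let ?x = "tens4 \<one> (sym_incl C M1 m) \<one>\<^bsub>C2\<^esub> (word [])"
  have "tens4 \<one> (sym_incl C M1 m) (\<one>\<^bsub>C\<^esub> \<odot>\<^bsub>C2\<^esub> \<one>\<^bsub>C2\<^esub>) (\<one>\<^bsub>C\<^esub> \<odot>\<^bsub>TT\<^esub> \<one>\<^bsub>TT\<^esub>) \<in> J_gens"
    unfolding J_gens_def using assms(2) CR.one_closed by (simp only: constants_fields) blast
  then have "?x \<in> J" using J_gens_J TT.smult_one[OF TT.one_closed] C2.smult_one[OF C2.one_closed] by auto
  then have "?x \<otimes>\<^bsub>IDR\<^esub> tens4 r y c2 (word f) \<in> J"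
    by (rule J.I_r_closed) (use assms in simp)
  then show ?thesis using assms m by (simp add: tens4_mult_Nil)
qed

lemma tens4_eps2_J:
  assumes "r \<in> carrier R" "m \<in> carrier M2" "y \<in> carrier C2" "c1 \<in> carrier C1" "f \<in> words"
  shows "tens4 r c1 (pr2 (sym_incl C M2 m) \<otimes>\<^bsub>C2\<^esub> y) (word f) \<in> J"
proof -
  have m: "pr2 (sym_incl C M2 m) \<in> carrier C2"
    by (rule pr2_closed[OF incl_M2_closed[OF assms(2)]])
  let ?x = "tens4 \<one> \<one>\<^bsub>C1\<^esub> (pr2 (sym_incl C M2 m)) (word [])"
  have "tens4 \<one> (\<one>\<^bsub>C\<^esub> \<odot>\<^bsub>C1\<^esub> \<one>\<^bsub>C1\<^esub>) (pr2 (sym_incl C M2 m)) (\<one>\<^bsub>C\<^esub> \<odot>\<^bsub>TT\<^esub> \<one>\<^bsub>TT\<^esub>) \<in> J_gens"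
    unfolding J_gens_def pr2_def using assms(2) CR.one_closed by (simp only: constants_fields) blast
  then have "?x \<in> J" using J_gens_J TT.smult_one[OF TT.one_closed] C1.smult_one[OF C1.one_closed] by auto
  then have "?x \<otimes>\<^bsub>IDR\<^esub> tens4 r c1 y (word f) \<in> J"
    by (rule J.I_r_closed) (use assms in simp)
  then show ?thesis using assms m by (simp add: tens4_mult_Nil)
qed

lemma C2_spans: "spans C C2 ({\<one>\<^bsub>C2\<^esub>} \<union>
    {pr2 (sym_incl C M2 m) \<otimes>\<^bsub>C2\<^esub> y | m y. m \<in> carrier M2 \<and> y \<in> carrier C2})"
proof (rule spans_mono)
  let ?G = "{\<one>\<^bsub>S2\<^esub>} \<union> {sym_incl C M2 m \<otimes>\<^bsub>S2\<^esub> y | m y. m \<in> carrier M2 \<and> y \<in> carrier S2}"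
  show "spans C C2 (pr2 ` ?G)"
    using coset_spans[OF S2'(1) J2_submodule sym_algebra_spans[OF M2_module, folded S2_def]]
    by (simp add: C2_def pr2_def[abs_def])
  note m = incl_M2_closed
  show "pr2 ` ?G \<subseteq> {\<one>\<^bsub>C2\<^esub>} \<union> {pr2 (sym_incl C M2 m) \<otimes>\<^bsub>C2\<^esub> y | m y. m \<in> carrier M2 \<and> y \<in> carrier C2}"
  proof
    fix x assume "x \<in> pr2 ` ?G"
    then consider "x = pr2 \<one>\<^bsub>S2\<^esub>" | m y where "m \<in> carrier M2" "y \<in> carrier S2" "x = pr2 (sym_incl C M2 m \<otimes>\<^bsub>S2\<^esub> y)"
      by blast
    then show "x \<in> {\<one>\<^bsub>C2\<^esub>} \<union> {pr2 (sym_incl C M2 m) \<otimes>\<^bsub>C2\<^esub> y | m y. m \<in> carrier M2 \<and> y \<in> carrier C2}"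
    proof cases
      case (2 m y)
      then have "x = pr2 (sym_incl C M2 m) \<otimes>\<^bsub>C2\<^esub> pr2 y" "pr2 y \<in> carrier C2"
        using m by (simp_all add: pr2_mult pr2_closed)
      with 2(1) show ?thesis by blast
    qed (simp add: pr2_one)
  qed
  show "{\<one>\<^bsub>C2\<^esub>} \<union> {pr2 (sym_incl C M2 m) \<otimes>\<^bsub>C2\<^esub> y | m y. m \<in> carrier M2 \<and> y \<in> carrier C2} \<subseteq> carrier C2"
    using m pr2_closed C2.m_closed C2.one_closed by blast
qed

text \<open>Modulo \<open>J\<close>, all factors from \<open>C\<^sub>1\<close> and \<open>C\<^sub>2\<close> reduce to scalars.\<close>

lemma diff_\<sigma>_J:
  assumes x: "x \<in> carrier IDR"
  shows "x \<ominus>\<^bsub>IDR\<^esub> \<sigma> (\<Psi> x) \<in> J"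
proof -
  let ?g = "\<lambda>x. x \<ominus>\<^bsub>IDR\<^esub> \<sigma> (\<Psi> x)"
  let ?G1 = "{\<one>\<^bsub>C1\<^esub>} \<union> {sym_incl C M1 m \<otimes>\<^bsub>C1\<^esub> y | m y. m \<in> carrier M1 \<and> y \<in> carrier C1}"
  let ?G2 = "{\<one>\<^bsub>C2\<^esub>} \<union> {pr2 (sym_incl C M2 m) \<otimes>\<^bsub>C2\<^esub> y | m y. m \<in> carrier M2 \<and> y \<in> carrier C2}"
  note G1 = sym_algebra_spans[OF M1_module, folded C1_def]
  have g: "linear_map C IDR IDR ?g"
    by (intro linear_map_sub IDR'(1) linear_map_id linear_map_compose[OF \<sigma>_linear \<Psi>_linear])
  \<comment> \<open>On \<open>J\<close> the map \<open>?g\<close> is the identity, because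
    \<open>J\<close> lies in the kernel. For a spanning tensor with a nontrivial second or third
    factor it therefore suffices to find the tensor itself in \<open>J\<close>.\<close>
  have J: "?g z \<in> J" if "z \<in> J" for z
  proof -
    have z: "\<Psi> z = \<zero>\<^bsub>IDRQ\<^esub>" "z \<in> carrier IDR" using J_ker that by auto
    then have "?g z = z"
      using linear_map_zero[OF IDRQ'(1) IDR'(1) \<sigma>_linear] A.M.minus_equality[of "\<zero>\<^bsub>IDR\<^esub>" "\<zero>\<^bsub>IDR\<^esub>"]
      by (simp add: a_minus_def)
    with that show ?thesis by simp
  qed
  show ?thesis
    using IDR'(1) tens4_spans[OF G1 C2_spans] x
  proof (induction rule: span_induct)
    case (gen x)
    then obtain r c1 c2 f where x: "x = tens4 r c1 c2 (word f)" "r \<in> carrier R" "c1 \<in> ?G1" "c2 \<in> ?G2" "f \<in> words"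
      by blast
    have c: "c1 \<in> carrier C1" "c2 \<in> carrier C2"
      using span_closed[OF G1 x(3)] span_closed[OF C2_spans x(4)] .
    show ?case
    proof (cases "c1 = \<one>\<^bsub>C1\<^esub> \<and> c2 = \<one>\<^bsub>C2\<^esub>")
      case True
      then have "?g x = \<zero>\<^bsub>IDR\<^esub>"
        using x minus_self[OF A.M.abelian_group_axioms, of x] by (simp add: \<Psi>_tens4_one \<sigma>_tensQ)
      then show ?thesis using J.zero_closed by simp
    next
      case False
      have "x \<in> J"
      proof (cases "c1 = \<one>\<^bsub>C1\<^esub>")
        case True
        with False x(4) obtain m y where "m \<in> carrier M2" "y \<in> carrier C2" "c2 = pr2 (sym_incl C M2 m) \<otimes>\<^bsub>C2\<^esub> y"
          by blast
        then show ?thesis using x c tens4_eps2_J by simp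
      next
        case False
        with x(3) obtain m y where "m \<in> carrier M1" "y \<in> carrier C1" "c1 = sym_incl C M1 m \<otimes>\<^bsub>C1\<^esub> y"
          by blast
        then show ?thesis using x c tens4_eps1_J by simp
      qed
      then show ?thesis by (rule J)
    qed
  next
    case (add x y)
    then show ?case using linear_mapD(2)[OF g] J.a_closed by simp
  next
    case (smult k x)
    then show ?case using linear_mapD(3)[OF g] A.submoduleE(4)[OF J_submodule] by simp
  next
    case zero
    show ?case using J[OF J.zero_closed] .
  qed
qed

lemma J_eq_ker: "J = ker_\<Psi>"
proof (intro equalityI J_ker subsetI)
  fix x assume "x \<in> ker_\<Psi>"
  then have x: "x \<in> carrier IDR" "\<Psi> x = \<zero>\<^bsub>IDRQ\<^esub>" by simp_all
  have "x \<ominus>\<^bsub>IDR\<^esub> \<sigma> (\<Psi> x) = x"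
    using x linear_map_zero[OF IDRQ'(1) IDR'(1) \<sigma>_linear] A.M.minus_equality[of "\<zero>\<^bsub>IDR\<^esub>" "\<zero>\<^bsub>IDR\<^esub>"]
    by (simp add: a_minus_def)
  with diff_\<sigma>_J[OF x(1)] show "x \<in> J" by simp
qed

interpretation \<Psi>: ring_hom_ring IDR IDRQ \<Psi>
  by (rule ring_hom_ringI2[OF A.ring_axioms S.ring_axioms \<Psi>_ring_hom])

lemma J_a_kernel: "a_kernel IDR IDRQ \<Psi> = J"
  unfolding a_kernel_def' J_eq_ker by (rule refl)

lemma incl_tens4: "incl r = tens4 r \<one>\<^bsub>C1\<^esub> \<one>\<^bsub>C2\<^esub> (word [])"
  by (simp add: incl_def)

text \<open>As for \<open>intQ_RT\<close>: all terms with \<open>Q a\<close> vanish, among them the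
  one with \<open>eps1\<close>.\<close>

lemma integ_RT:
  assumes a: "a \<in> carrier RT" and f: "f \<in> words"
  shows "integ (tens4 a \<one>\<^bsub>C1\<^esub> \<one>\<^bsub>C2\<^esub> (word f)) = tens4 \<one> \<one>\<^bsub>C1\<^esub> \<one>\<^bsub>C2\<^esub> (word (a # f))"
proof -
  have r: "a \<ominus> \<zero> = a" using a by (simp add: a_minus_def)
  have e: "eps1 \<zero> t = \<zero>\<^bsub>C1\<^esub>" if "t \<in> carrier TA" for t
    using linear_map_zero[OF RJ_module C1'(1) bilinear_mapD(2)[OF eps1_bilinear that]] by simp
  have z: "tens4 \<zero> \<one>\<^bsub>C1\<^esub> \<one>\<^bsub>C2\<^esub> (word g) = \<zero>\<^bsub>IDR\<^esub>" if "g \<in> words" for g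
    using linear_map_zero[OF RR'(1) IDR'(1) tens4_lin1[OF _ _ _ linear_map_id]] that by simp
  have z': "tens4 \<one> \<zero>\<^bsub>C1\<^esub> \<one>\<^bsub>C2\<^esub> (word []) = \<zero>\<^bsub>IDR\<^esub>"
    using linear_map_zero[OF C1'(1) IDR'(1) tens4_lin2[OF _ _ _ linear_map_id]] by simp
  have i: "i4_word \<one>\<^bsub>C1\<^esub> \<one>\<^bsub>C2\<^esub> g \<zero> = \<zero>\<^bsub>IDR\<^esub>" if "g \<in> words" for g
    using linear_map_zero[OF RR'(1) IDR'(1) i4_word_linear1[OF that]] by simp
  note m = minus_self[OF A.M.abelian_group_axioms A.M.zero_closed]
  have "i4_word \<one>\<^bsub>C1\<^esub> \<one>\<^bsub>C2\<^esub> f a = tens4 \<one> \<one>\<^bsub>C1\<^esub> \<one>\<^bsub>C2\<^esub> (word (a # f))"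
    using a f by (cases f) (simp_all add: r e z z' i m)
  then show ?thesis using a f by (simp add: integ_tens4)
qed

section \<open>The induced isomorphism and its uniqueness\<close>

text \<open>Restricted to the carrier, because uniqueness is claimed among extensional
  functions.\<close>

definition "quot_iso = (\<lambda>X\<in>carrier (IDR Quot J). the_elem (\<Psi> ` X))"

lemma Quot_carrier: "carrier (IDR Quot J) = (\<lambda>x. J +>\<^bsub>IDR\<^esub> x) ` carrier IDR"
  by (auto simp: FactRing_def A_RCOSETS_def' a_r_coset_def')

lemma quot_iso_coset: "x \<in> carrier IDR \<Longrightarrow> quot_iso (J +>\<^bsub>IDR\<^esub> x) = \<Psi> x"
  using \<Psi>.the_elem_simp[of x] by (simp add: quot_iso_def Quot_carrier J_a_kernel)

lemma \<Psi>_surj: "\<Psi> ` carrier IDR = carrier IDRQ"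
  using \<Psi>_closed \<Psi>_\<sigma> \<sigma>_closed by (metis image_eqI image_subsetI subsetI subset_antisym)

lemma quot_iso_ring_iso: "quot_iso \<in> ring_hom (IDR Quot J) IDRQ"
  "bij_betw quot_iso (carrier (IDR Quot J)) (carrier IDRQ)"
proof -
  interpret Q: ring "IDR Quot J" by (rule J.quotient_is_ring)
  have i: "(\<lambda>X. the_elem (\<Psi> ` X)) \<in> ring_iso (IDR Quot J) IDRQ"
    using \<Psi>.FactRing_iso_set[OF \<Psi>_surj] by (simp add: J_a_kernel)
  then show "bij_betw quot_iso (carrier (IDR Quot J)) (carrier IDRQ)"
    unfolding quot_iso_def by (subst bij_betw_restrict_eq) (simp add: ring_iso_def)
  from i have h: "(\<lambda>X. the_elem (\<Psi> ` X)) \<in> ring_hom (IDR Quot J) IDRQ" by (simp add: ring_iso_def)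
  show "quot_iso \<in> ring_hom (IDR Quot J) IDRQ"
    using h Q.m_closed Q.a_closed Q.one_closed
    by (intro ring_hom_memI) (simp_all add: quot_iso_def ring_hom_closed[OF h] ring_hom_mult[OF h]
        ring_hom_add[OF h] ring_hom_one[OF h])
qed

lemma quot_deriv: "x \<in> carrier IDR \<Longrightarrow> quot_map IDR J deriv (J +>\<^bsub>IDR\<^esub> x) = J +>\<^bsub>IDR\<^esub> deriv x"
  using J_ideal by (intro quot_map_coset[OF J.ideal_axioms])
    (simp_all add: linear_mapD[OF deriv_linear] int_diff_ideal_def)

lemma quot_integ: "x \<in> carrier IDR \<Longrightarrow> quot_map IDR J integ (J +>\<^bsub>IDR\<^esub> x) = J +>\<^bsub>IDR\<^esub> integ x"
  using J_ideal by (intro quot_map_coset[OF J.ideal_axioms])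
    (simp_all add: linear_mapD[OF integ_linear] int_diff_ideal_def)

lemma quot_iso_hom:
  "int_diff_ring_hom (IDR Quot J) (quot_map IDR J deriv) (quot_map IDR J integ) IDRQ derivQ intQ quot_iso"
proof -
  have D: "quot_map IDR J deriv X \<in> carrier (IDR Quot J) \<and> quot_iso (quot_map IDR J deriv X) = derivQ (quot_iso X)"
    "quot_map IDR J integ X \<in> carrier (IDR Quot J) \<and> quot_iso (quot_map IDR J integ X) = intQ (quot_iso X)"
    if "X \<in> carrier (IDR Quot J)" for X
  proof -
    from that obtain x where x: "x \<in> carrier IDR" "X = J +>\<^bsub>IDR\<^esub> x" by (auto simp: Quot_carrier)
    note cl = linear_mapD(1)[OF deriv_linear x(1)] linear_mapD(1)[OF integ_linear x(1)]
    show "quot_map IDR J deriv X \<in> carrier (IDR Quot J) \<and> quot_iso (quot_map IDR J deriv X) = derivQ (quot_iso X)"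
      "quot_map IDR J integ X \<in> carrier (IDR Quot J) \<and> quot_iso (quot_map IDR J integ X) = intQ (quot_iso X)"
      unfolding x(2) quot_deriv[OF x(1)] quot_integ[OF x(1)] quot_iso_coset[OF x(1)]
        quot_iso_coset[OF cl(1)] quot_iso_coset[OF cl(2)] \<Psi>_deriv[OF x(1)] \<Psi>_integ[OF x(1)] Quot_carrier
      using cl by (blast intro: refl)+
  qed
  have "comm_int_diff_ring (IDR Quot J) (quot_map IDR J deriv) (quot_map IDR J integ)"
    by (rule comm_int_diff_ring_transport[OF IDRQ_comm_int_diff_ring J.quotient_is_cring[OF IDR'(2)] quot_iso_ring_iso(1)
          bij_betw_imp_inj_on[OF quot_iso_ring_iso(2)] D])
  with D IDRQ_comm_int_diff_ring quot_iso_ring_iso(1) show ?thesis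
    unfolding int_diff_ring_hom_def by blast
qed

lemma hom_eq_\<Psi>:
  assumes h: "int_diff_ring_hom (IDR Quot J) (quot_map IDR J deriv) (quot_map IDR J integ) IDRQ derivQ intQ h"
    and i: "\<And>r. r \<in> carrier R \<Longrightarrow> h (J +>\<^bsub>IDR\<^esub> incl r) = inclQ r" and x: "x \<in> carrier IDR"
  shows "h (J +>\<^bsub>IDR\<^esub> x) = \<Psi> x"
proof -
  let ?g = "\<lambda>x. h (J +>\<^bsub>IDR\<^esub> x)"
  have hr: "h \<in> ring_hom (IDR Quot J) IDRQ" using h by (simp add: int_diff_ring_hom_def)
  note g = ring_hom_trans[OF J.rcos_ring_hom hr, unfolded comp_def]
  interpret g: ring_hom_ring IDR IDRQ ?g
    by (rule ring_hom_ringI2[OF A.ring_axioms S.ring_axioms g])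
  have gI: "?g (integ y) = intQ (?g y)" if "y \<in> carrier IDR" for y
    using h that quot_integ[OF that] unfolding int_diff_ring_hom_def Quot_carrier by (metis imageI)
  have inc: "incl r \<in> carrier IDR" if "r \<in> carrier R" for r
    using that by (simp add: incl_tens4)
  have l: "linear_map C RR IDR (\<lambda>r. tens4 r \<one>\<^bsub>C1\<^esub> \<one>\<^bsub>C2\<^esub> (word []))"
    by (intro tens4_lin1 linear_map_id) simp_all
  \<comment> \<open>The scalar \<open>c\<close> acts as multiplication by \<open>incl c\<close>,
    where \<open>h\<close> is prescribed; so compatibility with the inclusions makes the ring
    homomorphism linear over \<open>C\<close>.\<close>
  have gs: "?g (c \<odot>\<^bsub>IDR\<^esub> y) = c \<odot>\<^bsub>IDRQ\<^esub> ?g y" if c: "c \<in> carrier C" and y: "y \<in> carrier IDR" for c y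
  proof -
    have "c \<odot>\<^bsub>IDR\<^esub> y = (c \<odot>\<^bsub>IDR\<^esub> \<one>\<^bsub>IDR\<^esub>) \<otimes>\<^bsub>IDR\<^esub> y"
      using A.smult_assoc2[OF c A.one_closed y] y by simp
    also have "c \<odot>\<^bsub>IDR\<^esub> \<one>\<^bsub>IDR\<^esub> = incl c"
      using linear_mapD(3)[OF l c, of \<one>] c
      by (simp add: incl_tens4 one_IDR)
    finally have "?g (c \<odot>\<^bsub>IDR\<^esub> y) = inclQ c \<otimes>\<^bsub>IDRQ\<^esub> ?g y"
      using inc[of c] i[of c] c y by simp
    also have "inclQ c = c \<odot>\<^bsub>IDRQ\<^esub> \<one>\<^bsub>IDRQ\<^esub>"
      using tensQ_constant[OF c, of "word []"] by (simp add: inclQ_def one_IDRQ)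
    also have "(c \<odot>\<^bsub>IDRQ\<^esub> \<one>\<^bsub>IDRQ\<^esub>) \<otimes>\<^bsub>IDRQ\<^esub> ?g y = c \<odot>\<^bsub>IDRQ\<^esub> ?g y"
      using S.smult_assoc2[OF c S.one_closed g.hom_closed[OF y]] g.hom_closed[OF y] by simp
    finally show ?thesis .
  qed
  have gl: "linear_map C IDR IDRQ ?g"
    by (rule linear_mapI) (simp_all add: gs)
  have mult: "tens4 r \<one>\<^bsub>C1\<^esub> \<one>\<^bsub>C2\<^esub> (word f) = incl r \<otimes>\<^bsub>IDR\<^esub> tens4 \<one> \<one>\<^bsub>C1\<^esub> \<one>\<^bsub>C2\<^esub> (word f)"
    if "r \<in> carrier R" "f \<in> words" for r f
    using that by (simp add: incl_tens4 tens4_mult_Nil)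
  have w: "?g (tens4 \<one> \<one>\<^bsub>C1\<^esub> \<one>\<^bsub>C2\<^esub> (word f)) = tensQ \<one> (word f)" if "f \<in> words" for f
    using that
  proof (induction f)
    case Nil
    show ?case using i[OF one_closed] by (simp add: incl_tens4 inclQ_def)
  next
    case (Cons a f)
    then have a: "a \<in> carrier R" "a \<in> carrier RT" "f \<in> words" by simp_all
    have "?g (tens4 \<one> \<one>\<^bsub>C1\<^esub> \<one>\<^bsub>C2\<^esub> (word (a # f))) = intQ (?g (tens4 a \<one>\<^bsub>C1\<^esub> \<one>\<^bsub>C2\<^esub> (word f)))"
      using a by (simp add: integ_RT[symmetric] gI)
    also have "\<dots> = intQ (inclQ a \<otimes>\<^bsub>IDRQ\<^esub> tensQ \<one> (word f))"
      using a Cons.IH i[OF a(1)] inc[OF a(1)] by (simp add: mult[OF a(1,3)])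
    also have "\<dots> = tensQ \<one> (word (a # f))"
      using a by (simp add: inclQ_def tensQ_mult shuffle_word intQ_RT)
    finally show ?case .
  qed
  have "?g (\<sigma> s) = s" if s: "s \<in> carrier IDRQ" for s
  proof (rule linear_map_eq[OF IDRQ'(1) IDRQ'(1) tensQ_spans linear_map_compose[OF gl \<sigma>_linear] linear_map_id _ s])
    fix y assume "y \<in> {tensQ r (word f) | r f. r \<in> carrier R \<and> f \<in> words}"
    then obtain r f where y: "y = tensQ r (word f)" and r: "r \<in> carrier R" "f \<in> words" by blast
    show "?g (\<sigma> y) = y"
      using r w[OF r(2)] i[OF r(1)] inc[OF r(1)]
      by (simp add: y \<sigma>_tensQ mult[OF r]) (simp add: inclQ_def tensQ_mult shuffle_word)
  qed
  then have s: "?g (\<sigma> (\<Psi> x)) = \<Psi> x" using \<Psi>_closed[OF x] by blast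
  \<comment> \<open>The coset of \<open>x\<close> also has the representative
    \<open>\<sigma> (\<Psi> x)\<close>, so agreement on the image of \<open>\<sigma>\<close> is
    enough.\<close>
  have "J +>\<^bsub>IDR\<^esub> x = J +>\<^bsub>IDR\<^esub> \<sigma> (\<Psi> x)"
    using coset_eq_iff[OF IDR'(1) J_submodule x \<sigma>_closed[OF \<Psi>_closed[OF x]]] diff_\<sigma>_J[OF x] by blast
  with s show ?thesis by simp
qed

lemma quot_iso_unique:
  "\<exists>!\<psi>. \<psi> \<in> extensional (carrier (IDR Quot J)) \<and>
    bij_betw \<psi> (carrier (IDR Quot J)) (carrier IDRQ) \<and>
    int_diff_ring_hom (IDR Quot J) (quot_map IDR J deriv) (quot_map IDR J integ) IDRQ derivQ intQ \<psi> \<and>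
    (\<forall>f\<in>carrier R. \<psi> (J +>\<^bsub>IDR\<^esub> incl f) = inclQ f)"
proof (rule ex1I[of _ quot_iso], intro conjI ballI)
  show "quot_iso \<in> extensional (carrier (IDR Quot J))" by (simp add: quot_iso_def)
  show "quot_iso (J +>\<^bsub>IDR\<^esub> incl f) = inclQ f" if "f \<in> carrier R" for f
    using that by (simp add: incl_tens4 quot_iso_coset \<Psi>_tens4_one inclQ_def)
  fix h assume h: "h \<in> extensional (carrier (IDR Quot J)) \<and>
    bij_betw h (carrier (IDR Quot J)) (carrier IDRQ) \<and>
    int_diff_ring_hom (IDR Quot J) (quot_map IDR J deriv) (quot_map IDR J integ) IDRQ derivQ intQ h \<and>
    (\<forall>f\<in>carrier R. h (J +>\<^bsub>IDR\<^esub> incl f) = inclQ f)"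
  show "h = quot_iso"
  proof (rule extensionalityI[of h "carrier (IDR Quot J)"])
    fix X assume "X \<in> carrier (IDR Quot J)"
    then obtain x where x: "x \<in> carrier IDR" "X = J +>\<^bsub>IDR\<^esub> x" by (auto simp: Quot_carrier)
    show "h X = quot_iso X"
      unfolding x(2) quot_iso_coset[OF x(1)] by (rule hom_eq_\<Psi>) (use h x in auto)
  qed (use h in \<open>simp_all add: quot_iso_def\<close>)
qed (rule quot_iso_ring_iso(2) quot_iso_hom)+

end

theorem theorem51:
  fixes R :: "('a, 'm) ring_scheme" (structure) and d Q :: "'a \<Rightarrow> 'a"
  assumes "comm_diff_ring R d" and "quasi_integration R d Q"
  shows
    "let S = quasi_integration.IDRQ R d Q;
         dS = quasi_integration.derivQ R d Q;
         iS = quasi_integration.intQ R d Q;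
         \<iota> = quasi_integration.inclQ R d Q;
         EQ = evaluation S dS iS;
         N = nested_int S iS \<iota>;
         RJ = Q ` carrier R;
         RT = {r \<in> carrier R. Q r = \<zero>};
         A = quasi_integration.IDR R d Q;
         dA = quasi_integration.deriv R d Q;
         iA = quasi_integration.integ R d Q;
         J = quasi_integration.J R d Q;
         \<pi> = (\<lambda>x. J +>\<^bsub>A\<^esub> x)
     in
       comm_int_diff_ring S dS iS \<and>

       (diff_ring_hom R d S dS \<iota> \<and> inj_on \<iota> (carrier R) \<and>
        (\<forall>f \<in> d ` carrier R. iS (\<iota> f) = \<iota> (Q f)) \<and>
        (\<forall>f0 \<in> RJ. \<forall>fs \<in> lists RT. \<forall>gs \<in> lists RT. fs \<noteq> [] \<longrightarrow> gs \<noteq> [] \<longrightarrow>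
           EQ (\<iota> f0 \<otimes>\<^bsub>S\<^esub> N fs) = \<zero>\<^bsub>S\<^esub> \<and> EQ (N fs \<otimes>\<^bsub>S\<^esub> N gs) = \<zero>\<^bsub>S\<^esub>)) \<and>

       (\<exists>!\<psi>. \<psi> \<in> extensional (carrier (A Quot J)) \<and>
          bij_betw \<psi> (carrier (A Quot J)) (carrier S) \<and>
          int_diff_ring_hom (A Quot J) (quot_map A J dA) (quot_map A J iA) S dS iS \<psi> \<and>
          (\<forall>f \<in> carrier R. \<psi> (\<pi> (quasi_integration.incl R d Q f)) = \<iota> f))"
proof -
  interpret quasi_integration R d Q by fact
  have Q: "r \<in> carrier R" if "r \<in> Q ` carrier R" for r
    using that by auto
  have words: "f \<in> lists (carrier RT) \<longleftrightarrow> f \<in> lists {r \<in> carrier R. Q r = \<zero>}" for f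
    by (simp only: RT_carrier)
  show ?thesis
    unfolding Let_def
    using IDRQ_comm_int_diff_ring inclQ_hom inclQ_inj intQ_inclQ evalQ_incl_nested[OF Q, unfolded words]
      evalQ_nested_nested[unfolded words] quot_iso_unique
    by (intro conjI ballI impI)
qed

end
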